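(* Let $I^0\in\mathcal D$, and let $f\in L^2(I^0,\sigma)$ and $g\in L^2(I^0,w)$ be good functions supported on $I^0$, of $\sigma$-integral zero and $w$-integral zero, respectively. Then $$|B^{\mathrm{above}}(f,g)|\lesssim \{\mathscr H+\mathscr L\}\,\|f\|_\sigma\,\|g\|_w .$$ The same inequality holds for the dual form $B^{\mathrm{below}}(f,g)$, that is, $|B^{\mathrm{below}}(f,g)|\lesssim\{\mathscr H+\mathscr L^{*}\}\|f\|_\sigma\|g\|_w$, where $\mathscr L^*$ is the constant defined as $\mathscr L$ but with the roles of $\sigma$ and $w$ interchanged. The implied constants depend only on the goodness parameters $\epsilon,r$.
   Context: Standing assumptions. $\sigma,w$ are locally finite positive Borel measures on $\mathbb R$ with no common point masses. $\mathcal D$ is a fixed dyadic grid: a collection of intervals, any two of which are nested or disjoint, such that for each $I\in\mathcal D$ the intervals of $\mathcal D$ of length $|I|$ partition $\mathbb R$ up to endpoints, the left and right halves $I_-,I_+$ (children) of $I$ are in $\mathcal D$, and $I$ is a child of a unique interval of $\mathcal D$. No endpoint of an interval of $\mathcal D$ is a point mass of $\sigma$ or $w$. Intervals below are in $\mathcal D$ unless stated otherwise, and an interval is identified with its indicator function; $\|\cdot\|_\sigma$, $\langle\cdot,\cdot\rangle_\sigma$ are the norm and inner product of $L^2(\sigma)$, and $\mathbb E^\sigma_I\phi=\sigma(I)^{-1}\int_I\phi\,d\sigma$ (taken to be $0$ if $\sigma(I)=0$); similarly for $w$. Truncations. For $0<\alpha<\beta$, $K_{\alpha,\beta}$ is the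 odd function with $K_{\alpha,\beta}(0)=0$ and, for $y>0$, $K_{\alpha,\beta}(y)=-\frac{y}{\alpha^2}+\frac2\alpha$ if $0<y<\alpha$, $\frac1y$ if $\alpha\le y\le\beta$, $-\frac{y}{\beta^2}+\frac2\beta$ if $\beta<y<2\beta$, and $0$ if $y\ge2\beta$. $H_\sigma f(x)=\int f(y)K_{\alpha,\beta}(y-x)\,\sigma(dy)$; the parameters are suppressed, and all inequalities and best constants are understood uniformly over $0<\alpha<\beta$. Constants. $P(\sigma,I)=\int_{\mathbb R}\frac{|I|}{|I|^2+\operatorname{dist}(x,I)^2}\sigma(dx)$. $\mathscr A_2$ is the best constant in $P(\sigma,I)P(w,I)\le\mathscr A_2$ and $\mathscr T$ the best constant in $\int_I|H_\sigma I|^2dw\le\mathscr T^2\sigma(I)$ and $\int_I|H_w I|^2d\sigma\le\mathscr T^2w(I)$, over all intervals $I\subset\mathbb R$ (not only dyadic); both are assumed finite, and $\mathscr H:=\mathscr A_2^{1/2}+\mathscr T$. Haar functions and goodness. If $\sigma$ charges both children of $I$, $h_I^\sigma:=\sqrt{\frac{\sigma(I_-)\sigma(I_+)}{\sigma(I)}}\bigl(-\frac{I_-}{\sigma(I_-)}+\frac{I_+}{\sigma(I_+)}\bigr)$, $\Delta_I^\sigma f:=\langle f,h_I^\sigma\rangle_\sigma h_I^\sigma$; otherwise $\Delta^\sigma_If:=0$. The Haar support of $f$ is $\{I\in\mathcal D:\langle f,h^\sigma_I\rangle_\sigma\ne0\}$. Fix $0<\epsilon<\frac12$ sufficiently small and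 an integer $r$ sufficiently large depending on $\epsilon$. $J\in\mathcal D$ is good if for every $I\in\mathcal D$ with $|I|\ge2^{r-1}|J|$ the distance from $J$ to the boundary of either child of $I$ is at least $|J|^\epsilon|I|^{1-\epsilon}$. A function is good if only good intervals are in its Haar support. All functions $f,g$ considered (including in the definition of $\mathscr L$) are good, of integral zero, and in the linear span of Haar functions. $J\Subset I$ means $J\subset I$ and $2^r|J|\le|I|$. Forms. With $I_J$ the child of $I$ containing $J$, $$B^{\mathrm{above}}(f,g):=\sum_{I: I\subset I^0}\ \sum_{J: J\Subset I_J}\mathbb E^\sigma_{I_J}\Delta^\sigma_If\cdot\langle H_\sigma I_J,\Delta^w_Jg\rangle_w,$$ and dually, with $J_I$ the child of $J$ containing $I$, $B^{\mathrm{below}}(f,g):=\sum_{J: J\subset I^0}\sum_{I: I\Subset J_I}\mathbb E^w_{J_I}\Delta^w_Jg\cdot\langle H_\sigma\Delta^\sigma_If,J_I\rangle_w$. Energy stopping. $E(w,I)^2:=\mathbb E_I^{w(dx)}\mathbb E_I^{w(dx')}\frac{(x-x')^2}{|I|^2}$. $C_0$ is an absolute constant for which $\sum_{I\in\mathcal P}P(\sigma I_0,I)^2E(w,I)^2w(I)\le C_0\mathscr H^2\sigma(I_0)$, and the dual inequality, hold for all $I_0\in\mathcal D$ and all partitions $\mathcal P$ of $I_0$ into dyadic intervals. Here $\sigma I_0$ is the restriction of $\sigma$ to $I_0$. For an interval $F_0$, $\mathcal F_{\mathrm{energy}}(F_0)$ is the set of maximal subintervals $F\subsetneq F_0$ with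 $P(\sigma F_0,F)^2E(w,F)^2w(F)>10C_0\mathscr H^2\sigma(F)$. The local constant. Let $I_0$ be an interval and $\mathcal S$ a collection of disjoint intervals contained in $I_0$. A function $f\in L^2(I_0,\sigma)$ of $\sigma$-integral zero is uniform with respect to $\mathcal S$ if (1) each $F\in\mathcal F_{\mathrm{energy}}(I_0)$ is contained in some $S\in\mathcal S$; (2) $f$ is constant on each $S\in\mathcal S$; (3) $\mathbb E^\sigma_I|f|\le1$ for every interval $I\subset I_0$ not contained in any $S\in\mathcal S$. A function $g$ is weakly adapted to such an $f$ if $\langle g,h_J^w\rangle_w=0$ whenever $J\Subset S$ for some $S\in\mathcal S$. $\mathscr L$ is the best constant in the inequality $$|B^{\mathrm{above}}(f,g)|\le\mathscr L\{\sigma(I_0)^{1/2}+\|f\|_\sigma\}\|g\|_w,$$ over all intervals $I_0$ (used in place of $I^0$ in the form), all collections $\mathcal S$, all $f$ supported on $I_0$ that are uniform with respect to $\mathcal S$, and all $g$ supported on $I_0$, of $w$-integral zero, weakly adapted to $f$. *)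

theory Defs
  imports "HOL-Analysis.Analysis"
begin

text \<open>
  Elements of a dyadic grid are represented by half-open intervals $[a,b)$. As no endpoint
  of such an interval is ever a point mass, this choice of endpoints is immaterial.
  Functions in $L^2(\sigma)$ are represented by Borel functions, and conditions on them
  are imposed almost everywhere.
\<close>

abbreviation len :: "real set \<Rightarrow> real" where
  "len I \<equiv> measure lborel I"

definition left_child :: "real set \<Rightarrow> real set" where
  "left_child I = {Inf I ..< (Inf I + Sup I) / 2}"

definition right_child :: "real set \<Rightarrow> real set" where
  "right_child I = {(Inf I + Sup I) / 2 ..< Sup I}"

definition dyadic_grid :: "real set set \<Rightarrow> bool" where
  "dyadic_grid D \<longleftrightarrow>
     (\<forall>I\<in>D. \<exists>a b. a < b \<and> I = {a..<b}) \<and>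
     (\<forall>I\<in>D. \<forall>J\<in>D. I \<subseteq> J \<or> J \<subseteq> I \<or> I \<inter> J = {}) \<and>
     (\<forall>I\<in>D. partition_on UNIV {J\<in>D. len J = len I}) \<and>
     (\<forall>I\<in>D. left_child I \<in> D \<and> right_child I \<in> D) \<and>
     (\<forall>I\<in>D. \<exists>!K. K \<in> D \<and> (I = left_child K \<or> I = right_child K))"

definition locally_finite_borel :: "real measure \<Rightarrow> bool" where
  "locally_finite_borel \<sigma> \<longleftrightarrow>
     sets \<sigma> = sets borel \<and> (\<forall>A. compact A \<longrightarrow> emeasure \<sigma> A < \<infinity>)"

definition admissible :: "real set set \<Rightarrow> real measure \<Rightarrow> real measure \<Rightarrow> bool" where
  "admissible D \<sigma> w \<longleftrightarrow>
     dyadic_grid D \<and> locally_finite_borel \<sigma> \<and> locally_finite_borel w \<and>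
     (\<forall>x. emeasure \<sigma> {x} = 0 \<or> emeasure w {x} = 0) \<and>
     (\<forall>I\<in>D. \<forall>x\<in>{Inf I, Sup I}. emeasure \<sigma> {x} = 0 \<and> emeasure w {x} = 0)"

definition l2_inner :: "real measure \<Rightarrow> (real \<Rightarrow> real) \<Rightarrow> (real \<Rightarrow> real) \<Rightarrow> real" where
  "l2_inner \<sigma> f g = (LINT x|\<sigma>. f x * g x)"

definition l2_norm :: "real measure \<Rightarrow> (real \<Rightarrow> real) \<Rightarrow> real" where
  "l2_norm \<sigma> f = sqrt (LINT x|\<sigma>. (f x)\<^sup>2)"

text \<open>Division by zero makes the average vanish when $\sigma(I) = 0$.\<close>

definition average :: "real measure \<Rightarrow> real set \<Rightarrow> (real \<Rightarrow> real) \<Rightarrow> real" where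
  "average \<sigma> I \<phi> = (LINT x:I|\<sigma>. \<phi> x) / measure \<sigma> I"


subsection \<open>Truncated Hilbert transform and the two constants\<close>

definition trunc_kernel :: "real \<Rightarrow> real \<Rightarrow> real \<Rightarrow> real" where
  "trunc_kernel \<alpha> \<beta> y = sgn y *
     (if \<bar>y\<bar> < \<alpha> then - \<bar>y\<bar> / \<alpha>\<^sup>2 + 2 / \<alpha>
      else if \<bar>y\<bar> \<le> \<beta> then 1 / \<bar>y\<bar>
      else if \<bar>y\<bar> < 2 * \<beta> then - \<bar>y\<bar> / \<beta>\<^sup>2 + 2 / \<beta>
      else 0)"

definition hilbert :: "real \<Rightarrow> real \<Rightarrow> real measure \<Rightarrow> (real \<Rightarrow> real) \<Rightarrow> real \<Rightarrow> real" where
  "hilbert \<alpha> \<beta> \<sigma> f x = (LINT y|\<sigma>. f y * trunc_kernel \<alpha> \<beta> (y - x))"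

definition poisson :: "real measure \<Rightarrow> real set \<Rightarrow> ennreal" where
  "poisson \<sigma> I = (\<integral>\<^sup>+x. ennreal (len I / ((len I)\<^sup>2 + (infdist x I)\<^sup>2)) \<partial>\<sigma>)"

text \<open>Arbitrary bounded nondegenerate intervals: open, closed or half-open, not only dyadic.\<close>

definition real_interval :: "real set \<Rightarrow> bool" where
  "real_interval I \<longleftrightarrow> is_interval I \<and> bounded I \<and> interior I \<noteq> {}"

text \<open>Best constants are infima in the extended nonnegative reals, possibly infinite;
  they are uniform over the truncation parameters.\<close>

definition A2_const :: "real measure \<Rightarrow> real measure \<Rightarrow> ennreal" where
  "A2_const \<sigma> w = Inf {A. \<forall>I. real_interval I \<longrightarrow> poisson \<sigma> I * poisson w I \<le> A}"

definition testing_const :: "real measure \<Rightarrow> real measure \<Rightarrow> ennreal" where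
  "testing_const \<sigma> w = Inf {T. \<forall>\<alpha> \<beta> I. 0 < \<alpha> \<and> \<alpha> < \<beta> \<and> real_interval I \<longrightarrow>
     (\<integral>\<^sup>+x\<in>I. ennreal ((hilbert \<alpha> \<beta> \<sigma> (indicator I) x)\<^sup>2) \<partial>w) \<le> T\<^sup>2 * emeasure \<sigma> I \<and>
     (\<integral>\<^sup>+x\<in>I. ennreal ((hilbert \<alpha> \<beta> w (indicator I) x)\<^sup>2) \<partial>\<sigma>) \<le> T\<^sup>2 * emeasure w I}"

text \<open>Only meaningful when both constants are finite.\<close>

definition H_const :: "real measure \<Rightarrow> real measure \<Rightarrow> real" where
  "H_const \<sigma> w = sqrt (enn2real (A2_const \<sigma> w)) + enn2real (testing_const \<sigma> w)"


subsection \<open>Haar functions and goodness\<close>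

text \<open>The Haar function is set to zero when one of the children is not charged, which makes
  the corresponding martingale difference vanish.\<close>

definition haar :: "real measure \<Rightarrow> real set \<Rightarrow> real \<Rightarrow> real" where
  "haar \<sigma> I x =
     (if measure \<sigma> (left_child I) > 0 \<and> measure \<sigma> (right_child I) > 0 then
        sqrt (measure \<sigma> (left_child I) * measure \<sigma> (right_child I) / measure \<sigma> I) *
        (- indicator (left_child I) x / measure \<sigma> (left_child I)
         + indicator (right_child I) x / measure \<sigma> (right_child I))
      else 0)"

definition mart_diff :: "real measure \<Rightarrow> real set \<Rightarrow> (real \<Rightarrow> real) \<Rightarrow> real \<Rightarrow> real" where
  "mart_diff \<sigma> I f x = l2_inner \<sigma> f (haar \<sigma> I) * haar \<sigma> I x"

definition haar_support :: "real set set \<Rightarrow> real measure \<Rightarrow> (real \<Rightarrow> real) \<Rightarrow> real set set" where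
  "haar_support D \<sigma> f = {I\<in>D. l2_inner \<sigma> f (haar \<sigma> I) \<noteq> 0}"

definition good_interval :: "real \<Rightarrow> nat \<Rightarrow> real set set \<Rightarrow> real set \<Rightarrow> bool" where
  "good_interval \<epsilon> r D J \<longleftrightarrow> J \<in> D \<and>
     (\<forall>I\<in>D. len I \<ge> 2 ^ (r - 1) * len J \<longrightarrow>
        (\<forall>K\<in>{left_child I, right_child I}.
           setdist J (frontier K) \<ge> len J powr \<epsilon> * len I powr (1 - \<epsilon>)))"

text \<open>Good functions in the (algebraic) linear span of the Haar functions that are of
  integral zero and supported on \<open>I0\<close>.\<close>

definition good_function ::
  "real \<Rightarrow> nat \<Rightarrow> real set set \<Rightarrow> real measure \<Rightarrow> real set \<Rightarrow> (real \<Rightarrow> real) \<Rightarrow> bool" where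
  "good_function \<epsilon> r D \<sigma> I0 f \<longleftrightarrow>
     f \<in> borel_measurable borel \<and>
     integrable \<sigma> (\<lambda>x. (f x)\<^sup>2) \<and>
     (AE x in \<sigma>. x \<notin> I0 \<longrightarrow> f x = 0) \<and>
     integrable \<sigma> f \<and> (LINT x|\<sigma>. f x) = 0 \<and>
     (\<exists>G c. finite G \<and> G \<subseteq> D \<and> (AE x in \<sigma>. f x = (\<Sum>I\<in>G. c I * haar \<sigma> I x))) \<and>
     (\<forall>I\<in>haar_support D \<sigma> f. good_interval \<epsilon> r D I)"

definition deep_inside :: "nat \<Rightarrow> real set \<Rightarrow> real set \<Rightarrow> bool" where
  "deep_inside r J I \<longleftrightarrow> J \<subseteq> I \<and> 2 ^ r * len J \<le> len I"


subsection \<open>The bilinear forms\<close>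

text \<open>The child of \<open>I\<close> containing \<open>J\<close>; a junk value if there is none, in which case
  \<open>J\<close> is not \<open>deep_inside\<close> it.\<close>

definition child_containing :: "real set \<Rightarrow> real set \<Rightarrow> real set" where
  "child_containing I J = (if J \<subseteq> left_child I then left_child I else right_child I)"

text \<open>For \<open>f\<close> and \<open>g\<close> in the linear span of the Haar functions only finitely many terms
  of these sums are nonzero.\<close>

definition B_above ::
  "real \<Rightarrow> real \<Rightarrow> nat \<Rightarrow> real set set \<Rightarrow> real measure \<Rightarrow> real measure \<Rightarrow> real set
     \<Rightarrow> (real \<Rightarrow> real) \<Rightarrow> (real \<Rightarrow> real) \<Rightarrow> real" where
  "B_above \<alpha> \<beta> r D \<sigma> w I0 f g =
     (\<Sum>\<^sub>\<infinity>I\<in>{I\<in>D. I \<subseteq> I0}. \<Sum>\<^sub>\<infinity>J\<in>{J\<in>D. deep_inside r J (child_containing I J)}.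
        average \<sigma> (child_containing I J) (mart_diff \<sigma> I f) *
        l2_inner w (hilbert \<alpha> \<beta> \<sigma> (indicator (child_containing I J))) (mart_diff w J g))"

definition B_below ::
  "real \<Rightarrow> real \<Rightarrow> nat \<Rightarrow> real set set \<Rightarrow> real measure \<Rightarrow> real measure \<Rightarrow> real set
     \<Rightarrow> (real \<Rightarrow> real) \<Rightarrow> (real \<Rightarrow> real) \<Rightarrow> real" where
  "B_below \<alpha> \<beta> r D \<sigma> w I0 f g =
     (\<Sum>\<^sub>\<infinity>J\<in>{J\<in>D. J \<subseteq> I0}. \<Sum>\<^sub>\<infinity>I\<in>{I\<in>D. deep_inside r I (child_containing J I)}.
        average w (child_containing J I) (mart_diff w J g) *
        l2_inner w (hilbert \<alpha> \<beta> \<sigma> (mart_diff \<sigma> I f)) (indicator (child_containing J I)))"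


subsection \<open>Energy\<close>

text \<open>The square $E(w,I)^2$ of the energy.\<close>

definition energy_sq :: "real measure \<Rightarrow> real set \<Rightarrow> real" where
  "energy_sq w I = average w I (\<lambda>x. average w I (\<lambda>x'. (x - x')\<^sup>2 / (len I)\<^sup>2))"

text \<open>The quantity $P(\sigma I_0, I)^2 E(w,I)^2 w(I)$, where $\sigma I_0$ is the restriction
  of $\sigma$ to $I_0$.\<close>

definition energy_term :: "real measure \<Rightarrow> real measure \<Rightarrow> real set \<Rightarrow> real set \<Rightarrow> ennreal" where
  "energy_term \<sigma> w I0 I =
     (poisson (density \<sigma> (indicator I0)) I)\<^sup>2 * ennreal (energy_sq w I) * emeasure w I"

definition energy_inequality ::
  "real \<Rightarrow> real set set \<Rightarrow> real measure \<Rightarrow> real measure \<Rightarrow> bool" where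
  "energy_inequality C0 D \<sigma> w \<longleftrightarrow>
     (\<forall>I0\<in>D. \<forall>P. P \<subseteq> D \<and> partition_on I0 P \<longrightarrow>
        (\<Sum>\<^sub>\<infinity>I\<in>P. energy_term \<sigma> w I0 I) \<le> ennreal (C0 * (H_const \<sigma> w)\<^sup>2) * emeasure \<sigma> I0)"

definition energy_violating ::
  "real \<Rightarrow> real set set \<Rightarrow> real measure \<Rightarrow> real measure \<Rightarrow> real set \<Rightarrow> real set set" where
  "energy_violating C0 D \<sigma> w F0 =
     {F\<in>D. F \<subset> F0 \<and>
        energy_term \<sigma> w F0 F > ennreal (10 * C0 * (H_const \<sigma> w)\<^sup>2) * emeasure \<sigma> F}"

definition F_energy ::
  "real \<Rightarrow> real set set \<Rightarrow> real measure \<Rightarrow> real measure \<Rightarrow> real set \<Rightarrow> real set set" where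
  "F_energy C0 D \<sigma> w F0 =
     {F \<in> energy_violating C0 D \<sigma> w F0.
        \<forall>F' \<in> energy_violating C0 D \<sigma> w F0. F \<subseteq> F' \<longrightarrow> F' = F}"


subsection \<open>The local constant\<close>

definition uniform_wrt ::
  "real \<Rightarrow> real set set \<Rightarrow> real measure \<Rightarrow> real measure \<Rightarrow> real set \<Rightarrow> real set set
     \<Rightarrow> (real \<Rightarrow> real) \<Rightarrow> bool" where
  "uniform_wrt C0 D \<sigma> w I0 \<S> f \<longleftrightarrow>
     (\<forall>F \<in> F_energy C0 D \<sigma> w I0. \<exists>S\<in>\<S>. F \<subseteq> S) \<and>
     (\<forall>S\<in>\<S>. \<exists>c. AE x in \<sigma>. x \<in> S \<longrightarrow> f x = c) \<and>
     (\<forall>I\<in>D. I \<subseteq> I0 \<and> \<not> (\<exists>S\<in>\<S>. I \<subseteq> S) \<longrightarrow> average \<sigma> I (\<lambda>x. \<bar>f x\<bar>) \<le> 1)"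

definition weakly_adapted ::
  "nat \<Rightarrow> real set set \<Rightarrow> real measure \<Rightarrow> real set set \<Rightarrow> (real \<Rightarrow> real) \<Rightarrow> bool" where
  "weakly_adapted r D w \<S> g \<longleftrightarrow>
     (\<forall>J\<in>D. (\<exists>S\<in>\<S>. deep_inside r J S) \<longrightarrow> l2_inner w g (haar w J) = 0)"

definition local_const ::
  "real \<Rightarrow> nat \<Rightarrow> real \<Rightarrow> real set set \<Rightarrow> real measure \<Rightarrow> real measure \<Rightarrow> ennreal" where
  "local_const \<epsilon> r C0 D \<sigma> w = Inf {L. \<forall>\<alpha> \<beta> I0 \<S> f g.
     0 < \<alpha> \<and> \<alpha> < \<beta> \<and> I0 \<in> D \<and>
     \<S> \<subseteq> D \<and> disjoint \<S> \<and> (\<forall>S\<in>\<S>. S \<subseteq> I0) \<and>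
     good_function \<epsilon> r D \<sigma> I0 f \<and> uniform_wrt C0 D \<sigma> w I0 \<S> f \<and>
     good_function \<epsilon> r D w I0 g \<and> weakly_adapted r D w \<S> g \<longrightarrow>
       ennreal \<bar>B_above \<alpha> \<beta> r D \<sigma> w I0 f g\<bar>
         \<le> L * ennreal ((sqrt (measure \<sigma> I0) + l2_norm \<sigma> f) * l2_norm w g)}"

end

(*
Expand both functions in Haar series. Stop at the maximal subintervals on which the mean of |f|
exceeds 8 times its mean over the previous stopping interval, or on which the energy condition is
violated; the stopping intervals F are sparse, so they satisfy a Carleson packing condition. Attach
an interval J of the Haar support of g to the stopping interval F of its r-th dyadic ancestor.

The terms with I in the same corona as J are controlled by the local constant: the corona projection
of f, divided by 9 times the mean of |f| over F, is uniform with respect to the stopping children of F,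
and the part of g attached to F is weakly adapted to it. The sum over F is Cauchy-Schwarz, the
Carleson embedding theorem and orthogonality.

For the terms with I above F the argument of the Hilbert transform telescopes to the average of f
over F times the indicator of F, which is handled by testing, plus a function outside of F that is
dominated by the maximal function. As J is good, the Haar coefficients of the Hilbert transform of
the latter are dominated by Poisson integrals times the Haar coefficients of x (monotonicity
principle). This leaves a two weight inequality for the Poisson integral, which follows from its
testing conditions (on two shifted dyadic grids); these follow from A2, the testing condition and,
again through monotonicity, from an energy estimate for disjoint intervals.

The dual form reduces to the first one by antisymmetry of the kernel.
*)
theory Submission
  imports Defs "HOL-Library.Sublist"
begin

text \<open>The obstacle is the Poisson inequality for the terms above the stopping intervals. Its
  second measure puts the mass \<open>(xh q)\<^sup>2\<close> on \<open>V q\<close>, the largest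
  interval of the Haar support of g that contains q and lies at least r generations inside its
  stopping interval. Intervals \<open>V q\<close> of different stopping intervals overlap, so the
  energy estimate for disjoint intervals does not apply to them at once. In the testing condition on
  a window, the sum over points is therefore cut according to how many of the stopping intervals
  around q contain the point. A point inside \<open>A\<close> but outside the next stopping interval
  \<open>B\<close> sees \<open>V q\<close> comparably to a larger interval chosen relative to
  \<open>B\<close>, because that one is good, and for fixed \<open>A\<close> the larger intervals
  are disjoint or equal. The stopping intervals at depth d have measure at most 4^-d of the window,
  which pays for the factor 2^d lost in Cauchy-Schwarz over the depths. The energy estimate may
  choose a truncation of its own, as the testing constant is uniform: one under which the lower
  bound for the kernel holds on the whole window.\<close>

section \<open>Carleson embedding and the maximal function for finite laminar families\<close>

text \<open>Joint convexity of \<open>a\<^sup>2 / c\<close>, the property on which the Bellman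
  function rests. A vanishing weight is allowed, since the quotient is then 0.\<close>

lemma titu:
  fixes a b c d :: real
  assumes "c \<ge> 0" "d \<ge> 0" "c = 0 \<Longrightarrow> a = 0" "d = 0 \<Longrightarrow> b = 0"
  shows "(a + b)\<^sup>2 / (c + d) \<le> a\<^sup>2 / c + b\<^sup>2 / d"
proof (cases "c = 0 \<or> d = 0")
  case True
  then show ?thesis using assms by auto
next
  case False
  then have pos: "c > 0" "d > 0" using assms by auto
  have "a\<^sup>2 / c + b\<^sup>2 / d - (a + b)\<^sup>2 / (c + d) = (a * d - b * c)\<^sup>2 / (c * d * (c + d))"
    using pos by (simp add: divide_simps) (simp add: algebra_simps power2_eq_square power_numeral_reduce)
  moreover have "\<dots> \<ge> 0" using pos by simp
  ultimately show ?thesis by linarith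
qed

lemma weighted_Cauchy_Schwarz:
  fixes f g s :: "'a \<Rightarrow> real"
  assumes "\<And>x. x \<in> X \<Longrightarrow> s x \<ge> 0"
  shows "(\<Sum>x\<in>X. f x * g x * s x)\<^sup>2 \<le> (\<Sum>x\<in>X. (f x)\<^sup>2 * s x) * (\<Sum>x\<in>X. (g x)\<^sup>2 * s x)"
proof -
  have "(\<Sum>x\<in>X. f x * g x * s x) = (\<Sum>x\<in>X. (f x * sqrt (s x)) * (g x * sqrt (s x)))"
    using assms by (intro sum.cong refl) (simp add: algebra_simps flip: power2_eq_square)
  also have "\<dots>\<^sup>2 \<le> (\<Sum>x\<in>X. (f x * sqrt (s x))\<^sup>2) * (\<Sum>x\<in>X. (g x * sqrt (s x))\<^sup>2)"
    by (rule Cauchy_Schwarz_ineq_sum)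
  also have "\<dots> = (\<Sum>x\<in>X. (f x)\<^sup>2 * s x) * (\<Sum>x\<in>X. (g x)\<^sup>2 * s x)"
    using assms by (simp add: power_mult_distrib)
  finally show ?thesis .
qed

lemma weighted_mean_square:
  fixes f s :: "'a \<Rightarrow> real"
  assumes "\<And>x. x \<in> X \<Longrightarrow> s x \<ge> 0"
  shows "(\<Sum>x\<in>X. f x * s x)\<^sup>2 / sum s X \<le> (\<Sum>x\<in>X. (f x)\<^sup>2 * s x)"
proof (cases "sum s X = 0")
  case True
  then show ?thesis using assms by (simp add: sum_nonneg)
next
  case False
  then have "sum s X > 0" using sum_nonneg[of X s] assms by (metis order_less_le)
  moreover have "(\<Sum>x\<in>X. f x * s x)\<^sup>2 \<le> (\<Sum>x\<in>X. (f x)\<^sup>2 * s x) * sum s X"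
    using weighted_Cauchy_Schwarz[of X s f "\<lambda>_. 1"] assms by simp
  ultimately show ?thesis by (simp add: divide_simps)
qed

lemma weighted_sum_eq_0:
  fixes f s :: "'a \<Rightarrow> real"
  assumes "finite X" "\<And>x. x \<in> X \<Longrightarrow> s x \<ge> 0" "sum s X = 0"
  shows "(\<Sum>x\<in>X. f x * s x) = 0"
  using assms by (simp add: sum_nonneg_eq_0_iff)

text \<open>Induction on the number of sets with the Bellman function \<open>4 (F - f\<^sup>2 / (s + a))\<close>.\<close>

lemma carleson_embedding_Bellman:
  fixes A :: "'k \<Rightarrow> 'x set" and s \<phi> :: "'x \<Rightarrow> real" and a :: "'k \<Rightarrow> real"
  assumes "finite \<K>" "finite Y" "\<And>K. K \<in> \<K> \<Longrightarrow> A K \<subseteq> Y"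
    "\<And>K K'. K \<in> \<K> \<Longrightarrow> K' \<in> \<K> \<Longrightarrow> A K \<subseteq> A K' \<or> A K' \<subseteq> A K \<or> A K \<inter> A K' = {}"
    "\<And>x. x \<in> Y \<Longrightarrow> s x \<ge> 0" "\<And>K. K \<in> \<K> \<Longrightarrow> a K \<ge> 0"
    "\<And>R. R \<in> \<K> \<Longrightarrow> sum a {K \<in> \<K>. A K \<subseteq> A R} \<le> sum s (A R)"
  shows "(\<Sum>K\<in>\<K>. a K * ((\<Sum>x\<in>A K. \<phi> x * s x) / sum s (A K))\<^sup>2)
    \<le> 4 * ((\<Sum>x\<in>Y. (\<phi> x)\<^sup>2 * s x) - (\<Sum>x\<in>Y. \<phi> x * s x)\<^sup>2 / (sum s Y + sum a \<K>))"
  using assms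
proof (induction "card \<K>" arbitrary: \<K> Y rule: less_induct)
  case less
  note fin = less.prems(1,2) and sub = less.prems(3) and lam = less.prems(4)
    and s0 = less.prems(5) and a0 = less.prems(6) and car = less.prems(7)
  show ?case
  proof (cases "\<K> = {}")
    case True
    then show ?thesis using weighted_mean_square[of Y s \<phi>] s0 by simp
  next
    case False
    \<comment> \<open>A maximal set is removed. By laminarity the others lie inside
      \<open>A R\<close> or are disjoint from it; another index with the same set as
      \<open>R\<close> goes to \<open>\<K>1\<close>.\<close>
    then obtain R where R: "R \<in> \<K>" and Rmax: "\<And>K. K \<in> \<K> \<Longrightarrow> \<not> A R \<subset> A K"
    proof -
      have "\<exists>B\<in>A ` \<K>. \<forall>C\<in>A ` \<K>. B \<subseteq> C \<longrightarrow> B = C"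
        by (rule finite_has_maximal) (use fin False in auto)
      then show ?thesis using that by blast
    qed
    define \<K>1 where "\<K>1 = {K \<in> \<K> - {R}. A K \<subseteq> A R}"
    define \<K>2 where "\<K>2 = {K \<in> \<K>. \<not> A K \<subseteq> A R}"
    let ?t = "\<lambda>K. a K * ((\<Sum>x\<in>A K. \<phi> x * s x) / sum s (A K))\<^sup>2"
    let ?P = "\<lambda>Z. \<Sum>x\<in>Z. \<phi> x * s x" and ?Q = "\<lambda>Z. \<Sum>x\<in>Z. (\<phi> x)\<^sup>2 * s x"
    have spl: "\<K> = insert R (\<K>1 \<union> \<K>2)" "R \<notin> \<K>1 \<union> \<K>2" "\<K>1 \<inter> \<K>2 = {}"
      using R by (auto simp: \<K>1_def \<K>2_def)
    have fin12: "finite \<K>1" "finite \<K>2" using fin by (auto simp: \<K>1_def \<K>2_def)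
    have c1: "card \<K>1 < card \<K>"
      by (rule psubset_card_mono) (use fin spl in auto)
    have c2: "card \<K>2 < card \<K>"
      by (rule psubset_card_mono) (use fin spl in auto)
    have disj2: "A K \<inter> A R = {}" if "K \<in> \<K>2" for K
      using lam[of K R] R Rmax[of K] that by (auto simp: \<K>2_def)
    have RY: "A R \<subseteq> Y" using sub R by blast
    have finR: "finite (A R)" using RY fin finite_subset by blast
    have carsub: "sum a {K \<in> \<K>'. A K \<subseteq> A R'} \<le> sum s (A R')" if "\<K>' \<subseteq> \<K>" "R' \<in> \<K>'" for \<K>' R'
    proof -
      have "sum a {K \<in> \<K>'. A K \<subseteq> A R'} \<le> sum a {K \<in> \<K>. A K \<subseteq> A R'}"
        by (rule sum_mono2) (use that fin a0 in auto)
      with car[of R'] that show ?thesis by auto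
    qed
    have "(\<Sum>K\<in>\<K>1. ?t K) \<le> 4 * (?Q (A R) - (?P (A R))\<^sup>2 / (sum s (A R) + sum a \<K>1))"
    proof (rule less.hyps[OF c1 fin12(1) finR])
      show "A K \<subseteq> A K' \<or> A K' \<subseteq> A K \<or> A K \<inter> A K' = {}" if "K \<in> \<K>1" "K' \<in> \<K>1" for K K'
        using lam[of K K'] that by (auto simp: \<K>1_def)
      show "sum a {K \<in> \<K>1. A K \<subseteq> A R'} \<le> sum s (A R')" if "R' \<in> \<K>1" for R'
        by (rule carsub[OF _ that]) (auto simp: \<K>1_def)
    qed (use s0 a0 RY in \<open>auto simp: \<K>1_def\<close>)
    moreover have "(\<Sum>K\<in>\<K>2. ?t K) \<le> 4 * (?Q (Y - A R) - (?P (Y - A R))\<^sup>2 / (sum s (Y - A R) + sum a \<K>2))"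
    proof (rule less.hyps[OF c2 fin12(2)])
      show "A K \<subseteq> Y - A R" if "K \<in> \<K>2" for K
        using disj2[OF that] sub[of K] that by (auto simp: \<K>2_def)
      show "A K \<subseteq> A K' \<or> A K' \<subseteq> A K \<or> A K \<inter> A K' = {}" if "K \<in> \<K>2" "K' \<in> \<K>2" for K K'
        using lam[of K K'] that by (auto simp: \<K>2_def)
      show "sum a {K \<in> \<K>2. A K \<subseteq> A R'} \<le> sum s (A R')" if "R' \<in> \<K>2" for R'
        by (rule carsub[OF _ that]) (auto simp: \<K>2_def)
    qed (use s0 a0 fin in \<open>auto simp: \<K>2_def\<close>)
    moreover have "?t R \<le> 4 * ((?P (A R))\<^sup>2 / (sum s (A R) + sum a \<K>1)
        - (?P (A R))\<^sup>2 / (sum s (A R) + (sum a \<K>1 + a R)))"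
    proof (cases "sum s (A R) = 0")
      case True
      then have "?P (A R) = 0" using weighted_sum_eq_0[OF finR, of s \<phi>] s0 RY by auto
      then show ?thesis by simp
    next
      case False
      define S where "S = sum s (A R)"
      define u where "u = sum a \<K>1"
      define v where "v = a R"
      have "S > 0" using False sum_nonneg[of "A R" s] s0 RY unfolding S_def by (metis in_mono order_less_le)
      have u: "u \<ge> 0" unfolding u_def using a0 by (auto simp: \<K>1_def intro!: sum_nonneg)
      have v: "v \<ge> 0" unfolding v_def using a0 R by auto
      have "{K \<in> \<K>. A K \<subseteq> A R} = insert R \<K>1" using R by (auto simp: \<K>1_def)
      \<comment> \<open>The Carleson condition at \<open>R\<close> keeps \<open>S + u\<close> and
        \<open>S + (u + v)\<close> below \<open>2 * S\<close>. This is the origin of the factor 4 in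
        the Bellman function.\<close>
      then have uv: "u + v \<le> S" using car[OF R] fin12 spl unfolding u_def v_def S_def by auto
      have "(S + u) * (S + (u + v)) \<le> (2 * S) * (2 * S)"
        by (rule mult_mono) (use u v uv \<open>S > 0\<close> in auto)
      then have "(S + u) * (S + (u + v)) \<le> 4 * S\<^sup>2" by (simp add: power2_eq_square)
      moreover have "(S + u) * (S + (u + v)) > 0" using \<open>S > 0\<close> u v by (intro mult_pos_pos) auto
      ultimately have "v / S\<^sup>2 \<le> 4 * v / ((S + u) * (S + (u + v)))"
        using v \<open>S > 0\<close> mult_left_mono[of "(S + u) * (S + (u + v))" "4 * S\<^sup>2" v]
        by (simp add: divide_simps)
      also have "\<dots> = 4 * (1 / (S + u) - 1 / (S + (u + v)))"
        using \<open>S > 0\<close> u v by (simp add: divide_simps) 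
      finally have "v / S\<^sup>2 * (?P (A R))\<^sup>2 \<le> 4 * (1 / (S + u) - 1 / (S + (u + v))) * (?P (A R))\<^sup>2"
        by (rule mult_right_mono) simp
      then show ?thesis unfolding S_def[symmetric] u_def[symmetric] v_def[symmetric]
        by (simp add: power_divide algebra_simps)
    qed
    moreover have "(?P Y)\<^sup>2 / (sum s Y + sum a \<K>) \<le> (?P (A R))\<^sup>2 / (sum s (A R) + (sum a \<K>1 + a R))
        + (?P (Y - A R))\<^sup>2 / (sum s (Y - A R) + sum a \<K>2)"
    proof -
      have nn: "sum s (A R) \<ge> 0" "sum s (Y - A R) \<ge> 0" "sum a \<K>1 \<ge> 0" "sum a \<K>2 \<ge> 0" "a R \<ge> 0"
        using s0 a0 RY R by (auto intro!: sum_nonneg simp: \<K>1_def \<K>2_def)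
      have e1: "?P Y = ?P (A R) + ?P (Y - A R)" "sum s Y = sum s (A R) + sum s (Y - A R)"
        using sum.subset_diff[OF RY fin(2)] by (simp_all add: add.commute)
      have e2: "sum a \<K> = a R + (sum a \<K>1 + sum a \<K>2)"
        using spl fin12 by (subst spl(1)) (simp add: sum.union_disjoint)
      have z: "sum s Z = 0 \<Longrightarrow> ?P Z = 0" if "Z \<subseteq> Y" for Z
        using weighted_sum_eq_0[of Z s \<phi>] s0 that fin finite_subset by blast
      have "(?P (A R) + ?P (Y - A R))\<^sup>2 / ((sum s (A R) + (sum a \<K>1 + a R)) + (sum s (Y - A R) + sum a \<K>2))
         \<le> (?P (A R))\<^sup>2 / (sum s (A R) + (sum a \<K>1 + a R))
        + (?P (Y - A R))\<^sup>2 / (sum s (Y - A R) + sum a \<K>2)"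
        by (rule titu) (use nn z[of "A R"] z[of "Y - A R"] RY in auto)
      then show ?thesis using e1 e2 by (simp add: algebra_simps)
    qed
    moreover have "?Q Y = ?Q (A R) + ?Q (Y - A R)"
      using sum.subset_diff[OF RY fin(2)] by (simp add: add.commute)
    moreover have "(\<Sum>K\<in>\<K>. ?t K) = ?t R + ((\<Sum>K\<in>\<K>1. ?t K) + (\<Sum>K\<in>\<K>2. ?t K))"
      using spl fin12 by (subst spl(1)) (simp add: sum.union_disjoint)
    ultimately show ?thesis by simp
  qed
qed

text \<open>Dividing \<open>a\<close> by \<open>C\<close> normalises the packing condition; the
  subtracted square in the Bellman bound is then dropped. The sets are indexed, so that different
  intervals with the same trace on \<open>X\<close> are counted separately.\<close>

lemma carleson_embedding:
  fixes A :: "'k \<Rightarrow> 'x set" and s \<phi> :: "'x \<Rightarrow> real" and a :: "'k \<Rightarrow> real"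
  assumes fin: "finite \<K>" "finite X" and sub: "\<And>K. K \<in> \<K> \<Longrightarrow> A K \<subseteq> X"
    and lam: "\<And>K K'. K \<in> \<K> \<Longrightarrow> K' \<in> \<K> \<Longrightarrow> A K \<subseteq> A K' \<or> A K' \<subseteq> A K \<or> A K \<inter> A K' = {}"
    and s0: "\<And>x. x \<in> X \<Longrightarrow> s x \<ge> 0" and a0: "\<And>K. K \<in> \<K> \<Longrightarrow> a K \<ge> 0"
    and car: "\<And>R. R \<in> \<K> \<Longrightarrow> sum a {K \<in> \<K>. A K \<subseteq> A R} \<le> C * sum s (A R)" and C: "C > 0"
  shows "(\<Sum>K\<in>\<K>. a K * ((\<Sum>x\<in>A K. \<phi> x * s x) / sum s (A K))\<^sup>2) \<le> 4 * C * (\<Sum>x\<in>X. (\<phi> x)\<^sup>2 * s x)"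
proof -
  have "(\<Sum>K\<in>\<K>. (a K / C) * ((\<Sum>x\<in>A K. \<phi> x * s x) / sum s (A K))\<^sup>2)
    \<le> 4 * ((\<Sum>x\<in>X. (\<phi> x)\<^sup>2 * s x) - (\<Sum>x\<in>X. \<phi> x * s x)\<^sup>2 / (sum s X + (\<Sum>K\<in>\<K>. a K / C)))"
  proof (rule carleson_embedding_Bellman[OF fin sub lam s0])
    show "(\<Sum>K\<in>{K \<in> \<K>. A K \<subseteq> A R}. a K / C) \<le> sum s (A R)" if "R \<in> \<K>" for R
      using car[OF that] C by (simp add: sum_divide_distrib[symmetric] divide_simps mult.commute)
  qed (use a0 C in auto)
  also have "\<dots> \<le> 4 * (\<Sum>x\<in>X. (\<phi> x)\<^sup>2 * s x)"
    using s0 a0 C by (simp add: sum_nonneg)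
  finally have "(\<Sum>K\<in>\<K>. a K * ((\<Sum>x\<in>A K. \<phi> x * s x) / sum s (A K))\<^sup>2) / C \<le> 4 * (\<Sum>x\<in>X. (\<phi> x)\<^sup>2 * s x)"
    by (simp add: sum_divide_distrib)
  then show ?thesis using C by (simp add: divide_simps mult.commute mult.left_commute)
qed

text \<open>A linearised maximal function: \<open>\<kappa> x\<close> names the set whose average is
  taken at \<open>x\<close>. The points that select a given set are disjoint from those that select
  another one, so their masses satisfy the packing condition with constant 1.\<close>

lemma maximal_function_bound:
  fixes A :: "'k \<Rightarrow> 'x set" and s \<phi> :: "'x \<Rightarrow> real" and \<kappa> :: "'x \<Rightarrow> 'k"
  assumes fin: "finite \<K>" "finite X" and sub: "\<And>K. K \<in> \<K> \<Longrightarrow> A K \<subseteq> X"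
    and lam: "\<And>K K'. K \<in> \<K> \<Longrightarrow> K' \<in> \<K> \<Longrightarrow> A K \<subseteq> A K' \<or> A K' \<subseteq> A K \<or> A K \<inter> A K' = {}"
    and s0: "\<And>x. x \<in> X \<Longrightarrow> s x \<ge> 0"
    and \<kappa>: "\<And>x. x \<in> X' \<Longrightarrow> \<kappa> x \<in> \<K> \<and> x \<in> A (\<kappa> x)"
  shows "(\<Sum>x\<in>X'. s x * ((\<Sum>z\<in>A (\<kappa> x). \<phi> z * s z) / sum s (A (\<kappa> x)))\<^sup>2) \<le> 4 * (\<Sum>x\<in>X. (\<phi> x)\<^sup>2 * s x)"
proof -
  have X': "X' \<subseteq> X" using \<kappa> sub by blast
  then have finX': "finite X'" using fin finite_subset by blast
  define a where "a K = sum s {x \<in> X'. \<kappa> x = K}" for K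
  let ?g = "\<lambda>K. ((\<Sum>z\<in>A K. \<phi> z * s z) / sum s (A K))\<^sup>2"
  have "(\<Sum>x\<in>X'. s x * ?g (\<kappa> x)) = (\<Sum>K\<in>\<K>. \<Sum>x\<in>{x \<in> X'. \<kappa> x = K}. s x * ?g (\<kappa> x))"
    by (rule sum.group[symmetric]) (use fin finX' \<kappa> in auto)
  also have "\<dots> = (\<Sum>K\<in>\<K>. a K * ?g K)"
    unfolding a_def sum_distrib_right by (intro sum.cong) auto
  also have "\<dots> \<le> 4 * 1 * (\<Sum>x\<in>X. (\<phi> x)\<^sup>2 * s x)"
  proof (rule carleson_embedding[OF fin sub lam s0])
    show "a K \<ge> 0" for K unfolding a_def using s0 X' by (intro sum_nonneg) auto
    show "sum a {K \<in> \<K>. A K \<subseteq> A R} \<le> 1 * sum s (A R)" if "R \<in> \<K>" for R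
    proof -
      have "sum a {K \<in> \<K>. A K \<subseteq> A R} = sum s (\<Union>K\<in>{K \<in> \<K>. A K \<subseteq> A R}. {x \<in> X'. \<kappa> x = K})"
        unfolding a_def by (rule sum.UNION_disjoint[symmetric]) (use fin finX' in auto)
      also have "\<dots> \<le> sum s (A R)"
      proof (rule sum_mono2)
        show "finite (A R)" using sub[OF that] fin finite_subset by blast
        show "s b \<ge> 0" if "b \<in> A R - (\<Union>K\<in>{K \<in> \<K>. A K \<subseteq> A R}. {x \<in> X'. \<kappa> x = K})" for b
          using that sub[OF \<open>R \<in> \<K>\<close>] s0 by blast
      qed (use \<kappa> in blast)
      finally show ?thesis by simp
    qed
  qed auto
  finally show ?thesis by simp
qed

section \<open>The dyadic two weight testing theorem for positive operators\<close>

lemma Union_mem_chain: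
  assumes "finite S" "S \<noteq> {}" "\<And>a b. a \<in> S \<Longrightarrow> b \<in> S \<Longrightarrow> a \<subseteq> b \<or> b \<subseteq> a"
  shows "\<Union>S \<in> S"
  using assms
proof (induction S rule: finite_ne_induct)
  case (insert x F)
  then have "\<Union>F \<in> F" by blast
  with insert.prems[of x "\<Union>F"] show ?case by (auto simp: Un_absorb1 Un_absorb2)
qed auto

lemma sum_four_powr_le:
  fixes I :: "int set"
  assumes "finite I" "\<And>i. i \<in> I \<Longrightarrow> i \<le> n"
  shows "(\<Sum>i\<in>I. 4 powr real_of_int i) \<le> 4/3 * 4 powr real_of_int n"
proof -
  have inj: "inj_on (\<lambda>i. nat (n - i)) I"
    using assms(2) by (intro inj_onI) (simp add: eq_nat_nat_iff)
  have "(\<Sum>i\<in>I. 4 powr real_of_int i) = (\<Sum>i\<in>I. 4 powr real_of_int n * (1/4::real) ^ nat (n - i))"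
  proof (intro sum.cong refl)
    fix i assume "i \<in> I"
    then have "real (nat (n - i)) = real_of_int n - real_of_int i" using assms(2) by force
    then have "(4::real) ^ nat (n - i) = 4 powr (real_of_int n - real_of_int i)"
      by (simp add: powr_realpow[symmetric])
    then show "4 powr real_of_int i = 4 powr real_of_int n * (1/4::real) ^ nat (n - i)"
      by (simp add: power_one_over powr_diff)
  qed
  also have "\<dots> = 4 powr real_of_int n * (\<Sum>k\<in>(\<lambda>i. nat (n - i)) ` I. (1/4::real) ^ k)"
    by (simp add: sum.reindex[OF inj] sum_distrib_left)
  also have "(\<Sum>k\<in>(\<lambda>i. nat (n - i)) ` I. (1/4::real) ^ k) \<le> (\<Sum>k. (1/4) ^ k)"
    by (rule sum_le_suminf) (use assms in \<open>auto intro!: summable_geometric\<close>)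
  also have "\<dots> = 4/3" by (subst suminf_geometric) auto
  finally show ?thesis by simp
qed

text \<open>Treil's proof of the dyadic testing theorem: the form is split according to which of the
  two functions has the larger mean energy, and each half needs one of the two testing conditions.\<close>

locale half_testing =
  fixes \<K> :: "'p set set" and A :: "'p set \<Rightarrow> 'x set" and B :: "'p set \<Rightarrow> 'y set"
    and X :: "'x set" and Y :: "'y set" and s \<phi> :: "'x \<Rightarrow> real" and m \<psi> :: "'y \<Rightarrow> real"
    and lam :: "'p set \<Rightarrow> real" and T :: real
  assumes fin: "finite \<K>" "finite X" "finite Y"
    and AX: "\<And>K. K \<in> \<K> \<Longrightarrow> A K \<subseteq> X" and BY: "\<And>K. K \<in> \<K> \<Longrightarrow> B K \<subseteq> Y"
    and laminar: "\<And>K K'. K \<in> \<K> \<Longrightarrow> K' \<in> \<K> \<Longrightarrow> K \<subseteq> K' \<or> K' \<subseteq> K \<or> K \<inter> K' = {}"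
    and monoA: "\<And>K K'. K \<in> \<K> \<Longrightarrow> K' \<in> \<K> \<Longrightarrow> K \<subseteq> K' \<Longrightarrow> A K \<subseteq> A K'"
    and disjA: "\<And>K K'. K \<in> \<K> \<Longrightarrow> K' \<in> \<K> \<Longrightarrow> K \<inter> K' = {} \<Longrightarrow> A K \<inter> A K' = {}"
    and monoB: "\<And>K K'. K \<in> \<K> \<Longrightarrow> K' \<in> \<K> \<Longrightarrow> K \<subseteq> K' \<Longrightarrow> B K \<subseteq> B K'"
    and disjB: "\<And>K K'. K \<in> \<K> \<Longrightarrow> K' \<in> \<K> \<Longrightarrow> K \<inter> K' = {} \<Longrightarrow> B K \<inter> B K' = {}"
    and s0: "\<And>x. x \<in> X \<Longrightarrow> s x \<ge> 0" and \<phi>0: "\<And>x. x \<in> X \<Longrightarrow> \<phi> x \<ge> 0"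
    and m0: "\<And>y. y \<in> Y \<Longrightarrow> m y \<ge> 0" and \<psi>0: "\<And>y. y \<in> Y \<Longrightarrow> \<psi> y \<ge> 0"
    and lam0: "\<And>K. K \<in> \<K> \<Longrightarrow> lam K \<ge> 0" and T0: "T \<ge> 0"
    and pos: "\<And>K. K \<in> \<K> \<Longrightarrow> (\<Sum>x\<in>A K. \<phi> x * s x) > 0"
    and cls: "\<And>K. K \<in> \<K> \<Longrightarrow> (\<Sum>y\<in>B K. \<psi> y * m y)\<^sup>2 * sum s (A K) \<le> (\<Sum>x\<in>A K. \<phi> x * s x)\<^sup>2 * sum m (B K)"
    and test: "\<And>R. R \<in> \<K> \<Longrightarrow>
      (\<Sum>y\<in>B R. m y * (\<Sum>K | K \<in> \<K> \<and> K \<subseteq> R \<and> y \<in> B K. lam K * sum s (A K))\<^sup>2) \<le> T\<^sup>2 * sum s (A R)"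
begin

definition av where "av K = (\<Sum>x\<in>A K. \<phi> x * s x) / sum s (A K)"
text \<open>The running maximum over ancestors is used in place of the average because it never
  decreases as \<open>K\<close> shrinks. Its binary level thus cuts the tree into connected pieces,
  and the largest members \<open>tp K\<close> of the pieces are the principal intervals.\<close>

definition Mx where "Mx K = Max (av ` {K' \<in> \<K>. K \<subseteq> K'})"
definition lev where "lev K = \<lfloor>log 2 (Mx K)\<rfloor>"
definition tp where "tp K = \<Union>{K' \<in> \<K>. K \<subseteq> K' \<and> lev K' = lev K}"
definition tops where "tops = tp ` \<K>"
definition ch where "ch F = {F' \<in> tops. F' \<subset> F \<and> \<not> (\<exists>G\<in>tops. F' \<subset> G \<and> G \<subset> F)}"

lemma finA: "K \<in> \<K> \<Longrightarrow> finite (A K)" and finB: "K \<in> \<K> \<Longrightarrow> finite (B K)"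
  using finite_subset[OF AX fin(2)] finite_subset[OF BY fin(3)] by auto

lemma sA_pos: assumes "K \<in> \<K>" shows "sum s (A K) > 0"
proof -
  have "sum s (A K) \<ge> 0" using s0 AX assms by (intro sum_nonneg) auto
  moreover have "sum s (A K) \<noteq> 0"
    using weighted_sum_eq_0[OF finA[OF assms], of s \<phi>] s0 AX[OF assms] pos[OF assms] by auto
  ultimately show ?thesis by simp
qed

lemma av_pos: "K \<in> \<K> \<Longrightarrow> av K > 0"
  unfolding av_def using pos sA_pos by simp

lemma nonempty: "K \<in> \<K> \<Longrightarrow> K \<noteq> {}"
  using disjA[of K K] pos[of K] by force

lemma nested: "K \<in> \<K> \<Longrightarrow> K' \<in> \<K> \<Longrightarrow> L \<in> \<K> \<Longrightarrow> L \<subseteq> K \<Longrightarrow> L \<subseteq> K' \<Longrightarrow> K \<subseteq> K' \<or> K' \<subseteq> K"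
  using laminar[of K K'] nonempty[of L] by (metis Int_subset_iff subset_empty)

lemma Mx_ge: "K \<in> \<K> \<Longrightarrow> K' \<in> \<K> \<Longrightarrow> K \<subseteq> K' \<Longrightarrow> av K' \<le> Mx K"
  unfolding Mx_def using fin by (intro Max_ge) auto

lemma Mx_attained: assumes "K \<in> \<K>" obtains K' where "K' \<in> \<K>" "K \<subseteq> K'" "av K' = Mx K"
proof -
  have "Mx K \<in> av ` {K' \<in> \<K>. K \<subseteq> K'}" unfolding Mx_def using fin assms by (intro Max_in) auto
  then show ?thesis using that by auto
qed

lemma Mx_pos: "K \<in> \<K> \<Longrightarrow> Mx K > 0"
  using Mx_ge[of K K] av_pos[of K] by auto

lemma Mx_antimono: "K \<in> \<K> \<Longrightarrow> K' \<in> \<K> \<Longrightarrow> K \<subseteq> K' \<Longrightarrow> Mx K' \<le> Mx K"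
  by (metis Mx_attained Mx_ge order_trans)

lemma lev_antimono: "K \<in> \<K> \<Longrightarrow> K' \<in> \<K> \<Longrightarrow> K \<subseteq> K' \<Longrightarrow> lev K' \<le> lev K"
  unfolding lev_def using Mx_antimono[of K K'] Mx_pos[of K'] Mx_pos[of K]
  by (intro floor_mono) simp

lemma lev_bounds: assumes "K \<in> \<K>"
  shows "2 powr lev K \<le> Mx K" "Mx K < 2 * 2 powr lev K"
proof -
  have "2 powr lev K \<le> 2 powr log 2 (Mx K)" unfolding lev_def by (intro powr_mono) auto
  then show "2 powr lev K \<le> Mx K" using Mx_pos[OF assms] by simp
  have "2 powr log 2 (Mx K) < 2 powr (1 + real_of_int (lev K))" unfolding lev_def
    by (intro powr_less_mono) linarith+
  then show "Mx K < 2 * 2 powr lev K" using Mx_pos[OF assms] by (simp add: powr_add)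
qed

lemma tp_props: assumes "K \<in> \<K>" shows "tp K \<in> \<K>" "K \<subseteq> tp K" "lev (tp K) = lev K"
proof -
  have "tp K \<in> {K' \<in> \<K>. K \<subseteq> K' \<and> lev K' = lev K}" unfolding tp_def
    by (rule Union_mem_chain) (use fin assms nested in auto)
  then show "tp K \<in> \<K>" "K \<subseteq> tp K" "lev (tp K) = lev K" by auto
qed

lemma tp_eq: assumes "K \<in> \<K>" "K' \<in> \<K>" "K \<subseteq> K'" "lev K = lev K'" shows "tp K = tp K'"
proof
  have "K' \<subseteq> tp K" using assms unfolding tp_def by auto
  then show "tp K \<subseteq> tp K'" using tp_props[OF assms(1)] assms unfolding tp_def[of K'] by auto
  show "tp K' \<subseteq> tp K" using assms unfolding tp_def by auto
qed

text \<open>The ancestor at which the running maximum of a top is attained has the same level as the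
  top. It therefore lies in the union that defines the top, so it is the top itself.\<close>

lemma Mx_tp: assumes "K \<in> \<K>" shows "av (tp K) = Mx (tp K)"
proof -
  let ?F = "tp K"
  note F = tp_props[OF assms]
  obtain K' where K': "K' \<in> \<K>" "?F \<subseteq> K'" "av K' = Mx ?F" using Mx_attained F by blast
  have "Mx K' = Mx ?F" using Mx_ge[of K' K'] Mx_antimono[of ?F K'] K' F by auto
  then have "lev K' = lev K" using F unfolding lev_def by simp
  moreover have "K \<subseteq> K'" using K' F by blast
  ultimately have "K' \<subseteq> ?F" using K'(1) unfolding tp_def by auto
  then show ?thesis using K' by auto
qed

lemma av_le: assumes "K \<in> \<K>" shows "av K \<le> 2 * av (tp K)"
proof -
  have "av K \<le> Mx K" using Mx_ge assms by blast
  also have "\<dots> \<le> 2 * 2 powr lev K" using lev_bounds[OF assms] by simp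
  also have "\<dots> \<le> 2 * Mx (tp K)" using lev_bounds(1)[OF tp_props(1)[OF assms]] tp_props(3)[OF assms] by simp
  finally show ?thesis using Mx_tp[OF assms] by simp
qed

lemma finite_tops: "finite tops"
  using fin by (simp add: tops_def)

lemma tops: assumes "F \<in> tops" shows "F \<in> \<K>" "tp F = F"
proof -
  obtain K where K: "K \<in> \<K>" "F = tp K" using assms by (auto simp: tops_def)
  show "F \<in> \<K>" using tp_props(1)[OF K(1)] K by simp
  show "tp F = F" using tp_eq[OF K(1) tp_props(1,2)[OF K(1)] tp_props(3)[OF K(1), symmetric]] K by simp
qed

lemma tops_bounds: assumes "F \<in> tops" shows "2 powr lev F \<le> av F" "av F < 2 * 2 powr lev F"
  using lev_bounds[of F] Mx_tp[of F] tops[of F] assms by auto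

text \<open>Nested tops have different levels, so the squares are dominated by a geometric series of
  ratio 4. The constant is 4, from comparing an average with its level, times 4/3.\<close>

lemma tops_sum_pointwise:
  assumes "S \<subseteq> tops" "S \<noteq> {}" "x \<in> X" "\<And>F. F \<in> S \<Longrightarrow> x \<in> A F" "F0 \<in> S" "\<And>F. F \<in> S \<Longrightarrow> av F \<le> av F0"
  shows "(\<Sum>F\<in>S. (av F)\<^sup>2) \<le> 16/3 * (av F0)\<^sup>2"
proof -
  have S: "finite S" "\<And>F. F \<in> S \<Longrightarrow> F \<in> \<K>"
    using finite_subset[OF assms(1) finite_tops] tops(1) assms(1) by auto
  have inj: "inj_on lev S"
  proof (rule inj_onI)
    fix F G assume FG: "F \<in> S" "G \<in> S" "lev F = lev G"
    then have "F \<subseteq> G \<or> G \<subseteq> F" using laminar[of F G] disjA[of F G] S assms(4) by blast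
    then have "tp F = tp G" using tp_eq[of F G] tp_eq[of G F] FG S by auto
    then show "F = G" using tops finite_tops FG assms(1) by (metis subsetD)
  qed
  define n where "n = Max (lev ` S)"
  have "n \<in> lev ` S" unfolding n_def using S assms(2) by (intro Max_in) auto
  then obtain G where G: "G \<in> S" "lev G = n" by auto
  have sq: "(2 powr real_of_int l)\<^sup>2 = 4 powr real_of_int l" for l
    by (simp add: powr_numeral[symmetric] powr_powr powr_mult[symmetric] power2_eq_square)
  have "(\<Sum>F\<in>S. (av F)\<^sup>2) \<le> (\<Sum>F\<in>S. 4 * 4 powr lev F)"
  proof (rule sum_mono)
    fix F assume F: "F \<in> S"
    have "(av F)\<^sup>2 \<le> (2 * 2 powr lev F)\<^sup>2"
      by (rule power_mono) (use tops_bounds[of F] assms(1) F S av_pos[of F] in force)+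
    then show "(av F)\<^sup>2 \<le> 4 * 4 powr lev F" by (simp add: power_mult_distrib sq)
  qed
  also have "\<dots> = 4 * (\<Sum>i\<in>lev ` S. 4 powr real_of_int i)"
    by (simp add: sum.reindex[OF inj] sum_distrib_left)
  also have "\<dots> \<le> 4 * (4/3 * 4 powr real_of_int n)"
    by (intro mult_left_mono sum_four_powr_le) (use S in \<open>auto simp: n_def\<close>)
  also have "\<dots> = 16/3 * (2 powr lev G)\<^sup>2" using G sq by simp
  also have "\<dots> \<le> 16/3 * (av F0)\<^sup>2"
    using tops_bounds[of G] assms(1) G assms(6)[of G]
    by (intro mult_left_mono power_mono) auto
  finally show ?thesis .
qed

text \<open>At each point the tops reduce to the one with the largest average, and choosing it is a
  linearised maximal function: 64/3 = 16/3 * 4.\<close>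

lemma tops_sparse: "(\<Sum>F\<in>tops. sum s (A F) * (av F)\<^sup>2) \<le> 64/3 * (\<Sum>x\<in>X. (\<phi> x)\<^sup>2 * s x)"
proof -
  define S where "S x = {F \<in> tops. x \<in> A F}" for x
  define X' where "X' = {x \<in> X. S x \<noteq> {}}"
  define \<kappa> where "\<kappa> x = (SOME F. F \<in> S x \<and> (\<forall>G\<in>S x. av G \<le> av F))" for x
  have \<kappa>: "\<kappa> x \<in> S x \<and> (\<forall>G\<in>S x. av G \<le> av (\<kappa> x))" if "x \<in> X'" for x
  proof -
    have fS: "finite (S x)" "S x \<noteq> {}" using tops finite_tops that by (auto simp: S_def X'_def)
    then have "Max (av ` S x) \<in> av ` S x" by (intro Max_in) auto
    then obtain F where "F \<in> S x" "av F = Max (av ` S x)" by auto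
    then have "\<exists>F. F \<in> S x \<and> (\<forall>G\<in>S x. av G \<le> av F)" using fS by auto
    then show ?thesis unfolding \<kappa>_def by (rule someI_ex)
  qed
  have "(\<Sum>F\<in>tops. sum s (A F) * (av F)\<^sup>2) = (\<Sum>F\<in>tops. \<Sum>x | x \<in> X \<and> x \<in> A F. s x * (av F)\<^sup>2)"
    using AX tops by (intro sum.cong refl) (auto simp: sum_distrib_right intro!: sum.cong)
  also have "\<dots> = (\<Sum>x\<in>X. \<Sum>F\<in>S x. s x * (av F)\<^sup>2)"
    unfolding S_def by (rule sum.swap_restrict) (use tops finite_tops fin in auto)
  also have "\<dots> = (\<Sum>x\<in>X'. \<Sum>F\<in>S x. s x * (av F)\<^sup>2)"
    by (rule sum.mono_neutral_right) (use fin in \<open>auto simp: X'_def\<close>)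
  also have "\<dots> \<le> (\<Sum>x\<in>X'. s x * (16/3 * (av (\<kappa> x))\<^sup>2))"
  proof (rule sum_mono)
    fix x assume x: "x \<in> X'"
    have "(\<Sum>F\<in>S x. (av F)\<^sup>2) \<le> 16/3 * (av (\<kappa> x))\<^sup>2"
      by (rule tops_sum_pointwise[of _ x]) (use \<kappa>[OF x] x in \<open>auto simp: S_def X'_def\<close>)
    then show "(\<Sum>F\<in>S x. s x * (av F)\<^sup>2) \<le> s x * (16/3 * (av (\<kappa> x))\<^sup>2)"
      using s0 x unfolding sum_distrib_left[symmetric] by (intro mult_left_mono) (auto simp: X'_def)
  qed
  also have "\<dots> = 16/3 * (\<Sum>x\<in>X'. s x * (av (\<kappa> x))\<^sup>2)"
    by (simp add: sum_distrib_left algebra_simps)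
  also have "(\<Sum>x\<in>X'. s x * (av (\<kappa> x))\<^sup>2) \<le> 4 * (\<Sum>x\<in>X. (\<phi> x)\<^sup>2 * s x)"
    unfolding av_def
  proof (rule maximal_function_bound[OF fin(1,2) AX])
    show "A K \<subseteq> A K' \<or> A K' \<subseteq> A K \<or> A K \<inter> A K' = {}" if "K \<in> \<K>" "K' \<in> \<K>" for K K'
      using laminar[OF that] monoA disjA that by metis
    show "\<kappa> x \<in> \<K> \<and> x \<in> A (\<kappa> x)" if "x \<in> X'" for x
      using \<kappa>[OF that] tops by (auto simp: S_def)
  qed (use s0 in auto)
  finally show ?thesis by simp
qed

lemma ch_sub: "F' \<in> ch F \<Longrightarrow> F' \<in> tops \<and> F' \<subset> F"
  unfolding ch_def by auto

lemma ex_child: assumes "F \<in> tops" "G \<in> tops" "G \<subset> F" obtains F' where "F' \<in> ch F" "G \<subseteq> F'"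
proof -
  have "\<exists>m\<in>{G' \<in> tops. G \<subseteq> G' \<and> G' \<subset> F}. G \<subseteq> m \<and> (\<forall>b\<in>{G' \<in> tops. G \<subseteq> G' \<and> G' \<subset> F}. m \<subseteq> b \<longrightarrow> m = b)"
    by (rule finite_has_maximal2) (use tops finite_tops assms in auto)
  then obtain F' where m: "F' \<in> {G' \<in> tops. G \<subseteq> G' \<and> G' \<subset> F}"
      "G \<subseteq> F' \<and> (\<forall>b\<in>{G' \<in> tops. G \<subseteq> G' \<and> G' \<subset> F}. F' \<subseteq> b \<longrightarrow> F' = b)"
    by (rule bexE)
  have F': "F' \<in> tops" "G \<subseteq> F'" "F' \<subset> F" using m(1) by simp_all
  have "H = F'" if "H \<in> tops" "F' \<subseteq> H" "H \<subset> F" for H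
  proof -
    have "H \<in> {G' \<in> tops. G \<subseteq> G' \<and> G' \<subset> F}" using that F'(2) by simp
    then show ?thesis using m(2) that(2) by metis
  qed
  then have "\<not> (F' \<subset> H \<and> H \<subset> F)" if "H \<in> tops" for H
    using that by (auto simp: psubset_eq)
  then have "\<not> (\<exists>H\<in>tops. F' \<subset> H \<and> H \<subset> F)" by simp
  with F' have "F' \<in> ch F" unfolding ch_def by blast
  then show ?thesis using that F' by blast
qed

lemma ch_disjoint: assumes "F1 \<in> ch F" "F2 \<in> ch F" "F1 \<noteq> F2" shows "B F1 \<inter> B F2 = {}"
proof -
  have "\<not> F1 \<subseteq> F2" "\<not> F2 \<subseteq> F1" using assms unfolding ch_def by auto
  then show ?thesis using laminar[of F1 F2] disjB[of F1 F2] tops ch_sub assms by blast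
qed

lemma ch_unique: assumes "F' \<in> ch F1" "F' \<in> ch F2" "F1 \<in> tops" "F2 \<in> tops" shows "F1 = F2"
proof (rule ccontr)
  assume "F1 \<noteq> F2"
  moreover have "F1 \<subseteq> F2 \<or> F2 \<subseteq> F1" using nested[of F1 F2 F'] tops ch_sub assms by blast
  ultimately show False using assms unfolding ch_def by auto
qed

text \<open>Otherwise \<open>K\<close> would lie inside \<open>F'\<close>, the level of
  \<open>F'\<close> would be squeezed between those of \<open>K\<close> and \<open>F\<close>, and
  \<open>F'\<close> would have \<open>F\<close> as its top. Hence the testing function of a fibre is
  constant on \<open>B F'\<close>.\<close>

lemma fibre_child: assumes "K \<in> \<K>" "tp K = F" "F' \<in> ch F" "y \<in> B K" "y \<in> B F'" shows "F' \<subseteq> K"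
proof (rule ccontr)
  assume n: "\<not> F' \<subseteq> K"
  have F': "F' \<in> \<K>" "F' \<subseteq> F" "F' \<noteq> F" "F' \<in> tops" using assms ch_sub tops by blast+
  have F: "F \<in> \<K>" "lev F = lev K" "tp F = F"
    using tp_props[OF assms(1)] assms(1,2) tops(2)[of F] by (auto simp: tops_def)
  have "K \<subseteq> F'" using laminar[of K F'] disjB[of K F'] assms F' n by blast
  then have "lev F' = lev F" using lev_antimono[of K F'] lev_antimono[of F' F] F F' assms by auto
  then have "tp F' = tp F" using tp_eq[of F' F] F F' by auto
  then show False using F' F tops by metis
qed

text \<open>The part of \<open>B F\<close> on which \<psi> has to be kept as it is; on the sets
  \<open>B F'\<close> of the children it can be averaged. Terminal sets of different tops are
  disjoint, so the square integral of \<psi> is spent once.\<close>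

definition terminal where "terminal F = {y \<in> B F. \<forall>F'\<in>ch F. y \<notin> B F'}"

text \<open>Over the fibre of \<open>F\<close> the averages of \<phi> are at most
  \<open>2 * av F\<close>, which leaves the testing function of \<open>F\<close> integrated against
  \<psi>. As that function is constant on each \<open>B F'\<close>, \<psi> may be replaced there by
  its mean, whose energy \<open>cls\<close> bounds by that of \<phi> over
  \<open>A F'\<close>.\<close>

lemma fibre_bound:
  assumes F: "F \<in> tops"
  shows "(\<Sum>K | K \<in> \<K> \<and> tp K = F. lam K * (\<Sum>x\<in>A K. \<phi> x * s x) * (\<Sum>y\<in>B K. \<psi> y * m y))
    \<le> T * (sum s (A F) * (av F)\<^sup>2 + ((\<Sum>y\<in>terminal F. (\<psi> y)\<^sup>2 * m y) + (\<Sum>F'\<in>ch F. sum s (A F') * (av F')\<^sup>2)))"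
proof -
  define KF where "KF = {K \<in> \<K>. tp K = F}"
  have FK: "F \<in> \<K>" "finite KF" "\<And>K. K \<in> KF \<Longrightarrow> K \<in> \<K> \<and> K \<subseteq> F"
    using tops(1)[OF F] fin(1) tp_props(2) unfolding KF_def by auto
  define u where "u y = (\<Sum>K | K \<in> KF \<and> y \<in> B K. lam K * sum s (A K))" for y
  define c where "c F' = (\<Sum>K | K \<in> KF \<and> F' \<subseteq> K. lam K * sum s (A K))" for F'
  let ?pB = "\<lambda>K. \<Sum>y\<in>B K. \<psi> y * m y" and ?mB = "\<lambda>K. sum m (B K)"
  have sA0: "sum s (A K) \<ge> 0" if "K \<in> \<K>" for K using sA_pos[OF that] by simp
  have mB0: "?mB K \<ge> 0" if "K \<in> \<K>" for K using BY[OF that] m0 by (intro sum_nonneg) auto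
  have pB0: "?pB K \<ge> 0" if "K \<in> \<K>" for K using BY[OF that] m0 \<psi>0 by (intro sum_nonneg mult_nonneg_nonneg) auto
  have u0: "u y \<ge> 0" for y unfolding u_def by (rule sum_nonneg) (auto intro!: mult_nonneg_nonneg lam0 sA0 dest: FK(3))
  have chB: "B F' \<subseteq> B F" "F' \<in> \<K>" "F' \<in> tops" if "F' \<in> ch F" for F'
  proof -
    note F' = ch_sub[OF that]
    show "F' \<in> tops" using F' by blast
    then show "F' \<in> \<K>" by (rule tops(1))
    then show "B F' \<subseteq> B F" using monoB[of F' F] FK(1) F' by blast
  qed
  have uc: "u y = c F'" if "F' \<in> ch F" "y \<in> B F'" for y F'
  proof -
    have "{K \<in> KF. y \<in> B K} = {K \<in> KF. F' \<subseteq> K}"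
    proof -
      have "y \<in> B K \<longleftrightarrow> F' \<subseteq> K" if K: "K \<in> KF" for K
      proof
        have K': "K \<in> \<K>" "tp K = F" using K by (auto simp: KF_def)
        show "F' \<subseteq> K" if "y \<in> B K"
          by (rule fibre_child[OF K' \<open>F' \<in> ch F\<close> that \<open>y \<in> B F'\<close>])
        show "y \<in> B K" if "F' \<subseteq> K"
          using monoB[OF chB(2)[OF \<open>F' \<in> ch F\<close>] K'(1) that] \<open>y \<in> B F'\<close> by blast
      qed
      then show ?thesis by blast
    qed
    then show ?thesis unfolding u_def c_def by simp
  qed
  have "(\<Sum>K\<in>KF. lam K * (\<Sum>x\<in>A K. \<phi> x * s x) * ?pB K) \<le> (\<Sum>K\<in>KF. 2 * av F * (lam K * sum s (A K) * ?pB K))"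
  proof (rule sum_mono)
    fix K assume K: "K \<in> KF"
    then have K': "K \<in> \<K>" "tp K = F" by (auto simp: KF_def)
    have "(\<Sum>x\<in>A K. \<phi> x * s x) = av K * sum s (A K)" using sA_pos[OF K'(1)] by (simp add: av_def)
    also have "\<dots> \<le> (2 * av F) * sum s (A K)"
      by (rule mult_right_mono) (use av_le[OF K'(1)] K' sA0 in auto)
    finally have "lam K * ?pB K * (\<Sum>x\<in>A K. \<phi> x * s x) \<le> lam K * ?pB K * ((2 * av F) * sum s (A K))"
      by (rule mult_left_mono) (use lam0 pB0 K' in auto)
    then show "lam K * (\<Sum>x\<in>A K. \<phi> x * s x) * ?pB K \<le> 2 * av F * (lam K * sum s (A K) * ?pB K)"
      by (simp add: algebra_simps)
  qed
  then have step1: "(\<Sum>K\<in>KF. lam K * (\<Sum>x\<in>A K. \<phi> x * s x) * ?pB K) \<le> 2 * av F * (\<Sum>K\<in>KF. lam K * sum s (A K) * ?pB K)"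
    by (simp only: sum_distrib_left[symmetric])
  have step2: "(\<Sum>K\<in>KF. lam K * sum s (A K) * ?pB K) = (\<Sum>y\<in>B F. \<psi> y * m y * u y)"
  proof -
    have "(\<Sum>K\<in>KF. lam K * sum s (A K) * ?pB K) = (\<Sum>K\<in>KF. \<Sum>y | y \<in> B F \<and> y \<in> B K. lam K * sum s (A K) * (\<psi> y * m y))"
    proof (intro sum.cong refl)
      fix K assume "K \<in> KF"
      then have "{y \<in> B F. y \<in> B K} = B K" using monoB[of K F] FK(1) FK(3)[of K] by blast
      then show "lam K * sum s (A K) * ?pB K = (\<Sum>y | y \<in> B F \<and> y \<in> B K. lam K * sum s (A K) * (\<psi> y * m y))"
        by (simp add: sum_distrib_left)
    qed
    also have "\<dots> = (\<Sum>y\<in>B F. \<Sum>K | K \<in> KF \<and> y \<in> B K. lam K * sum s (A K) * (\<psi> y * m y))"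
      by (rule sum.swap_restrict) (use FK(2) finB[OF FK(1)] in auto)
    also have "\<dots> = (\<Sum>y\<in>B F. \<psi> y * m y * u y)"
      unfolding u_def by (simp add: sum_distrib_left algebra_simps)
    finally show ?thesis .
  qed
  have part: "B F = terminal F \<union> (\<Union>F'\<in>ch F. B F')" "terminal F \<inter> (\<Union>F'\<in>ch F. B F') = {}"
    using chB(1) by (auto simp: terminal_def)
  have fch: "finite (ch F)" using finite_tops by (simp add: ch_def)
  have ft: "finite (terminal F)" using finB[OF FK(1)] by (auto simp: terminal_def)
  have split: "(\<Sum>y\<in>B F. h y) = (\<Sum>y\<in>terminal F. h y) + (\<Sum>F'\<in>ch F. \<Sum>y\<in>B F'. h y)" for h :: "'y \<Rightarrow> real"
  proof -
    have "(\<Sum>y\<in>B F. h y) = (\<Sum>y\<in>terminal F. h y) + (\<Sum>y\<in>(\<Union>F'\<in>ch F. B F'). h y)"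
      by (subst part(1)) (rule sum.union_disjoint, use part(2) ft fch finB[OF chB(2)] in auto)
    also have "(\<Sum>y\<in>(\<Union>F'\<in>ch F. B F'). h y) = (\<Sum>F'\<in>ch F. \<Sum>y\<in>B F'. h y)"
      by (rule sum.UNION_disjoint) (use fch finB[OF chB(2)] ch_disjoint in auto)
    finally show ?thesis .
  qed
  define own where "own y = (THE F'. F' \<in> ch F \<and> y \<in> B F')" for y
  define \<psi>' where "\<psi>' y = (if y \<in> terminal F then \<psi> y else ?pB (own y) / ?mB (own y))" for y
  have own: "own y = F'" if "F' \<in> ch F" "y \<in> B F'" for y F'
    unfolding own_def by (rule the_equality) (use that ch_disjoint[of _ F] in blast)+
  have \<psi>'ch: "\<psi>' y = ?pB F' / ?mB F'" if "F' \<in> ch F" "y \<in> B F'" for y F'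
  proof -
    have "y \<notin> terminal F" using that by (auto simp: terminal_def)
    then show ?thesis using own[OF that] by (simp add: \<psi>'_def)
  qed
  \<comment> \<open>If \<open>B F'\<close> has no mass the mean is 0 by division, which is
    consistent because \<psi> then has no integral over it.\<close>
  have mz: "?pB F' = 0" if "F' \<in> ch F" "?mB F' = 0" for F'
    by (rule weighted_sum_eq_0) (use that m0 BY[OF chB(2)[OF that(1)]] finB[OF chB(2)[OF that(1)]] in auto)
  have step3: "(\<Sum>y\<in>B F. \<psi> y * m y * u y) = (\<Sum>y\<in>B F. \<psi>' y * u y * m y)"
  proof -
    have "(\<Sum>y\<in>B F'. \<psi> y * m y * u y) = (\<Sum>y\<in>B F'. \<psi>' y * u y * m y)" if F': "F' \<in> ch F" for F'
    proof -
      have "(\<Sum>y\<in>B F'. \<psi> y * m y * u y) = c F' * ?pB F'"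
        using uc[OF F'] by (simp add: sum_distrib_left algebra_simps)
      moreover have "(\<Sum>y\<in>B F'. \<psi>' y * u y * m y) = (\<Sum>y\<in>B F'. c F' * (?pB F' / ?mB F') * m y)"
        by (intro sum.cong refl) (simp add: uc[OF F'] \<psi>'ch[OF F'])
      moreover have "\<dots> = c F' * (?pB F' / ?mB F') * ?mB F'" by (rule sum_distrib_left[symmetric])
      ultimately show ?thesis using mz[OF F'] by auto
    qed
    moreover have "(\<Sum>y\<in>terminal F. \<psi> y * m y * u y) = (\<Sum>y\<in>terminal F. \<psi>' y * u y * m y)"
      by (intro sum.cong refl) (auto simp: \<psi>'_def)
    ultimately show ?thesis unfolding split by simp
  qed
  have step4: "(\<Sum>y\<in>B F. (u y)\<^sup>2 * m y) \<le> T\<^sup>2 * sum s (A F)"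
  proof -
    have "(\<Sum>y\<in>B F. (u y)\<^sup>2 * m y) \<le> (\<Sum>y\<in>B F. m y * (\<Sum>K | K \<in> \<K> \<and> K \<subseteq> F \<and> y \<in> B K. lam K * sum s (A K))\<^sup>2)"
    proof (rule sum_mono)
      fix y assume y: "y \<in> B F"
      have "u y \<le> (\<Sum>K | K \<in> \<K> \<and> K \<subseteq> F \<and> y \<in> B K. lam K * sum s (A K))"
        unfolding u_def by (rule sum_mono2) (use fin(1) FK(3) lam0 sA0 in auto)
      then have "(u y)\<^sup>2 \<le> (\<Sum>K | K \<in> \<K> \<and> K \<subseteq> F \<and> y \<in> B K. lam K * sum s (A K))\<^sup>2"
        using u0 by (rule power_mono)
      then have "m y * (u y)\<^sup>2 \<le> m y * (\<Sum>K | K \<in> \<K> \<and> K \<subseteq> F \<and> y \<in> B K. lam K * sum s (A K))\<^sup>2"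
        by (rule mult_left_mono) (use m0 BY[OF FK(1)] y in auto)
      then show "(u y)\<^sup>2 * m y \<le> m y * (\<Sum>K | K \<in> \<K> \<and> K \<subseteq> F \<and> y \<in> B K. lam K * sum s (A K))\<^sup>2"
        by (simp add: mult.commute)
    qed
    also have "\<dots> \<le> T\<^sup>2 * sum s (A F)" by (rule test[OF FK(1)])
    finally show ?thesis .
  qed
  define D where "D = (\<Sum>y\<in>B F. (\<psi>' y)\<^sup>2 * m y)"
  have D0: "D \<ge> 0" unfolding D_def using m0 BY[OF FK(1)] by (intro sum_nonneg mult_nonneg_nonneg) auto
  have step5: "D \<le> (\<Sum>y\<in>terminal F. (\<psi> y)\<^sup>2 * m y) + (\<Sum>F'\<in>ch F. sum s (A F') * (av F')\<^sup>2)"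
  proof -
    have "(\<Sum>y\<in>B F'. (\<psi>' y)\<^sup>2 * m y) \<le> sum s (A F') * (av F')\<^sup>2" if F': "F' \<in> ch F" for F'
    proof -
      have sp: "sum s (A F') > 0" using sA_pos chB F' by blast
      have eq: "(\<Sum>y\<in>B F'. (\<psi>' y)\<^sup>2 * m y) = (?pB F' / ?mB F')\<^sup>2 * ?mB F'"
        using \<psi>'ch[OF F'] by (simp add: sum_distrib_left)
      show ?thesis
      proof (cases "?mB F' = 0")
        case True
        then show ?thesis unfolding eq using sp by simp
      next
        case False
        then have mp: "?mB F' > 0" using mB0[of F'] chB F' by force
        have "(?pB F')\<^sup>2 * sum s (A F') \<le> (\<Sum>x\<in>A F'. \<phi> x * s x)\<^sup>2 * ?mB F'"
          using cls chB F' by blast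
        then show ?thesis unfolding eq av_def using sp mp
          by (simp add: power2_eq_square divide_simps)
      qed
    qed
    then have "(\<Sum>F'\<in>ch F. \<Sum>y\<in>B F'. (\<psi>' y)\<^sup>2 * m y) \<le> (\<Sum>F'\<in>ch F. sum s (A F') * (av F')\<^sup>2)"
      by (rule sum_mono)
    moreover have "(\<Sum>y\<in>terminal F. (\<psi>' y)\<^sup>2 * m y) = (\<Sum>y\<in>terminal F. (\<psi> y)\<^sup>2 * m y)"
      by (intro sum.cong refl) (auto simp: \<psi>'_def)
    ultimately show ?thesis unfolding D_def split by simp
  qed
  define Z where "Z = (\<Sum>y\<in>B F. \<psi>' y * u y * m y)"
  have "Z\<^sup>2 \<le> D * (\<Sum>y\<in>B F. (u y)\<^sup>2 * m y)"
    unfolding Z_def D_def by (rule weighted_Cauchy_Schwarz) (use m0 BY[OF FK(1)] in auto)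
  also have "\<dots> \<le> D * (T\<^sup>2 * sum s (A F))" by (rule mult_left_mono[OF step4 D0])
  finally have "Z \<le> sqrt (D * (T\<^sup>2 * sum s (A F)))" by (rule real_le_rsqrt)
  also have "\<dots> = T * (sqrt D * sqrt (sum s (A F)))" using T0 by (simp add: real_sqrt_mult)
  finally have Z: "2 * av F * Z \<le> 2 * av F * (T * (sqrt D * sqrt (sum s (A F))))"
    using av_pos[OF FK(1)] by (intro mult_left_mono) auto
  \<comment> \<open>From here on the bound is a sum of squares and no longer homogeneous in \<phi>
    and \<psi> separately; \<open>optimize_scale\<close> restores the product at the very
    end.\<close>
  have "2 * (av F * sqrt (sum s (A F))) * sqrt D \<le> (av F * sqrt (sum s (A F)))\<^sup>2 + (sqrt D)\<^sup>2"
    by (rule sum_squares_bound)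
  also have "\<dots> = sum s (A F) * (av F)\<^sup>2 + D"
    using D0 sA0[OF FK(1)] by (simp add: power_mult_distrib mult.commute)
  finally have "T * (2 * (av F * sqrt (sum s (A F))) * sqrt D) \<le> T * (sum s (A F) * (av F)\<^sup>2 + D)"
    using T0 by (rule mult_left_mono)
  also have "\<dots> \<le> T * (sum s (A F) * (av F)\<^sup>2 + ((\<Sum>y\<in>terminal F. (\<psi> y)\<^sup>2 * m y) + (\<Sum>F'\<in>ch F. sum s (A F') * (av F')\<^sup>2)))"
    using step5 T0 by (intro mult_left_mono) auto
  finally show ?thesis using step1 step2 step3 Z
    unfolding KF_def[symmetric] Z_def[symmetric] by (simp add: algebra_simps)
qed

text \<open>Each top is a child of at most one other top, so summing over the fibres counts the tops
  at most twice: 43 is 2 * 64/3 rounded up.\<close>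

theorem half_bound:
  "(\<Sum>K\<in>\<K>. lam K * (\<Sum>x\<in>A K. \<phi> x * s x) * (\<Sum>y\<in>B K. \<psi> y * m y))
    \<le> T * (43 * (\<Sum>x\<in>X. (\<phi> x)\<^sup>2 * s x) + (\<Sum>y\<in>Y. (\<psi> y)\<^sup>2 * m y))"
proof -
  let ?w = "\<lambda>F. sum s (A F) * (av F)\<^sup>2"
  have w0: "?w F \<ge> 0" if "F \<in> tops" for F using sA_pos[OF tops(1)[OF that]] by simp
  have "(\<Sum>K\<in>\<K>. lam K * (\<Sum>x\<in>A K. \<phi> x * s x) * (\<Sum>y\<in>B K. \<psi> y * m y))
    = (\<Sum>F\<in>tops. \<Sum>K | K \<in> \<K> \<and> tp K = F. lam K * (\<Sum>x\<in>A K. \<phi> x * s x) * (\<Sum>y\<in>B K. \<psi> y * m y))"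
    by (rule sum.group[symmetric]) (use fin finite_tops in \<open>auto simp: tops_def\<close>)
  also have "\<dots> \<le> (\<Sum>F\<in>tops. T * (?w F + ((\<Sum>y\<in>terminal F. (\<psi> y)\<^sup>2 * m y) + (\<Sum>F'\<in>ch F. ?w F'))))"
    by (rule sum_mono) (rule fibre_bound)
  also have "\<dots> = T * (sum ?w tops + ((\<Sum>F\<in>tops. \<Sum>y\<in>terminal F. (\<psi> y)\<^sup>2 * m y) + (\<Sum>F\<in>tops. \<Sum>F'\<in>ch F. ?w F')))"
    by (simp add: sum.distrib sum_distrib_left[symmetric])
  also have "\<dots> \<le> T * (43 * (\<Sum>x\<in>X. (\<phi> x)\<^sup>2 * s x) + (\<Sum>y\<in>Y. (\<psi> y)\<^sup>2 * m y))"
  proof (rule mult_left_mono[OF _ T0])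
    have fch: "finite (ch F)" for F using finite_tops by (simp add: ch_def)
    have "(\<Sum>F\<in>tops. \<Sum>F'\<in>ch F. ?w F') = sum ?w (\<Union>F\<in>tops. ch F)"
      by (rule sum.UNION_disjoint[symmetric]) (use finite_tops fch ch_unique in auto)
    also have "\<dots> \<le> sum ?w tops"
      by (rule sum_mono2) (use finite_tops ch_sub w0 in auto)
    finally have 1: "(\<Sum>F\<in>tops. \<Sum>F'\<in>ch F. ?w F') \<le> sum ?w tops" .
    have fterm: "finite (terminal F)" if "F \<in> tops" for F using finB[OF tops(1)[OF that]] by (simp add: terminal_def)
    have disj: "terminal F1 \<inter> terminal F2 = {}" if "F1 \<in> tops" "F2 \<in> tops" "F1 \<noteq> F2" for F1 F2
    proof -
      have *: "terminal F1 \<inter> terminal F2 = {}" if sub: "F1 \<subset> F2" and "F1 \<in> tops" "F2 \<in> tops" for F1 F2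
      proof -
        obtain F' where "F' \<in> ch F2" "F1 \<subseteq> F'" by (rule ex_child[OF \<open>F2 \<in> tops\<close> \<open>F1 \<in> tops\<close> sub])
        then have "B F1 \<subseteq> B F'" using monoB[of F1 F'] tops(1) ch_sub[OF \<open>F' \<in> ch F2\<close>] that by blast
        then show ?thesis using \<open>F' \<in> ch F2\<close> by (auto simp: terminal_def)
      qed
      have "F1 \<subset> F2 \<or> F2 \<subset> F1 \<or> F1 \<inter> F2 = {}" using laminar[OF tops(1)[OF that(1)] tops(1)[OF that(2)]] that by blast
      then show ?thesis using *[of F1 F2] *[of F2 F1] disjB[OF tops(1)[OF that(1)] tops(1)[OF that(2)]] that unfolding terminal_def by blast
    qed
    have "(\<Sum>F\<in>tops. \<Sum>y\<in>terminal F. (\<psi> y)\<^sup>2 * m y) = (\<Sum>y\<in>(\<Union>F\<in>tops. terminal F). (\<psi> y)\<^sup>2 * m y)"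
      by (rule sum.UNION_disjoint[symmetric]) (use finite_tops fterm disj in auto)
    also have "\<dots> \<le> (\<Sum>y\<in>Y. (\<psi> y)\<^sup>2 * m y)"
      by (rule sum_mono2) (use fin BY[OF tops(1)] m0 in \<open>auto simp: terminal_def\<close>)
    finally have 2: "(\<Sum>F\<in>tops. \<Sum>y\<in>terminal F. (\<psi> y)\<^sup>2 * m y) \<le> (\<Sum>y\<in>Y. (\<psi> y)\<^sup>2 * m y)" .
    have "(\<Sum>x\<in>X. (\<phi> x)\<^sup>2 * s x) \<ge> 0" using s0 by (intro sum_nonneg) auto
    with 1 2 tops_sparse
    show "sum ?w tops + ((\<Sum>F\<in>tops. \<Sum>y\<in>terminal F. (\<psi> y)\<^sup>2 * m y) + (\<Sum>F\<in>tops. \<Sum>F'\<in>ch F. ?w F'))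
      \<le> 43 * (\<Sum>x\<in>X. (\<phi> x)\<^sup>2 * s x) + (\<Sum>y\<in>Y. (\<psi> y)\<^sup>2 * m y)" by linarith
  qed
  finally show ?thesis .
qed

end

subsection \<open>Two weight inequality for a Poisson kernel\<close>

text \<open>Up to constants the kernel of \<open>poisson\<close> for an interval of length
  \<open>t\<close> at distance \<open>z\<close>, without its factor \<open>t\<close>. That factor is
  carried by the Haar coefficients of x.\<close>

definition pk :: "real \<Rightarrow> real \<Rightarrow> real" where
  "pk t z = 1 / (t + \<bar>z\<bar>)\<^sup>2"

lemma pk_nonneg [simp]: "pk t z \<ge> 0"
  by (simp add: pk_def)

text \<open>The one-third trick: \<open>d = 0\<close> gives a standard grid below the scale
  \<open>l\<close>, and \<open>d = 1\<close> its shift by a third of a cell. The sign alternates to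
  keep the shifted grid nested, because 2 (i + e/3) = (2 i + e) - e/3 for the shift e of the
  parent.\<close>

definition gcell :: "real \<Rightarrow> int \<Rightarrow> nat \<Rightarrow> int \<Rightarrow> real set" where
  "gcell l d k j = {l / 2 ^ k * (real_of_int j + real_of_int d * (-1) ^ k / 3) ..<
                    l / 2 ^ k * (real_of_int j + 1 + real_of_int d * (-1) ^ k / 3)}"

lemma gcell_parent:
  assumes "l > 0"
  shows "gcell l d (Suc k) j \<subseteq> gcell l d k ((j - d * (-1) ^ k) div 2)"
proof -
  define i where "i = j - d * (-1) ^ k"
  define e where "e = real_of_int d * (-1) ^ k"
  have i: "real_of_int i = real_of_int j - e" by (simp add: i_def e_def)
  have "2 * (i div 2) \<le> i" "i \<le> 2 * (i div 2) + 1" by presburger+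
  then have b: "2 * real_of_int (i div 2) \<le> real_of_int j - e" "real_of_int j - e \<le> 2 * real_of_int (i div 2) + 1"
    unfolding i[symmetric] by linarith+
  define W where "W = l / 2 ^ Suc k"
  have W: "W > 0" "l / 2 ^ k = 2 * W" using assms by (auto simp: W_def)
  have "2 * W * (real_of_int (i div 2) + e / 3) \<le> W * (real_of_int j - e / 3)"
    using mult_left_mono[of "2 * (real_of_int (i div 2) + e / 3)" "real_of_int j - e / 3" W] b W by (simp add: mult.assoc mult.left_commute)
  moreover have "W * (real_of_int j + 1 - e / 3) \<le> 2 * W * (real_of_int (i div 2) + 1 + e / 3)"
    using mult_left_mono[of "real_of_int j + 1 - e / 3" "2 * (real_of_int (i div 2) + 1 + e / 3)" W] b W by (simp add: mult.assoc mult.left_commute)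
  ultimately show ?thesis
    unfolding gcell_def i_def[symmetric] W(2) W_def[symmetric] e_def[symmetric]
    by (auto simp: e_def[symmetric] simp flip: mult_minus_right)
qed

lemma gcell_ancestor:
  assumes "l > 0" "k \<le> k'"
  shows "\<exists>J. gcell l d k' j \<subseteq> gcell l d k J"
  using assms(2)
proof (induction k' arbitrary: j rule: dec_induct)
  case (step n)
  then show ?case using gcell_parent[OF assms(1), of d n j] by (meson order_trans)
qed auto

lemma gcell_inj:
  assumes "l > 0" "x \<in> gcell l d k j" "x \<in> gcell l d k j'"
  shows "j = j'"
proof -
  define W where "W = l / 2 ^ k"
  have W: "W > 0" using assms by (simp add: W_def)
  define z where "z = x / W - real_of_int d * (-1) ^ k / 3"
  have "real_of_int i \<le> z \<and> z < real_of_int i + 1" if "x \<in> gcell l d k i" for i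
    using that W unfolding gcell_def W_def[symmetric] z_def by (auto simp: field_simps)
  from this[OF assms(2)] this[OF assms(3)] show ?thesis by linarith
qed

lemma gcell_laminar:
  assumes "l > 0"
  shows "gcell l d k j \<subseteq> gcell l d k' j' \<or> gcell l d k' j' \<subseteq> gcell l d k j \<or> gcell l d k j \<inter> gcell l d k' j' = {}"
proof -
  have *: "gcell l d k' j' \<subseteq> gcell l d k j \<or> gcell l d k j \<inter> gcell l d k' j' = {}" if "k \<le> k'" for k k' j j'
    using gcell_ancestor[OF assms that, of d j'] gcell_inj[OF assms, of _ d k j] by blast
  show ?thesis using *[of k k' j' j] *[of k' k j j'] by (cases "k \<le> k'") auto
qed

lemma gcell_len: "l > 0 \<Longrightarrow> measure lborel (gcell l d k j) = l / 2 ^ k"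
  unfolding gcell_def by (simp add: algebra_simps)

text \<open>At every scale the endpoints of the grids \<open>d = 0\<close> and \<open>d = 1\<close> are separated by a third of
  the length of a cell, so an interval shorter than that is contained in a cell of one of them.\<close>

lemma gcell_covers:
  assumes "l > 0" "v - u \<le> l / 2 ^ k / 3" "u \<le> v"
  obtains d j where "d \<in> {0, 1}" "u \<in> gcell l d k j" "v \<in> gcell l d k j"
proof -
  define W where "W = l / 2 ^ k"
  have W: "W > 0" using assms by (simp add: W_def)
  define \<delta> where "\<delta> = (-1 :: real) ^ k"
  have \<delta>: "\<delta> = 1 \<or> \<delta> = -1" unfolding \<delta>_def by (simp add: minus_one_power_iff)
  define j0 where "j0 = \<lfloor>u / W\<rfloor>"
  define j1 where "j1 = \<lfloor>u / W - \<delta> / 3\<rfloor>"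
  have f: "real_of_int j0 \<le> u / W" "u / W < real_of_int j0 + 1"
    "real_of_int j1 \<le> u / W - \<delta> / 3" "u / W - \<delta> / 3 < real_of_int j1 + 1"
    unfolding j0_def j1_def by linarith+
  have u0: "W * real_of_int j0 \<le> u" "u < W * (real_of_int j0 + 1)"
    using f W by (simp_all add: field_simps)
  have u1: "W * (real_of_int j1 + \<delta> / 3) \<le> u" "u < W * (real_of_int j1 + 1 + \<delta> / 3)"
    using f W by (simp_all add: field_simps)
  show ?thesis
  proof (cases "v < W * (real_of_int j0 + 1)")
    case True
    then show ?thesis using that[of 0 j0] u0 assms(3) unfolding gcell_def W_def[symmetric] by auto
  next
    case v0: False
    show ?thesis
    proof (cases "v < W * (real_of_int j1 + 1 + \<delta> / 3)")
      case True
      then show ?thesis using that[of 1 j1] u1 assms(3) unfolding gcell_def W_def[symmetric] by (auto simp: \<delta>_def)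
    next
      case False
      have "\<bar>W * (real_of_int j0 + 1) - W * (real_of_int j1 + 1 + \<delta> / 3)\<bar> < W / 3"
        using v0 False u0 u1 assms(2) unfolding W_def[symmetric] by linarith
      moreover have "W * (real_of_int j0 + 1) - W * (real_of_int j1 + 1 + \<delta> / 3) = W * (real_of_int (j0 - j1) - \<delta> / 3)"
        by (simp add: algebra_simps)
      ultimately have "W * \<bar>real_of_int (j0 - j1) - \<delta> / 3\<bar> < W * (1 / 3)"
        using W by (simp add: abs_mult)
      then have "\<bar>real_of_int (j0 - j1) - \<delta> / 3\<bar> < 1 / 3" using W by (simp only: mult_less_cancel_left_pos)
      moreover define z where "z = real_of_int (j0 - j1)"
      ultimately have z: "\<bar>z - \<delta> / 3\<bar> < 1 / 3" by simp
      have "z > 0 \<and> z < 1 \<or> z < 0 \<and> z > -1"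
      proof (cases "\<delta> = 1")
        case True
        with z have "\<bar>z - 1 / 3\<bar> < 1 / 3" by simp
        then show ?thesis by linarith
      next
        case False
        with z \<delta> have "\<bar>z + 1 / 3\<bar> < 1 / 3" by simp
        then show ?thesis by linarith
      qed
      moreover have "0 < z \<longleftrightarrow> 0 < j0 - j1" "z < 1 \<longleftrightarrow> j0 - j1 < 1" "z < 0 \<longleftrightarrow> j0 - j1 < 0"
        unfolding z_def by (simp_all only: of_int_0_less_iff of_int_less_1_iff of_int_less_0_iff)
      moreover have "-1 < z \<longleftrightarrow> 0 < z + 1" "z + 1 = real_of_int (j0 - j1 + 1)" unfolding z_def by auto
      ultimately have False by (simp only: of_int_0_less_iff) linarith
      then show ?thesis ..
    qed
  qed
qed

text \<open>With h = t + |c - a|, the level \<open>k\<close> is the last whose cells have length at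
  least 3 h, as \<open>gcell_covers\<close> requires. These cells are shorter than 6 h, which gives
  36. The hypothesis on \<open>l\<close> makes level 0 long enough.\<close>

lemma pk_le_grid:
  assumes "t > 0" "3 * (t + \<bar>c - a\<bar>) \<le> l"
  obtains d k j where "d \<in> {0, 1}" "c \<in> gcell l d k j" "{a..<a + t} \<subseteq> gcell l d k j"
    "pk t (c - a) \<le> 36 / (measure lborel (gcell l d k j))\<^sup>2"
proof -
  define h where "h = t + \<bar>c - a\<bar>"
  have h: "h > 0" "3 * h \<le> l" using assms by (auto simp: h_def)
  then have l: "l > 0" by linarith
  define k where "k = nat \<lfloor>log 2 (l / (3 * h))\<rfloor>"
  have z: "l / (3 * h) \<ge> 1" using h by simp
  then have "log 2 (l / (3 * h)) \<ge> 0" by simp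
  then have rk: "real k \<le> log 2 (l / (3 * h))" "log 2 (l / (3 * h)) < real k + 1" unfolding k_def by linarith+
  have "2 powr real k \<le> l / (3 * h)" using rk(1) z by (simp add: le_log_iff)
  then have k1: "2 ^ k * (3 * h) \<le> l" using h by (simp add: powr_realpow field_simps)
  have "l / (3 * h) < 2 powr (real k + 1)" using rk(2) z by (simp add: log_less_iff)
  then have k2: "l < 2 ^ k * (6 * h)" using h by (simp add: powr_realpow powr_add field_simps)
  have u: "max c (a + t) - min c a \<le> l / 2 ^ k / 3"
  proof -
    have "max c (a + t) - min c a \<le> h" using assms(1) by (auto simp: h_def)
    also have "h \<le> l / 2 ^ k / 3" using k1 by (simp add: field_simps)
    finally show ?thesis .
  qed
  have "min c a \<le> max c (a + t)" using assms(1) by auto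
  from gcell_covers[OF l u this]
  obtain d j where dj: "d \<in> {0, 1}" "min c a \<in> gcell l d k j" "max c (a + t) \<in> gcell l d k j"
    by blast
  show ?thesis
  proof (rule that[OF dj(1)])
    show "c \<in> gcell l d k j" "{a..<a + t} \<subseteq> gcell l d k j"
      using dj assms(1) unfolding gcell_def by auto
    define W where "W = l / 2 ^ k"
    have W: "W > 0" "W \<le> 6 * h" using k2 l by (simp_all add: W_def field_simps)
    then have "W\<^sup>2 \<le> (6 * h)\<^sup>2" by (intro power_mono) auto
    then have "W\<^sup>2 \<le> 36 * h\<^sup>2" by (simp add: power2_eq_square)
    then have "36 / (36 * h\<^sup>2) \<le> 36 / W\<^sup>2" using W h by (intro divide_left_mono) auto
    then have "1 / h\<^sup>2 \<le> 36 / W\<^sup>2" by simp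
    then show "pk t (c - a) \<le> 36 / (measure lborel (gcell l d k j))\<^sup>2"
      unfolding gcell_len[OF l] pk_def h_def[symmetric] W_def .
  qed
qed

text \<open>Cells of one grid that contain \<open>c\<close> have different levels, so the sum is at
  most 4/3 times the term of the shortest cell. That cell contains both \<open>c\<close> and the
  interval, hence twice its length is at least t + |c - a|, which costs a further factor 4.\<close>

lemma sum_grid_le_pk:
  assumes "finite S" "l > 0" "t > 0" "\<And>K. K \<in> S \<Longrightarrow> (\<exists>k j. K = gcell l d k j) \<and> c \<in> K \<and> {a..<a + t} \<subseteq> K"
  shows "(\<Sum>K\<in>S. 1 / (measure lborel K)\<^sup>2) \<le> 16/3 * pk t (c - a)"
proof (cases "S = {}")
  case False
  note S1 = conjunct1[OF assms(4)] and S2 = conjunct1[OF conjunct2[OF assms(4)]] and S3 = conjunct2[OF conjunct2[OF assms(4)]]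
  define lv where "lv K = (SOME k. \<exists>j. K = gcell l d k j)" for K
  have lv: "\<exists>j. K = gcell l d (lv K) j" if "K \<in> S" for K
    unfolding lv_def by (rule someI_ex) (rule S1[OF that])
  have inj: "inj_on (\<lambda>K. int (lv K)) S"
  proof (rule inj_onI)
    fix K K' assume KK: "K \<in> S" "K' \<in> S" "int (lv K) = int (lv K')"
    obtain j where j: "K = gcell l d (lv K) j" using lv[OF KK(1)] by blast
    obtain j' where "K' = gcell l d (lv K') j'" using lv[OF KK(2)] by blast
    then have j': "K' = gcell l d (lv K) j'" using KK(3) by simp
    have "c \<in> gcell l d (lv K) j" "c \<in> gcell l d (lv K) j'"
      unfolding j[symmetric] j'[symmetric] by (rule S2[OF KK(1)], rule S2[OF KK(2)])
    then have "j = j'" by (rule gcell_inj[OF assms(2)])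
    then show "K = K'" using j j' by metis
  qed
  have len: "1 / (measure lborel K)\<^sup>2 = 4 powr real_of_int (int (lv K)) / l\<^sup>2" if K: "K \<in> S" for K
  proof -
    obtain j where j: "K = gcell l d (lv K) j" using lv K by blast
    have "measure lborel K = l / 2 ^ lv K"
      using gcell_len[OF assms(2), of d "lv K" j] unfolding j[symmetric] .
    moreover have "((2::real) ^ lv K)\<^sup>2 = 4 ^ lv K" by (simp add: power_even_eq[symmetric] power_mult)
    ultimately show ?thesis using assms(2) by (simp add: powr_realpow power_divide)
  qed
  define n where "n = Max ((\<lambda>K. int (lv K)) ` S)"
  have "n \<in> (\<lambda>K. int (lv K)) ` S" unfolding n_def using assms(1) False by (intro Max_in) auto
  then obtain K where K: "K \<in> S" "int (lv K) = n" by auto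
  have "(\<Sum>K\<in>S. 1 / (measure lborel K)\<^sup>2) = (\<Sum>i\<in>(\<lambda>K. int (lv K)) ` S. 4 powr real_of_int i) / l\<^sup>2"
    by (simp only: sum.reindex[OF inj] o_def sum_divide_distrib len cong: sum.cong)
  also have "\<dots> \<le> (4/3 * 4 powr real_of_int n) / l\<^sup>2"
    by (intro divide_right_mono sum_four_powr_le) (use assms in \<open>auto simp: n_def\<close>)
  also have "\<dots> = 4/3 * (1 / (measure lborel K)\<^sup>2)" using len[OF K(1)] K(2) by simp
  also have "1 / (measure lborel K)\<^sup>2 \<le> 4 * pk t (c - a)"
  proof -
    obtain k j where Kk: "K = gcell l d k j" using S1[OF K(1)] by blast
    define p where "p = l / 2 ^ k * (real_of_int j + real_of_int d * (-1) ^ k / 3)"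
    have Kp: "K = {p..<p + l / 2 ^ k}" unfolding Kk gcell_def p_def by (simp add: algebra_simps)
    have W: "measure lborel K = l / 2 ^ k" unfolding Kk by (rule gcell_len[OF assms(2)])
    have "c \<in> K" "{a..<a + t} \<subseteq> K" by (rule S2[OF K(1)], rule S3[OF K(1)])
    then have "p \<le> c" "c < p + l / 2 ^ k" "p \<le> a" "a + t \<le> p + l / 2 ^ k" using assms(3) unfolding Kp by auto
    then have "t + \<bar>c - a\<bar> \<le> 2 * (l / 2 ^ k)" by linarith
    then have "(t + \<bar>c - a\<bar>)\<^sup>2 \<le> (2 * (l / 2 ^ k))\<^sup>2" using assms(3) by (intro power_mono) auto
    then have "(t + \<bar>c - a\<bar>)\<^sup>2 \<le> 4 * (measure lborel K)\<^sup>2" unfolding W power_mult_distrib by simp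
    moreover have "measure lborel K > 0" "t + \<bar>c - a\<bar> > 0" using assms(2,3) W by auto
    ultimately show ?thesis unfolding pk_def by (simp add: divide_simps)
  qed
  finally show ?thesis by simp
qed auto

text \<open>A finite model with weights \<open>s\<close> at the points \<open>c x\<close> and
  weights \<open>m\<close> on the intervals from \<open>a y\<close> to \<open>a y + t y\<close>.
  Intervals are assigned to a window only if they lie wholly inside it; as they are not empty,
  disjoint cells then receive disjoint families.\<close>

locale poisson_testing =
  fixes X :: "'x set" and Y :: "'y set" and c s :: "'x \<Rightarrow> real" and a t m :: "'y \<Rightarrow> real" and T :: real
  assumes fin: "finite X" "finite Y"
    and s0: "\<And>x. x \<in> X \<Longrightarrow> s x \<ge> 0" and m0: "\<And>y. y \<in> Y \<Longrightarrow> m y \<ge> 0"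
    and t0: "\<And>y. y \<in> Y \<Longrightarrow> t y > 0" and T0: "T \<ge> 0"
    and T1: "\<And>p q. p < q \<Longrightarrow>
      (\<Sum>y | y \<in> Y \<and> {a y..<a y + t y} \<subseteq> {p..<q}. m y * (\<Sum>x | x \<in> X \<and> c x \<in> {p..<q}. s x * pk (t y) (c x - a y))\<^sup>2)
        \<le> T\<^sup>2 * (\<Sum>x | x \<in> X \<and> c x \<in> {p..<q}. s x)"
    and T2: "\<And>p q. p < q \<Longrightarrow>
      (\<Sum>x | x \<in> X \<and> c x \<in> {p..<q}. s x * (\<Sum>y | y \<in> Y \<and> {a y..<a y + t y} \<subseteq> {p..<q}. m y * pk (t y) (c x - a y))\<^sup>2)
        \<le> T\<^sup>2 * (\<Sum>y | y \<in> Y \<and> {a y..<a y + t y} \<subseteq> {p..<q}. m y)"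
begin

lemma grid_bound:
  assumes \<phi>0: "\<And>x. x \<in> X \<Longrightarrow> \<phi> x \<ge> 0" and \<psi>0: "\<And>y. y \<in> Y \<Longrightarrow> \<psi> y \<ge> 0"
    and \<K>: "finite \<K>" "\<And>K. K \<in> \<K> \<Longrightarrow> \<exists>k j. K = gcell l d k j" and l: "l > 0"
  shows "(\<Sum>K\<in>\<K>. 1 / (measure lborel K)\<^sup>2 * (\<Sum>x | x \<in> X \<and> c x \<in> K. \<phi> x * s x) *
      (\<Sum>y | y \<in> Y \<and> {a y..<a y + t y} \<subseteq> K. \<psi> y * m y))
    \<le> (16/3 * T) * (44 * ((\<Sum>x\<in>X. (\<phi> x)\<^sup>2 * s x) + (\<Sum>y\<in>Y. (\<psi> y)\<^sup>2 * m y)))"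
proof -
  define A where "A K = {x \<in> X. c x \<in> K}" for K
  define B where "B K = {y \<in> Y. {a y..<a y + t y} \<subseteq> K}" for K
  define lam where "lam K = 1 / (measure lborel K)\<^sup>2" for K :: "real set"
  let ?pA = "\<lambda>K. \<Sum>x\<in>A K. \<phi> x * s x" and ?pB = "\<lambda>K. \<Sum>y\<in>B K. \<psi> y * m y"
  let ?f = "\<lambda>K. lam K * ?pA K * ?pB K"
  have pA0: "?pA K \<ge> 0" for K using s0 \<phi>0 by (auto simp: A_def intro!: sum_nonneg)
  have pB0: "?pB K \<ge> 0" for K using m0 \<psi>0 by (auto simp: B_def intro!: sum_nonneg)
  have lam0: "lam K \<ge> 0" for K by (simp add: lam_def)
  have finAB: "finite (A K)" "finite (B K)" for K using fin by (auto simp: A_def B_def)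
  have lamn: "K \<subseteq> K' \<or> K' \<subseteq> K \<or> K \<inter> K' = {}" if "K \<in> \<K>" "K' \<in> \<K>" for K K'
    using \<K>(2)[OF that(1)] \<K>(2)[OF that(2)] gcell_laminar[OF l, of d] by metis
  have monoA: "A K \<subseteq> A K'" "B K \<subseteq> B K'" if "K \<subseteq> K'" for K K' using that by (auto simp: A_def B_def)
  have disjA: "A K \<inter> A K' = {}" "B K \<inter> B K' = {}" if "K \<inter> K' = {}" for K K'
  proof -
    show "A K \<inter> A K' = {}" using that by (auto simp: A_def)
    have "a y \<in> K \<and> a y \<in> K'" if "y \<in> B K \<inter> B K'" for y
      using that t0[of y] by (auto simp: B_def)
    then show "B K \<inter> B K' = {}" using that by blast
  qed
  \<comment> \<open>The dyadic kernel of any subfamily of cells stays below a multiple of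
    \<open>pk\<close>. Its testing conditions thus follow from \<open>T1\<close> and
    \<open>T2\<close>, with \<open>16/3 * T\<close> in place of \<open>T\<close>.\<close>
  have gsum: "(\<Sum>K | K \<in> S \<and> K \<subseteq> R \<and> x \<in> A K \<and> y \<in> B K. lam K) \<le> 16/3 * pk (t y) (c x - a y)"
    if "S \<subseteq> \<K>" "y \<in> Y" for S R x y
    unfolding lam_def
  proof (rule sum_grid_le_pk[where l = l and d = d, OF _ l t0[OF that(2)]])
    show "finite {K. K \<in> S \<and> K \<subseteq> R \<and> x \<in> A K \<and> y \<in> B K}"
      using finite_subset[OF that(1) \<K>(1)] by simp
    fix K assume "K \<in> {K. K \<in> S \<and> K \<subseteq> R \<and> x \<in> A K \<and> y \<in> B K}"
    then have K: "K \<in> \<K>" "x \<in> A K" "y \<in> B K" using that(1) by auto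
    then show "(\<exists>k j. K = gcell l d k j) \<and> c x \<in> K \<and> {a y..<a y + t y} \<subseteq> K"
      using \<K>(2)[OF K(1)] unfolding A_def B_def by blast
  qed
  have proper: "\<exists>p q. K = {p..<q} \<and> p < q" if K: "K \<in> \<K>" for K
  proof -
    obtain k j where Kk: "K = gcell l d k j" using \<K>(2) K by blast
    define p where "p = l / 2 ^ k * (real_of_int j + real_of_int d * (-1) ^ k / 3)"
    have "K = {p..<p + l / 2 ^ k}" unfolding Kk gcell_def p_def by (simp add: algebra_simps)
    moreover have "p < p + l / 2 ^ k" using l by simp
    ultimately show ?thesis by blast
  qed
  have test1: "(\<Sum>y\<in>B R. m y * (\<Sum>K | K \<in> S \<and> K \<subseteq> R \<and> y \<in> B K. lam K * sum s (A K))\<^sup>2) \<le> (16/3 * T)\<^sup>2 * sum s (A R)"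
    if S: "S \<subseteq> \<K>" and R: "R \<in> S" for S R
  proof -
    have fS: "finite S" using S \<K> finite_subset by blast
    have "(\<Sum>y\<in>B R. m y * (\<Sum>K | K \<in> S \<and> K \<subseteq> R \<and> y \<in> B K. lam K * sum s (A K))\<^sup>2)
      \<le> (\<Sum>y\<in>B R. m y * (16/3 * (\<Sum>x\<in>A R. s x * pk (t y) (c x - a y)))\<^sup>2)"
    proof (intro sum_mono mult_left_mono power_mono)
      fix y assume y: "y \<in> B R"
      then show "m y \<ge> 0" using m0 by (auto simp: B_def)
      show "(\<Sum>K | K \<in> S \<and> K \<subseteq> R \<and> y \<in> B K. lam K * sum s (A K)) \<ge> 0"
        using lam0 s0 by (auto simp: A_def intro!: sum_nonneg mult_nonneg_nonneg)
      have "(\<Sum>K | K \<in> S \<and> K \<subseteq> R \<and> y \<in> B K. lam K * sum s (A K))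
        = (\<Sum>K | K \<in> S \<and> K \<subseteq> R \<and> y \<in> B K. \<Sum>x | x \<in> A R \<and> x \<in> A K. lam K * s x)"
      proof (intro sum.cong refl)
        fix K assume "K \<in> {K. K \<in> S \<and> K \<subseteq> R \<and> y \<in> B K}"
        then have "{x. x \<in> A R \<and> x \<in> A K} = A K" using monoA(1)[of K R] by auto
        then show "lam K * sum s (A K) = (\<Sum>x | x \<in> A R \<and> x \<in> A K. lam K * s x)" by (simp add: sum_distrib_left)
      qed
      also have "\<dots> = (\<Sum>x\<in>A R. \<Sum>K | K \<in> {K. K \<in> S \<and> K \<subseteq> R \<and> y \<in> B K} \<and> x \<in> A K. lam K * s x)"
        by (rule sum.swap_restrict) (use finAB fS in auto)
      also have "\<dots> \<le> (\<Sum>x\<in>A R. 16/3 * (s x * pk (t y) (c x - a y)))"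
      proof (rule sum_mono)
        fix x assume x: "x \<in> A R"
        have "{K. K \<in> {K. K \<in> S \<and> K \<subseteq> R \<and> y \<in> B K} \<and> x \<in> A K} = {K. K \<in> S \<and> K \<subseteq> R \<and> x \<in> A K \<and> y \<in> B K}" by auto
        then have "(\<Sum>K | K \<in> {K. K \<in> S \<and> K \<subseteq> R \<and> y \<in> B K} \<and> x \<in> A K. lam K * s x)
          = s x * (\<Sum>K | K \<in> S \<and> K \<subseteq> R \<and> x \<in> A K \<and> y \<in> B K. lam K)"
          by (simp add: sum_distrib_left mult.commute)
        also have "\<dots> \<le> s x * (16/3 * pk (t y) (c x - a y))"
          by (rule mult_left_mono[OF gsum[OF S]]) (use x y s0 in \<open>auto simp: A_def B_def\<close>)
        finally show "(\<Sum>K | K \<in> {K. K \<in> S \<and> K \<subseteq> R \<and> y \<in> B K} \<and> x \<in> A K. lam K * s x) \<le> 16/3 * (s x * pk (t y) (c x - a y))"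
          by (simp add: algebra_simps)
      qed
      finally show "(\<Sum>K | K \<in> S \<and> K \<subseteq> R \<and> y \<in> B K. lam K * sum s (A K)) \<le> 16/3 * (\<Sum>x\<in>A R. s x * pk (t y) (c x - a y))"
        by (simp add: sum_distrib_left)
    qed
    also have "\<dots> = (16/3)\<^sup>2 * (\<Sum>y\<in>B R. m y * (\<Sum>x\<in>A R. s x * pk (t y) (c x - a y))\<^sup>2)"
      by (simp only: sum_distrib_left[of _ _ "B R"] power_mult_distrib ac_simps)
    also have "\<dots> \<le> (16/3)\<^sup>2 * (T\<^sup>2 * sum s (A R))"
    proof (rule mult_left_mono)
      obtain p q where "R = {p..<q}" "p < q" using proper R S by blast
      then show "(\<Sum>y\<in>B R. m y * (\<Sum>x\<in>A R. s x * pk (t y) (c x - a y))\<^sup>2) \<le> T\<^sup>2 * sum s (A R)"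
        using T1[of p q] by (simp only: A_def B_def)
    qed simp
    finally show ?thesis by (simp add: power_mult_distrib power_divide)
  qed
  have test2: "(\<Sum>x\<in>A R. s x * (\<Sum>K | K \<in> S \<and> K \<subseteq> R \<and> x \<in> A K. lam K * sum m (B K))\<^sup>2) \<le> (16/3 * T)\<^sup>2 * sum m (B R)"
    if S: "S \<subseteq> \<K>" and R: "R \<in> S" for S R
  proof -
    have fS: "finite S" using S \<K> finite_subset by blast
    have "(\<Sum>x\<in>A R. s x * (\<Sum>K | K \<in> S \<and> K \<subseteq> R \<and> x \<in> A K. lam K * sum m (B K))\<^sup>2)
      \<le> (\<Sum>x\<in>A R. s x * (16/3 * (\<Sum>y\<in>B R. m y * pk (t y) (c x - a y)))\<^sup>2)"
    proof (intro sum_mono mult_left_mono power_mono)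
      fix x assume x: "x \<in> A R"
      then show "s x \<ge> 0" using s0 by (auto simp: A_def)
      show "(\<Sum>K | K \<in> S \<and> K \<subseteq> R \<and> x \<in> A K. lam K * sum m (B K)) \<ge> 0"
        using lam0 m0 by (auto simp: B_def intro!: sum_nonneg mult_nonneg_nonneg)
      have "(\<Sum>K | K \<in> S \<and> K \<subseteq> R \<and> x \<in> A K. lam K * sum m (B K))
        = (\<Sum>K | K \<in> S \<and> K \<subseteq> R \<and> x \<in> A K. \<Sum>y | y \<in> B R \<and> y \<in> B K. lam K * m y)"
      proof (intro sum.cong refl)
        fix K assume "K \<in> {K. K \<in> S \<and> K \<subseteq> R \<and> x \<in> A K}"
        then have "{y. y \<in> B R \<and> y \<in> B K} = B K" using monoA(2)[of K R] by auto
        then show "lam K * sum m (B K) = (\<Sum>y | y \<in> B R \<and> y \<in> B K. lam K * m y)" by (simp add: sum_distrib_left)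
      qed
      also have "\<dots> = (\<Sum>y\<in>B R. \<Sum>K | K \<in> {K. K \<in> S \<and> K \<subseteq> R \<and> x \<in> A K} \<and> y \<in> B K. lam K * m y)"
        by (rule sum.swap_restrict) (use finAB fS in auto)
      also have "\<dots> \<le> (\<Sum>y\<in>B R. 16/3 * (m y * pk (t y) (c x - a y)))"
      proof (rule sum_mono)
        fix y assume y: "y \<in> B R"
        have "{K. K \<in> {K. K \<in> S \<and> K \<subseteq> R \<and> x \<in> A K} \<and> y \<in> B K} = {K. K \<in> S \<and> K \<subseteq> R \<and> x \<in> A K \<and> y \<in> B K}" by auto
        then have "(\<Sum>K | K \<in> {K. K \<in> S \<and> K \<subseteq> R \<and> x \<in> A K} \<and> y \<in> B K. lam K * m y)
          = m y * (\<Sum>K | K \<in> S \<and> K \<subseteq> R \<and> x \<in> A K \<and> y \<in> B K. lam K)"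
          by (simp add: sum_distrib_left mult.commute)
        also have "\<dots> \<le> m y * (16/3 * pk (t y) (c x - a y))"
          by (rule mult_left_mono[OF gsum[OF S]]) (use x y m0 in \<open>auto simp: A_def B_def\<close>)
        finally show "(\<Sum>K | K \<in> {K. K \<in> S \<and> K \<subseteq> R \<and> x \<in> A K} \<and> y \<in> B K. lam K * m y) \<le> 16/3 * (m y * pk (t y) (c x - a y))"
          by (simp add: algebra_simps)
      qed
      finally show "(\<Sum>K | K \<in> S \<and> K \<subseteq> R \<and> x \<in> A K. lam K * sum m (B K)) \<le> 16/3 * (\<Sum>y\<in>B R. m y * pk (t y) (c x - a y))"
        by (simp add: sum_distrib_left)
    qed
    also have "\<dots> = (16/3)\<^sup>2 * (\<Sum>x\<in>A R. s x * (\<Sum>y\<in>B R. m y * pk (t y) (c x - a y))\<^sup>2)"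
      by (simp only: sum_distrib_left[of _ _ "A R"] power_mult_distrib ac_simps)
    also have "\<dots> \<le> (16/3)\<^sup>2 * (T\<^sup>2 * sum m (B R))"
    proof (rule mult_left_mono)
      obtain p q where "R = {p..<q}" "p < q" using proper R S by blast
      then show "(\<Sum>x\<in>A R. s x * (\<Sum>y\<in>B R. m y * pk (t y) (c x - a y))\<^sup>2) \<le> T\<^sup>2 * sum m (B R)"
        using T2[of p q] by (simp only: A_def B_def)
    qed simp
    finally show ?thesis by (simp add: power_mult_distrib power_divide)
  qed
  \<comment> \<open>Cells in which one of the two integrals vanishes contribute nothing. The others
    are sorted by which function has the larger mean energy; in the second class the roles of \<phi>
    and \<psi> are exchanged.\<close>
  define \<K>0 where "\<K>0 = {K \<in> \<K>. ?pA K > 0 \<and> ?pB K > 0}"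
  define \<K>1 where "\<K>1 = {K \<in> \<K>0. (?pB K)\<^sup>2 * sum s (A K) \<le> (?pA K)\<^sup>2 * sum m (B K)}"
  define \<K>2 where "\<K>2 = {K \<in> \<K>0. \<not> (?pB K)\<^sup>2 * sum s (A K) \<le> (?pA K)\<^sup>2 * sum m (B K)}"
  have sub: "\<K>1 \<subseteq> \<K>" "\<K>2 \<subseteq> \<K>" "finite \<K>1" "finite \<K>2" "finite \<K>0"
    using \<K> by (auto simp: \<K>0_def \<K>1_def \<K>2_def)
  let ?a = "\<Sum>x\<in>X. (\<phi> x)\<^sup>2 * s x" and ?b = "\<Sum>y\<in>Y. (\<psi> y)\<^sup>2 * m y"
  interpret h1: half_testing \<K>1 A B X Y s \<phi> m \<psi> lam "16/3 * T"
  proof unfold_locales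
    show "K \<subseteq> K' \<or> K' \<subseteq> K \<or> K \<inter> K' = {}" if "K \<in> \<K>1" "K' \<in> \<K>1" for K K' using lamn sub that by blast
    show "(\<Sum>y\<in>B R. m y * (\<Sum>K | K \<in> \<K>1 \<and> K \<subseteq> R \<and> y \<in> B K. lam K * sum s (A K))\<^sup>2) \<le> (16/3 * T)\<^sup>2 * sum s (A R)"
      if "R \<in> \<K>1" for R by (rule test1[OF sub(1) that])
    show "A K \<subseteq> A K'" "B K \<subseteq> B K'" if "K \<subseteq> K'" for K K' using monoA[OF that] by blast+
    show "A K \<inter> A K' = {}" "B K \<inter> B K' = {}" if "K \<inter> K' = {}" for K K' using disjA[OF that] by blast+
    show "A K \<subseteq> X" "B K \<subseteq> Y" for K by (auto simp: A_def B_def)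
    show "0 < ?pA K" if "K \<in> \<K>1" for K using that by (auto simp: \<K>0_def \<K>1_def)
  qed (use fin s0 m0 \<phi>0 \<psi>0 T0 sub lam0 in \<open>auto simp: \<K>1_def\<close>)
  interpret h2: half_testing \<K>2 B A Y X m \<psi> s \<phi> lam "16/3 * T"
  proof unfold_locales
    show "K \<subseteq> K' \<or> K' \<subseteq> K \<or> K \<inter> K' = {}" if "K \<in> \<K>2" "K' \<in> \<K>2" for K K' using lamn sub that by blast
    show "(\<Sum>x\<in>A R. s x * (\<Sum>K | K \<in> \<K>2 \<and> K \<subseteq> R \<and> x \<in> A K. lam K * sum m (B K))\<^sup>2) \<le> (16/3 * T)\<^sup>2 * sum m (B R)"
      if "R \<in> \<K>2" for R by (rule test2[OF sub(2) that])
    show "(?pA K)\<^sup>2 * sum m (B K) \<le> (?pB K)\<^sup>2 * sum s (A K)" if "K \<in> \<K>2" for K using that by (auto simp: \<K>2_def)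
    show "A K \<subseteq> A K'" "B K \<subseteq> B K'" if "K \<subseteq> K'" for K K' using monoA[OF that] by blast+
    show "A K \<inter> A K' = {}" "B K \<inter> B K' = {}" if "K \<inter> K' = {}" for K K' using disjA[OF that] by blast+
    show "A K \<subseteq> X" "B K \<subseteq> Y" for K by (auto simp: A_def B_def)
    show "0 < ?pB K" if "K \<in> \<K>2" for K using that by (auto simp: \<K>0_def \<K>2_def)
  qed (use fin s0 m0 \<phi>0 \<psi>0 T0 sub lam0 in \<open>auto simp: \<K>2_def\<close>)
  have "(\<Sum>K\<in>\<K>. ?f K) = (\<Sum>K\<in>\<K>0. ?f K)"
  proof (rule sum.mono_neutral_right[OF \<K>(1)])
    show "\<forall>K\<in>\<K> - \<K>0. ?f K = 0"
      using pA0 pB0 unfolding \<K>0_def by (auto simp: not_less intro: antisym)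
  qed (auto simp: \<K>0_def)
  also have "\<dots> = (\<Sum>K\<in>\<K>1. ?f K) + (\<Sum>K\<in>\<K>2. ?f K)"
    by (subst sum.union_disjoint[symmetric]) (use sub in \<open>auto simp: \<K>1_def \<K>2_def intro!: sum.cong\<close>)
  also have "\<dots> \<le> (16/3 * T) * (43 * ?a + ?b) + (16/3 * T) * (43 * ?b + ?a)"
    using h1.half_bound h2.half_bound by (simp add: mult.commute mult.left_commute)
  also have "\<dots> = (16/3 * T) * (44 * (?a + ?b))" by (simp add: algebra_simps)
  finally show ?thesis unfolding lam_def A_def B_def .
qed

text \<open>Each pair of a point and an interval is caught by a cell of one of the two grids, so
  \<open>pk\<close> is at most 36 times the sum of the two dyadic kernels. The constant is 36 * 2 *
  16/3 * 44.\<close>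

theorem two_weight_poisson:
  assumes \<phi>0: "\<And>x. x \<in> X \<Longrightarrow> \<phi> x \<ge> 0" and \<psi>0: "\<And>y. y \<in> Y \<Longrightarrow> \<psi> y \<ge> 0"
  shows "(\<Sum>x\<in>X. \<Sum>y\<in>Y. \<phi> x * s x * (\<psi> y * m y) * pk (t y) (c x - a y))
    \<le> 16896 * T * ((\<Sum>x\<in>X. (\<phi> x)\<^sup>2 * s x) + (\<Sum>y\<in>Y. (\<psi> y)\<^sup>2 * m y))"
proof -
  \<comment> \<open>Large enough for \<open>pk_le_grid\<close> at all pairs at once, and positive
    even if there are no pairs.\<close>
  define l where "l = 1 + 3 * (\<Sum>x\<in>X. \<Sum>y\<in>Y. t y + \<bar>c x - a y\<bar>)"
  have hpos: "t y + \<bar>c x - a y\<bar> \<ge> 0" if "y \<in> Y" for x y using t0[OF that] by simp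
  have hl: "3 * (t y + \<bar>c x - a y\<bar>) \<le> l" if "x \<in> X" "y \<in> Y" for x y
  proof -
    have "t y + \<bar>c x - a y\<bar> \<le> (\<Sum>y\<in>Y. t y + \<bar>c x - a y\<bar>)"
      by (rule member_le_sum) (use fin hpos that in auto)
    also have "\<dots> \<le> (\<Sum>x\<in>X. \<Sum>y\<in>Y. t y + \<bar>c x - a y\<bar>)"
      by (rule member_le_sum) (use fin hpos that in \<open>auto intro!: sum_nonneg\<close>)
    finally show ?thesis by (simp add: l_def)
  qed
  have l: "l > 0" unfolding l_def using hpos by (simp add: add_pos_nonneg sum_nonneg)
  define P where "P x y d K \<longleftrightarrow> d \<in> {0, 1::int} \<and> (\<exists>k j. K = gcell l d k j) \<and> c x \<in> K \<and> {a y..<a y + t y} \<subseteq> K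
     \<and> pk (t y) (c x - a y) \<le> 36 / (measure lborel K)\<^sup>2" for x y d K
  have "\<exists>d K. P x y d K" if "x \<in> X" "y \<in> Y" for x y
    using pk_le_grid[OF t0[OF that(2)] hl[OF that]] unfolding P_def by metis
  then obtain dd KK where PP: "\<And>x y. x \<in> X \<Longrightarrow> y \<in> Y \<Longrightarrow> P x y (dd x y) (KK x y)" by metis
  define \<K> where "\<K> d = {K. \<exists>x\<in>X. \<exists>y\<in>Y. dd x y = d \<and> K = KK x y}" for d
  have f\<K>: "finite (\<K> d)" for d
    by (rule finite_subset[of _ "(\<lambda>(x, y). KK x y) ` (X \<times> Y)"]) (use fin in \<open>auto simp: \<K>_def\<close>)
  let ?L = "\<lambda>d. \<Sum>K\<in>\<K> d. 1 / (measure lborel K)\<^sup>2 * (\<Sum>x | x \<in> X \<and> c x \<in> K. \<phi> x * s x) *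
      (\<Sum>y | y \<in> Y \<and> {a y..<a y + t y} \<subseteq> K. \<psi> y * m y)"
  define ker where "ker d x y = (\<Sum>K | K \<in> \<K> d \<and> c x \<in> K \<and> {a y..<a y + t y} \<subseteq> K. 1 / (measure lborel K)\<^sup>2)" for d x y
  have ker0: "ker d x y \<ge> 0" for d x y unfolding ker_def by (intro sum_nonneg) auto
  have dom: "pk (t y) (c x - a y) \<le> 36 * (ker 0 x y + ker 1 x y)" if xy: "x \<in> X" "y \<in> Y" for x y
  proof -
    have p: "P x y (dd x y) (KK x y)" using PP xy by blast
    have "1 / (measure lborel (KK x y))\<^sup>2 \<le> ker (dd x y) x y" unfolding ker_def
      by (rule member_le_sum[of "KK x y" _ "\<lambda>K. 1 / (measure lborel K)\<^sup>2"]) (use f\<K> p xy in \<open>auto simp: P_def \<K>_def\<close>)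
    moreover have "ker (dd x y) x y \<le> ker 0 x y + ker 1 x y" using p ker0 by (auto simp: P_def)
    ultimately have "36 * (1 / (measure lborel (KK x y))\<^sup>2) \<le> 36 * (ker 0 x y + ker 1 x y)"
      by (intro mult_left_mono) auto
    moreover have "pk (t y) (c x - a y) \<le> 36 * (1 / (measure lborel (KK x y))\<^sup>2)" using p by (simp add: P_def)
    ultimately show ?thesis by (rule order_trans[rotated])
  qed
  have L: "?L d = (\<Sum>x\<in>X. \<Sum>y\<in>Y. \<phi> x * s x * (\<psi> y * m y) * ker d x y)" for d
  proof -
    have "?L d = (\<Sum>K\<in>\<K> d. \<Sum>x | x \<in> X \<and> c x \<in> K. \<Sum>y | y \<in> Y \<and> {a y..<a y + t y} \<subseteq> K.
        \<phi> x * s x * (\<psi> y * m y) * (1 / (measure lborel K)\<^sup>2))"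
      by (simp only: sum_distrib_left sum_distrib_right ac_simps)
    also have "\<dots> = (\<Sum>x\<in>X. \<Sum>K | K \<in> \<K> d \<and> c x \<in> K. \<Sum>y | y \<in> Y \<and> {a y..<a y + t y} \<subseteq> K.
        \<phi> x * s x * (\<psi> y * m y) * (1 / (measure lborel K)\<^sup>2))"
      by (rule sum.swap_restrict) (use fin f\<K> in auto)
    also have "\<dots> = (\<Sum>x\<in>X. \<Sum>y\<in>Y. \<Sum>K | K \<in> {K \<in> \<K> d. c x \<in> K} \<and> {a y..<a y + t y} \<subseteq> K.
        \<phi> x * s x * (\<psi> y * m y) * (1 / (measure lborel K)\<^sup>2))"
      by (intro sum.cong refl sum.swap_restrict) (use fin f\<K> in auto)
    also have "\<dots> = (\<Sum>x\<in>X. \<Sum>y\<in>Y. \<phi> x * s x * (\<psi> y * m y) * ker d x y)"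
      unfolding ker_def by (simp add: sum_distrib_left)
    finally show ?thesis .
  qed
  have Lb: "?L d \<le> (16/3 * T) * (44 * ((\<Sum>x\<in>X. (\<phi> x)\<^sup>2 * s x) + (\<Sum>y\<in>Y. (\<psi> y)\<^sup>2 * m y)))" for d
    by (rule grid_bound[OF \<phi>0 \<psi>0 f\<K> _ l, where d = d]) (use PP in \<open>auto simp: \<K>_def P_def\<close>)
  have "(\<Sum>x\<in>X. \<Sum>y\<in>Y. \<phi> x * s x * (\<psi> y * m y) * pk (t y) (c x - a y))
    \<le> (\<Sum>x\<in>X. \<Sum>y\<in>Y. \<phi> x * s x * (\<psi> y * m y) * (36 * (ker 0 x y + ker 1 x y)))"
    by (intro sum_mono mult_left_mono dom mult_nonneg_nonneg) (use \<phi>0 \<psi>0 s0 m0 in auto)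
  also have "\<dots> = 36 * (?L 0 + ?L 1)"
    unfolding L by (simp add: sum_distrib_left sum.distrib[symmetric] algebra_simps)
  also have "\<dots> \<le> 36 * (2 * ((16/3 * T) * (44 * ((\<Sum>x\<in>X. (\<phi> x)\<^sup>2 * s x) + (\<Sum>y\<in>Y. (\<psi> y)\<^sup>2 * m y)))))"
  proof (rule mult_left_mono)
    show "?L 0 + ?L 1 \<le> 2 * ((16/3 * T) * (44 * ((\<Sum>x\<in>X. (\<phi> x)\<^sup>2 * s x) + (\<Sum>y\<in>Y. (\<psi> y)\<^sup>2 * m y))))"
      unfolding mult_2 by (rule add_mono[OF Lb Lb])
  qed simp
  finally show ?thesis by (simp add: algebra_simps)
qed

end

subsection \<open>Dyadic subintervals as paths in the binary tree\<close>

lemma grid_interval: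
  assumes "dyadic_grid D" "I \<in> D" obtains u v where "u < v" "I = {u..<v}"
proof -
  have "\<forall>I\<in>D. \<exists>a b. a < b \<and> I = {a..<b}" using assms(1) unfolding dyadic_grid_def by (elim conjE)
  then have "\<exists>a b. a < b \<and> I = {a..<b}" using assms(2) by (rule bspec)
  then show ?thesis using that by (elim exE conjE)
qed

lemma grid_nested:
  assumes "dyadic_grid D" "I \<in> D" "J \<in> D" shows "I \<subseteq> J \<or> J \<subseteq> I \<or> I \<inter> J = {}"
proof -
  have "\<forall>I\<in>D. \<forall>J\<in>D. I \<subseteq> J \<or> J \<subseteq> I \<or> I \<inter> J = {}" using assms(1) unfolding dyadic_grid_def by (elim conjE)
  then show ?thesis using assms(2,3) by simp
qed

lemma grid_children:
  assumes "dyadic_grid D" "I \<in> D" shows "left_child I \<in> D" "right_child I \<in> D"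
proof -
  have "\<forall>I\<in>D. left_child I \<in> D \<and> right_child I \<in> D" using assms(1) unfolding dyadic_grid_def by (elim conjE)
  then show "left_child I \<in> D" "right_child I \<in> D" using assms(2) by auto
qed

lemma child_ivl:
  assumes "u < (v::real)"
  shows "left_child {u..<v} = {u..<(u + v) / 2}" "right_child {u..<v} = {(u + v) / 2..<v}"
  using assms by (simp_all add: left_child_def right_child_def)

lemma grid_subset_child:
  assumes D: "dyadic_grid D" and "I \<in> D" "J \<in> D" "J \<subset> I"
  shows "J \<subseteq> left_child I \<or> J \<subseteq> right_child I"
proof -
  obtain u v where uv: "u < v" "I = {u..<v}" using grid_interval[OF D assms(2)] .
  obtain c d where cd: "c < d" "J = {c..<d}" using grid_interval[OF D assms(3)] .
  have ch: "left_child I = {u..<(u + v) / 2}" "right_child I = {(u + v) / 2..<v}" "left_child I \<in> D" "right_child I \<in> D"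
    using child_ivl[OF uv(1)] uv(2) grid_children[OF D assms(2)] by auto
  have J: "u \<le> c" "d \<le> v" "c \<noteq> u \<or> d \<noteq> v" using assms(4) uv cd by auto
  have l: "J \<subseteq> left_child I \<or> left_child I \<subseteq> J \<or> J \<inter> left_child I = {}"
    using grid_nested[OF D assms(3) ch(3)] by blast
  have r: "J \<subseteq> right_child I \<or> right_child I \<subseteq> J \<or> J \<inter> right_child I = {}"
    using grid_nested[OF D assms(3) ch(4)] by blast
  have IJ: "I = left_child I \<union> right_child I" using ch uv by auto
  from l r show ?thesis using IJ assms(4) by blast
qed

locale dyadic_tree =
  fixes a L :: real
  assumes L_pos: "L > 0"
begin

text \<open>A list codes a dyadic subinterval of \<open>[a, a + L)\<close>: \<open>b # p\<close> is the left (\<open>False\<close>) or right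
  (\<open>True\<close>) child of \<open>p\<close>, so that the ancestors of an interval are the suffixes of its code.\<close>

primrec lo :: "bool list \<Rightarrow> real" where
  "lo [] = a"
| "lo (b # p) = lo p + (if b then L / 2 ^ Suc (length p) else 0)"

definition wd :: "bool list \<Rightarrow> real" where "wd p = L / 2 ^ length p"

definition iv :: "bool list \<Rightarrow> real set" where "iv p = {lo p..<lo p + wd p}"

lemma wd_pos [simp]: "wd p > 0" using L_pos by (simp add: wd_def)

lemma wd_nonneg [simp]: "wd p \<ge> 0" using wd_pos[of p] by linarith

lemma wd_Cons: "wd (b # p) = wd p / 2" by (simp add: wd_def)

lemma lo_Cons: "lo (b # p) = lo p + (if b then wd p / 2 else 0)" by (simp add: wd_def)

lemma wd_eq: "length p = length q \<Longrightarrow> wd p = wd q" by (simp add: wd_def)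

lemma wd_mono: "length p \<le> length q \<Longrightarrow> wd q \<le> wd p"
  using L_pos by (simp add: wd_def frac_le power_increasing)

lemma wd_shift: "length q = length p + n \<Longrightarrow> wd p = 2 ^ n * wd q"
  by (simp add: wd_def power_add)

lemma iv_Nil: "iv [] = {a..<a + L}" by (simp add: iv_def wd_def)

lemma left_child_iv: "left_child (iv p) = iv (False # p)"
  and right_child_iv: "right_child (iv p) = iv (True # p)"
  using child_ivl[of "lo p" "lo p + wd p"] by (auto simp: iv_def lo_Cons wd_Cons field_simps simp del: lo.simps)

lemma iv_split: "iv p = iv (False # p) \<union> iv (True # p)" "iv (False # p) \<inter> iv (True # p) = {}"
  using wd_pos[of p] by (auto simp: iv_def lo_Cons wd_Cons field_simps simp del: lo.simps wd_pos)

lemma iv_nonempty [simp]: "iv p \<noteq> {}" by (simp add: iv_def)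

lemma lo_in_iv [simp]: "lo p \<in> iv p" by (simp add: iv_def)

lemma iv_borel [measurable, simp]: "iv p \<in> sets borel" by (simp add: iv_def)

lemma iv_bounded [simp]: "bounded (iv p)" by (simp add: iv_def)

lemma len_iv [simp]: "measure lborel (iv p) = wd p" by (simp add: iv_def)

lemma iv_child_subset: "iv (b # p) \<subseteq> iv p" using iv_split(1)[of p] by (cases b) auto

lemma iv_mono: "suffix q p \<Longrightarrow> iv p \<subseteq> iv q"
  by (induction p) (use iv_child_subset in \<open>auto simp: suffix_Cons\<close>)

lemma iv_disjoint_child: "\<not> suffix p q \<Longrightarrow> \<not> suffix q p \<Longrightarrow> iv p \<inter> iv q = {}"
proof (induction p arbitrary: q)
  case (Cons b p)
  show ?case
  proof (cases "suffix p q")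
    case True
    then obtain zs where zs: "q = zs @ p" by (auto elim: suffixE)
    then have "zs \<noteq> []" using Cons.prems(2) suffix_ConsI[of p p b] by auto
    then obtain ys c where "zs = ys @ [c]" by (metis rev_exhaust)
    then have q: "q = ys @ (c # p)" using zs by simp
    then have "c \<noteq> b" using Cons.prems(1) by (auto simp: suffix_def)
    then have 1: "iv (b # p) \<inter> iv (c # p) = {}" using iv_split(2)[of p] by (cases b; cases c) auto
    have 2: "iv q \<subseteq> iv (c # p)" using iv_mono[of "c # p" q] q by (simp add: suffix_def)
    show ?thesis using Int_mono[OF order_refl 2, of "iv (b # p)"] unfolding 1 by simp
  next
    case False
    have "\<not> suffix q p" using Cons.prems(2) suffix_ConsI by metis
    with False have "iv p \<inter> iv q = {}" by (rule Cons.IH)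
    then show ?thesis using Int_mono[OF iv_child_subset[of b p] order_refl[of "iv q"]] by simp
  qed
qed auto

lemma iv_disjoint: "\<not> suffix p q \<Longrightarrow> \<not> suffix q p \<Longrightarrow> iv p \<inter> iv q = {}"
  by (rule iv_disjoint_child)

lemma iv_subset_iff: "iv p \<subseteq> iv q \<longleftrightarrow> suffix q p"
proof
  assume sub: "iv p \<subseteq> iv q"
  show "suffix q p"
  proof (rule ccontr)
    assume n: "\<not> suffix q p"
    then have "suffix p q" using iv_disjoint[of p q] sub iv_nonempty[of p] by (metis Int_absorb2)
    then have "iv p = iv q" using iv_mono[of p q] sub by simp
    then have "wd p = wd q" using len_iv[of p] len_iv[of q] by simp
    then have "length p = length q" using L_pos by (simp add: wd_def power_inject_exp)
    then show False using \<open>suffix p q\<close> n by (metis suffix_length_suffix suffix_order.refl order_refl)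
  qed
qed (rule iv_mono)

lemma iv_inj: "iv p = iv q \<longleftrightarrow> p = q"
  using iv_subset_iff[of p q] iv_subset_iff[of q p] suffix_order.antisym[of p q] by auto

lemma iv_endpoints: assumes "suffix q p" shows "lo q \<le> lo p" "lo p + wd p \<le> lo q + wd q"
  using iv_mono[OF assms] wd_pos[of p] unfolding iv_def by auto

lemma iv_separated:
  assumes "\<not> suffix p q" "\<not> suffix q p" shows "lo p + wd p \<le> lo q \<or> lo q + wd q \<le> lo p"
proof (rule ccontr)
  assume "\<not> ?thesis"
  then have "max (lo p) (lo q) \<in> iv p \<inter> iv q" using wd_pos[of p] wd_pos[of q] unfolding iv_def by auto
  then show False using iv_disjoint[OF assms] by simp
qed

text \<open>One generation serves as the points of the finite model; it will be chosen below the
  Haar supports of both functions.\<close>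

definition atoms :: "nat \<Rightarrow> bool list set" where "atoms N = {x. length x = N}"

lemma finite_atoms [simp]: "finite (atoms N)"
  unfolding atoms_def using finite_lists_length_eq[of "UNIV :: bool set" N] by simp

lemma finite_short [simp]: "finite {p :: bool list. length p \<le> N}" "finite {p :: bool list. length p < N}"
  using finite_lists_length_le[of "UNIV :: bool set" N]
  by (auto intro: finite_subset[of "{p :: bool list. length p < N}" "{p. length p \<le> N}"])

lemma finite_suffixes [simp]: "finite {v. suffix v p}"
  using finite_set[of "suffixes p"] by (simp add: set_suffixes_eq)

lemma additive_atoms:
  fixes h :: "bool list \<Rightarrow> real"
  assumes "\<And>p. h p = h (False # p) + h (True # p)" "length q \<le> N"
  shows "h q = (\<Sum>x | x \<in> atoms N \<and> suffix q x. h x)"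
  using assms(2)
proof (induction N rule: dec_induct)
  case base
  have "{x. x \<in> atoms (length q) \<and> suffix q x} = {q}"
    by (auto simp: atoms_def suffix_def)
  then show ?case by simp
next
  case (step N)
  let ?S = "{x. x \<in> atoms N \<and> suffix q x}"
  have eq: "{x. x \<in> atoms (Suc N) \<and> suffix q x} = (\<lambda>x. False # x) ` ?S \<union> (\<lambda>x. True # x) ` ?S"
  proof (intro equalityI subsetI)
    fix x assume x: "x \<in> {x. x \<in> atoms (Suc N) \<and> suffix q x}"
    then obtain b y where y: "x = b # y" "length y = N" by (cases x) (auto simp: atoms_def)
    then have "suffix q y" using x step.hyps by (auto simp: suffix_Cons)
    then show "x \<in> (\<lambda>x. False # x) ` ?S \<union> (\<lambda>x. True # x) ` ?S" using y by (cases b) (auto simp: atoms_def)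
  qed (auto simp: atoms_def suffix_ConsI)
  have fS: "finite ?S" by (rule finite_subset[OF _ finite_atoms[of N]]) auto
  have "(\<Sum>x | x \<in> atoms (Suc N) \<and> suffix q x. h x) = (\<Sum>x\<in>?S. h (False # x)) + (\<Sum>x\<in>?S. h (True # x))"
    unfolding eq by (subst sum.union_disjoint) (use fS in \<open>auto simp: sum.reindex inj_on_def\<close>)
  also have "\<dots> = (\<Sum>x\<in>?S. h x)" by (simp add: assms(1)[symmetric] sum.distrib[symmetric])
  finally show ?case using step.IH by simp
qed

lemma iv_atoms: assumes "length q \<le> N" shows "iv q = (\<Union>x\<in>{x \<in> atoms N. suffix q x}. iv x)"
  using assms
proof (induction N rule: dec_induct)
  case base
  have "{x. x \<in> atoms (length q) \<and> suffix q x} = {q}"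
    by (auto simp: atoms_def suffix_def)
  then show ?case by simp
next
  case (step N)
  show ?case
  proof (intro equalityI subsetI)
    fix z assume "z \<in> iv q"
    then obtain x where x: "x \<in> atoms N" "suffix q x" "z \<in> iv x" using step.IH by auto
    then obtain b where b: "z \<in> iv (b # x)" using iv_split(1)[of x] by blast
    have "b # x \<in> {x \<in> atoms (Suc N). suffix q x}" using x by (auto simp: atoms_def suffix_ConsI)
    then show "z \<in> (\<Union>x\<in>{x \<in> atoms (Suc N). suffix q x}. iv x)" using b by blast
  qed (use iv_mono in auto)
qed

lemma antichain_sum_le:
  fixes h :: "bool list \<Rightarrow> real"
  assumes add: "\<And>p. h p = h (False # p) + h (True # p)" and nn: "\<And>p. h p \<ge> 0"
    and Q: "finite Q" "\<And>q. q \<in> Q \<Longrightarrow> suffix p q"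
    and anti: "\<And>q q'. q \<in> Q \<Longrightarrow> q' \<in> Q \<Longrightarrow> suffix q q' \<Longrightarrow> q = q'"
  shows "sum h Q \<le> h p"
proof -
  define N where "N = Max (insert (length p) (length ` Q))"
  have N: "length p \<le> N" "\<And>q. q \<in> Q \<Longrightarrow> length q \<le> N" unfolding N_def using Q(1) by auto
  let ?A = "\<lambda>q. {x. x \<in> atoms N \<and> suffix q x}"
  have fA: "finite (?A q)" for q by (rule finite_subset[OF _ finite_atoms[of N]]) auto
  have "sum h Q = (\<Sum>q\<in>Q. sum h (?A q))" using additive_atoms[OF add] N by (intro sum.cong) auto
  also have "\<dots> = sum h (\<Union>q\<in>Q. ?A q)"
  proof (rule sum.UNION_disjoint[symmetric, OF Q(1)])
    show "\<forall>q\<in>Q. finite (?A q)" using fA by blast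
    show "\<forall>q\<in>Q. \<forall>q'\<in>Q. q \<noteq> q' \<longrightarrow> ?A q \<inter> ?A q' = {}"
    proof (intro ballI impI equals0I)
      fix q q' x assume q: "q \<in> Q" "q' \<in> Q" "q \<noteq> q'" "x \<in> ?A q \<inter> ?A q'"
      then have "suffix q q' \<or> suffix q' q" using suffix_same_cases[of q x q'] by auto
      then show False using anti q by metis
    qed
  qed
  also have "\<dots> \<le> sum h (?A p)"
  proof (rule sum_mono2[OF fA])
    show "(\<Union>q\<in>Q. ?A q) \<subseteq> ?A p" using Q(2) suffix_order.trans by blast
  qed (use nn in auto)
  also have "\<dots> = h p" using additive_atoms[OF add N(1)] by simp
  finally show ?thesis .
qed

text \<open>The energy inequality speaks of partitions. An antichain is completed to one by the
  intervals of a common deepest generation that lie in none of its members.\<close>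

lemma antichain_partition:
  assumes Q: "finite Q" "\<And>q. q \<in> Q \<Longrightarrow> suffix p q"
    and anti: "\<And>q q'. q \<in> Q \<Longrightarrow> q' \<in> Q \<Longrightarrow> suffix q q' \<Longrightarrow> q = q'"
  obtains P where "finite P" "Q \<subseteq> P" "partition_on (iv p) (iv ` P)"
proof -
  define N where "N = Max (insert (length p) (length ` Q))"
  have N: "length p \<le> N" "\<And>q. q \<in> Q \<Longrightarrow> length q \<le> N" unfolding N_def using Q(1) by auto
  define P where "P = Q \<union> {x \<in> atoms N. suffix p x \<and> (\<forall>q\<in>Q. \<not> suffix q x)}"
  have suf: "suffix p x" if "x \<in> P" for x using that Q(2) by (auto simp: P_def)
  have anti': "q = q'" if "q \<in> P" "q' \<in> P" "suffix q q'" for q q'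
  proof (cases "q \<in> Q")
    case True
    then show ?thesis using that anti by (auto simp: P_def)
  next
    case False
    then have q: "length q = N" using that by (auto simp: P_def atoms_def)
    have "length q' \<le> N" using that N by (auto simp: P_def atoms_def)
    then show ?thesis using that(3) q by (auto simp: suffix_def)
  qed
  show ?thesis
  proof
    show "finite P" using Q(1) by (auto simp: P_def)
    show "Q \<subseteq> P" by (auto simp: P_def)
    show "partition_on (iv p) (iv ` P)"
    proof (rule partition_onI)
      show "\<Union>(iv ` P) = iv p"
      proof (intro equalityI subsetI)
        fix z assume "z \<in> iv p"
        then obtain x where x: "x \<in> atoms N" "suffix p x" "z \<in> iv x" using iv_atoms[OF N(1)] by auto
        show "z \<in> \<Union>(iv ` P)"
        proof (cases "\<exists>q\<in>Q. suffix q x")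
          case True
          then obtain q where "q \<in> Q" "suffix q x" by blast
          then show ?thesis using iv_mono[of q x] x by (auto simp: P_def)
        qed (use x in \<open>auto simp: P_def\<close>)
      qed (use suf iv_mono in blast)
      show "disjnt p q" if pq: "p \<in> iv ` P" "q \<in> iv ` P" "p \<noteq> q" for p q
      proof -
        obtain x y where "x \<in> P" "y \<in> P" "p = iv x" "q = iv y" using pq(1,2) by blast
        then show ?thesis using anti'[of x y] anti'[of y x] iv_disjoint[of x y] pq(3) by (auto simp: disjnt_def)
      qed
      show "{} \<notin> iv ` P" using iv_nonempty by (metis imageE)
    qed
  qed
qed

lemma atom_order:
  assumes "length x = length y" "u \<in> iv x" "z \<in> iv y" "u \<le> z" shows "lo x \<le> lo y"
proof (cases "x = y")
  case False
  have "\<not> suffix x y" "\<not> suffix y x" using False assms(1) by (auto simp: suffix_def)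
  then have "lo x + wd x \<le> lo y \<or> lo y + wd y \<le> lo x" by (rule iv_separated)
  then show ?thesis using assms wd_pos[of x] unfolding iv_def by auto
qed simp

text \<open>A Riemann sum compared with its antiderivative: \<open>G\<close> has derivative T / (T +
  |z - c|)^2. Its increment over a cell dominates the term of the cell up to T/4, and the increments
  telescope to at most 2 because |G| is at most 1.\<close>

lemma sum_pk_level_le:
  assumes "T > 0" "\<And>v. v \<in> atoms n \<Longrightarrow> wd v \<le> T"
  shows "(\<Sum>v\<in>atoms n. wd v * pk T (lo v - c)) \<le> 8 / T"
proof -
  define G where "G z = (z - c) / (T + \<bar>z - c\<bar>)" for z
  have G1: "G (z + t) - G z \<ge> T * t / 4 * pk T (z - c)" if t: "0 < t" "t \<le> T" for z t
  proof -
    define x where "x = z - c"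
    have Gx: "G (z + t) = (x + t) / (T + \<bar>x + t\<bar>)" "G z = x / (T + \<bar>x\<bar>)" by (simp_all add: G_def x_def algebra_simps)
    have pos: "T + \<bar>x + t\<bar> > 0" "T + \<bar>x\<bar> > 0" using assms(1) by auto
    have "(x + t) * (T + \<bar>x\<bar>) - x * (T + \<bar>x + t\<bar>) \<ge> T * t"
    proof -
      have "(x + t) * \<bar>x\<bar> - x * \<bar>x + t\<bar> \<ge> 0"
      proof (cases "x \<ge> 0 \<or> x + t \<le> 0")
        case True
        then have "(x + t) * \<bar>x\<bar> = x * \<bar>x + t\<bar>" using t by (auto simp: abs_of_nonneg abs_of_nonpos) (simp add: algebra_simps)
        then show ?thesis by simp
      next
        case False
        have "(x + t) * \<bar>x\<bar> \<ge> 0" using False by (intro mult_nonneg_nonneg) auto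
        moreover have "x * \<bar>x + t\<bar> \<le> 0" using False by (intro mult_nonpos_nonneg) auto
        ultimately show ?thesis by linarith
      qed
      then show ?thesis by (simp add: algebra_simps)
    qed
    then have "T * t / ((T + \<bar>x + t\<bar>) * (T + \<bar>x\<bar>)) \<le> ((x + t) * (T + \<bar>x\<bar>) - x * (T + \<bar>x + t\<bar>)) / ((T + \<bar>x + t\<bar>) * (T + \<bar>x\<bar>))"
      using pos by (intro divide_right_mono) auto
    also have "\<dots> = G (z + t) - G z" unfolding Gx using pos by (simp add: diff_frac_eq)
    finally have 1: "T * t / ((T + \<bar>x + t\<bar>) * (T + \<bar>x\<bar>)) \<le> G (z + t) - G z" .
    have "(T + \<bar>x + t\<bar>) * (T + \<bar>x\<bar>) \<le> (2 * (T + \<bar>x\<bar>)) * (T + \<bar>x\<bar>)"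
      using t pos by (intro mult_right_mono) auto
    also have "\<dots> \<le> 4 * (T + \<bar>x\<bar>)\<^sup>2"
    proof -
      have "(2 * z) * z \<le> 4 * z\<^sup>2" for z :: real by (simp add: power2_eq_square)
      then show ?thesis .
    qed
    finally have "T * t / (4 * (T + \<bar>x\<bar>)\<^sup>2) \<le> T * t / ((T + \<bar>x + t\<bar>) * (T + \<bar>x\<bar>))"
      using pos t assms(1) by (intro divide_left_mono mult_pos_pos) auto
    with 1 show ?thesis by (simp add: pk_def x_def)
  qed
  have absG: "\<bar>G z\<bar> \<le> 1" for z using assms(1) by (simp add: G_def)
  define h where "h p = G (lo p + wd p) - G (lo p)" for p
  have h: "h p = h (False # p) + h (True # p)" for p
    by (simp add: h_def lo_Cons wd_Cons add_ac del: lo.simps)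
  have "T / 4 * (\<Sum>v\<in>atoms n. wd v * pk T (lo v - c)) = (\<Sum>v\<in>atoms n. T * wd v / 4 * pk T (lo v - c))"
    by (simp add: sum_distrib_left algebra_simps)
  also have "\<dots> \<le> (\<Sum>v\<in>atoms n. h v)"
    unfolding h_def by (intro sum_mono G1) (use assms in auto)
  also have "\<dots> = h []" using additive_atoms[of h "[]" n, OF h] by simp
  also have "\<dots> \<le> 2" using absG[of "lo [] + wd []"] absG[of "lo []"] unfolding h_def by linarith
  finally show ?thesis using assms(1) by (simp add: field_simps)
qed

end

locale grid_tree = dyadic_tree +
  fixes D :: "real set set"
  assumes D: "dyadic_grid D" and root: "{a..<a + L} \<in> D"
begin

lemma iv_in_D [simp]: "iv p \<in> D"
proof (induction p)
  case Nil
  then show ?case using root by (simp add: iv_Nil)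
next
  case (Cons b p)
  then show ?case using grid_children[OF D Cons.IH] left_child_iv[of p] right_child_iv[of p] by (cases b) auto
qed

text \<open>Descending from \<open>p\<close>, an interval that still properly contains
  \<open>J\<close> has a child containing \<open>J\<close>. The lengths halve at each step, so the
  descent reaches \<open>J\<close>.\<close>

lemma D_subset_iv:
  assumes J: "J \<in> D" "J \<subseteq> iv p" obtains q where "suffix p q" "J = iv q"
proof -
  obtain c d where cd: "c < d" "J = {c..<d}" using grid_interval[OF D J(1)] .
  have step: "(\<exists>q. suffix p q \<and> J = iv q) \<or> (\<exists>q. suffix p q \<and> length q = length p + n \<and> J \<subseteq> iv q)" for n
  proof (induction n)
    case 0
    then show ?case using J by auto
  next
    case (Suc n)
    then show ?case
    proof (elim disjE)
      assume "\<exists>q. suffix p q \<and> length q = length p + n \<and> J \<subseteq> iv q"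
      then obtain q where q: "suffix p q" "length q = length p + n" "J \<subseteq> iv q" by blast
      show ?thesis
      proof (cases "J = iv q")
        case False
        then have "J \<subseteq> left_child (iv q) \<or> J \<subseteq> right_child (iv q)"
          using grid_subset_child[OF D iv_in_D J(1)] q by blast
        then obtain b where "J \<subseteq> iv (b # q)" unfolding left_child_iv right_child_iv by blast
        then show ?thesis using q by (intro disjI2 exI[of _ "b # q"]) (auto simp: suffix_ConsI)
      qed (use q in blast)
    qed auto
  qed
  obtain n where n: "wd p / (d - c) < 2 ^ n" using real_arch_pow[of 2 "wd p / (d - c)"] by auto
  have "\<not> J \<subseteq> iv q" if "length q = length p + n" for q
  proof
    assume "J \<subseteq> iv q"
    then have "d - c \<le> wd q" using cd unfolding iv_def by auto
    moreover have "wd p = 2 ^ n * wd q" using wd_shift that by blast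
    ultimately have "2 ^ n * (d - c) \<le> wd p" by simp
    then show False using n cd by (simp add: divide_less_eq)
  qed
  then show ?thesis using step[of n] that by blast
qed

text \<open>The endpoints of \<open>F\<close> lie on the frontiers of its two children, and
  |q|^\<epsilon> |F|^(1-\<epsilon>) is at least |q|. This is the consequence of goodness from which
  all distance estimates are drawn.\<close>

lemma good_far:
  assumes good: "good_interval \<epsilon> r D (iv q)" and \<epsilon>: "0 < \<epsilon>" "\<epsilon> < 1" and suf: "suffix F q" "length F + r \<le> length q"
    and x: "x \<in> iv q" and y: "y \<notin> iv F"
  shows "wd q \<le> \<bar>x - y\<bar>"
proof -
  obtain n where n: "length q = length F + (r + n)" using suf(2) by (metis add.assoc le_Suc_ex)
  have wdF: "wd F = 2 ^ (r + n) * wd q" using wd_shift[OF n] .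
  have "(2::real) ^ (r - 1) \<le> 2 ^ (r + n)" by (intro power_increasing) auto
  then have big: "2 ^ (r - 1) * len (iv q) \<le> len (iv F)" using wdF by simp
  have "wd q \<le> wd F" using wd_mono[of F q] suf by simp
  then have "wd q powr \<epsilon> * wd q powr (1 - \<epsilon>) \<le> wd q powr \<epsilon> * wd F powr (1 - \<epsilon>)"
    using \<epsilon> by (intro mult_left_mono powr_mono2) auto
  then have pw: "wd q \<le> wd q powr \<epsilon> * wd F powr (1 - \<epsilon>)"
    by (simp add: powr_add[symmetric])
  have "\<forall>K\<in>{left_child (iv F), right_child (iv F)}.
           setdist (iv q) (frontier K) \<ge> wd q powr \<epsilon> * wd F powr (1 - \<epsilon>)"
    using good big unfolding good_interval_def by (metis iv_in_D len_iv)
  then have sd: "wd q \<le> setdist (iv q) (frontier (iv (False # F)))" "wd q \<le> setdist (iv q) (frontier (iv (True # F)))"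
    using pw unfolding left_child_iv right_child_iv by auto
  have fr: "lo F \<in> frontier (iv (False # F))" "lo F + wd F \<in> frontier (iv (True # F))"
    by (auto simp: frontier_def iv_def lo_Cons wd_Cons simp del: lo.simps)
  have "wd q \<le> dist x (lo F)" "wd q \<le> dist x (lo F + wd F)"
    using sd fr setdist_le_dist[OF x] by (meson order_trans)+
  moreover have "x \<in> iv F" using x iv_mono[OF suf(1)] by blast
  ultimately show ?thesis using y unfolding iv_def dist_real_def by auto
qed

end

subsection \<open>Haar functions\<close>

lemma lfb_sets: "locally_finite_borel \<sigma> \<Longrightarrow> sets \<sigma> = sets borel"
  by (simp add: locally_finite_borel_def)

lemma lfb_space: "locally_finite_borel \<sigma> \<Longrightarrow> space \<sigma> = UNIV"
  using sets_eq_imp_space_eq[OF lfb_sets] by simp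

lemma lfb_measurable: "locally_finite_borel \<sigma> \<Longrightarrow> f \<in> borel_measurable \<sigma> \<longleftrightarrow> f \<in> borel_measurable borel"
  using measurable_cong_sets[OF lfb_sets refl] by blast

lemma lfb_finite:
  assumes "locally_finite_borel \<sigma>" "bounded S" "S \<in> sets borel" shows "emeasure \<sigma> S < \<infinity>"
proof -
  obtain x R where R: "S \<subseteq> cball x R" using assms(2) unfolding bounded_subset_cball by blast
  have "emeasure \<sigma> S \<le> emeasure \<sigma> (cball x R)"
    by (rule emeasure_mono[OF R]) (simp add: lfb_sets[OF assms(1)])
  also have "\<dots> < \<infinity>" using assms(1) by (simp add: locally_finite_borel_def)
  finally show ?thesis .
qed

lemma lfb_not_top:
  assumes "locally_finite_borel \<sigma>" "bounded S" "S \<in> sets borel" shows "emeasure \<sigma> S \<noteq> top"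
  using lfb_finite[OF assms] by simp

lemma lfb_emeasure:
  assumes "locally_finite_borel \<sigma>" "bounded S" "S \<in> sets borel" shows "emeasure \<sigma> S = ennreal (measure \<sigma> S)"
  using lfb_finite[OF assms] by (simp add: emeasure_eq_ennreal_measure)

lemma lfb_sigma_finite:
  assumes "locally_finite_borel \<sigma>" shows "sigma_finite_measure \<sigma>"
proof (rule sigma_finite_measure.intro)
  let ?A = "range (\<lambda>n::nat. cball (0::real) (real n))"
  have "countable ?A \<and> ?A \<subseteq> sets \<sigma> \<and> \<Union>?A = space \<sigma> \<and> (\<forall>a\<in>?A. emeasure \<sigma> a \<noteq> \<infinity>)"
  proof (intro conjI)
    show "\<Union>?A = space \<sigma>"
      using real_arch_simple by (auto simp: lfb_space[OF assms] dist_real_def)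
    show "\<forall>a\<in>?A. emeasure \<sigma> a \<noteq> \<infinity>"
      using lfb_not_top[OF assms] by simp
  qed (auto simp: lfb_sets[OF assms])
  then show "\<exists>A. countable A \<and> A \<subseteq> sets \<sigma> \<and> \<Union>A = space \<sigma> \<and> (\<forall>a\<in>A. emeasure \<sigma> a \<noteq> \<infinity>)" by blast
qed

lemma lfb_bounded_integrable:
  fixes f :: "real \<Rightarrow> real"
  assumes \<sigma>: "locally_finite_borel \<sigma>" and S: "bounded S" "S \<in> sets borel"
    and f: "f \<in> borel_measurable borel" "\<And>x. x \<in> S \<Longrightarrow> \<bar>f x\<bar> \<le> B" "\<And>x. x \<notin> S \<Longrightarrow> f x = 0"
  shows "integrable \<sigma> f"
proof (rule Bochner_Integration.integrable_bound)
  show "integrable \<sigma> (\<lambda>x. B * indicator S x)"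
    using lfb_finite[OF \<sigma> S] S(2) lfb_sets[OF \<sigma>] by (intro integrable_mult_right integrable_real_indicator) auto
  show "f \<in> borel_measurable \<sigma>" using f(1) lfb_measurable[OF \<sigma>] by blast
  show "AE x in \<sigma>. norm (f x) \<le> norm (B * indicator S x)"
    using f(2,3) by (intro AE_I2) (force simp: indicator_def)
qed

lemma lfb_indicator_integrable:
  assumes "locally_finite_borel \<sigma>" "bounded S" "S \<in> sets borel" shows "integrable \<sigma> (indicator S :: real \<Rightarrow> real)"
  by (rule lfb_bounded_integrable[OF assms, where B = 1]) (use assms in \<open>auto simp: indicator_def\<close>)

lemma lfb_integral_indicator:
  assumes "locally_finite_borel \<sigma>" "S \<in> sets borel" shows "(LINT x|\<sigma>. indicator S x :: real) = measure \<sigma> S"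
  using assms by (simp add: lfb_sets lfb_space)

definition haar_scale :: "real measure \<Rightarrow> real set \<Rightarrow> real" where
  "haar_scale \<sigma> I = (if measure \<sigma> (left_child I) > 0 \<and> measure \<sigma> (right_child I) > 0 then
     sqrt (measure \<sigma> (left_child I) * measure \<sigma> (right_child I) / measure \<sigma> I) else 0)"

lemma haar_eq: "haar \<sigma> I x = haar_scale \<sigma> I *
    (indicator (right_child I) x / measure \<sigma> (right_child I) - indicator (left_child I) x / measure \<sigma> (left_child I))"
  by (simp add: haar_def haar_scale_def)

lemma haar_measurable [measurable]: "haar \<sigma> I \<in> borel_measurable borel"
  unfolding haar_eq[abs_def] left_child_def right_child_def by measurable

locale haar_interval =
  fixes \<sigma> :: "real measure" and I :: "real set" and u v :: real
  assumes \<sigma>: "locally_finite_borel \<sigma>" and uv: "u < v" and I: "I = {u..<v}"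
begin

lemma ch: "left_child I = {u..<(u + v) / 2}" "right_child I = {(u + v) / 2..<v}"
  using child_ivl[OF uv] I by auto

lemma ch_split: "I = left_child I \<union> right_child I" "left_child I \<inter> right_child I = {}"
  using uv unfolding I child_ivl[OF uv] by auto

lemma ch_sub: "left_child I \<subseteq> I" "right_child I \<subseteq> I"
  using uv unfolding I child_ivl[OF uv] by auto

lemma ch_borel [measurable, simp]: "left_child I \<in> sets borel" "right_child I \<in> sets borel" "I \<in> sets borel"
  unfolding I child_ivl[OF uv] by auto

lemma ch_bounded [simp]: "bounded (left_child I)" "bounded (right_child I)" "bounded I"
  unfolding I child_ivl[OF uv] by auto

lemma measure_split: "measure \<sigma> I = measure \<sigma> (left_child I) + measure \<sigma> (right_child I)"
  by (subst ch_split(1), rule measure_Union)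
    (use ch_split(2) lfb_not_top[OF \<sigma>] lfb_sets[OF \<sigma>] in auto)

lemma haar_outside: "x \<notin> I \<Longrightarrow> haar \<sigma> I x = 0"
proof -
  assume "x \<notin> I"
  then have "x \<notin> left_child I" "x \<notin> right_child I" using ch_sub by blast+
  then show ?thesis by (simp add: haar_eq)
qed

lemma haar_left: "x \<in> left_child I \<Longrightarrow> haar \<sigma> I x = - haar_scale \<sigma> I / measure \<sigma> (left_child I)"
  and haar_right: "x \<in> right_child I \<Longrightarrow> haar \<sigma> I x = haar_scale \<sigma> I / measure \<sigma> (right_child I)"
proof -
  show "haar \<sigma> I x = - haar_scale \<sigma> I / measure \<sigma> (left_child I)" if "x \<in> left_child I"
  proof -
    have "x \<notin> right_child I" using that ch_split(2) by blast
    then show ?thesis using that by (simp add: haar_eq)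
  qed
  show "haar \<sigma> I x = haar_scale \<sigma> I / measure \<sigma> (right_child I)" if "x \<in> right_child I"
  proof -
    have "x \<notin> left_child I" using that ch_split(2) by blast
    then show ?thesis using that by (simp add: haar_eq)
  qed
qed

lemma haar_bounded: obtains B where "\<And>x. \<bar>haar \<sigma> I x\<bar> \<le> B"
proof -
  have "\<bar>haar \<sigma> I x\<bar> \<le> \<bar>haar_scale \<sigma> I\<bar> * (1 / measure \<sigma> (right_child I) + 1 / measure \<sigma> (left_child I))" for x
    unfolding haar_eq abs_mult
    by (rule mult_left_mono) (auto simp: indicator_def intro!: order_trans[OF abs_triangle_ineq4])
  then show ?thesis using that by blast
qed

lemma haar_mult_integrable:
  assumes "set_integrable \<sigma> I f" shows "integrable \<sigma> (\<lambda>x. f x * haar \<sigma> I x)"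
proof -
  obtain B where B: "\<And>x. \<bar>haar \<sigma> I x\<bar> \<le> B" using haar_bounded by blast
  have m: "haar \<sigma> I \<in> borel_measurable \<sigma>" by (rule lfb_measurable[OF \<sigma>, THEN iffD2, OF haar_measurable])
  have i: "integrable \<sigma> (\<lambda>x. indicator I x *\<^sub>R f x)" using assms by (simp add: set_integrable_def)
  have "integrable \<sigma> (\<lambda>x. haar \<sigma> I x * (indicator I x *\<^sub>R f x))"
  proof (rule Bochner_Integration.integrable_bound[OF integrable_mult_right[OF i, of B]])
    show "(\<lambda>x. haar \<sigma> I x * (indicator I x *\<^sub>R f x)) \<in> borel_measurable \<sigma>"
      using m borel_measurable_integrable[OF i] by (rule borel_measurable_times)
    show "AE x in \<sigma>. norm (haar \<sigma> I x * (indicator I x *\<^sub>R f x)) \<le> norm (B * (indicator I x *\<^sub>R f x))"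
    proof (rule AE_I2)
      fix x
      have "\<bar>haar \<sigma> I x\<bar> \<le> \<bar>B\<bar>" using B[of x] by linarith
      then show "norm (haar \<sigma> I x * (indicator I x *\<^sub>R f x)) \<le> norm (B * (indicator I x *\<^sub>R f x))"
        unfolding norm_mult by (intro mult_right_mono) auto
    qed
  qed
  also have "(\<lambda>x. haar \<sigma> I x * (indicator I x *\<^sub>R f x)) = (\<lambda>x. f x * haar \<sigma> I x)"
    using haar_outside by (auto simp: indicator_def fun_eq_iff)
  finally show ?thesis .
qed

lemma haar_coeff:
  assumes "set_integrable \<sigma> I f"
  shows "l2_inner \<sigma> f (haar \<sigma> I) = haar_scale \<sigma> I * (average \<sigma> (right_child I) f - average \<sigma> (left_child I) f)"
proof -
  have i: "set_integrable \<sigma> (left_child I) f" "set_integrable \<sigma> (right_child I) f"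
    using set_integrable_subset[OF assms] ch_sub ch_borel lfb_sets[OF \<sigma>] by simp_all
  have "l2_inner \<sigma> f (haar \<sigma> I) = (LINT x|\<sigma>. haar_scale \<sigma> I *
     ((indicator (right_child I) x *\<^sub>R f x) / measure \<sigma> (right_child I)
      - (indicator (left_child I) x *\<^sub>R f x) / measure \<sigma> (left_child I)))"
    unfolding l2_inner_def haar_eq by (rule Bochner_Integration.integral_cong) (auto simp: algebra_simps)
  also have "\<dots> = haar_scale \<sigma> I * (average \<sigma> (right_child I) f - average \<sigma> (left_child I) f)"
    using i unfolding set_integrable_def average_def set_lebesgue_integral_def by simp
  finally show ?thesis .
qed

lemma average_const:
  assumes "S \<subseteq> I" "S \<in> sets borel" "measure \<sigma> S > 0" "\<And>x. x \<in> S \<Longrightarrow> f x = c" shows "average \<sigma> S f = c"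
proof -
  have "(LINT x:S|\<sigma>. f x) = (LINT x|\<sigma>. c * indicator S x)"
    unfolding set_lebesgue_integral_def by (rule Bochner_Integration.integral_cong) (use assms in \<open>auto simp: indicator_def\<close>)
  also have "\<dots> = c * measure \<sigma> S" using lfb_integral_indicator[OF \<sigma> assms(2)] by simp
  finally show ?thesis using assms(3) by (simp add: average_def)
qed

lemma haar_scale_pos_imp: "haar_scale \<sigma> I \<noteq> 0 \<Longrightarrow> measure \<sigma> (left_child I) > 0 \<and> measure \<sigma> (right_child I) > 0"
  by (auto simp: haar_scale_def split: if_splits)

lemma haar_scale_nonneg: "haar_scale \<sigma> I \<ge> 0"
  by (auto simp: haar_scale_def)

lemma const_integrable:
  assumes "\<And>x. x \<in> I \<Longrightarrow> f x = (c::real)" shows "set_integrable \<sigma> I f"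
proof -
  have "(\<lambda>x. indicator I x *\<^sub>R f x) = (\<lambda>x. c * indicator I x)" using assms by (auto simp: indicator_def)
  moreover have "integrable \<sigma> (\<lambda>x. c * indicator I x)"
    by (intro integrable_mult_right lfb_indicator_integrable[OF \<sigma>]) auto
  ultimately show ?thesis by (simp add: set_integrable_def)
qed

lemma haar_coeff_const:
  assumes "\<And>x. x \<in> I \<Longrightarrow> f x = (c::real)" shows "l2_inner \<sigma> f (haar \<sigma> I) = 0"
proof (cases "haar_scale \<sigma> I = 0")
  case False
  then have p: "measure \<sigma> (left_child I) > 0" "measure \<sigma> (right_child I) > 0" using haar_scale_pos_imp by auto
  note s = ch_sub
  have "average \<sigma> (left_child I) f = c" by (rule average_const[OF s(1)]) (use p assms s in auto)
  moreover have "average \<sigma> (right_child I) f = c" by (rule average_const[OF s(2)]) (use p assms s in auto)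
  ultimately show ?thesis using haar_coeff[OF const_integrable[OF assms]] by simp
qed (simp add: haar_coeff[OF const_integrable[OF assms]])

lemma haar_set_integrable: "set_integrable \<sigma> S (haar \<sigma> I)" if "S \<in> sets borel"
proof -
  obtain B where B: "\<And>x. \<bar>haar \<sigma> I x\<bar> \<le> B" using haar_bounded by blast
  show ?thesis unfolding set_integrable_def
  proof (rule lfb_bounded_integrable[OF \<sigma>, where S = I and B = B])
    show "\<bar>indicator S x *\<^sub>R haar \<sigma> I x\<bar> \<le> B" for x
      using B[of x] order_trans[OF abs_ge_zero B[of x]] by (simp add: indicator_def)
    show "(\<lambda>x. indicator S x *\<^sub>R haar \<sigma> I x) \<in> borel_measurable borel"
      using that by measurable
  qed (use haar_outside in auto)
qed

lemma haar_integrable: "integrable \<sigma> (haar \<sigma> I)"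
  using haar_set_integrable[of UNIV] by (simp add: set_integrable_def)

lemma haar_integral: "(LINT x|\<sigma>. haar \<sigma> I x) = 0"
  using haar_coeff_const[of "\<lambda>_. 1" 1] by (simp add: l2_inner_def)

lemma haar_scale_sq:
  assumes "haar_scale \<sigma> I \<noteq> 0"
  shows "(haar_scale \<sigma> I)\<^sup>2 = measure \<sigma> (left_child I) * measure \<sigma> (right_child I) / measure \<sigma> I"
  using haar_scale_pos_imp[OF assms] by (simp add: haar_scale_def)

lemma haar_norm: "l2_inner \<sigma> (haar \<sigma> I) (haar \<sigma> I) = (if haar_scale \<sigma> I = 0 then 0 else 1)"
proof (cases "haar_scale \<sigma> I = 0")
  case False
  define \<alpha> \<beta> k where "\<alpha> = measure \<sigma> (left_child I)" "\<beta> = measure \<sigma> (right_child I)" "k = haar_scale \<sigma> I"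
  have p: "\<alpha> > 0" "\<beta> > 0" using haar_scale_pos_imp[OF False] by (auto simp: \<alpha>_\<beta>_k_def)
  note s = ch_sub
  have "average \<sigma> (left_child I) (haar \<sigma> I) = - k / \<alpha>"
    by (rule average_const[OF s(1)]) (use p haar_left in \<open>auto simp: \<alpha>_\<beta>_k_def\<close>)
  moreover have "average \<sigma> (right_child I) (haar \<sigma> I) = k / \<beta>"
    by (rule average_const[OF s(2)]) (use p haar_right in \<open>auto simp: \<alpha>_\<beta>_k_def\<close>)
  ultimately have "l2_inner \<sigma> (haar \<sigma> I) (haar \<sigma> I) = k * (k / \<beta> - - k / \<alpha>)"
    using haar_coeff[OF haar_set_integrable] by (simp add: \<alpha>_\<beta>_k_def)
  also have "\<dots> = k\<^sup>2 * ((\<alpha> + \<beta>) / (\<alpha> * \<beta>))" using p by (simp add: power2_eq_square field_simps)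
  also have "k\<^sup>2 = \<alpha> * \<beta> / (\<alpha> + \<beta>)"
    using haar_scale_sq[OF False] measure_split by (simp add: \<alpha>_\<beta>_k_def)
  finally show ?thesis using p False by simp
qed (simp add: haar_eq[abs_def] l2_inner_def)

text \<open>If a child has no mass, the martingale difference is 0 by definition, and the averages
  over \<open>I\<close> and over the charged child agree. With this case included, differences
  telescope along every path that ends in an interval of positive mass.\<close>

lemma average_mart_diff:
  assumes f: "set_integrable \<sigma> I f" and S: "S = left_child I \<or> S = right_child I" and pos: "measure \<sigma> S > 0"
  shows "average \<sigma> S (mart_diff \<sigma> I f) = average \<sigma> S f - average \<sigma> I f"
proof -
  define \<alpha> \<beta> where "\<alpha> = measure \<sigma> (left_child I)" "\<beta> = measure \<sigma> (right_child I)"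
  define x y where "x = (LINT z:left_child I|\<sigma>. f z)" "y = (LINT z:right_child I|\<sigma>. f z)"
  have i: "set_integrable \<sigma> (left_child I) f" "set_integrable \<sigma> (right_child I) f"
    using set_integrable_subset[OF f] ch_sub ch_borel lfb_sets[OF \<sigma>] by simp_all
  have xy: "(LINT z:I|\<sigma>. f z) = x + y"
    unfolding x_y_def by (subst ch_split(1), rule set_integral_Un) (use i ch_split(2) in auto)
  have nn: "\<alpha> \<ge> 0" "\<beta> \<ge> 0" by (auto simp: \<alpha>_\<beta>_def)
  have m: "measure \<sigma> I = \<alpha> + \<beta>" using measure_split by (simp add: \<alpha>_\<beta>_def)
  have null: "(LINT z:T|\<sigma>. f z) = 0" if T: "T \<in> sets borel" "bounded T" "measure \<sigma> T = 0" for T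
  proof -
    have "emeasure \<sigma> T = 0" using lfb_emeasure[OF \<sigma> T(2,1)] T(3) by simp
    then have "AE z in \<sigma>. z \<notin> T" using T(1) lfb_sets[OF \<sigma>] by (intro AE_not_in) (auto simp: null_sets_def)
    then have "AE z in \<sigma>. indicator T z *\<^sub>R f z = 0" by eventually_elim (simp add: indicator_def)
    then show ?thesis unfolding set_lebesgue_integral_def by (rule integral_eq_zero_AE)
  qed
  note s = ch_sub
  show ?thesis
  proof (cases "haar_scale \<sigma> I = 0")
    case True
    then have "\<alpha> = 0 \<or> \<beta> = 0" using nn measure_split m unfolding haar_scale_def \<alpha>_\<beta>_def[symmetric]
      by (auto split: if_splits simp: less_eq_real_def)
    moreover have "average \<sigma> S (mart_diff \<sigma> I f) = 0" using True by (simp add: mart_diff_def haar_eq average_def)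
    moreover have "average \<sigma> S f = average \<sigma> I f"
      using calculation(1) S pos null[of "left_child I"] null[of "right_child I"] xy m
      by (auto simp: average_def x_y_def \<alpha>_\<beta>_def)
    ultimately show ?thesis by simp
  next
    case False
    then have p: "\<alpha> > 0" "\<beta> > 0" using haar_scale_pos_imp by (auto simp: \<alpha>_\<beta>_def)
    define k where "k = haar_scale \<sigma> I"
    have k2: "k\<^sup>2 = \<alpha> * \<beta> / (\<alpha> + \<beta>)" using haar_scale_sq[OF False] m by (simp add: \<alpha>_\<beta>_def k_def)
    have c: "l2_inner \<sigma> f (haar \<sigma> I) = k * (y / \<beta> - x / \<alpha>)"
      using haar_coeff[OF f] by (simp add: average_def k_def x_y_def \<alpha>_\<beta>_def)
    from S show ?thesis
    proof
      assume S: "S = left_child I"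
      have "average \<sigma> S (mart_diff \<sigma> I f) = (k * (y / \<beta> - x / \<alpha>)) * (- k / \<alpha>)"
        unfolding S by (rule average_const[OF s(1)]) (use p haar_left c in \<open>auto simp: mart_diff_def k_def \<alpha>_\<beta>_def\<close>)
      also have "\<dots> = - k\<^sup>2 * (y / \<beta> - x / \<alpha>) / \<alpha>" by (simp add: power2_eq_square)
      also have "\<dots> = x / \<alpha> - (x + y) / (\<alpha> + \<beta>)" unfolding k2 using p by (simp add: divide_simps) (simp add: algebra_simps)
      finally show ?thesis using xy m S by (simp add: average_def x_y_def \<alpha>_\<beta>_def)
    next
      assume S: "S = right_child I"
      have "average \<sigma> S (mart_diff \<sigma> I f) = (k * (y / \<beta> - x / \<alpha>)) * (k / \<beta>)"
        unfolding S by (rule average_const[OF s(2)]) (use p haar_right c in \<open>auto simp: mart_diff_def k_def \<alpha>_\<beta>_def\<close>)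
      also have "\<dots> = k\<^sup>2 * (y / \<beta> - x / \<alpha>) / \<beta>" by (simp add: power2_eq_square)
      also have "\<dots> = y / \<beta> - (x + y) / (\<alpha> + \<beta>)" unfolding k2 using p by (simp add: divide_simps) (simp add: algebra_simps)
      finally show ?thesis using xy m S by (simp add: average_def x_y_def \<alpha>_\<beta>_def)
    qed
  qed
qed

end

lemma l2_inner_commute: "l2_inner \<sigma> f g = l2_inner \<sigma> g f"
  by (simp add: l2_inner_def mult.commute)

text \<open>Of two nested intervals the larger one has a Haar function that is constant on the
  smaller one, and the smaller one's Haar function annihilates constants.\<close>

lemma haar_orthogonal:
  assumes D: "dyadic_grid D" and \<sigma>: "locally_finite_borel \<sigma>" and IJ: "I \<in> D" "J \<in> D" "I \<noteq> J"
  shows "l2_inner \<sigma> (haar \<sigma> I) (haar \<sigma> J) = 0"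
proof -
  have sub: "l2_inner \<sigma> (haar \<sigma> I) (haar \<sigma> J) = 0" if JI: "J \<subset> I" and ID: "I \<in> D" and JD: "J \<in> D" for I J
  proof -
    obtain u v where uv: "u < v" "I = {u..<v}" using grid_interval[OF D ID] .
    obtain u' v' where uv': "u' < v'" "J = {u'..<v'}" using grid_interval[OF D JD] .
    interpret I: haar_interval \<sigma> I u v by unfold_locales (use \<sigma> uv in auto)
    interpret J: haar_interval \<sigma> J u' v' by unfold_locales (use \<sigma> uv' in auto)
    have "J \<subseteq> left_child I \<or> J \<subseteq> right_child I" using grid_subset_child[OF D ID JD JI] .
    then show ?thesis
      using J.haar_coeff_const[of "haar \<sigma> I"] I.haar_left I.haar_right by (meson subsetD)
  qed
  show ?thesis
  proof (cases "I \<inter> J = {}")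
    case True
    obtain u v where uv: "u < v" "I = {u..<v}" using grid_interval[OF D IJ(1)] .
    obtain u' v' where uv': "u' < v'" "J = {u'..<v'}" using grid_interval[OF D IJ(2)] .
    interpret I: haar_interval \<sigma> I u v by unfold_locales (use \<sigma> uv in auto)
    interpret J: haar_interval \<sigma> J u' v' by unfold_locales (use \<sigma> uv' in auto)
    have "haar \<sigma> I x = 0" if "x \<in> J" for x using that True I.haar_outside by blast
    then show ?thesis by (rule J.haar_coeff_const)
  next
    case False
    then have "I \<subset> J \<or> J \<subset> I" using grid_nested[OF D IJ(1,2)] IJ(3) by blast
    then show ?thesis using sub[of J I] sub[of I J] IJ l2_inner_commute[of \<sigma> "haar \<sigma> I"] by metis
  qed
qed

lemma bessel:
  fixes h :: "'i \<Rightarrow> real \<Rightarrow> real"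
  assumes Q: "finite Q"
    and orth: "\<And>i j. i \<in> Q \<Longrightarrow> j \<in> Q \<Longrightarrow> i \<noteq> j \<Longrightarrow> l2_inner \<sigma> (h i) (h j) = 0"
    and norm: "\<And>i. i \<in> Q \<Longrightarrow> l2_inner \<sigma> (h i) (h i) \<le> 1"
    and int: "\<And>i j. i \<in> Q \<Longrightarrow> j \<in> Q \<Longrightarrow> integrable \<sigma> (\<lambda>x. h i x * h j x)"
      "\<And>i. i \<in> Q \<Longrightarrow> integrable \<sigma> (\<lambda>x. u x * h i x)" "integrable \<sigma> (\<lambda>x. (u x)\<^sup>2)"
  shows "(\<Sum>i\<in>Q. (l2_inner \<sigma> u (h i))\<^sup>2) \<le> (LINT x|\<sigma>. (u x)\<^sup>2)"
proof -
  define c where "c i = l2_inner \<sigma> u (h i)" for i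
  have "0 \<le> (LINT x|\<sigma>. (u x - (\<Sum>i\<in>Q. c i * h i x))\<^sup>2)" by (rule integral_nonneg_AE) simp
  also have "\<dots> = (LINT x|\<sigma>. (u x)\<^sup>2 - 2 * (\<Sum>i\<in>Q. c i * (u x * h i x)) + (\<Sum>i\<in>Q. \<Sum>j\<in>Q. c i * c j * (h i x * h j x)))"
    by (rule Bochner_Integration.integral_cong)
      (simp_all add: power2_eq_square algebra_simps sum_distrib_left sum_distrib_right)
  also have "\<dots> = (LINT x|\<sigma>. (u x)\<^sup>2) - 2 * (\<Sum>i\<in>Q. c i * c i) + (\<Sum>i\<in>Q. \<Sum>j\<in>Q. c i * c j * l2_inner \<sigma> (h i) (h j))"
    using int by (simp add: c_def l2_inner_def)
  also have "(\<Sum>i\<in>Q. \<Sum>j\<in>Q. c i * c j * l2_inner \<sigma> (h i) (h j)) \<le> (\<Sum>i\<in>Q. c i * c i)"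
  proof (rule sum_mono)
    fix i assume i: "i \<in> Q"
    have "(\<Sum>j\<in>Q. c i * c j * l2_inner \<sigma> (h i) (h j)) = (\<Sum>j\<in>Q. if i = j then c i * c i * l2_inner \<sigma> (h i) (h i) else 0)"
      by (intro sum.cong refl) (use orth[OF i] in auto)
    also have "\<dots> = c i * c i * l2_inner \<sigma> (h i) (h i)" using i Q by simp
    also have "\<dots> \<le> c i * c i * 1" by (rule mult_left_mono[OF norm[OF i]]) simp
    finally show "(\<Sum>j\<in>Q. c i * c j * l2_inner \<sigma> (h i) (h j)) \<le> c i * c i" by simp
  qed
  finally show ?thesis by (simp add: c_def power2_eq_square)
qed

context dyadic_tree
begin

lemma haar_iv: "locally_finite_borel \<sigma> \<Longrightarrow> haar_interval \<sigma> (iv q) (lo q) (lo q + wd q)"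
  by unfold_locales (auto simp: iv_def)

lemma haar_iv_orthogonal:
  assumes \<sigma>: "locally_finite_borel \<sigma>" and pq: "p \<noteq> q"
  shows "l2_inner \<sigma> (haar \<sigma> (iv p)) (haar \<sigma> (iv q)) = 0"
proof -
  have sub: "l2_inner \<sigma> (haar \<sigma> (iv p)) (haar \<sigma> (iv q)) = 0" if pq: "suffix p q" "p \<noteq> q" for p q
  proof -
    interpret I: haar_interval \<sigma> "iv p" "lo p" "lo p + wd p" by (rule haar_iv[OF \<sigma>])
    interpret J: haar_interval \<sigma> "iv q" "lo q" "lo q + wd q" by (rule haar_iv[OF \<sigma>])
    obtain zs where zs: "q = zs @ p" using pq(1) unfolding suffix_def by blast
    then have "zs \<noteq> []" using pq(2) by auto
    then obtain ys b where "zs = ys @ [b]" by (metis rev_exhaust)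
    then have "suffix (b # p) q" using zs by (simp add: suffix_def)
    then have "iv q \<subseteq> iv (b # p)" by (rule iv_mono)
    then have "iv q \<subseteq> left_child (iv p) \<or> iv q \<subseteq> right_child (iv p)"
      unfolding left_child_iv right_child_iv by (cases b) auto
    then show ?thesis
      using J.haar_coeff_const[of "haar \<sigma> (iv p)"] I.haar_left I.haar_right by (meson subsetD)
  qed
  show ?thesis
  proof (cases "suffix p q \<or> suffix q p")
    case True
    then show ?thesis using sub[of p q] sub[of q p] pq l2_inner_commute[of \<sigma> "haar \<sigma> (iv p)"] by metis
  next
    case False
    interpret I: haar_interval \<sigma> "iv p" "lo p" "lo p + wd p" by (rule haar_iv[OF \<sigma>])
    interpret J: haar_interval \<sigma> "iv q" "lo q" "lo q + wd q" by (rule haar_iv[OF \<sigma>])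
    have "haar \<sigma> (iv p) x = 0" if "x \<in> iv q" for x using that False iv_disjoint[of p q] I.haar_outside by blast
    then show ?thesis by (rule J.haar_coeff_const)
  qed
qed

lemma haar_iv_mult_integrable:
  assumes \<sigma>: "locally_finite_borel \<sigma>" shows "integrable \<sigma> (\<lambda>x. haar \<sigma> (iv p) x * haar \<sigma> (iv q) x)"
proof -
  interpret I: haar_interval \<sigma> "iv p" "lo p" "lo p + wd p" by (rule haar_iv[OF \<sigma>])
  interpret J: haar_interval \<sigma> "iv q" "lo q" "lo q + wd q" by (rule haar_iv[OF \<sigma>])
  show ?thesis by (rule J.haar_mult_integrable) (simp add: I.haar_set_integrable)
qed

lemma bessel_haar:
  assumes \<sigma>: "locally_finite_borel \<sigma>" and Q: "finite Q"
    and u: "integrable \<sigma> (\<lambda>x. (u x)\<^sup>2)" "\<And>q. q \<in> Q \<Longrightarrow> set_integrable \<sigma> (iv q) u"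
  shows "(\<Sum>q\<in>Q. (l2_inner \<sigma> u (haar \<sigma> (iv q)))\<^sup>2) \<le> (LINT x|\<sigma>. (u x)\<^sup>2)"
proof (rule bessel[OF Q _ _ haar_iv_mult_integrable[OF \<sigma>] _ u(1)])
  show "l2_inner \<sigma> (haar \<sigma> (iv p)) (haar \<sigma> (iv q)) = 0" if "p \<noteq> q" for p q by (rule haar_iv_orthogonal[OF \<sigma> that])
  show "l2_inner \<sigma> (haar \<sigma> (iv p)) (haar \<sigma> (iv p)) \<le> 1" for p
    using haar_interval.haar_norm[OF haar_iv[OF \<sigma>]] by simp
  show "integrable \<sigma> (\<lambda>x. u x * haar \<sigma> (iv q) x)" if "q \<in> Q" for q
    by (rule haar_interval.haar_mult_integrable[OF haar_iv[OF \<sigma>] u(2)[OF that]])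
qed

text \<open>Cutting \<open>u\<close> off outside \<open>v\<close> changes none of the coefficients
  below \<open>v\<close>. So only local integrability is asked of \<open>u\<close>, which is what
  bounds on a Hilbert transform provide.\<close>

lemma bessel_haar_local:
  assumes \<sigma>: "locally_finite_borel \<sigma>" and Q: "finite Q" "\<And>q. q \<in> Q \<Longrightarrow> suffix v q"
    and u: "set_integrable \<sigma> (iv v) (\<lambda>x. (u x)\<^sup>2)" "set_integrable \<sigma> (iv v) u"
  shows "(\<Sum>q\<in>Q. (l2_inner \<sigma> u (haar \<sigma> (iv q)))\<^sup>2) \<le> (LINT x:iv v|\<sigma>. (u x)\<^sup>2)"
proof -
  let ?u = "\<lambda>x. indicator (iv v) x * u x"
  have eq: "l2_inner \<sigma> u (haar \<sigma> (iv q)) = l2_inner \<sigma> ?u (haar \<sigma> (iv q))" if "q \<in> Q" for q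
  proof -
    have "haar \<sigma> (iv q) x = 0" if "x \<notin> iv v" for x
      using that iv_mono[OF Q(2)[OF \<open>q \<in> Q\<close>]] haar_interval.haar_outside[OF haar_iv[OF \<sigma>]] by blast
    then show ?thesis unfolding l2_inner_def
      by (intro Bochner_Integration.integral_cong) (auto simp: indicator_def)
  qed
  have sq: "(\<lambda>x. (?u x)\<^sup>2) = (\<lambda>x. indicator (iv v) x *\<^sub>R (u x)\<^sup>2)" by (auto simp: indicator_def)
  have "(\<Sum>q\<in>Q. (l2_inner \<sigma> ?u (haar \<sigma> (iv q)))\<^sup>2) \<le> (LINT x|\<sigma>. (?u x)\<^sup>2)"
  proof (rule bessel_haar[OF \<sigma> Q(1)])
    show "integrable \<sigma> (\<lambda>x. (?u x)\<^sup>2)" using u(1) unfolding sq set_integrable_def .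
    show "set_integrable \<sigma> (iv q) ?u" if "q \<in> Q" for q
    proof -
      have "set_integrable \<sigma> (iv q) u"
        by (rule set_integrable_subset[OF u(2)]) (use iv_mono[OF Q(2)[OF that]] lfb_sets[OF \<sigma>] in auto)
      also have "(set_integrable \<sigma> (iv q) u) = (set_integrable \<sigma> (iv q) ?u)"
        unfolding set_integrable_def
        by (rule Bochner_Integration.integrable_cong) (use iv_mono[OF Q(2)[OF that]] in \<open>auto simp: indicator_def\<close>)
      finally show ?thesis .
    qed
  qed
  then show ?thesis unfolding sq set_lebesgue_integral_def using eq by simp
qed

end

subsection \<open>The truncated Hilbert transform\<close>

lemma trunc_kernel_odd: "trunc_kernel \<alpha> \<beta> (- y) = - trunc_kernel \<alpha> \<beta> y"
  by (simp add: trunc_kernel_def sgn_minus)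

lemma trunc_kernel_measurable [measurable]: "trunc_kernel \<alpha> \<beta> \<in> borel_measurable borel"
  unfolding trunc_kernel_def[abs_def] by measurable

lemma trunc_kernel_pieces:
  assumes "0 < \<alpha>" "\<alpha> < \<beta>"
  shows "0 < y \<Longrightarrow> y \<le> \<alpha> \<Longrightarrow> trunc_kernel \<alpha> \<beta> y = 2 / \<alpha> - y / \<alpha>\<^sup>2"
    "\<alpha> \<le> y \<Longrightarrow> y \<le> \<beta> \<Longrightarrow> trunc_kernel \<alpha> \<beta> y = 1 / y"
    "\<beta> \<le> y \<Longrightarrow> y \<le> 2 * \<beta> \<Longrightarrow> trunc_kernel \<alpha> \<beta> y = 2 / \<beta> - y / \<beta>\<^sup>2"
    "2 * \<beta> \<le> y \<Longrightarrow> trunc_kernel \<alpha> \<beta> y = 0"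
proof -
  have q: "\<gamma> / \<gamma>\<^sup>2 = 1 / \<gamma>" "2 * \<gamma> / \<gamma>\<^sup>2 = 2 / \<gamma>" if "\<gamma> > 0" for \<gamma> :: real
    using that by (simp_all add: power2_eq_square)
  show "trunc_kernel \<alpha> \<beta> y = 2 / \<alpha> - y / \<alpha>\<^sup>2" if y: "0 < y" "y \<le> \<alpha>"
  proof (cases "y = \<alpha>")
    case True
    then show ?thesis using assms q(1)[of \<alpha>] by (simp add: trunc_kernel_def diff_divide_distrib[symmetric])
  next
    case False
    then show ?thesis using assms y by (simp add: trunc_kernel_def)
  qed
  show "trunc_kernel \<alpha> \<beta> y = 1 / y" if "\<alpha> \<le> y" "y \<le> \<beta>"
    using assms that by (simp add: trunc_kernel_def)
  show "trunc_kernel \<alpha> \<beta> y = 2 / \<beta> - y / \<beta>\<^sup>2" if y: "\<beta> \<le> y" "y \<le> 2 * \<beta>"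
  proof -
    consider "y = \<beta>" | "y = 2 * \<beta>" | "\<beta> < y" "y < 2 * \<beta>" using y by linarith
    then show ?thesis
    proof cases
      case 1
      then show ?thesis using assms q(1)[of \<beta>] by (simp add: trunc_kernel_def diff_divide_distrib[symmetric])
    next
      case 2
      then show ?thesis using assms q(2)[of \<beta>] by (simp add: trunc_kernel_def)
    qed (use assms in \<open>simp add: trunc_kernel_def\<close>)
  qed
  show "trunc_kernel \<alpha> \<beta> y = 0" if "2 * \<beta> \<le> y"
    using assms that by (simp add: trunc_kernel_def)
qed

lemma trunc_kernel_bound:
  assumes "0 < \<alpha>" "\<alpha> < \<beta>" shows "\<bar>trunc_kernel \<alpha> \<beta> y\<bar> \<le> 2 / \<alpha>"
proof -
  have *: "\<bar>trunc_kernel \<alpha> \<beta> y\<bar> \<le> 2 / \<alpha>" if y: "y > 0" for y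
  proof -
    consider "y \<le> \<alpha>" | "\<alpha> \<le> y" "y \<le> \<beta>" | "\<beta> \<le> y" "y \<le> 2 * \<beta>" | "2 * \<beta> \<le> y" by linarith
    then show ?thesis
    proof cases
      case 1
      have "y / \<alpha>\<^sup>2 \<le> \<alpha> / \<alpha>\<^sup>2" using 1 by (intro divide_right_mono) auto
      also have "\<alpha> / \<alpha>\<^sup>2 = 1 / \<alpha>" using assms by (simp add: power2_eq_square)
      also have "\<dots> \<le> 2 / \<alpha>" using assms by (simp add: divide_right_mono)
      finally have "y / \<alpha>\<^sup>2 \<le> 2 / \<alpha>" .
      moreover have "y / \<alpha>\<^sup>2 \<ge> 0" using y by simp
      ultimately show ?thesis using trunc_kernel_pieces(1)[OF assms y 1] by simp
    next
      case 2
      have "1 / y \<le> 2 / \<alpha>" using 2 assms by (intro frac_le) auto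
      then show ?thesis using trunc_kernel_pieces(2)[OF assms 2] y by simp
    next
      case 3
      have "y / \<beta>\<^sup>2 \<le> 2 * \<beta> / \<beta>\<^sup>2" using 3 by (intro divide_right_mono) auto
      also have "2 * \<beta> / \<beta>\<^sup>2 = 2 / \<beta>" using assms by (simp add: power2_eq_square)
      finally have "y / \<beta>\<^sup>2 \<le> 2 / \<beta>" .
      moreover have "y / \<beta>\<^sup>2 \<ge> 0" using y by simp
      moreover have "2 / \<beta> \<le> 2 / \<alpha>" using assms by (intro divide_left_mono) auto
      ultimately show ?thesis using trunc_kernel_pieces(3)[OF assms 3] by simp
    next
      case 4
      then show ?thesis using trunc_kernel_pieces(4)[OF assms 4] assms by simp
    qed
  qed
  consider "y > 0" | "y = 0" | "- y > 0" by linarith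
  then show ?thesis
  proof cases
    case 2
    then show ?thesis using assms by (simp add: trunc_kernel_def)
  next
    case 3
    then show ?thesis using *[OF 3] trunc_kernel_odd[of \<alpha> \<beta> y] by simp
  qed (rule *)
qed

lemma trunc_kernel_diff_pieces:
  assumes "0 < \<alpha>" "\<alpha> < \<beta>" "0 < a" "a \<le> b"
  defines "K \<equiv> trunc_kernel \<alpha> \<beta>"
  shows "b \<le> \<alpha> \<Longrightarrow> K a - K b = (b - a) * (1 / \<alpha>\<^sup>2)"
    "\<alpha> \<le> a \<Longrightarrow> b \<le> \<beta> \<Longrightarrow> K a - K b = (b - a) * (1 / (a * b))"
    "\<beta> \<le> a \<Longrightarrow> b \<le> 2 * \<beta> \<Longrightarrow> K a - K b = (b - a) * (1 / \<beta>\<^sup>2)"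
    "2 * \<beta> \<le> a \<Longrightarrow> K a - K b = 0"
proof -
  show "K a - K b = (b - a) * (1 / \<alpha>\<^sup>2)" if "b \<le> \<alpha>"
    unfolding K_def using trunc_kernel_pieces(1)[OF assms(1,2), of a] trunc_kernel_pieces(1)[OF assms(1,2), of b] that assms(3,4)
    by (simp add: diff_divide_distrib)
  show "K a - K b = (b - a) * (1 / (a * b))" if "\<alpha> \<le> a" "b \<le> \<beta>"
    unfolding K_def using trunc_kernel_pieces(2)[OF assms(1,2), of a] trunc_kernel_pieces(2)[OF assms(1,2), of b] that assms(1-4)
    by (simp add: field_simps)
  show "K a - K b = (b - a) * (1 / \<beta>\<^sup>2)" if "\<beta> \<le> a" "b \<le> 2 * \<beta>"
    unfolding K_def using trunc_kernel_pieces(3)[OF assms(1,2), of a] trunc_kernel_pieces(3)[OF assms(1,2), of b] that assms(3,4)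
    by (simp add: diff_divide_distrib)
  show "K a - K b = 0" if "2 * \<beta> \<le> a"
    unfolding K_def using trunc_kernel_pieces(4)[OF assms(1,2), of a] trunc_kernel_pieces(4)[OF assms(1,2), of b] that assms(3,4)
    by simp
qed

text \<open>The last linear piece decides the constant: its slope is 1/\<beta>^2, while \<delta> may
  be as large as 2 \<beta>. The estimates on the pieces are chained at the break points.\<close>

lemma trunc_kernel_diff_upper:
  assumes ab: "0 < \<alpha>" "\<alpha> < \<beta>" and d: "0 < \<delta>" "\<delta> \<le> a" "a \<le> b"
  shows "trunc_kernel \<alpha> \<beta> a - trunc_kernel \<alpha> \<beta> b \<le> (b - a) * (4 / \<delta>\<^sup>2)"
proof -
  let ?K = "trunc_kernel \<alpha> \<beta>"
  define U where "U a b \<longleftrightarrow> ?K a - ?K b \<le> (b - a) * (4 / \<delta>\<^sup>2)" for a b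
  have join: "U a c" if "U a b" "U b c" for a b c
  proof -
    have "(b - a) * (4 / \<delta>\<^sup>2) + (c - b) * (4 / \<delta>\<^sup>2) = (c - a) * (4 / \<delta>\<^sup>2)"
      unfolding left_diff_distrib by simp
    then show ?thesis using that unfolding U_def by linarith
  qed
  have u1: "U a b" if "\<delta> \<le> a" "a \<le> b" "b \<le> \<alpha>" for a b
  proof -
    have "1 / \<alpha>\<^sup>2 \<le> 4 / \<delta>\<^sup>2" using that ab d by (intro frac_le power_mono) auto
    then have "(b - a) * (1 / \<alpha>\<^sup>2) \<le> (b - a) * (4 / \<delta>\<^sup>2)" using that by (intro mult_left_mono) auto
    then show ?thesis using trunc_kernel_diff_pieces(1)[OF ab, of a b] that d by (simp add: U_def)
  qed
  have u2: "U a b" if "\<delta> \<le> a" "a \<le> b" "\<alpha> \<le> a" "b \<le> \<beta>" for a b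
  proof -
    have "\<delta>\<^sup>2 \<le> a * b" unfolding power2_eq_square using that d by (intro mult_mono) auto
    then have "1 / (a * b) \<le> 4 / \<delta>\<^sup>2" using that ab d by (intro frac_le) auto
    then have "(b - a) * (1 / (a * b)) \<le> (b - a) * (4 / \<delta>\<^sup>2)" using that by (intro mult_left_mono) auto
    then show ?thesis using trunc_kernel_diff_pieces(2)[OF ab, of a b] that d by (simp add: U_def)
  qed
  have u3: "U a b" if "\<delta> \<le> a" "a \<le> b" "\<beta> \<le> a" "b \<le> 2 * \<beta>" for a b
  proof -
    have "\<delta>\<^sup>2 \<le> (2 * \<beta>)\<^sup>2" using that d by (intro power_mono) auto
    then have "4 / (2 * \<beta>)\<^sup>2 \<le> 4 / \<delta>\<^sup>2" using d by (intro divide_left_mono mult_pos_pos) (use ab in auto)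
    then have "1 / \<beta>\<^sup>2 \<le> 4 / \<delta>\<^sup>2" by (simp add: power2_eq_square)
    then have "(b - a) * (1 / \<beta>\<^sup>2) \<le> (b - a) * (4 / \<delta>\<^sup>2)" using that by (intro mult_left_mono) auto
    then show ?thesis using trunc_kernel_diff_pieces(3)[OF ab, of a b] that d by (simp add: U_def)
  qed
  have u4: "U a b" if "\<delta> \<le> a" "a \<le> b" "2 * \<beta> \<le> a" for a b
    using trunc_kernel_diff_pieces(4)[OF ab, of a b] that d by (simp add: U_def)
  have v3: "U a b" if "\<delta> \<le> a" "a \<le> b" "\<beta> \<le> a" for a b
  proof -
    consider "b \<le> 2 * \<beta>" | "2 * \<beta> \<le> a" | "a \<le> 2 * \<beta>" "2 * \<beta> \<le> b" by linarith
    then show ?thesis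
    proof cases
      case 3
      then show ?thesis using join[of a "2 * \<beta>" b] u3[of a "2 * \<beta>"] u4[of "2 * \<beta>" b] that by simp
    qed (use u3[of a b] u4[of a b] that in auto)
  qed
  have v2: "U a b" if "\<delta> \<le> a" "a \<le> b" "\<alpha> \<le> a" for a b
  proof -
    consider "b \<le> \<beta>" | "\<beta> \<le> a" | "a \<le> \<beta>" "\<beta> \<le> b" by linarith
    then show ?thesis
    proof cases
      case 3
      then show ?thesis using join[of a \<beta> b] u2[of a \<beta>] v3[of \<beta> b] that by simp
    qed (use u2[of a b] v3[of a b] that in auto)
  qed
  consider "b \<le> \<alpha>" | "\<alpha> \<le> a" | "a \<le> \<alpha>" "\<alpha> \<le> b" by linarith
  then have "U a b"
  proof cases
    case 3
    then show ?thesis using join[of a \<alpha> b] u1[of a \<alpha>] v2[of \<alpha> b] d by simp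
  qed (use u1[of a b] v2[of a b] d in auto)
  then show ?thesis by (simp add: U_def)
qed

lemma trunc_kernel_diff_nonneg:
  assumes ab: "0 < \<alpha>" "\<alpha> < \<beta>" and d: "0 < a" "a \<le> b"
  shows "trunc_kernel \<alpha> \<beta> a - trunc_kernel \<alpha> \<beta> b \<ge> 0"
proof -
  let ?K = "trunc_kernel \<alpha> \<beta>"
  have ge: "p \<ge> q" if "p - q = y * z" "0 \<le> y" "0 \<le> z" for p q y z :: real
    using that by (metis diff_ge_0_iff_ge mult_nonneg_nonneg)
  have u1: "?K a \<ge> ?K b" if "0 < a" "a \<le> b" "b \<le> \<alpha>" for a b
    by (rule ge[OF trunc_kernel_diff_pieces(1)[OF ab that]]) (use that ab in auto)
  have u2: "?K a \<ge> ?K b" if "0 < a" "a \<le> b" "\<alpha> \<le> a" "b \<le> \<beta>" for a b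
    by (rule ge[OF trunc_kernel_diff_pieces(2)[OF ab that]]) (use that ab in auto)
  have u3: "?K a \<ge> ?K b" if "0 < a" "a \<le> b" "\<beta> \<le> a" "b \<le> 2 * \<beta>" for a b
    by (rule ge[OF trunc_kernel_diff_pieces(3)[OF ab that]]) (use that ab in auto)
  have u4: "?K a \<ge> ?K b" if "0 < a" "a \<le> b" "2 * \<beta> \<le> a" for a b
    using trunc_kernel_diff_pieces(4)[OF ab, of a b] that ab by simp
  have v3: "?K a \<ge> ?K b" if "0 < a" "a \<le> b" "\<beta> \<le> a" for a b
    using u3[of a b] u4[of a b] u3[of a "2 * \<beta>"] u4[of "2 * \<beta>" b] that ab
    by (cases "b \<le> 2 * \<beta>"; cases "2 * \<beta> \<le> a") auto
  have v2: "?K a \<ge> ?K b" if "0 < a" "a \<le> b" "\<alpha> \<le> a" for a b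
    using u2[of a b] v3[of a b] u2[of a \<beta>] v3[of \<beta> b] that ab
    by (cases "b \<le> \<beta>"; cases "\<beta> \<le> a") auto
  have "?K a \<ge> ?K b"
    using u1[of a b] v2[of a b] u1[of a \<alpha>] v2[of \<alpha> b] d ab
    by (cases "b \<le> \<alpha>"; cases "\<alpha> \<le> a") auto
  then show ?thesis by simp
qed

text \<open>Beyond \<beta> the kernel becomes too flat, so both points stay below it; up to there
  the slopes 1/\<alpha>^2 and 1/(a b) are at least 1/c^2. In the application \<open>c\<close> is t
  plus the distance to a left endpoint, and 1/c^2 is \<open>pk\<close>.\<close>

lemma trunc_kernel_diff_lower:
  assumes ab: "0 < \<alpha>" "\<alpha> < \<beta>" and d: "0 < a" "a \<le> b" "b \<le> \<beta>" "\<alpha> \<le> c" "b \<le> c"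
  shows "trunc_kernel \<alpha> \<beta> a - trunc_kernel \<alpha> \<beta> b \<ge> (b - a) * (1 / c\<^sup>2)"
proof -
  let ?K = "trunc_kernel \<alpha> \<beta>"
  have u1: "?K a - ?K b \<ge> (b - a) * (1 / c\<^sup>2)" if "0 < a" "a \<le> b" "b \<le> \<alpha>" for a b
  proof -
    have "1 / c\<^sup>2 \<le> 1 / \<alpha>\<^sup>2" using that ab d by (intro frac_le power_mono) auto
    then have "(b - a) * (1 / c\<^sup>2) \<le> (b - a) * (1 / \<alpha>\<^sup>2)" using that by (intro mult_left_mono) auto
    then show ?thesis using trunc_kernel_diff_pieces(1)[OF ab that(1,2)] that by simp
  qed
  have u2: "?K a - ?K b \<ge> (b - a) * (1 / c\<^sup>2)" if "\<alpha> \<le> a" "a \<le> b" "b \<le> \<beta>" "b \<le> c" for a b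
  proof -
    have "a * b \<le> c * c" using that ab d by (intro mult_mono) auto
    then have "1 / c\<^sup>2 \<le> 1 / (a * b)" using that ab d unfolding power2_eq_square by (intro frac_le mult_pos_pos) auto
    then have "(b - a) * (1 / c\<^sup>2) \<le> (b - a) * (1 / (a * b))" using that by (intro mult_left_mono) auto
    then show ?thesis using trunc_kernel_diff_pieces(2)[OF ab, of a b] that ab by simp
  qed
  consider "b \<le> \<alpha>" | "\<alpha> \<le> a" | "a \<le> \<alpha>" "\<alpha> \<le> b" by linarith
  then show ?thesis
  proof cases
    case 3
    have "(\<alpha> - a) * (1 / c\<^sup>2) + (b - \<alpha>) * (1 / c\<^sup>2) = (b - a) * (1 / c\<^sup>2)"
      unfolding left_diff_distrib by simp
    then show ?thesis using u1[of a \<alpha>] u2[of \<alpha> b] 3 d by linarith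
  qed (use u1[of a b] u2[of a b] d in auto)
qed

locale truncation =
  fixes \<alpha> \<beta> :: real and \<sigma> :: "real measure"
  assumes ab: "0 < \<alpha>" "\<alpha> < \<beta>" and \<sigma>: "locally_finite_borel \<sigma>"
begin

abbreviation "K \<equiv> trunc_kernel \<alpha> \<beta>"
abbreviation "HS S \<equiv> hilbert \<alpha> \<beta> \<sigma> (indicator S)"

lemma kernel_integrable:
  assumes "bounded S" "S \<in> sets borel" shows "integrable \<sigma> (\<lambda>y. indicator S y * K (y - x))"
proof (rule lfb_bounded_integrable[OF \<sigma> assms, where B = "2 / \<alpha>"])
  show "\<bar>indicator S y * K (y - x)\<bar> \<le> 2 / \<alpha>" for y
    using trunc_kernel_bound[OF ab, of "y - x"] ab by (simp add: indicator_def)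
  show "(\<lambda>y. indicator S y * K (y - x)) \<in> borel_measurable borel" using assms(2) by measurable
qed auto

lemma HS_Un:
  assumes "bounded S" "S \<in> sets borel" "bounded S'" "S' \<in> sets borel" "S \<inter> S' = {}"
  shows "HS (S \<union> S') x = HS S x + HS S' x"
proof -
  have "indicator (S \<union> S') y * K (y - x) = indicator S y * K (y - x) + indicator S' y * K (y - x)" for y
    using assms(5) by (auto simp: indicator_def)
  then show ?thesis unfolding hilbert_def
    using kernel_integrable[OF assms(1,2)] kernel_integrable[OF assms(3,4)] by simp
qed

lemma HS_bound:
  assumes "bounded S" "S \<in> sets borel" shows "\<bar>HS S x\<bar> \<le> 2 / \<alpha> * measure \<sigma> S"
proof -
  have "\<bar>HS S x\<bar> \<le> (LINT y|\<sigma>. \<bar>indicator S y * K (y - x)\<bar>)"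
    unfolding hilbert_def using integral_abs_bound by blast
  also have "\<dots> \<le> (LINT y|\<sigma>. 2 / \<alpha> * indicator S y)"
  proof (rule integral_mono)
    show "integrable \<sigma> (\<lambda>y. \<bar>indicator S y * K (y - x)\<bar>)" using kernel_integrable[OF assms] by simp
    show "integrable \<sigma> (\<lambda>y. 2 / \<alpha> * indicator S y)"
      by (intro integrable_mult_right lfb_indicator_integrable[OF \<sigma> assms])
    show "\<bar>indicator S y * K (y - x)\<bar> \<le> 2 / \<alpha> * indicator S y" for y
      using trunc_kernel_bound[OF ab, of "y - x"] by (simp add: indicator_def)
  qed
  also have "\<dots> = 2 / \<alpha> * measure \<sigma> S" using lfb_integral_indicator[OF \<sigma> assms(2)] by simp
  finally show ?thesis .
qed

lemma HS_measurable [measurable]: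
  assumes [measurable]: "S \<in> sets borel" shows "HS S \<in> borel_measurable borel"
proof -
  interpret sigma_finite_measure \<sigma> by (rule lfb_sigma_finite[OF \<sigma>])
  have "(\<lambda>(x, y). indicator S y * K (y - x)) \<in> borel_measurable (borel \<Otimes>\<^sub>M borel)" by measurable
  then have "(\<lambda>(x, y). indicator S y * K (y - x)) \<in> borel_measurable (borel \<Otimes>\<^sub>M \<sigma>)"
    unfolding measurable_cong_sets[OF sets_pair_measure_cong[OF refl lfb_sets[OF \<sigma>]] refl] .
  then have "(\<lambda>x. LINT y|\<sigma>. indicator S y * K (y - x)) \<in> borel_measurable borel"
    by (rule borel_measurable_lebesgue_integral)
  then show ?thesis unfolding hilbert_def[abs_def] .
qed

text \<open>Monotonicity principle: away from its support, the Hilbert transform of a positive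
  measure varies at most, and for mild truncations at least, like a Poisson integral times
  the identity function.\<close>

lemma HS_diff_upper:
  assumes S: "bounded S" "S \<in> sets borel" and \<delta>: "\<delta> > 0" and x: "x \<le> x'"
    and side: "\<And>y. y \<in> S \<Longrightarrow> x' + \<delta> \<le> y \<or> y + \<delta> \<le> x"
  shows "0 \<le> HS S x' - HS S x" "HS S x' - HS S x \<le> (x' - x) * (4 / \<delta>\<^sup>2 * measure \<sigma> S)"
proof -
  have eq: "HS S x' - HS S x = (LINT y|\<sigma>. indicator S y * (K (y - x') - K (y - x)))"
    unfolding hilbert_def using kernel_integrable[OF S, of x'] kernel_integrable[OF S, of x]
    by (simp add: right_diff_distrib)
  have pt: "0 \<le> K (y - x') - K (y - x) \<and> K (y - x') - K (y - x) \<le> (x' - x) * (4 / \<delta>\<^sup>2)" if "y \<in> S" for y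
    using side[OF that]
  proof
    assume y: "x' + \<delta> \<le> y"
    then show ?thesis using trunc_kernel_diff_upper[OF ab \<delta>, of "y - x'" "y - x"]
        trunc_kernel_diff_nonneg[OF ab, of "y - x'" "y - x"] x \<delta> by simp
  next
    assume y: "y + \<delta> \<le> x"
    have "K (y - x') = - K (x' - y)" "K (y - x) = - K (x - y)"
      using trunc_kernel_odd[of \<alpha> \<beta> "x' - y"] trunc_kernel_odd[of \<alpha> \<beta> "x - y"] by simp_all
    then show ?thesis using trunc_kernel_diff_upper[OF ab \<delta>, of "x - y" "x' - y"]
        trunc_kernel_diff_nonneg[OF ab, of "x - y" "x' - y"] x \<delta> y by simp
  qed
  show "0 \<le> HS S x' - HS S x" unfolding eq
    by (rule integral_nonneg_AE) (use pt in \<open>auto simp: indicator_def\<close>)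
  have "HS S x' - HS S x \<le> (LINT y|\<sigma>. (x' - x) * (4 / \<delta>\<^sup>2) * indicator S y)" unfolding eq
  proof (rule integral_mono)
    show "integrable \<sigma> (\<lambda>y. indicator S y * (K (y - x') - K (y - x)))"
      using kernel_integrable[OF S, of x'] kernel_integrable[OF S, of x] by (simp add: right_diff_distrib)
    show "integrable \<sigma> (\<lambda>y. (x' - x) * (4 / \<delta>\<^sup>2) * indicator S y)"
      by (intro integrable_mult_right lfb_indicator_integrable[OF \<sigma> S])
    show "indicator S y * (K (y - x') - K (y - x)) \<le> (x' - x) * (4 / \<delta>\<^sup>2) * indicator S y" for y
      using pt[of y] by (simp add: indicator_def)
  qed
  also have "\<dots> = (x' - x) * (4 / \<delta>\<^sup>2 * measure \<sigma> S)" using lfb_integral_indicator[OF \<sigma> S(2)] by simp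
  finally show "HS S x' - HS S x \<le> (x' - x) * (4 / \<delta>\<^sup>2 * measure \<sigma> S)" .
qed

lemma pk_measurable [measurable]: "(\<lambda>y. pk t (y - c)) \<in> borel_measurable borel"
  unfolding pk_def by measurable

lemma pk_le: "t > 0 \<Longrightarrow> pk t z \<le> 1 / t\<^sup>2"
  unfolding pk_def by (intro divide_left_mono power_mono mult_pos_pos) (auto simp: add_pos_nonneg)

lemma pk_integrable:
  assumes S: "bounded S" "S \<in> sets borel" and t: "t > 0" shows "integrable \<sigma> (\<lambda>y. indicator S y * pk t (y - c))"
proof (rule lfb_bounded_integrable[OF \<sigma> S, where B = "1 / t\<^sup>2"])
  show "\<bar>indicator S y * pk t (y - c)\<bar> \<le> 1 / t\<^sup>2" for y
    using pk_le[OF t, of "y - c"] by (simp add: indicator_def)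
  show "(\<lambda>y. indicator S y * pk t (y - c)) \<in> borel_measurable borel" using S(2) by measurable
qed auto

lemma HS_diff_lower:
  assumes S: "bounded S" "S \<in> sets borel" and x: "c \<le> x" "x \<le> x'" "x' < c + t" and t: "\<alpha> \<le> t"
    and side: "\<And>y. y \<in> S \<Longrightarrow> (c + t \<le> y \<or> y < c) \<and> \<bar>y - x\<bar> \<le> \<beta> \<and> \<bar>y - x'\<bar> \<le> \<beta>"
  shows "HS S x' - HS S x \<ge> (x' - x) * (LINT y|\<sigma>. indicator S y * pk t (y - c))"
proof -
  have eq: "HS S x' - HS S x = (LINT y|\<sigma>. indicator S y * (K (y - x') - K (y - x)))"
    unfolding hilbert_def using kernel_integrable[OF S, of x'] kernel_integrable[OF S, of x]
    by (simp add: right_diff_distrib)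
  have pt: "(x' - x) * pk t (y - c) \<le> K (y - x') - K (y - x)" if "y \<in> S" for y
  proof (cases "c + t \<le> y")
    case True
    then show ?thesis using trunc_kernel_diff_lower[OF ab, of "y - x'" "y - x" "t + \<bar>y - c\<bar>"] x t side[OF that]
      by (simp add: pk_def)
  next
    case False
    then have y: "y < c" using side[OF that] by blast
    have "K (y - x') = - K (x' - y)" "K (y - x) = - K (x - y)"
      using trunc_kernel_odd[of \<alpha> \<beta> "x' - y"] trunc_kernel_odd[of \<alpha> \<beta> "x - y"] by simp_all
    then show ?thesis using trunc_kernel_diff_lower[OF ab, of "x - y" "x' - y" "t + \<bar>y - c\<bar>"] x t side[OF that] y
      by (simp add: pk_def)
  qed
  have t0: "t > 0" using t ab by linarith
  have "(x' - x) * (LINT y|\<sigma>. indicator S y * pk t (y - c)) = (LINT y|\<sigma>. (x' - x) * (indicator S y * pk t (y - c)))"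
    by simp
  also have "\<dots> \<le> (LINT y|\<sigma>. indicator S y * (K (y - x') - K (y - x)))"
  proof (rule integral_mono)
    show "integrable \<sigma> (\<lambda>y. indicator S y * (K (y - x') - K (y - x)))"
      using kernel_integrable[OF S, of x'] kernel_integrable[OF S, of x] by (simp add: right_diff_distrib)
    show "integrable \<sigma> (\<lambda>y. (x' - x) * (indicator S y * pk t (y - c)))"
      by (intro integrable_mult_right pk_integrable[OF S t0])
    show "(x' - x) * (indicator S y * pk t (y - c)) \<le> indicator S y * (K (y - x') - K (y - x))" for y
      using pt[of y] by (simp add: indicator_def)
  qed
  finally show ?thesis unfolding eq .
qed

end

context haar_interval
begin

text \<open>On the left child the function is below its value at the midpoint, on the right child
  above it. Applied to a difference of two functions, this turns a comparison of increments into one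
  of Haar coefficients.\<close>

lemma mono_coeff:
  assumes int: "set_integrable \<sigma> I f" and mono: "\<And>x x'. x \<in> I \<Longrightarrow> x' \<in> I \<Longrightarrow> x \<le> x' \<Longrightarrow> f x \<le> f x'"
  shows "l2_inner \<sigma> f (haar \<sigma> I) \<ge> 0"
proof (cases "haar_scale \<sigma> I = 0")
  case True
  then show ?thesis using haar_coeff[OF int] by simp
next
  case False
  then have p: "measure \<sigma> (left_child I) > 0" "measure \<sigma> (right_child I) > 0" using haar_scale_pos_imp by auto
  define m where "m = (u + v) / 2"
  have mI: "m \<in> I" using uv by (auto simp: m_def I)
  have i: "set_integrable \<sigma> (left_child I) f" "set_integrable \<sigma> (right_child I) f"
    using set_integrable_subset[OF int] ch_sub ch_borel lfb_sets[OF \<sigma>] by simp_all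
  have c: "set_integrable \<sigma> S (\<lambda>_. f m)" if "S \<in> sets borel" "bounded S" for S
    using lfb_indicator_integrable[OF \<sigma> that(2,1)] unfolding set_integrable_def by simp
  have cm: "(LINT x:S|\<sigma>. f m) = measure \<sigma> S * f m" if "S \<in> sets borel" for S
    using lfb_integral_indicator[OF \<sigma> that] unfolding set_lebesgue_integral_def by simp
  have "(LINT x:left_child I|\<sigma>. f x) \<le> (LINT x:left_child I|\<sigma>. f m)"
  proof (rule set_integral_mono[OF i(1) c])
    show "f x \<le> f m" if "x \<in> left_child I" for x
      by (rule mono) (use that ch_sub mI in \<open>auto simp: ch m_def\<close>)
  qed auto
  then have 1: "average \<sigma> (left_child I) f \<le> f m" using p cm[OF ch_borel(1)] by (simp add: average_def divide_le_eq mult.commute)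
  have "(LINT x:right_child I|\<sigma>. f m) \<le> (LINT x:right_child I|\<sigma>. f x)"
  proof (rule set_integral_mono[OF c i(2)])
    show "f m \<le> f x" if "x \<in> right_child I" for x
      by (rule mono) (use that ch_sub mI in \<open>auto simp: ch m_def\<close>)
  qed auto
  then have 2: "f m \<le> average \<sigma> (right_child I) f" using p cm[OF ch_borel(2)] by (simp add: average_def le_divide_eq mult.commute)
  show ?thesis using haar_coeff[OF int] haar_scale_nonneg 1 2 by simp
qed

end

subsection \<open>Testing, Muckenhoupt and energy conditions\<close>

lemma lfb_set_integrable:
  fixes f :: "real \<Rightarrow> real"
  assumes "locally_finite_borel \<sigma>" "bounded S" "S \<in> sets borel" "f \<in> borel_measurable borel" "\<And>x. x \<in> S \<Longrightarrow> \<bar>f x\<bar> \<le> B"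
  shows "set_integrable \<sigma> S f"
  unfolding set_integrable_def
proof (rule lfb_bounded_integrable[OF assms(1-3), where B = B])
  show "(\<lambda>x. indicator S x *\<^sub>R f x) \<in> borel_measurable borel" using assms(3,4) by measurable
  show "\<bar>indicator S x *\<^sub>R f x\<bar> \<le> B" if "x \<in> S" for x using assms(5)[OF that] that by simp
qed simp

lemma (in truncation) HS_sq_bound:
  assumes "bounded S" "S \<in> sets borel" shows "\<bar>(HS S x)\<^sup>2\<bar> \<le> (2 / \<alpha> * measure \<sigma> S)\<^sup>2"
  using power_mono[OF HS_bound[OF assms, of x] abs_ge_zero, of 2] by (simp only: power2_abs abs_power2)

lemma set_integral_disjoint_le:
  fixes f :: "real \<Rightarrow> real"
  assumes "finite V" "\<And>v. v \<in> V \<Longrightarrow> A v \<in> sets M" "\<And>v. v \<in> V \<Longrightarrow> A v \<subseteq> R"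
    and disj: "\<And>v v'. v \<in> V \<Longrightarrow> v' \<in> V \<Longrightarrow> v \<noteq> v' \<Longrightarrow> A v \<inter> A v' = {}"
    and f: "set_integrable M R f" "\<And>x. f x \<ge> 0"
  shows "(\<Sum>v\<in>V. (LINT x:A v|M. f x)) \<le> (LINT x:R|M. f x)"
proof -
  have i: "set_integrable M (A v) f" if "v \<in> V" for v
    by (rule set_integrable_subset[OF f(1)]) (use assms(2,3) that in auto)
  have pt: "(\<Sum>v\<in>V. indicator (A v) x *\<^sub>R f x) \<le> indicator R x *\<^sub>R f x" for x
  proof (cases "\<exists>v\<in>V. x \<in> A v")
    case True
    then obtain v where v: "v \<in> V" "x \<in> A v" by blast
    have "(\<Sum>v'\<in>V. indicator (A v') x *\<^sub>R f x) = (\<Sum>v'\<in>V. if v' = v then f x else 0)"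
    proof (intro sum.cong refl)
      fix v' assume v': "v' \<in> V"
      show "indicator (A v') x *\<^sub>R f x = (if v' = v then f x else 0)"
        using disj[OF v' v(1)] v(2) by (auto simp: indicator_def)
    qed
    also have "\<dots> = f x" using v assms(1) by simp
    finally show ?thesis using v assms(3)[of v] by (auto simp: indicator_def)
  next
    case False
    then have "(\<Sum>v'\<in>V. indicator (A v') x *\<^sub>R f x) = 0" by (intro sum.neutral) auto
    then show ?thesis using f(2) by simp
  qed
  have "(\<Sum>v\<in>V. (LINT x:A v|M. f x)) = (LINT x|M. (\<Sum>v\<in>V. indicator (A v) x *\<^sub>R f x))"
    unfolding set_lebesgue_integral_def
    by (rule Bochner_Integration.integral_sum[symmetric]) (use i in \<open>simp add: set_integrable_def\<close>)
  also have "\<dots> \<le> (LINT x|M. indicator R x *\<^sub>R f x)"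
    by (rule integral_mono) (use i f(1) pt in \<open>auto simp: set_integrable_def intro!: Bochner_Integration.integrable_sum\<close>)
  finally show ?thesis by (simp add: set_lebesgue_integral_def)
qed

lemma lfb_measure_disjoint_le:
  assumes \<sigma>: "locally_finite_borel \<sigma>" and V: "finite V" "\<And>v. v \<in> V \<Longrightarrow> A v \<in> sets borel" "\<And>v. v \<in> V \<Longrightarrow> A v \<subseteq> R"
    and disj: "\<And>v v'. v \<in> V \<Longrightarrow> v' \<in> V \<Longrightarrow> v \<noteq> v' \<Longrightarrow> A v \<inter> A v' = {}"
    and R: "bounded R" "R \<in> sets borel"
  shows "(\<Sum>v\<in>V. measure \<sigma> (A v)) \<le> measure \<sigma> R"
proof -
  have c: "(LINT x:S|\<sigma>. 1) = measure \<sigma> S" if "S \<in> sets borel" for S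
    using lfb_integral_indicator[OF \<sigma> that] unfolding set_lebesgue_integral_def by simp
  have "(\<Sum>v\<in>V. (LINT x:A v|\<sigma>. 1 :: real)) \<le> (LINT x:R|\<sigma>. 1)"
    by (rule set_integral_disjoint_le[OF V(1) _ V(3) disj])
      (use V(2) lfb_sets[OF \<sigma>] lfb_set_integrable[OF \<sigma> R, of "\<lambda>_. 1" 1] in auto)
  then show ?thesis using c V(2) R by simp
qed

lemma pk_le_4:
  assumes "t > 0" "t + \<bar>z'\<bar> \<le> 2 * (t + \<bar>z\<bar>)" shows "pk t z \<le> 4 * pk t z'"
proof -
  have "(t + \<bar>z'\<bar>)\<^sup>2 \<le> (2 * (t + \<bar>z\<bar>))\<^sup>2" using assms by (intro power_mono) auto
  then have "4 / (2 * (t + \<bar>z\<bar>))\<^sup>2 \<le> 4 / (t + \<bar>z'\<bar>)\<^sup>2" using assms(1) by (intro divide_left_mono mult_pos_pos) auto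
  then show ?thesis unfolding pk_def power_mult_distrib by simp
qed

lemma pk_pos: "t > 0 \<Longrightarrow> pk t z > 0"
  unfolding pk_def by (intro divide_pos_pos zero_less_power) auto

lemma real_interval_ivl: "p < q \<Longrightarrow> real_interval {p..<q}"
  unfolding real_interval_def by (auto simp: is_interval_def)

text \<open>The infimum is itself an admissible constant: below every \<open>T + \<delta>\<close>
  there is an admissible one, and \<delta> tends to 0. Finiteness of the measure of \<open>R\<close>
  keeps the products real.\<close>

lemma testing_const_admissible:
  assumes fin: "testing_const \<sigma> w < \<infinity>" and ab: "0 < \<alpha>" "\<alpha> < \<beta>" and R: "real_interval R"
    and c: "emeasure \<sigma> R = ennreal c" "c \<ge> 0"
  shows "(\<integral>\<^sup>+x\<in>R. ennreal ((hilbert \<alpha> \<beta> \<sigma> (indicator R) x)\<^sup>2) \<partial>w) \<le> ennreal ((enn2real (testing_const \<sigma> w))\<^sup>2 * c)"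
proof -
  define T where "T = enn2real (testing_const \<sigma> w)"
  have T: "testing_const \<sigma> w = ennreal T" "T \<ge> 0" using fin by (simp_all add: T_def)
  let ?X = "\<integral>\<^sup>+x\<in>R. ennreal ((hilbert \<alpha> \<beta> \<sigma> (indicator R) x)\<^sup>2) \<partial>w"
  have le: "?X \<le> ennreal ((T + \<delta>)\<^sup>2 * c)" if "\<delta> > 0" for \<delta>
  proof -
    have "testing_const \<sigma> w < ennreal (T + \<delta>)" unfolding T(1) using T(2) that by (simp add: ennreal_lessI)
    then obtain S where S: "S < ennreal (T + \<delta>)" "\<forall>\<alpha> \<beta> I. 0 < \<alpha> \<and> \<alpha> < \<beta> \<and> real_interval I \<longrightarrow>
     (\<integral>\<^sup>+x\<in>I. ennreal ((hilbert \<alpha> \<beta> \<sigma> (indicator I) x)\<^sup>2) \<partial>w) \<le> S\<^sup>2 * emeasure \<sigma> I \<and>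
     (\<integral>\<^sup>+x\<in>I. ennreal ((hilbert \<alpha> \<beta> w (indicator I) x)\<^sup>2) \<partial>\<sigma>) \<le> S\<^sup>2 * emeasure w I"
      unfolding testing_const_def Inf_less_iff by auto
    have "?X \<le> S\<^sup>2 * emeasure \<sigma> R" using S(2) ab R by simp
    also have "\<dots> \<le> (ennreal (T + \<delta>))\<^sup>2 * emeasure \<sigma> R"
      using S(1) by (intro mult_right_mono power_mono) auto
    also have "\<dots> = ennreal ((T + \<delta>)\<^sup>2 * c)"
      using c T(2) that by (simp add: ennreal_power ennreal_mult del: ennreal_plus)
    finally show ?thesis .
  qed
  have lim: "((\<lambda>\<delta>. ennreal ((T + \<delta>)\<^sup>2 * c)) \<longlongrightarrow> ennreal ((T + 0)\<^sup>2 * c)) (at_right 0)"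
    by (intro tendsto_intros)
  have "?X \<le> ennreal ((T + 0)\<^sup>2 * c)"
    by (rule tendsto_lowerbound[OF lim]) (auto simp: eventually_at_right_less intro!: eventually_at_rightI[of 0 1] le)
  then show ?thesis by (simp add: T_def)
qed

lemma A2_const_upper: "real_interval I \<Longrightarrow> poisson \<sigma> I * poisson w I \<le> A2_const \<sigma> w"
  unfolding A2_const_def by (rule Inf_greatest) auto

lemma A2_const_commute: "A2_const \<sigma> w = A2_const w \<sigma>"
  unfolding A2_const_def by (simp add: mult.commute)

lemma testing_const_commute: "testing_const \<sigma> w = testing_const w \<sigma>"
  unfolding testing_const_def by (rule arg_cong[where f = Inf], rule Collect_cong, intro iff_allI imp_cong refl conj_commute)

lemma (in dyadic_tree) wd_nonzero [simp]: "wd p \<noteq> 0"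
  using wd_pos[of p] by (metis less_irrefl)

locale weight_pair = dyadic_tree +
  fixes \<sigma> w :: "real measure"
  assumes \<sigma>: "locally_finite_borel \<sigma>" and w: "locally_finite_borel w"
    and A2_fin: "A2_const \<sigma> w < \<infinity>" and T_fin: "testing_const \<sigma> w < \<infinity>"
begin

definition "s p = measure \<sigma> (iv p)"
definition "A2 = enn2real (A2_const \<sigma> w)"
definition "Tst = enn2real (testing_const \<sigma> w)"
abbreviation "H \<equiv> H_const \<sigma> w"
text \<open>Haar coefficients of x. Their squares, summed over the intervals below \<open>v\<close>,
  take the place of the energy times |v|^2 w(v); compare \<open>energy_sq\<close>.\<close>

definition "xh q = l2_inner w (\<lambda>x. x) (haar w (iv q))"

lemma s_nonneg [simp]: "s p \<ge> 0" by (simp add: s_def)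

lemma A2_nonneg [simp]: "A2 \<ge> 0" and Tst_nonneg [simp]: "Tst \<ge> 0" by (simp_all add: A2_def Tst_def)

lemma H_eq: "H = sqrt A2 + Tst" by (simp add: H_const_def A2_def Tst_def)

lemma H_nonneg [simp]: "H \<ge> 0" by (simp add: H_eq)

lemma A2_Tst_le_H: "A2 \<le> H\<^sup>2" "Tst \<le> H" "Tst\<^sup>2 \<le> H\<^sup>2"
proof -
  have "(sqrt A2)\<^sup>2 \<le> H\<^sup>2" unfolding H_eq by (intro power_mono) auto
  then show "A2 \<le> H\<^sup>2" by simp
  show "Tst \<le> H" by (simp add: H_eq)
  then show "Tst\<^sup>2 \<le> H\<^sup>2" by (intro power_mono) auto
qed

lemma measure_split_iv:
  assumes "locally_finite_borel \<mu>" shows "measure \<mu> (iv p) = measure \<mu> (iv (False # p)) + measure \<mu> (iv (True # p))"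
  using haar_interval.measure_split[OF haar_iv[OF assms, of p]] by (simp add: left_child_iv right_child_iv)

lemma s_split: "s p = s (False # p) + s (True # p)"
  unfolding s_def by (rule measure_split_iv[OF \<sigma>])

lemma testing_real:
  assumes ab: "0 < \<alpha>" "\<alpha> < \<beta>" and R: "R = {p..<q}" "p < q"
  shows "(LINT x:R|w. (hilbert \<alpha> \<beta> \<sigma> (indicator R) x)\<^sup>2) \<le> Tst\<^sup>2 * measure \<sigma> R"
proof -
  interpret truncation \<alpha> \<beta> \<sigma> by unfold_locales (use ab \<sigma> in auto)
  have R': "bounded R" "R \<in> sets borel" unfolding R by auto
  define B where "B = 2 / \<alpha> * measure \<sigma> R"
  have B: "\<bar>(HS R x)\<^sup>2\<bar> \<le> B\<^sup>2" for x
    unfolding B_def by (rule HS_sq_bound[OF R'])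
  have int: "integrable w (\<lambda>x. indicator R x *\<^sub>R (HS R x)\<^sup>2)"
    using lfb_set_integrable[OF w R', of "\<lambda>x. (HS R x)\<^sup>2" "B\<^sup>2"] B HS_measurable[OF R'(2)]
    unfolding set_integrable_def by simp
  have "ennreal (LINT x:R|w. (HS R x)\<^sup>2) = (\<integral>\<^sup>+x. ennreal (indicator R x *\<^sub>R (HS R x)\<^sup>2) \<partial>w)"
    unfolding set_lebesgue_integral_def by (rule nn_integral_eq_integral[OF int, symmetric]) auto
  also have "\<dots> = (\<integral>\<^sup>+x\<in>R. ennreal ((HS R x)\<^sup>2) \<partial>w)"
    by (rule nn_integral_cong) (auto simp: indicator_def)
  also have "\<dots> \<le> ennreal (Tst\<^sup>2 * measure \<sigma> R)"
    unfolding Tst_def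
    by (rule testing_const_admissible[OF T_fin ab])
      (use real_interval_ivl[OF R(2)] R lfb_emeasure[OF \<sigma> R'] in auto)
  finally show ?thesis by simp
qed

lemma A2_real:
  assumes "real_interval I" "ennreal x \<le> poisson \<sigma> I" "ennreal y \<le> poisson w I" "x \<ge> 0" "y \<ge> 0"
  shows "x * y \<le> A2"
proof -
  have "ennreal (x * y) = ennreal x * ennreal y" using assms by (simp add: ennreal_mult)
  also have "\<dots> \<le> poisson \<sigma> I * poisson w I" using assms by (intro mult_mono) auto
  also have "\<dots> \<le> A2_const \<sigma> w" by (rule A2_const_upper[OF assms(1)])
  also have "\<dots> = ennreal A2" using A2_fin by (simp add: A2_def)
  finally show ?thesis by simp
qed

text \<open>Intervals of the generation of \<open>U\<close> resolve the Poisson kernel of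
  \<open>U\<close>: a point of \<open>v\<close> is within |lo U - lo v| + wd U of \<open>U\<close>,
  which costs the factor 4.\<close>

lemma poisson_ge_level:
  assumes \<mu>: "locally_finite_borel \<mu>" and U: "U \<in> atoms n"
  shows "ennreal (wd U / 4 * (\<Sum>v\<in>atoms n. measure \<mu> (iv v) * pk (wd U) (lo U - lo v))) \<le> poisson \<mu> (iv U)"
proof -
  let ?c = "\<lambda>v. wd U / 4 * pk (wd U) (lo U - lo v)"
  have disj: "iv v \<inter> iv v' = {}" if "v \<in> atoms n" "v' \<in> atoms n" "v \<noteq> v'" for v v'
    by (rule iv_disjoint) (use that in \<open>auto simp: atoms_def suffix_def\<close>)
  have em: "emeasure \<mu> (iv v) = ennreal (measure \<mu> (iv v))" for v by (rule lfb_emeasure[OF \<mu>]) auto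
  have "ennreal (wd U / 4 * (\<Sum>v\<in>atoms n. measure \<mu> (iv v) * pk (wd U) (lo U - lo v)))
      = (\<Sum>v\<in>atoms n. ennreal (?c v) * emeasure \<mu> (iv v))"
    by (simp add: em sum_distrib_left ennreal_mult[symmetric] sum_ennreal[symmetric] mult_ac del: sum_ennreal)
  also have "\<dots> = (\<integral>\<^sup>+x. (\<Sum>v\<in>atoms n. ennreal (?c v) * indicator (iv v) x) \<partial>\<mu>)"
    by (subst nn_integral_sum) (use lfb_sets[OF \<mu>] in \<open>auto simp: nn_integral_cmult_indicator\<close>)
  also have "\<dots> \<le> poisson \<mu> (iv U)" unfolding poisson_def
  proof (rule nn_integral_mono)
    fix x
    show "(\<Sum>v\<in>atoms n. ennreal (?c v) * indicator (iv v) x) \<le> ennreal (len (iv U) / ((len (iv U))\<^sup>2 + (infdist x (iv U))\<^sup>2))"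
    proof (cases "\<exists>v\<in>atoms n. x \<in> iv v")
      case False
      then have "(\<Sum>v\<in>atoms n. ennreal (?c v) * indicator (iv v) x) = 0" by (intro sum.neutral) auto
      then show ?thesis by simp
    next
      case True
      then obtain v where v: "v \<in> atoms n" "x \<in> iv v" by blast
      have "(\<Sum>v'\<in>atoms n. ennreal (?c v') * indicator (iv v') x) = (\<Sum>v'\<in>atoms n. if v' = v then ennreal (?c v) else 0)"
      proof (intro sum.cong refl)
        fix v' assume v': "v' \<in> atoms n"
        show "ennreal (?c v') * indicator (iv v') x = (if v' = v then ennreal (?c v) else 0)"
          using disj[OF v' v(1)] v(2) by (auto simp: indicator_def)
      qed
      also have "\<dots> = ennreal (?c v)" using v by simp
      also have "\<dots> \<le> ennreal (wd U / ((wd U)\<^sup>2 + (infdist x (iv U))\<^sup>2))"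
      proof (rule ennreal_leI)
        define z where "z = \<bar>lo U - lo v\<bar>"
        have wv: "wd v = wd U" using v U by (intro wd_eq) (auto simp: atoms_def)
        have "infdist x (iv U) \<le> dist x (lo U)" by (rule infdist_le) simp
        also have "\<dots> \<le> z + wd U" using v(2) wv unfolding iv_def dist_real_def z_def by auto
        finally have d: "infdist x (iv U) \<le> z + wd U" .
        have "(wd U)\<^sup>2 + (infdist x (iv U))\<^sup>2 \<le> (wd U)\<^sup>2 + (z + wd U)\<^sup>2"
          using d infdist_nonneg by (intro add_left_mono power_mono) auto
        also have "\<dots> \<le> 4 * (wd U + z)\<^sup>2"
        proof -
          have "(wd U)\<^sup>2 \<le> (z + wd U)\<^sup>2" by (rule power_mono) (auto simp: z_def)
          then show ?thesis using zero_le_power2[of "z + wd U"] unfolding add.commute[of "wd U" z] by linarith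
        qed
        finally have le: "(wd U)\<^sup>2 + (infdist x (iv U))\<^sup>2 \<le> 4 * (wd U + z)\<^sup>2" .
        have "wd U / (4 * (wd U + z)\<^sup>2) \<le> wd U / ((wd U)\<^sup>2 + (infdist x (iv U))\<^sup>2)"
          by (rule divide_left_mono[OF le])
            (auto simp: z_def intro!: mult_pos_pos add_pos_nonneg zero_less_power)
        then show "?c v \<le> wd U / ((wd U)\<^sup>2 + (infdist x (iv U))\<^sup>2)" by (simp add: pk_def z_def)
      qed
      finally show ?thesis by simp
    qed
  qed
  finally show ?thesis .
qed

lemma poisson_ge_self:
  assumes \<mu>: "locally_finite_borel \<mu>" shows "ennreal (measure \<mu> (iv U) / wd U) \<le> poisson \<mu> (iv U)"
proof -
  have "ennreal (measure \<mu> (iv U) / wd U) = ennreal (1 / wd U) * emeasure \<mu> (iv U)"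
    using lfb_emeasure[OF \<mu>, of "iv U"] by (simp add: ennreal_mult[symmetric])
  also have "\<dots> = (\<integral>\<^sup>+x. ennreal (1 / wd U) * indicator (iv U) x \<partial>\<mu>)"
    using lfb_sets[OF \<mu>] by (simp add: nn_integral_cmult_indicator)
  also have "\<dots> \<le> poisson \<mu> (iv U)" unfolding poisson_def
  proof (rule nn_integral_mono)
    show "ennreal (1 / wd U) * indicator (iv U) x \<le> ennreal (len (iv U) / ((len (iv U))\<^sup>2 + (infdist x (iv U))\<^sup>2))" for x
      by (cases "x \<in> iv U") (auto simp: power2_eq_square)
  qed
  finally show ?thesis .
qed

lemma real_interval_iv: "real_interval (iv U)"
  unfolding iv_def by (rule real_interval_ivl) simp

lemma A2_self: "s U * measure w (iv U) \<le> A2 * (wd U)\<^sup>2"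
proof -
  have "(s U / wd U) * (measure w (iv U) / wd U) \<le> A2"
    unfolding s_def by (rule A2_real[OF real_interval_iv poisson_ge_self[OF \<sigma>] poisson_ge_self[OF w]]) auto
  then show ?thesis by (simp add: field_simps power2_eq_square)
qed

text \<open>In the product of Poisson integrals the one of \<sigma> is cut down to \<sigma>(U)/|U|,
  while the one of w keeps its tail over the whole generation.\<close>

lemma A2_level:
  assumes "U \<in> atoms n"
  shows "s U * (\<Sum>v\<in>atoms n. measure w (iv v) * pk (wd U) (lo U - lo v)) \<le> 4 * A2"
proof -
  have "(s U / wd U) * (wd U / 4 * (\<Sum>v\<in>atoms n. measure w (iv v) * pk (wd U) (lo U - lo v))) \<le> A2"
    unfolding s_def by (rule A2_real[OF real_interval_iv poisson_ge_self[OF \<sigma>] poisson_ge_level[OF w assms]])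
      (auto intro!: sum_nonneg mult_nonneg_nonneg)
  then show ?thesis using wd_pos[of U] by (simp add: mult.commute)
qed

lemma id_set_integrable: "set_integrable w (iv q) (\<lambda>x. c * x + d)"
proof (rule lfb_set_integrable[OF w, where B = "\<bar>c\<bar> * (\<bar>lo q\<bar> + wd q) + \<bar>d\<bar>"])
  fix x assume "x \<in> iv q"
  then have "\<bar>x\<bar> \<le> \<bar>lo q\<bar> + wd q" unfolding iv_def by auto
  then have "\<bar>c * x\<bar> \<le> \<bar>c\<bar> * (\<bar>lo q\<bar> + wd q)" unfolding abs_mult by (rule mult_left_mono) simp
  then show "\<bar>c * x + d\<bar> \<le> \<bar>c\<bar> * (\<bar>lo q\<bar> + wd q) + \<bar>d\<bar>" using abs_triangle_ineq[of "c * x" d] by linarith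
qed auto

lemma haar_linear:
  assumes "set_integrable w (iv q) f" "set_integrable w (iv q) g"
  shows "l2_inner w (\<lambda>x. f x + c * g x) (haar w (iv q)) = l2_inner w f (haar w (iv q)) + c * l2_inner w g (haar w (iv q))"
proof -
  have i: "integrable w (\<lambda>x. f x * haar w (iv q) x)" "integrable w (\<lambda>x. g x * haar w (iv q) x)"
    using haar_interval.haar_mult_integrable[OF haar_iv[OF w]] assms by auto
  then show ?thesis unfolding l2_inner_def by (simp add: distrib_right mult.assoc)
qed

lemma xh_nonneg: "xh q \<ge> 0"
  unfolding xh_def
  by (rule haar_interval.mono_coeff[OF haar_iv[OF w]]) (use id_set_integrable[of q 1 0] in auto)

lemma xh_shift: "l2_inner w (\<lambda>x. x - c) (haar w (iv q)) = xh q"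
proof -
  have "l2_inner w (\<lambda>x. x + (- c) * 1) (haar w (iv q)) = xh q + (- c) * l2_inner w (\<lambda>_. 1) (haar w (iv q))"
    unfolding xh_def by (rule haar_linear) (use id_set_integrable[of q 1 0] id_set_integrable[of q 0 1] in auto)
  moreover have "l2_inner w (\<lambda>_. 1) (haar w (iv q)) = 0"
    by (rule haar_interval.haar_coeff_const[OF haar_iv[OF w]]) simp
  ultimately show ?thesis by simp
qed

lemma sum_xh_sq_le:
  assumes Q: "finite Q" "\<And>q. q \<in> Q \<Longrightarrow> suffix v q"
  shows "(\<Sum>q\<in>Q. (xh q)\<^sup>2) \<le> (wd v)\<^sup>2 * measure w (iv v)"
proof -
  have b: "\<bar>(x - lo v)\<^sup>2\<bar> \<le> (wd v)\<^sup>2" if "x \<in> iv v" for x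
    using that unfolding iv_def by (auto intro!: power_mono)
  have i2: "set_integrable w (iv v) (\<lambda>x. (x - lo v)\<^sup>2)"
    by (rule lfb_set_integrable[OF w _ _ _ b]) auto
  have "(\<Sum>q\<in>Q. (xh q)\<^sup>2) = (\<Sum>q\<in>Q. (l2_inner w (\<lambda>x. x - lo v) (haar w (iv q)))\<^sup>2)" by (simp add: xh_shift)
  also have "\<dots> \<le> (LINT x:iv v|w. (x - lo v)\<^sup>2)"
    by (rule bessel_haar_local[OF w Q i2]) (use id_set_integrable[of v 1 "- lo v"] in auto)
  also have "\<dots> \<le> (LINT x:iv v|w. (wd v)\<^sup>2)"
  proof (rule set_integral_mono[OF i2])
    show "set_integrable w (iv v) (\<lambda>x. (wd v)\<^sup>2)" by (rule lfb_set_integrable[OF w, where B = "(wd v)\<^sup>2"]) auto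
    show "(x - lo v)\<^sup>2 \<le> (wd v)\<^sup>2" if "x \<in> iv v" for x using b[OF that] by simp
  qed
  also have "\<dots> = (wd v)\<^sup>2 * measure w (iv v)"
    using lfb_integral_indicator[OF w, of "iv v"] by (simp add: set_lebesgue_integral_def mult.commute)
  finally show ?thesis .
qed

text \<open>By \<open>HS_diff_lower\<close> the transform of \<open>S\<close> minus k times the
  identity is nondecreasing on \<open>v\<close>, where k is the integral of \<open>pk\<close>. So k
  times the Haar coefficients of x are at most those of the transform, and Bessel's inequality sums
  the squares.\<close>

lemma sum_xh_sq_le_HS:
  assumes ab: "0 < \<alpha>" "\<alpha> < \<beta>" and Q: "finite Q" "\<And>q. q \<in> Q \<Longrightarrow> suffix v q"
    and S: "bounded S" "S \<in> sets borel" "S \<inter> iv v = {}" and al: "\<alpha> \<le> wd v"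
    and be: "\<And>x y. x \<in> iv v \<Longrightarrow> y \<in> S \<Longrightarrow> \<bar>y - x\<bar> \<le> \<beta>"
  shows "(\<Sum>q\<in>Q. (xh q)\<^sup>2) * (LINT y|\<sigma>. indicator S y * pk (wd v) (y - lo v))\<^sup>2
    \<le> (LINT x:iv v|w. (hilbert \<alpha> \<beta> \<sigma> (indicator S) x)\<^sup>2)"
proof -
  interpret truncation \<alpha> \<beta> \<sigma> by unfold_locales (use ab \<sigma> in auto)
  define k where "k = (LINT y|\<sigma>. indicator S y * pk (wd v) (y - lo v))"
  have k0: "k \<ge> 0" unfolding k_def by (rule integral_nonneg_AE) (auto simp: indicator_def)
  have Hi: "set_integrable w (iv q) (HS S)" for q
    by (rule lfb_set_integrable[OF w _ _ HS_measurable[OF S(2)] HS_bound[OF S(1,2)]]) auto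
  have Hi2: "set_integrable w (iv v) (\<lambda>x. (HS S x)\<^sup>2)"
  proof (rule lfb_set_integrable[OF w, where B = "(2 / \<alpha> * measure \<sigma> S)\<^sup>2"])
    show "(\<lambda>x. (HS S x)\<^sup>2) \<in> borel_measurable borel" using HS_measurable[OF S(2)] by measurable
    show "\<bar>(HS S x)\<^sup>2\<bar> \<le> (2 / \<alpha> * measure \<sigma> S)\<^sup>2" for x
      by (rule HS_sq_bound[OF S(1,2)])
  qed auto
  have ge: "k * xh q \<le> l2_inner w (HS S) (haar w (iv q))" if q: "q \<in> Q" for q
  proof -
    have "l2_inner w (\<lambda>x. HS S x + (- k) * x) (haar w (iv q)) \<ge> 0"
    proof (rule haar_interval.mono_coeff[OF haar_iv[OF w]])
      show "set_integrable w (iv q) (\<lambda>x. HS S x + (- k) * x)"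
        using set_integral_add(1)[OF Hi id_set_integrable[of q "- k" 0]] by simp
      fix x x' assume x: "x \<in> iv q" "x' \<in> iv q" "x \<le> x'"
      then have xv: "x \<in> iv v" "x' \<in> iv v" using iv_mono[OF Q(2)[OF q]] by auto
      have "(x' - x) * k \<le> HS S x' - HS S x" unfolding k_def
      proof (rule HS_diff_lower[OF S(1,2) _ x(3) _ al])
        show "lo v \<le> x" "x' < lo v + wd v" using xv unfolding iv_def by auto
        show "(lo v + wd v \<le> y \<or> y < lo v) \<and> \<bar>y - x\<bar> \<le> \<beta> \<and> \<bar>y - x'\<bar> \<le> \<beta>" if "y \<in> S" for y
        proof (intro conjI be xv that)
          show "lo v + wd v \<le> y \<or> y < lo v" using that S(3) unfolding iv_def by auto
        qed
      qed
      then show "HS S x + (- k) * x \<le> HS S x' + (- k) * x'" by (simp add: algebra_simps)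
    qed
    then show ?thesis using haar_linear[OF Hi id_set_integrable[of q 1 0], of "- k"] by (simp add: xh_def)
  qed
  have "(\<Sum>q\<in>Q. (xh q)\<^sup>2) * k\<^sup>2 = (\<Sum>q\<in>Q. (k * xh q)\<^sup>2)"
    by (simp add: sum_distrib_left power_mult_distrib mult.commute)
  also have "\<dots> \<le> (\<Sum>q\<in>Q. (l2_inner w (HS S) (haar w (iv q)))\<^sup>2)"
    by (intro sum_mono power_mono ge mult_nonneg_nonneg k0 xh_nonneg)
  also have "\<dots> \<le> (LINT x:iv v|w. (HS S x)\<^sup>2)"
    by (rule bessel_haar_local[OF w Q Hi2 Hi])
  finally show ?thesis unfolding k_def .
qed

text \<open>Seen from \<open>v\<close>, the mass outside \<open>v\<close> is handled by
  monotonicity: the transform of \<open>R - iv v\<close> is that of \<open>R\<close> minus that of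
  \<open>v\<close>, and testing applies to both. The mass inside \<open>v\<close> is handled by A2.
  The constant is 2 * 4 + 2 * 1.\<close>

theorem energy_antichain:
  assumes R: "R = {p..<q}" "p < q" and V: "finite V" "\<And>v. v \<in> V \<Longrightarrow> iv v \<subseteq> R"
    and anti: "\<And>v v'. v \<in> V \<Longrightarrow> v' \<in> V \<Longrightarrow> suffix v v' \<Longrightarrow> v = v'"
    and Q: "\<And>v. v \<in> V \<Longrightarrow> finite (Q v)" "\<And>v u. v \<in> V \<Longrightarrow> u \<in> Q v \<Longrightarrow> suffix v u"
  shows "(\<Sum>v\<in>V. (\<Sum>u\<in>Q v. (xh u)\<^sup>2) * (LINT y|\<sigma>. indicator R y * pk (wd v) (y - lo v))\<^sup>2)
    \<le> 10 * H\<^sup>2 * measure \<sigma> R"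
proof (cases "V = {}")
  case False
  \<comment> \<open>Testing holds for every truncation, so one is chosen here for which no width is
    below \<alpha> and no distance within \<open>R\<close> exceeds \<beta>, as the lower bound on
    the kernel demands.\<close>
  define \<alpha> where "\<alpha> = Min (wd ` V)"
  define \<beta> where "\<beta> = \<alpha> + (q - p)"
  have "\<alpha> \<in> wd ` V" unfolding \<alpha>_def using V(1) False by (intro Min_in) auto
  then have ab: "0 < \<alpha>" "\<alpha> < \<beta>" using R(2) by (auto simp: \<beta>_def)
  have al: "\<alpha> \<le> wd v" if "v \<in> V" for v unfolding \<alpha>_def using V(1) that by (intro Min_le) auto
  interpret truncation \<alpha> \<beta> \<sigma> by unfold_locales (use ab \<sigma> in auto)
  have Rb: "bounded R" "R \<in> sets borel" unfolding R by auto
  have disj: "iv v \<inter> iv v' = {}" if "v \<in> V" "v' \<in> V" "v \<noteq> v'" for v v'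
    by (rule iv_disjoint) (use that anti in blast)+
  define G where "G v = (\<Sum>u\<in>Q v. (xh u)\<^sup>2)" for v
  have G0: "G v \<ge> 0" for v unfolding G_def by (intro sum_nonneg) auto
  define k where "k S v = (LINT y|\<sigma>. indicator S y * pk (wd v) (y - lo v))" for S v
  have sb: "bounded (R - iv v)" "R - iv v \<in> sets borel" for v
    using Rb bounded_subset[OF Rb(1)] by auto
  have ksum: "k R v = k (R - iv v) v + k (iv v) v" if "v \<in> V" for v
  proof -
    have "indicator R y = (indicator (R - iv v) y + indicator (iv v) y :: real)" for y
      using V(2)[OF that] by (auto simp: indicator_def)
    then show ?thesis unfolding k_def
      using pk_integrable[OF sb wd_pos] pk_integrable[OF iv_bounded iv_borel wd_pos] by (simp add: distrib_right)
  qed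
  have HSi: "set_integrable w S (\<lambda>x. (HS S' x)\<^sup>2)" if "bounded S" "S \<in> sets borel" "bounded S'" "S' \<in> sets borel" for S S'
  proof (rule lfb_set_integrable[OF w that(1,2), where B = "(2 / \<alpha> * measure \<sigma> S')\<^sup>2"])
    show "(\<lambda>x. (HS S' x)\<^sup>2) \<in> borel_measurable borel" using HS_measurable[OF that(4)] by measurable
    show "\<bar>(HS S' x)\<^sup>2\<bar> \<le> (2 / \<alpha> * measure \<sigma> S')\<^sup>2" for x
      by (rule HS_sq_bound[OF that(3,4)])
  qed
  have s_sum: "(\<Sum>v\<in>V. s v) \<le> measure \<sigma> R"
    unfolding s_def by (rule lfb_measure_disjoint_le[OF \<sigma> V(1) _ V(2) disj Rb]) auto
  have out: "(\<Sum>v\<in>V. G v * (k (R - iv v) v)\<^sup>2) \<le> 4 * (Tst\<^sup>2 * measure \<sigma> R)"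
  proof -
    have "G v * (k (R - iv v) v)\<^sup>2 \<le> 2 * (LINT x:iv v|w. (HS R x)\<^sup>2) + 2 * (Tst\<^sup>2 * s v)" if v: "v \<in> V" for v
    proof -
      have "G v * (k (R - iv v) v)\<^sup>2 \<le> (LINT x:iv v|w. (HS (R - iv v) x)\<^sup>2)"
        unfolding G_def k_def
      proof (rule sum_xh_sq_le_HS[OF ab Q(1)[OF v] Q(2)[OF v] sb _ al[OF v]])
        fix x y assume "x \<in> iv v" "y \<in> R - iv v"
        then show "\<bar>y - x\<bar> \<le> \<beta>" using V(2)[OF v] ab(1) unfolding R(1) \<beta>_def by (auto simp: subset_iff abs_if)
      qed auto
      also have "\<dots> \<le> (LINT x:iv v|w. 2 * (HS R x)\<^sup>2 + 2 * (HS (iv v) x)\<^sup>2)"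
      proof (rule set_integral_mono)
        show "set_integrable w (iv v) (\<lambda>x. (HS (R - iv v) x)\<^sup>2)" by (rule HSi) (use sb in auto)
        show "set_integrable w (iv v) (\<lambda>x. 2 * (HS R x)\<^sup>2 + 2 * (HS (iv v) x)\<^sup>2)"
          by (intro set_integral_add set_integrable_mult_right HSi) (use Rb in auto)
        fix x
        have "(R - iv v) \<union> iv v = R" using V(2)[OF v] by auto
        then have "HS R x = HS (R - iv v) x + HS (iv v) x"
          using HS_Un[OF sb[of v] iv_bounded iv_borel, of v x] by auto
        then have e: "HS (R - iv v) x = HS R x - HS (iv v) x" by simp
        have "(y - z)\<^sup>2 \<le> 2 * y\<^sup>2 + 2 * z\<^sup>2" for y z :: real
          using zero_le_power2[of "y + z"] by (simp add: power2_sum power2_diff)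
        then show "(HS (R - iv v) x)\<^sup>2 \<le> 2 * (HS R x)\<^sup>2 + 2 * (HS (iv v) x)\<^sup>2" unfolding e .
      qed
      also have "\<dots> = 2 * (LINT x:iv v|w. (HS R x)\<^sup>2) + 2 * (LINT x:iv v|w. (HS (iv v) x)\<^sup>2)"
        by (subst set_integral_add(2)) (use HSi Rb in auto)
      also have "(LINT x:iv v|w. (HS (iv v) x)\<^sup>2) \<le> Tst\<^sup>2 * s v"
        unfolding s_def by (rule testing_real[OF ab]) (auto simp: iv_def)
      finally show ?thesis by simp
    qed
    then have "(\<Sum>v\<in>V. G v * (k (R - iv v) v)\<^sup>2) \<le> (\<Sum>v\<in>V. 2 * (LINT x:iv v|w. (HS R x)\<^sup>2) + 2 * (Tst\<^sup>2 * s v))"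
      by (rule sum_mono)
    also have "\<dots> = 2 * (\<Sum>v\<in>V. (LINT x:iv v|w. (HS R x)\<^sup>2)) + 2 * (Tst\<^sup>2 * (\<Sum>v\<in>V. s v))"
      by (simp add: sum.distrib sum_distrib_left)
    also have "(\<Sum>v\<in>V. (LINT x:iv v|w. (HS R x)\<^sup>2)) \<le> (LINT x:R|w. (HS R x)\<^sup>2)"
      by (rule set_integral_disjoint_le[OF V(1) _ V(2) disj]) (use lfb_sets[OF w] HSi Rb in auto)
    also have "\<dots> \<le> Tst\<^sup>2 * measure \<sigma> R" by (rule testing_real[OF ab R])
    finally show ?thesis using mult_left_mono[OF s_sum, of "Tst\<^sup>2"] by simp
  qed
  have inn: "(\<Sum>v\<in>V. G v * (k (iv v) v)\<^sup>2) \<le> A2 * measure \<sigma> R"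
  proof -
    have "G v * (k (iv v) v)\<^sup>2 \<le> A2 * s v" if v: "v \<in> V" for v
    proof -
      have "k (iv v) v \<le> (LINT y|\<sigma>. 1 / (wd v)\<^sup>2 * indicator (iv v) y)" unfolding k_def
      proof (rule integral_mono)
        show "integrable \<sigma> (\<lambda>y. 1 / (wd v)\<^sup>2 * indicator (iv v) y)"
          by (intro integrable_mult_right lfb_indicator_integrable[OF \<sigma>]) auto
      qed (use pk_integrable[OF iv_bounded iv_borel wd_pos] pk_le[OF wd_pos] in \<open>auto simp: indicator_def\<close>)
      also have "\<dots> = s v / (wd v)\<^sup>2" using lfb_integral_indicator[OF \<sigma>, of "iv v"] by (simp add: s_def)
      finally have k: "k (iv v) v \<le> s v / (wd v)\<^sup>2" .
      have k0: "k (iv v) v \<ge> 0" unfolding k_def by (rule integral_nonneg_AE) (auto simp: indicator_def)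
      have "G v * (k (iv v) v)\<^sup>2 \<le> ((wd v)\<^sup>2 * measure w (iv v)) * (s v / (wd v)\<^sup>2)\<^sup>2"
        unfolding G_def by (intro mult_mono sum_xh_sq_le power_mono k k0) (use Q v in auto)
      also have "\<dots> = s v * (s v * measure w (iv v)) / (wd v)\<^sup>2"
        using wd_pos[of v] by (simp add: power2_eq_square field_simps)
      also have "\<dots> \<le> s v * (A2 * (wd v)\<^sup>2) / (wd v)\<^sup>2"
        by (intro divide_right_mono mult_left_mono A2_self) auto
      also have "\<dots> = A2 * s v" using wd_pos[of v] by simp
      finally show ?thesis .
    qed
    then have "(\<Sum>v\<in>V. G v * (k (iv v) v)\<^sup>2) \<le> (\<Sum>v\<in>V. A2 * s v)" by (rule sum_mono)
    also have "\<dots> \<le> A2 * measure \<sigma> R" unfolding sum_distrib_left[symmetric] by (rule mult_left_mono[OF s_sum]) simp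
    finally show ?thesis .
  qed
  have "(\<Sum>v\<in>V. G v * (k R v)\<^sup>2) \<le> (\<Sum>v\<in>V. 2 * (G v * (k (R - iv v) v)\<^sup>2) + 2 * (G v * (k (iv v) v)\<^sup>2))"
  proof (rule sum_mono)
    fix v assume v: "v \<in> V"
    have "(y + z)\<^sup>2 \<le> 2 * y\<^sup>2 + 2 * z\<^sup>2" for y z :: real
      using zero_le_power2[of "y - z"] by (simp add: power2_sum power2_diff)
    then have "G v * (k R v)\<^sup>2 \<le> G v * (2 * (k (R - iv v) v)\<^sup>2 + 2 * (k (iv v) v)\<^sup>2)"
      unfolding ksum[OF v] by (intro mult_left_mono G0)
    then show "G v * (k R v)\<^sup>2 \<le> 2 * (G v * (k (R - iv v) v)\<^sup>2) + 2 * (G v * (k (iv v) v)\<^sup>2)" by (simp add: algebra_simps)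
  qed
  also have "\<dots> = 2 * (\<Sum>v\<in>V. G v * (k (R - iv v) v)\<^sup>2) + 2 * (\<Sum>v\<in>V. G v * (k (iv v) v)\<^sup>2)"
    by (simp add: sum.distrib sum_distrib_left)
  also have "\<dots> \<le> 8 * (Tst\<^sup>2 * measure \<sigma> R) + 2 * (A2 * measure \<sigma> R)" using out inn by linarith
  also have "\<dots> \<le> 8 * (H\<^sup>2 * measure \<sigma> R) + 2 * (H\<^sup>2 * measure \<sigma> R)"
    by (intro add_mono mult_left_mono mult_right_mono A2_Tst_le_H) auto
  finally show ?thesis unfolding G_def k_def by (simp add: mult_ac)
qed simp

end

lemma sum_UN_le:
  fixes f :: "'a \<Rightarrow> real"
  assumes "finite I" "\<And>i. i \<in> I \<Longrightarrow> finite (A i)" "\<And>x. f x \<ge> 0"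
  shows "sum f (\<Union>i\<in>I. A i) \<le> (\<Sum>i\<in>I. sum f (A i))"
  using assms(1,2)
proof (induction I rule: finite_induct)
  case (insert i I)
  have "sum f (A i \<union> (\<Union>i\<in>I. A i)) \<le> sum f (A i) + sum f (\<Union>i\<in>I. A i)"
    using insert.hyps insert.prems sum_nonneg[of "A i \<inter> (\<Union>i\<in>I. A i)" f] assms(3) by (subst sum_Un) auto
  then show ?case using insert by simp
qed simp

section \<open>Dual testing condition for the Poisson kernel, and discretisation\<close>

context dyadic_tree
begin

lemma sum_atoms_group:
  fixes f :: "bool list \<Rightarrow> real"
  assumes "n \<le> N" shows "(\<Sum>x\<in>atoms N. f x) = (\<Sum>U\<in>atoms n. \<Sum>x | x \<in> atoms N \<and> suffix U x. f x)"
proof -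
  have eq: "{x. x \<in> atoms N \<and> suffix U x} = {x \<in> atoms N. drop (N - n) x = U}" if U: "U \<in> atoms n" for U
  proof -
    have "suffix U x \<longleftrightarrow> drop (N - n) x = U" if x: "x \<in> atoms N" for x
    proof
      assume "suffix U x"
      then obtain zs where "x = zs @ U" unfolding suffix_def by blast
      then show "drop (N - n) x = U" using U x by (auto simp: atoms_def)
    next
      assume "drop (N - n) x = U"
      then show "suffix U x" using suffix_drop[of "N - n" x] by simp
    qed
    then show ?thesis by blast
  qed
  have "(\<Sum>x\<in>atoms N. f x) = (\<Sum>U\<in>atoms n. sum f {x \<in> atoms N. drop (N - n) x = U})"
    by (rule sum.group[symmetric]) (use assms finite_atoms[of N] finite_atoms[of n] in \<open>auto simp: atoms_def\<close>)
  then show ?thesis using eq by simp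
qed

end

context weight_pair
begin

lemma s_atoms: "length q \<le> N \<Longrightarrow> s q = (\<Sum>x | x \<in> atoms N \<and> suffix q x. s x)"
  by (rule additive_atoms) (rule s_split)

text \<open>On a block \<open>U\<close> of generation \<open>n\<close> both kernels are constant up
  to a factor 4, and \<open>A2_level\<close> bounds \<sigma>(U) times the inner sum. What is left is
  a Riemann sum of size 8 / wd v0 times the length of the blocks, whence the decay in
  \<open>n\<close>; 512 = 4 * 4 * 4 * 8.\<close>

lemma dual_level:
  assumes n: "n \<le> N" "length v0 \<le> n"
  shows "(\<Sum>x\<in>atoms N. s x * pk (wd v0) (lo x - lo v0) *
      (\<Sum>v\<in>atoms n. (wd v)\<^sup>2 * measure w (iv v) * pk (wd v) (lo x - lo v)))
    \<le> 512 * A2 * (1 / 2) ^ (n - length v0)"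
proof -
  define t where "t = L / 2 ^ n"
  have wt: "wd v = t" if "v \<in> atoms n" for v using that by (simp add: atoms_def wd_def t_def)
  have t: "t > 0" using L_pos by (simp add: t_def)
  have Tt: "wd v0 = 2 ^ (n - length v0) * t" using wd_shift[of "replicate n True" v0 "n - length v0"] n
    by (simp add: wd_def t_def)
  have tT: "t \<le> wd v0" using wd_mono[of v0 "replicate n True"] n by (simp add: wd_def t_def)
  have near: "\<bar>lo x - lo U\<bar> \<le> t" if "U \<in> atoms n" "suffix U x" for U x
    using iv_endpoints[OF that(2)] wt[OF that(1)] wd_pos[of x] by linarith
  have blk: "(\<Sum>x | x \<in> atoms N \<and> suffix U x. s x * pk (wd v0) (lo x - lo v0) *
      (\<Sum>v\<in>atoms n. (wd v)\<^sup>2 * measure w (iv v) * pk (wd v) (lo x - lo v)))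
     \<le> 64 * A2 * t\<^sup>2 * pk (wd v0) (lo U - lo v0)" if U: "U \<in> atoms n" for U
  proof -
    define W where "W = (\<Sum>v\<in>atoms n. measure w (iv v) * pk t (lo U - lo v))"
    have W0: "W \<ge> 0" unfolding W_def by (intro sum_nonneg mult_nonneg_nonneg) auto
    have "(\<Sum>x | x \<in> atoms N \<and> suffix U x. s x * pk (wd v0) (lo x - lo v0) *
      (\<Sum>v\<in>atoms n. (wd v)\<^sup>2 * measure w (iv v) * pk (wd v) (lo x - lo v)))
      \<le> (\<Sum>x | x \<in> atoms N \<and> suffix U x. s x * (4 * pk (wd v0) (lo U - lo v0)) * (4 * (t\<^sup>2 * W)))"
    proof (rule sum_mono)
      fix x assume "x \<in> {x. x \<in> atoms N \<and> suffix U x}"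
      then have x: "suffix U x" by auto
      have 1: "pk (wd v0) (lo x - lo v0) \<le> 4 * pk (wd v0) (lo U - lo v0)"
        by (rule pk_le_4) (use near[OF U x] tT in \<open>auto simp: abs_if split: if_splits\<close>)
      have "(\<Sum>v\<in>atoms n. (wd v)\<^sup>2 * measure w (iv v) * pk (wd v) (lo x - lo v))
        \<le> (\<Sum>v\<in>atoms n. t\<^sup>2 * measure w (iv v) * (4 * pk t (lo U - lo v)))"
      proof (rule sum_mono)
        fix v assume v: "v \<in> atoms n"
        have "pk t (lo x - lo v) \<le> 4 * pk t (lo U - lo v)"
          by (rule pk_le_4[OF t]) (use near[OF U x] in \<open>auto simp: abs_if split: if_splits\<close>)
        then show "(wd v)\<^sup>2 * measure w (iv v) * pk (wd v) (lo x - lo v) \<le> t\<^sup>2 * measure w (iv v) * (4 * pk t (lo U - lo v))"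
          unfolding wt[OF v] by (rule mult_left_mono) simp
      qed
      also have "\<dots> = 4 * (t\<^sup>2 * W)" unfolding W_def by (simp add: sum_distrib_left mult_ac)
      finally have 2: "(\<Sum>v\<in>atoms n. (wd v)\<^sup>2 * measure w (iv v) * pk (wd v) (lo x - lo v)) \<le> 4 * (t\<^sup>2 * W)" .
      show "s x * pk (wd v0) (lo x - lo v0) * (\<Sum>v\<in>atoms n. (wd v)\<^sup>2 * measure w (iv v) * pk (wd v) (lo x - lo v))
        \<le> s x * (4 * pk (wd v0) (lo U - lo v0)) * (4 * (t\<^sup>2 * W))"
        by (intro mult_mono 1 2 mult_nonneg_nonneg sum_nonneg) auto
    qed
    also have "\<dots> = s U * W * (16 * t\<^sup>2 * pk (wd v0) (lo U - lo v0))"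
    proof -
      have "length U \<le> N" using U n by (simp add: atoms_def)
      then have "(\<Sum>x | x \<in> atoms N \<and> suffix U x. s x) = s U" by (rule s_atoms[symmetric])
      then show ?thesis unfolding sum_distrib_right[symmetric] by (simp only:) (simp add: mult_ac)
    qed
    also have "\<dots> \<le> 4 * A2 * (16 * t\<^sup>2 * pk (wd v0) (lo U - lo v0))"
      using A2_level[OF U] unfolding wt[OF U] W_def[symmetric] by (rule mult_right_mono) simp
    finally show ?thesis by simp
  qed
  have "(\<Sum>x\<in>atoms N. s x * pk (wd v0) (lo x - lo v0) *
      (\<Sum>v\<in>atoms n. (wd v)\<^sup>2 * measure w (iv v) * pk (wd v) (lo x - lo v)))
    \<le> (\<Sum>U\<in>atoms n. 64 * A2 * t\<^sup>2 * pk (wd v0) (lo U - lo v0))"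
    unfolding sum_atoms_group[OF n(1)] by (rule sum_mono) (rule blk)
  also have "\<dots> = 64 * A2 * t * (\<Sum>U\<in>atoms n. wd U * pk (wd v0) (lo U - lo v0))"
    using wt by (simp add: sum_distrib_left power2_eq_square mult_ac)
  also have "\<dots> \<le> 64 * A2 * t * (8 / wd v0)"
    by (intro mult_left_mono sum_pk_level_le) (use wt tT t in auto)
  also have "\<dots> = 512 * A2 * (t / wd v0)" by simp
  also have "t / wd v0 = (1 / 2) ^ (n - length v0)" unfolding Tt using t by (simp add: power_one_over)
  finally show ?thesis .
qed

text \<open>After squaring, symmetry allows \<open>V q'\<close> to be taken no wider than
  \<open>V q\<close> at the price of 2. The masses with \<open>V q' = v\<close> add up to at most
  |v|^2 w(v), and \<open>dual_level\<close> sums geometrically over the generations of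
  \<open>v\<close>: A2 alone controls this side.\<close>

theorem dual_testing:
  assumes Y: "finite Y" "\<And>q. q \<in> Y \<Longrightarrow> suffix (V q) q" "\<And>q. q \<in> Y \<Longrightarrow> length (V q) \<le> N" and X: "X \<subseteq> atoms N"
  shows "(\<Sum>x\<in>X. s x * (\<Sum>q\<in>Y. (xh q)\<^sup>2 * pk (wd (V q)) (lo x - lo (V q)))\<^sup>2) \<le> 2048 * A2 * (\<Sum>q\<in>Y. (xh q)\<^sup>2)"
proof -
  define k where "k x q = pk (wd (V q)) (lo x - lo (V q))" for x q
  define \<mu> where "\<mu> q = (xh q)\<^sup>2" for q
  have k0: "k x q \<ge> 0" "\<mu> q \<ge> 0" for x q by (simp_all add: k_def \<mu>_def)
  have finX: "finite X" using X finite_atoms finite_subset by blast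
  have sq: "(\<Sum>q\<in>Y. \<mu> q * k x q)\<^sup>2 \<le> 2 * (\<Sum>q\<in>Y. \<mu> q * k x q * (\<Sum>q' | q' \<in> Y \<and> length (V q) \<le> length (V q'). \<mu> q' * k x q'))" for x
  proof -
    let ?f = "\<lambda>q q'. \<mu> q * k x q * (\<mu> q' * k x q')"
    let ?g = "\<lambda>q q'. if length (V q) \<le> length (V q') then ?f q q' else 0"
    have "(\<Sum>q\<in>Y. \<mu> q * k x q)\<^sup>2 = (\<Sum>q\<in>Y. \<Sum>q'\<in>Y. ?f q q')"
      by (simp add: power2_eq_square sum_product)
    also have "\<dots> \<le> (\<Sum>q\<in>Y. \<Sum>q'\<in>Y. ?g q q' + ?g q' q)"
      by (intro sum_mono) (auto simp: k0 mult_ac)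
    also have "\<dots> = (\<Sum>q\<in>Y. \<Sum>q'\<in>Y. ?g q q') + (\<Sum>q\<in>Y. \<Sum>q'\<in>Y. ?g q' q)"
      by (simp add: sum.distrib)
    also have "(\<Sum>q\<in>Y. \<Sum>q'\<in>Y. ?g q' q) = (\<Sum>q\<in>Y. \<Sum>q'\<in>Y. ?g q q')" by (rule sum.swap)
    also have "(\<Sum>q\<in>Y. \<Sum>q'\<in>Y. ?g q q') = (\<Sum>q\<in>Y. \<mu> q * k x q * (\<Sum>q' | q' \<in> Y \<and> length (V q) \<le> length (V q'). \<mu> q' * k x q'))"
    proof (intro sum.cong refl)
      fix q assume "q \<in> Y"
      have "(\<Sum>q'\<in>Y. ?g q q') = (\<Sum>q' | q' \<in> Y \<and> length (V q) \<le> length (V q'). ?f q q')"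
        using Y(1) by (simp add: sum.inter_filter)
      then show "(\<Sum>q'\<in>Y. ?g q q') = \<mu> q * k x q * (\<Sum>q' | q' \<in> Y \<and> length (V q) \<le> length (V q'). \<mu> q' * k x q')"
        by (simp add: sum_distrib_left)
    qed
    finally show ?thesis by simp
  qed
  have row: "(\<Sum>x\<in>X. s x * k x q * (\<Sum>q' | q' \<in> Y \<and> length (V q) \<le> length (V q'). \<mu> q' * k x q')) \<le> 1024 * A2"
    if q: "q \<in> Y" for q
  proof -
    define Y' where "Y' = {q' \<in> Y. length (V q) \<le> length (V q')}"
    define l where "l = length (V q)"
    define e where "e x v = (wd v)\<^sup>2 * measure w (iv v) * pk (wd v) (lo x - lo v)" for x v
    have e0: "e x v \<ge> 0" for x v by (simp add: e_def)
    have finY': "finite Y'" using Y(1) by (simp add: Y'_def)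
    have in1: "(\<Sum>q'\<in>Y'. \<mu> q' * k x q') \<le> (\<Sum>n\<in>{l..N}. \<Sum>v\<in>atoms n. e x v)" for x
    proof -
      have "(\<Sum>q'\<in>Y'. \<mu> q' * k x q') = (\<Sum>v\<in>V ` Y'. \<Sum>q' | q' \<in> Y' \<and> V q' = v. \<mu> q' * k x q')"
        by (rule sum.group[symmetric]) (use finY' in auto)
      also have "\<dots> \<le> (\<Sum>v\<in>V ` Y'. e x v)"
      proof (rule sum_mono)
        fix v assume "v \<in> V ` Y'"
        have "(\<Sum>q' | q' \<in> Y' \<and> V q' = v. \<mu> q' * k x q') = (\<Sum>q' | q' \<in> Y' \<and> V q' = v. \<mu> q') * pk (wd v) (lo x - lo v)"
          unfolding sum_distrib_right by (intro sum.cong) (auto simp: k_def)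
        also have "\<dots> \<le> ((wd v)\<^sup>2 * measure w (iv v)) * pk (wd v) (lo x - lo v)"
        proof (rule mult_right_mono)
          show "(\<Sum>q' | q' \<in> Y' \<and> V q' = v. \<mu> q') \<le> (wd v)\<^sup>2 * measure w (iv v)" unfolding \<mu>_def
            by (rule sum_xh_sq_le) (use Y(1,2) in \<open>auto simp: Y'_def\<close>)
        qed simp
        finally show "(\<Sum>q' | q' \<in> Y' \<and> V q' = v. \<mu> q' * k x q') \<le> e x v" by (simp add: e_def)
      qed
      also have "\<dots> \<le> sum (e x) (\<Union>n\<in>{l..N}. atoms n)"
        by (rule sum_mono2) (use e0 Y(3) finite_atoms in \<open>auto simp: atoms_def Y'_def l_def\<close>)
      also have "\<dots> = (\<Sum>n\<in>{l..N}. \<Sum>v\<in>atoms n. e x v)"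
        by (rule sum.UNION_disjoint) (auto simp: atoms_def[of "_ :: nat"] intro: finite_atoms[unfolded atoms_def])
      finally show ?thesis .
    qed
    have "(\<Sum>x\<in>X. s x * k x q * (\<Sum>q'\<in>Y'. \<mu> q' * k x q')) \<le> (\<Sum>x\<in>X. s x * k x q * (\<Sum>n\<in>{l..N}. \<Sum>v\<in>atoms n. e x v))"
      by (intro sum_mono mult_left_mono in1) (auto simp: k0)
    also have "\<dots> \<le> (\<Sum>x\<in>atoms N. s x * k x q * (\<Sum>n\<in>{l..N}. \<Sum>v\<in>atoms n. e x v))"
      by (rule sum_mono2[OF finite_atoms X]) (auto simp: k0 e0 intro!: mult_nonneg_nonneg sum_nonneg)
    also have "\<dots> = (\<Sum>n\<in>{l..N}. \<Sum>x\<in>atoms N. s x * k x q * (\<Sum>v\<in>atoms n. e x v))"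
      unfolding sum_distrib_left[of _ _ "{l..N}"] by (rule sum.swap)
    also have "\<dots> \<le> (\<Sum>n\<in>{l..N}. 512 * A2 * (1 / 2) ^ (n - l))"
    proof (rule sum_mono)
      fix n assume "n \<in> {l..N}"
      then show "(\<Sum>x\<in>atoms N. s x * k x q * (\<Sum>v\<in>atoms n. e x v)) \<le> 512 * A2 * (1 / 2) ^ (n - l)"
        using dual_level[of n N "V q"] unfolding k_def e_def l_def by simp
    qed
    also have "\<dots> = 512 * A2 * (\<Sum>n\<in>{l..N}. (1 / 2) ^ (n - l))" by (simp add: sum_distrib_left)
    also have "(\<Sum>n\<in>{l..N}. (1 / 2 :: real) ^ (n - l)) \<le> 2"
    proof -
      have "(\<Sum>n\<in>{l..N}. (1 / 2 :: real) ^ (n - l)) = (\<Sum>i\<in>(\<lambda>n. n - l) ` {l..N}. (1 / 2) ^ i)"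
        by (subst sum.reindex) (auto simp: inj_on_def)
      also have "\<dots> \<le> (\<Sum>i. (1 / 2) ^ i)" by (rule sum_le_suminf) (auto intro!: summable_geometric)
      also have "\<dots> = 2" by (subst suminf_geometric) auto
      finally show ?thesis .
    qed
    finally show ?thesis unfolding Y'_def by (simp add: mult_left_mono)
  qed
  have "(\<Sum>x\<in>X. s x * (\<Sum>q\<in>Y. \<mu> q * k x q)\<^sup>2)
    \<le> (\<Sum>x\<in>X. s x * (2 * (\<Sum>q\<in>Y. \<mu> q * k x q * (\<Sum>q' | q' \<in> Y \<and> length (V q) \<le> length (V q'). \<mu> q' * k x q'))))"
    by (intro sum_mono mult_left_mono sq) auto
  also have "\<dots> = 2 * (\<Sum>q\<in>Y. \<mu> q * (\<Sum>x\<in>X. s x * k x q * (\<Sum>q' | q' \<in> Y \<and> length (V q) \<le> length (V q'). \<mu> q' * k x q')))"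
    by (simp only: sum_distrib_left[of _ _ Y] sum_distrib_left[of _ _ X]) (subst sum.swap, simp only: mult_ac)
  also have "\<dots> \<le> 2 * (\<Sum>q\<in>Y. \<mu> q * (1024 * A2))"
    by (intro mult_left_mono sum_mono row) (auto simp: k0)
  also have "\<dots> = 2048 * A2 * (\<Sum>q\<in>Y. \<mu> q)" by (simp add: sum_distrib_left sum_distrib_right mult_ac)
  finally show ?thesis unfolding \<mu>_def k_def .
qed

text \<open>Atoms are no wider than \<open>v\<close>, so moving a point inside its atom changes the
  kernel by at most a factor 4.\<close>

lemma disc_le_integral:
  assumes S: "bounded S" "S \<in> sets borel" and X: "X \<subseteq> atoms N" "\<And>x. x \<in> X \<Longrightarrow> iv x \<subseteq> S" and v: "length v \<le> N"
  shows "(\<Sum>x\<in>X. s x * pk (wd v) (lo x - lo v)) \<le> 4 * (LINT y|\<sigma>. indicator S y * pk (wd v) (y - lo v))"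
proof -
  \<comment> \<open>Any truncation would serve; only the integrability of \<open>pk\<close> is taken
    from it.\<close>
  interpret tr: truncation 1 2 \<sigma> by unfold_locales (use \<sigma> in auto)
  have finX: "finite X" using X(1) finite_atoms finite_subset by blast
  have pi: "set_integrable \<sigma> S' (\<lambda>y. pk (wd v) (y - lo v))" if "bounded S'" "S' \<in> sets borel" for S'
    using tr.pk_integrable[OF that wd_pos] unfolding set_integrable_def by simp
  have "s x * pk (wd v) (lo x - lo v) \<le> 4 * (LINT y:iv x|\<sigma>. pk (wd v) (y - lo v))" if x: "x \<in> X" for x
  proof -
    have wx: "wd x \<le> wd v" using wd_mono[of v x] v X(1) x by (auto simp: atoms_def)
    have "pk (wd v) (lo x - lo v) * s x = (LINT y:iv x|\<sigma>. pk (wd v) (lo x - lo v))"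
      using lfb_integral_indicator[OF \<sigma>, of "iv x"] by (simp add: set_lebesgue_integral_def s_def)
    also have "\<dots> \<le> (LINT y:iv x|\<sigma>. 4 * pk (wd v) (y - lo v))"
    proof (rule set_integral_mono)
      show "set_integrable \<sigma> (iv x) (\<lambda>y. pk (wd v) (lo x - lo v))"
        by (rule lfb_set_integrable[OF \<sigma>, where B = "pk (wd v) (lo x - lo v)"]) auto
      show "set_integrable \<sigma> (iv x) (\<lambda>y. 4 * pk (wd v) (y - lo v))"
        by (intro set_integrable_mult_right pi) auto
      show "pk (wd v) (lo x - lo v) \<le> 4 * pk (wd v) (y - lo v)" if "y \<in> iv x" for y
      proof (rule pk_le_4[OF wd_pos])
        have "\<bar>y - lo x\<bar> \<le> wd v" using that wx unfolding iv_def by auto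
        moreover have "\<bar>y - lo v\<bar> \<le> \<bar>y - lo x\<bar> + \<bar>lo x - lo v\<bar>"
          using abs_triangle_ineq[of "y - lo x" "lo x - lo v"] by simp
        ultimately show "wd v + \<bar>y - lo v\<bar> \<le> 2 * (wd v + \<bar>lo x - lo v\<bar>)"
          using abs_ge_zero[of "lo x - lo v"] by argo
      qed
    qed
    finally show ?thesis by (simp add: mult.commute)
  qed
  then have "(\<Sum>x\<in>X. s x * pk (wd v) (lo x - lo v)) \<le> (\<Sum>x\<in>X. 4 * (LINT y:iv x|\<sigma>. pk (wd v) (y - lo v)))"
    by (rule sum_mono)
  also have "\<dots> = 4 * (\<Sum>x\<in>X. (LINT y:iv x|\<sigma>. pk (wd v) (y - lo v)))" by (simp add: sum_distrib_left)
  also have "(\<Sum>x\<in>X. (LINT y:iv x|\<sigma>. pk (wd v) (y - lo v))) \<le> (LINT y:S|\<sigma>. pk (wd v) (y - lo v))"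
  proof (rule set_integral_disjoint_le[OF finX _ X(2) _ pi[OF S]])
    show "iv x \<inter> iv x' = {}" if "x \<in> X" "x' \<in> X" "x \<noteq> x'" for x x'
    proof -
      have "x \<in> atoms N" "x' \<in> atoms N" using subsetD[OF X(1)] that by auto
      then have "\<not> suffix x x'" "\<not> suffix x' x" using that(3) by (auto simp: atoms_def suffix_def)
      then show ?thesis by (rule iv_disjoint)
    qed
  qed (use lfb_sets[OF \<sigma>] in auto)
  finally show ?thesis by (simp add: set_lebesgue_integral_def)
qed

text \<open>The form in which \<open>energy_antichain\<close> enters the testing condition. The
  functions \<open>y\<close> are Poisson sums of one layer of points; the factor 9 leaves room for
  \<open>VV_compare\<close>, and 12960 = (9 * 4)^2 * 10.\<close>

lemma level_bound:
  assumes S: "S = {p..<p'}" "p < p'" and Q: "finite Q"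
    and v: "\<And>q. q \<in> Q \<Longrightarrow> suffix (v q) q" "\<And>q. q \<in> Q \<Longrightarrow> length (v q) \<le> N" "\<And>q. q \<in> Q \<Longrightarrow> iv (v q) \<subseteq> S"
    and anti: "\<And>q q'. q \<in> Q \<Longrightarrow> q' \<in> Q \<Longrightarrow> suffix (v q) (v q') \<Longrightarrow> v q = v q'"
    and y: "\<And>q. q \<in> Q \<Longrightarrow> 0 \<le> y q" "\<And>q. q \<in> Q \<Longrightarrow> y q \<le> 9 * (\<Sum>x | x \<in> atoms N \<and> iv x \<subseteq> S. s x * pk (wd (v q)) (lo x - lo (v q)))"
  shows "(\<Sum>q\<in>Q. (xh q)\<^sup>2 * (y q)\<^sup>2) \<le> 12960 * H\<^sup>2 * measure \<sigma> S"
proof -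
  have Sb: "bounded S" "S \<in> sets borel" unfolding S by auto
  define k where "k u = (LINT y|\<sigma>. indicator S y * pk (wd u) (y - lo u))" for u
  have yk: "(y q)\<^sup>2 \<le> 1296 * (k (v q))\<^sup>2" if "q \<in> Q" for q
  proof -
    have "y q \<le> 36 * k (v q)"
      using y(2)[OF that] disc_le_integral[OF Sb, of "{x. x \<in> atoms N \<and> iv x \<subseteq> S}" N "v q"] v(2)[OF that]
      unfolding k_def by fastforce
    then have "(y q)\<^sup>2 \<le> (36 * k (v q))\<^sup>2" using y(1)[OF that] by (rule power_mono)
    then show ?thesis by (simp add: power_mult_distrib)
  qed
  have "(\<Sum>q\<in>Q. (xh q)\<^sup>2 * (y q)\<^sup>2) \<le> (\<Sum>q\<in>Q. (xh q)\<^sup>2 * (1296 * (k (v q))\<^sup>2))"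
    by (intro sum_mono mult_left_mono yk) auto
  also have "\<dots> = 1296 * (\<Sum>q\<in>Q. (xh q)\<^sup>2 * (k (v q))\<^sup>2)" by (simp add: sum_distrib_left mult_ac)
  also have "(\<Sum>q\<in>Q. (xh q)\<^sup>2 * (k (v q))\<^sup>2) = (\<Sum>u\<in>v ` Q. \<Sum>q | q \<in> Q \<and> v q = u. (xh q)\<^sup>2 * (k (v q))\<^sup>2)"
    by (rule sum.group[symmetric]) (use Q in auto)
  also have "\<dots> = (\<Sum>u\<in>v ` Q. (\<Sum>q | q \<in> Q \<and> v q = u. (xh q)\<^sup>2) * (k u)\<^sup>2)"
    unfolding sum_distrib_right by (intro sum.cong refl) auto
  also have "\<dots> \<le> 10 * H\<^sup>2 * measure \<sigma> S" unfolding k_def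
    by (rule energy_antichain[OF S]) (use Q v anti in auto)
  finally show ?thesis by simp
qed

end

subsection \<open>Stopping intervals\<close>

locale stopping_tree = 
  fixes bad :: "bool list \<Rightarrow> bool list \<Rightarrow> bool"
begin

text \<open>The tail of a code is the parent, so the recursion passes from the root downwards:
  \<open>bad\<close> compares an interval with the stopping interval of its parent. The result is
  the smallest stopping interval containing \<open>p\<close>.\<close>

primrec stp :: "bool list \<Rightarrow> bool list" where
  "stp [] = []"
| "stp (b # p) = (if bad (stp p) (b # p) then b # p else stp p)"

definition FF where "FF = {p. stp p = p}"

definition ch where "ch F = {q. q \<noteq> [] \<and> stp q = q \<and> stp (tl q) = F}"

lemma suffix_stp: "suffix (stp p) p"
  by (induction p) (auto simp: suffix_ConsI)

lemma stp_stp [simp]: "stp (stp p) = stp p"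
  by (induction p) auto

lemma stp_in_FF [simp]: "stp p \<in> FF"
  by (simp add: FF_def)

lemma Nil_in_FF [simp]: "[] \<in> FF" by (simp add: FF_def)

lemma stp_between: "suffix (stp p) q \<Longrightarrow> suffix q p \<Longrightarrow> stp q = stp p"
proof (induction p)
  case (Cons b p)
  show ?case
  proof (cases "q = b # p")
    case False
    then have qp: "suffix q p" using Cons.prems(2) by (auto simp: suffix_Cons)
    show ?thesis
    proof (cases "bad (stp p) (b # p)")
      case True
      then have "suffix (b # p) q" using Cons.prems(1) by simp
      then have "length (b # p) \<le> length p" using qp suffix_length_le by (metis suffix_order.trans)
      then show ?thesis by simp
    next
      case False
      then show ?thesis using Cons.IH[OF _ qp] Cons.prems(1) by simp
    qed
  qed simp
qed simp

lemma FF_suffix_stp: "F \<in> FF \<Longrightarrow> suffix F p \<Longrightarrow> suffix F (stp p)"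
proof (induction p)
  case (Cons b p)
  show ?case
  proof (cases "F = b # p")
    case True
    then show ?thesis using Cons.prems(1) by (simp add: FF_def)
  next
    case False
    then have "suffix F p" using Cons.prems(2) by (auto simp: suffix_Cons)
    then show ?thesis using Cons.IH[OF Cons.prems(1)] by (simp add: suffix_ConsI)
  qed
qed simp

lemma ch_FF: "q \<in> ch F \<Longrightarrow> q \<in> FF" "q \<in> ch F \<Longrightarrow> F \<in> FF"
  by (auto simp: ch_def FF_def)

lemma ch_suffix: assumes "q \<in> ch F" shows "suffix F (tl q)" "suffix F q" "F \<noteq> q" "length F < length q"
proof -
  show 1: "suffix F (tl q)" using assms suffix_stp[of "tl q"] by (auto simp: ch_def)
  then show "suffix F q" using suffix_tl suffix_order.trans by blast
  show "length F < length q" using suffix_length_le[OF 1] assms by (cases q) (auto simp: ch_def)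
  then show "F \<noteq> q" by auto
qed

lemma ch_bad: assumes "q \<in> ch F" shows "bad F q"
proof -
  obtain b p where q: "q = b # p" using assms by (cases q) (auto simp: ch_def)
  have "stp p \<noteq> b # p" using suffix_length_le[OF suffix_stp[of p]] by auto
  then show ?thesis using assms q by (auto simp: ch_def split: if_splits)
qed

lemma ch_antichain: assumes "q \<in> ch F" "q' \<in> ch F" "suffix q q'" shows "q = q'"
proof (rule ccontr)
  assume "q \<noteq> q'"
  then have "suffix q (tl q')" using assms(3) by (cases q') (auto simp: suffix_Cons)
  then have "suffix q (stp (tl q'))" using FF_suffix_stp ch_FF(1)[OF assms(1)] by blast
  then have "suffix q F" using assms(2) by (simp add: ch_def)
  then show False using suffix_length_le[of q F] ch_suffix(4)[OF assms(1)] by simp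
qed

lemma ch_unique: assumes "q \<in> ch F" "q \<in> ch F'" shows "F = F'"
  using assms by (auto simp: ch_def)

lemma ex_ch: "F \<in> FF \<Longrightarrow> suffix F p \<Longrightarrow> stp p \<noteq> F \<Longrightarrow> \<exists>q\<in>ch F. suffix q p"
proof (induction p)
  case (Cons b p)
  then have "F \<noteq> b # p" by (auto simp: FF_def)
  then have Fp: "suffix F p" using Cons.prems by (auto simp: suffix_Cons)
  show ?case
  proof (cases "stp p = F")
    case True
    then have "stp (b # p) = b # p" using Cons.prems(3) by (auto split: if_splits)
    then have "b # p \<in> ch F" using True by (simp add: ch_def)
    then show ?thesis by blast
  next
    case False
    then obtain q where "q \<in> ch F" "suffix q p" using Cons.IH[OF Cons.prems(1) Fp] by blast
    then show ?thesis using suffix_ConsI[of q p b] by blast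
  qed
qed (auto simp: FF_def)

lemma FF_parent: assumes "F \<in> FF" "F \<noteq> []" shows "F \<in> ch (stp (tl F))"
  using assms by (simp add: ch_def FF_def)

end

locale sparse_stopping = stopping_tree bad for bad +
  fixes s :: "bool list \<Rightarrow> real"
  assumes s0: "\<And>p. s p \<ge> 0"
    and sparse: "\<And>F Q. F \<in> FF \<Longrightarrow> finite Q \<Longrightarrow> Q \<subseteq> ch F \<Longrightarrow> sum s Q \<le> s F / 4"
begin

lemma finite_FF: "finite {F \<in> FF. length F \<le> N}"
  using finite_lists_length_le[of "UNIV :: bool set" N] by (rule rev_finite_subset) auto

text \<open>The geometric series 1 + 1/4 + ..., summed by induction from generation \<open>N\<close>
  up to \<open>F0\<close>; the cut at \<open>N\<close> makes the family finite.\<close>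

lemma carleson_FF:
  assumes "F0 \<in> FF" shows "(\<Sum>F | F \<in> FF \<and> length F \<le> N \<and> suffix F0 F. s F) \<le> 4 / 3 * s F0"
  using assms
proof (induction "N - length F0" arbitrary: F0 rule: less_induct)
  case less
  let ?S = "\<lambda>F0. {F. F \<in> FF \<and> length F \<le> N \<and> suffix F0 F}"
  have fS: "finite (?S F)" for F by (rule finite_subset[OF _ finite_FF[of N]]) auto
  show ?case
  proof (cases "length F0 \<le> N")
    case False
    have e: "?S F0 = {}" using False suffix_length_le by fastforce
    show ?thesis unfolding e using s0[of F0] by simp
  next
    case True
    define Q where "Q = {q \<in> ch F0. length q \<le> N}"
    have fQ: "finite Q" by (rule finite_subset[OF _ finite_FF[of N]]) (auto simp: Q_def ch_FF)
    have sub: "?S F0 \<subseteq> insert F0 (\<Union>q\<in>Q. ?S q)"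
    proof
      fix F assume F: "F \<in> ?S F0"
      show "F \<in> insert F0 (\<Union>q\<in>Q. ?S q)"
      proof (cases "F = F0")
        case False
        then have "stp F \<noteq> F0" using F by (simp add: FF_def)
        then obtain q where q: "q \<in> ch F0" "suffix q F" using ex_ch[OF less.prems, of F] F by auto
        then have "length q \<le> N" using suffix_length_le[of q F] F by auto
        then show ?thesis using q F by (auto simp: Q_def)
      qed simp
    qed
    have "sum s (?S F0) \<le> sum s (insert F0 (\<Union>q\<in>Q. ?S q))"
      by (rule sum_mono2[OF _ sub]) (use fQ fS s0 in auto)
    also have "\<dots> \<le> s F0 + sum s (\<Union>q\<in>Q. ?S q)"
      using s0 fQ fS by (simp add: sum.insert_if)
    also have "sum s (\<Union>q\<in>Q. ?S q) \<le> (\<Sum>q\<in>Q. sum s (?S q))"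
      by (rule sum_UN_le) (use fQ fS s0 in auto)
    also have "(\<Sum>q\<in>Q. sum s (?S q)) \<le> (\<Sum>q\<in>Q. 4 / 3 * s q)"
    proof (rule sum_mono)
      fix q assume q: "q \<in> Q"
      then have "length F0 < length q" "length q \<le> N" using ch_suffix(4) by (auto simp: Q_def)
      then show "sum s (?S q) \<le> 4 / 3 * s q"
        using less.hyps[of q] q ch_FF(1) by (auto simp: Q_def)
    qed
    also have "\<dots> = 4 / 3 * sum s Q" by (simp add: sum_distrib_left)
    also have "sum s Q \<le> s F0 / 4" by (rule sparse[OF less.prems fQ]) (auto simp: Q_def)
    finally show ?thesis by simp
  qed
qed

end

subsection \<open>Testing for the measure of stopping data\<close>

text \<open>Cauchy-Schwarz with weights 2^d. In its use \<open>d\<close> counts nested stopping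
  intervals, and their measure decays like 4^-d, which absorbs the weights.\<close>

lemma weighted_sum_square_le:
  fixes y :: "nat \<Rightarrow> real"
  shows "(\<Sum>d\<le>M. y d)\<^sup>2 \<le> 2 * (\<Sum>d\<le>M. 2 ^ d * (y d)\<^sup>2)"
proof -
  have "(\<Sum>d\<le>M. y d)\<^sup>2 = (\<Sum>d\<le>M. 1 * (2 ^ d * y d) * (1 / 2) ^ d)\<^sup>2"
    by (simp add: power_one_over)
  also have "\<dots> \<le> (\<Sum>d\<le>M. 1\<^sup>2 * (1 / 2) ^ d) * (\<Sum>d\<le>M. (2 ^ d * y d)\<^sup>2 * (1 / 2) ^ d)"
    by (rule weighted_Cauchy_Schwarz) simp
  also have "(\<Sum>d\<le>M. (2 ^ d * y d)\<^sup>2 * (1 / 2) ^ d) = (\<Sum>d\<le>M. 2 ^ d * (y d)\<^sup>2)"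
    by (intro sum.cong refl) (simp add: power_mult_distrib power2_eq_square power_one_over)
  also have "(\<Sum>d\<le>M. 1\<^sup>2 * (1 / 2 :: real) ^ d) \<le> 2"
  proof -
    have "(\<Sum>d\<le>M. (1 / 2 :: real) ^ d) \<le> (\<Sum>d. (1 / 2) ^ d)" by (rule sum_le_suminf) (auto intro!: summable_geometric)
    also have "\<dots> = 2" by (subst suminf_geometric) auto
    finally show ?thesis by simp
  qed
  finally show ?thesis by (simp add: mult_right_mono sum_nonneg)
qed

text \<open>\<open>far\<close> is the content of \<open>good_far\<close>, stated for an arbitrary
  finite family \<open>G\<close>. In the end \<open>G\<close> is the part of the Haar support of g
  from generation \<open>r\<close> on.\<close>

locale pair_stopping = weight_pair a L \<sigma> w + stopping_tree bad
  for a L \<sigma> w bad +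
  fixes N r :: nat and G :: "bool list set"
  assumes sparse_s: "\<And>F Q. F \<in> FF \<Longrightarrow> finite Q \<Longrightarrow> Q \<subseteq> ch F \<Longrightarrow> sum s Q \<le> s F / 4"
    and finG: "finite G" and lenG: "\<And>q. q \<in> G \<Longrightarrow> r \<le> length q \<and> length q \<le> N"
    and far: "\<And>q F x y. q \<in> G \<Longrightarrow> suffix F q \<Longrightarrow> length F + r \<le> length q \<Longrightarrow> x \<in> iv q \<Longrightarrow> y \<notin> iv F \<Longrightarrow> wd q \<le> \<bar>x - y\<bar>"
begin

sublocale sparse_stopping bad s
  by unfold_locales (use sparse_s in auto)

text \<open>An interval \<open>J\<close> is assigned to the stopping interval of its ancestor \<open>r\<close> generations up. The
  intervals \<open>V q\<close> take the place of a Whitney decomposition of the stopping interval.\<close>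

definition "Fd q = stp (drop r q)"
definition "VV n q = (ARG_MIN length v. suffix v q \<and> v \<in> G \<and> n \<le> length v)"
definition "V q = VV (length (Fd q) + r) q"

lemma Fd_FF [simp]: "Fd q \<in> FF" by (simp add: Fd_def)

lemma Fd_suffix: "suffix (Fd q) (drop r q)" "suffix (Fd q) q"
proof -
  show 1: "suffix (Fd q) (drop r q)" unfolding Fd_def by (rule suffix_stp)
  show "suffix (Fd q) q" by (rule suffix_order.trans[OF 1 suffix_drop])
qed

lemma below_len: assumes "q \<in> G" "suffix F (drop r q)" shows "length F + r \<le> length q"
  using suffix_length_le[OF assms(2)] lenG[OF assms(1)] by auto

lemma VV_props:
  assumes "q \<in> G" "n \<le> length q"
  shows "suffix (VV n q) q" "VV n q \<in> G" "n \<le> length (VV n q)"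
proof -
  have "suffix (VV n q) q \<and> VV n q \<in> G \<and> n \<le> length (VV n q)"
    unfolding VV_def by (rule arg_min_natI[where k = q]) (use assms in auto)
  then show "suffix (VV n q) q" "VV n q \<in> G" "n \<le> length (VV n q)" by auto
qed

lemma VV_min:
  assumes "q \<in> G" "n \<le> length q" "suffix v q" "v \<in> G" "n \<le> length v" shows "suffix (VV n q) v"
proof -
  have "length (VV n q) \<le> length v"
    unfolding VV_def by (rule arg_min_nat_le) (use assms in auto)
  then show ?thesis using suffix_length_suffix[OF VV_props(1)[OF assms(1,2)] assms(3)] by blast
qed

text \<open>For a fixed \<open>n\<close> the intervals \<open>VV n q\<close> are the maximal members
  of \<open>G\<close> among those of generation at least \<open>n\<close>.\<close>

lemma VV_antichain:
  assumes "q \<in> G" "n \<le> length q" "q' \<in> G" "n \<le> length q'" "suffix (VV n q) (VV n q')"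
  shows "VV n q = VV n q'"
proof -
  have "suffix (VV n q) q'" using assms(5) VV_props(1)[OF assms(3,4)] suffix_order.trans by blast
  then have "suffix (VV n q') (VV n q)" using VV_min[OF assms(3,4)] VV_props[OF assms(1,2)] by blast
  then show ?thesis using assms(5) suffix_order.antisym by blast
qed

lemma V_props: assumes "q \<in> G"
  shows "suffix (V q) q" "V q \<in> G" "length (Fd q) + r \<le> length (V q)" "length (V q) \<le> N" "suffix (Fd q) (V q)"
proof -
  have n: "length (Fd q) + r \<le> length q" by (rule below_len[OF assms Fd_suffix(1)])
  show 1: "suffix (V q) q" "V q \<in> G" "length (Fd q) + r \<le> length (V q)"
    unfolding V_def using VV_props[OF assms n] by auto
  then show "length (V q) \<le> N" using lenG by blast
  show "suffix (Fd q) (V q)" using suffix_length_suffix[OF Fd_suffix(2) 1(1)] 1(3) by simp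
qed

text \<open>The point is outside \<open>B\<close>, and \<open>v\<close> lies \<open>r\<close>
  generations inside \<open>B\<close>; by goodness its distance to \<open>V q\<close> is at least
  the width of \<open>v\<close>. Passing from \<open>V q\<close> to the larger \<open>v\<close>
  multiplies the width plus the distance by at most 3. Thus the interval may be chosen relative to
  \<open>B\<close> in place of \<open>Fd q\<close>.\<close>

lemma VV_compare:
  assumes q: "q \<in> G" and B: "suffix B (Fd q)" and x: "lo x \<notin> iv B"
  defines "v \<equiv> VV (length B + r) q"
  shows "suffix v (V q)" "suffix B v" "pk (wd (V q)) (lo x - lo (V q)) \<le> 9 * pk (wd v) (lo x - lo v)"
proof -
  have lB: "length B \<le> length (Fd q)" by (rule suffix_length_le[OF B])
  have n: "length B + r \<le> length q" using below_len[OF q Fd_suffix(1)] lB by simp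
  note v = VV_props[OF q n, folded v_def]
  show vV: "suffix v (V q)" unfolding v_def
    by (rule VV_min[OF q n]) (use V_props[OF q] lB in auto)
  have "suffix B q" using B Fd_suffix(2) suffix_order.trans by blast
  then show Bv: "suffix B v" using suffix_length_suffix[of B q v] v by simp
  have "lo (V q) \<in> iv v" using iv_mono[OF vV] by auto
  then have d: "wd v \<le> \<bar>lo (V q) - lo x\<bar>" using far[OF v(2) Bv v(3) _ x] by blast
  have e: "lo v \<le> lo (V q)" "lo (V q) \<le> lo v + wd v" using \<open>lo (V q) \<in> iv v\<close> unfolding iv_def by auto
  have "wd v + \<bar>lo x - lo v\<bar> \<le> 3 * \<bar>lo x - lo (V q)\<bar>" using d e by (auto simp: abs_if split: if_splits)
  also have "\<dots> \<le> 3 * (wd (V q) + \<bar>lo x - lo (V q)\<bar>)" by simp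
  finally have "(wd v + \<bar>lo x - lo v\<bar>)\<^sup>2 \<le> (3 * (wd (V q) + \<bar>lo x - lo (V q)\<bar>))\<^sup>2"
    by (intro power_mono) (auto intro: add_nonneg_nonneg)
  then have "9 / (3 * (wd (V q) + \<bar>lo x - lo (V q)\<bar>))\<^sup>2 \<le> 9 / (wd v + \<bar>lo x - lo v\<bar>)\<^sup>2"
    by (intro divide_left_mono mult_pos_pos zero_less_power) (auto intro: add_pos_nonneg)
  then show "pk (wd (V q)) (lo x - lo (V q)) \<le> 9 * pk (wd v) (lo x - lo v)"
    unfolding pk_def power_mult_distrib by simp
qed

end

section \<open>The primal testing condition on one window\<close>

text \<open>The window consists of whole atoms, so the left endpoint of an atom decides whether the
  atom is inside.\<close>

locale testing_window = pair_stopping a L \<sigma> w bad N r G for a L \<sigma> w bad N r G +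
  fixes p p' :: real
  assumes window: "p < p'" "{p..<p'} = (\<Union>x\<in>{x \<in> atoms N. lo x \<in> {p..<p'}}. iv x)"
begin

abbreviation "R \<equiv> {p..<p'}"
definition "XR = {x \<in> atoms N. lo x \<in> R}"

lemma finXR [simp]: "finite XR" by (rule finite_subset[OF _ finite_atoms[of N]]) (auto simp: XR_def)

lemma XR_eq: "XR = {x \<in> atoms N. iv x \<subseteq> R}"
proof -
  have "iv x \<subseteq> R" if "x \<in> atoms N" "lo x \<in> R" for x using window(2) that by blast
  moreover have "lo x \<in> R" if "iv x \<subseteq> R" for x using that lo_in_iv by blast
  ultimately show ?thesis by (auto simp only: XR_def mem_Collect_eq)
qed

definition "YR = {q \<in> G. iv (V q) \<subseteq> R}"
definition "k q x = s x * pk (wd (V q)) (lo x - lo (V q))"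

lemma k_nonneg [simp]: "k q x \<ge> 0" by (simp add: k_def)

text \<open>If \<open>Fd q\<close> is not contained in the window, the intervals \<open>V q\<close>
  overlap boundedly and the energy estimate applies directly. The other case needs the layers
  introduced below.\<close>

definition "Yout = {q \<in> YR. \<not> iv (Fd q) \<subseteq> R}"
definition "Yin = {q \<in> YR. iv (Fd q) \<subseteq> R}"

lemma fin_Y: "finite YR" "finite Yout" "finite Yin" using finG by (auto simp: YR_def Yout_def Yin_def)

text \<open>The intervals counted here lie between \<open>Fd q\<close> and its descendants of generation \<open>r\<close>.\<close>

lemma out_depth:
  assumes q: "q \<in> Yout" shows "card {v \<in> V ` Yout. strict_suffix v (V q)} \<le> r"
proof -
  have qG: "q \<in> G" and F1: "\<not> iv (Fd q) \<subseteq> R" using q by (auto simp: Yout_def YR_def)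
  have "length ` {v \<in> V ` Yout. strict_suffix v (V q)} \<subseteq> {length (Fd q)..<length (Fd q) + r}"
  proof safe
    fix q2 assume q2: "q2 \<in> Yout" and ss: "strict_suffix (V q2) (V q)"
    then have q2G: "q2 \<in> G" and R2: "iv (V q2) \<subseteq> R" by (auto simp: Yout_def YR_def)
    have sv: "suffix (V q2) (V q)" using ss by (auto simp: strict_suffix_def)
    have "suffix (Fd q) (V q2)"
    proof (rule ccontr)
      assume "\<not> suffix (Fd q) (V q2)"
      then have "suffix (V q2) (Fd q)" using suffix_same_cases[OF sv V_props(5)[OF qG]] by blast
      then have "iv (Fd q) \<subseteq> R" using iv_mono R2 by blast
      then show False using F1 by blast
    qed
    then have "length (Fd q) \<le> length (V q2)" by (rule suffix_length_le)
    moreover have "length (V q2) < length (Fd q) + r"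
    proof (rule ccontr)
      assume "\<not> length (V q2) < length (Fd q) + r"
      then have "suffix (V q) (V q2)" unfolding V_def[of q]
        using VV_min[OF qG below_len[OF qG Fd_suffix(1)], of "V q2"] V_props[OF q2G] sv V_props(1)[OF qG] suffix_order.trans
        by fastforce
      then show False using ss by (auto simp: strict_suffix_def)
    qed
    ultimately show "length (V q2) \<in> {length (Fd q)..<length (Fd q) + r}" by simp
  qed
  then have "card (length ` {v \<in> V ` Yout. strict_suffix v (V q)}) \<le> r"
    using card_mono[of "{length (Fd q)..<length (Fd q) + r}"] by fastforce
  moreover have "inj_on length {v \<in> V ` Yout. strict_suffix v (V q)}"
  proof (rule inj_onI)
    fix v v' assume "v \<in> {v \<in> V ` Yout. strict_suffix v (V q)}" "v' \<in> {v \<in> V ` Yout. strict_suffix v (V q)}"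
      and l: "length v = length v'"
    then have "suffix v (V q)" "suffix v' (V q)" by (auto simp: strict_suffix_def)
    then show "v = v'" using l by (auto simp: suffix_def)
  qed
  ultimately show ?thesis by (simp add: card_image)
qed

text \<open>Sorting by the number of larger \<open>V\<close>-intervals gives at most r + 1
  antichains, to each of which \<open>level_bound\<close> applies.\<close>

lemma out_bound: "(\<Sum>q\<in>Yout. (xh q)\<^sup>2 * (\<Sum>x\<in>XR. k q x)\<^sup>2) \<le> (real r + 1) * (12960 * H\<^sup>2 * measure \<sigma> R)"
proof -
  define d where "d q = card {v \<in> V ` Yout. strict_suffix v (V q)}" for q
  have "(\<Sum>q\<in>Yout. (xh q)\<^sup>2 * (\<Sum>x\<in>XR. k q x)\<^sup>2) = (\<Sum>i\<in>{..r}. \<Sum>q | q \<in> Yout \<and> d q = i. (xh q)\<^sup>2 * (\<Sum>x\<in>XR. k q x)\<^sup>2)"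
    by (rule sum.group[symmetric]) (use fin_Y out_depth in \<open>auto simp: d_def\<close>)
  also have "\<dots> \<le> (\<Sum>i\<in>{..r}. 12960 * H\<^sup>2 * measure \<sigma> R)"
  proof (rule sum_mono)
    fix i assume "i \<in> {..r}"
    show "(\<Sum>q | q \<in> Yout \<and> d q = i. (xh q)\<^sup>2 * (\<Sum>x\<in>XR. k q x)\<^sup>2) \<le> 12960 * H\<^sup>2 * measure \<sigma> R"
    proof (rule level_bound[OF refl window(1), where v = V and N = N])
      show "V q = V q'" if "q \<in> {q \<in> Yout. d q = i}" "q' \<in> {q \<in> Yout. d q = i}" "suffix (V q) (V q')" for q q'
      proof (rule ccontr)
        assume "V q \<noteq> V q'"
        then have "strict_suffix (V q) (V q')" using that(3) by (simp add: strict_suffix_def)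
        then have "{v \<in> V ` Yout. strict_suffix v (V q)} \<subset> {v \<in> V ` Yout. strict_suffix v (V q')}"
          using that(1) suffix_order.less_trans by blast
        then have "d q < d q'" unfolding d_def using fin_Y(2) by (intro psubset_card_mono) auto
        then show False using that by simp
      qed
      show "(\<Sum>x\<in>XR. k q x) \<le> 9 * (\<Sum>x | x \<in> atoms N \<and> iv x \<subseteq> R. s x * pk (wd (V q)) (lo x - lo (V q)))" for q
        unfolding XR_eq k_def by (simp add: sum_nonneg)
      show "finite {q \<in> Yout. d q = i}" using fin_Y(2) by simp
    qed (use V_props in \<open>auto simp: Yout_def YR_def intro!: sum_nonneg\<close>)
  qed
  finally show ?thesis by (simp add: algebra_simps)
qed

text \<open>\<open>CC q\<close> is the chain of stopping intervals of the window around
  \<open>q\<close>, and \<open>ee q x\<close> counts those that also contain \<open>x\<close>. The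
  Poisson sum is cut into the layers \<open>yy d q\<close> by this count; layer 0 lies outside the
  whole chain.\<close>

definition "FR = {A \<in> FF. length A \<le> N \<and> iv A \<subseteq> R}"
definition "dep A = card {A' \<in> FR. strict_suffix A' A}"
definition "CC q = {A \<in> FR. suffix A (Fd q)}"
definition "ee q x = card {A \<in> CC q. suffix A x}"
definition "yy d q = (\<Sum>x | x \<in> XR \<and> ee q x = d. k q x)"

lemma fin_FR: "finite FR" by (rule finite_subset[OF _ finite_FF[of N]]) (auto simp: FR_def)

lemma fin_CC: "finite (CC q)" using fin_FR by (simp add: CC_def)

lemma yy_nonneg: "yy d q \<ge> 0" unfolding yy_def by (intro sum_nonneg) auto

lemma CC_chain: "A \<in> CC q \<Longrightarrow> A' \<in> CC q \<Longrightarrow> suffix A A' \<or> suffix A' A"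
  unfolding CC_def using suffix_same_cases by blast

lemma Fd_CC: assumes "q \<in> Yin" shows "Fd q \<in> CC q"
proof -
  have "q \<in> G" using assms by (auto simp: Yin_def YR_def)
  then have "length (Fd q) \<le> N" using below_len[OF _ Fd_suffix(1), of q] lenG[of q] by auto
  then show ?thesis using assms by (auto simp: CC_def FR_def Yin_def)
qed

lemma ee_le: assumes "q \<in> G" shows "ee q x \<le> Suc N"
proof -
  have "inj_on length (CC q)"
  proof (rule inj_onI)
    fix A A' assume "A \<in> CC q" "A' \<in> CC q" and l: "length A = length A'"
    then have "suffix A A' \<or> suffix A' A" using CC_chain by blast
    then show "A = A'" using l by (auto simp: suffix_def)
  qed
  then have "card (CC q) = card (length ` CC q)" by (simp add: card_image)
  also have "\<dots> \<le> card {..N}" by (rule card_mono) (auto simp: CC_def FR_def)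
  finally have "card (CC q) \<le> Suc N" by simp
  moreover have "ee q x \<le> card (CC q)" unfolding ee_def by (rule card_mono[OF fin_CC]) auto
  ultimately show ?thesis by simp
qed

lemma sum_k_eq: assumes "q \<in> G" shows "(\<Sum>x\<in>XR. k q x) = (\<Sum>d\<le>Suc N. yy d q)"
  unfolding yy_def by (rule sum.group[symmetric]) (use ee_le[OF assms] in auto)

lemma no_suffix_iv: assumes "x \<in> XR" "length B \<le> N" "\<not> suffix B x" shows "lo x \<notin> iv B"
proof
  assume "lo x \<in> iv B"
  then have "iv x \<inter> iv B \<noteq> {}" using lo_in_iv[of x] by blast
  then have "suffix x B" using iv_disjoint[of x B] assms(3) by blast
  moreover have "length x = N" using assms(1) by (auto simp: XR_def atoms_def)
  ultimately have "x = B" using assms(2) by (auto simp: suffix_def)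
  then show False using assms(3) by simp
qed

text \<open>By goodness the part of the measure outside of \<open>B q\<close> sees the intervals below
  \<open>VV (length B + r) q\<close> at a comparable distance, and these are an antichain, to which the
  energy estimate applies.\<close>

lemma hole_bound:
  assumes S: "S = {u..<u'}" "u < u'" and Q: "Q \<subseteq> Yin"
    and B: "\<And>q. q \<in> Q \<Longrightarrow> B q \<in> CC q" "\<And>q. q \<in> Q \<Longrightarrow> iv (B q) \<subseteq> S"
    and anti: "\<And>q q'. q \<in> Q \<Longrightarrow> q' \<in> Q \<Longrightarrow> suffix (B q) (B q') \<Longrightarrow> B q = B q'"
    and Z: "\<And>q. q \<in> Q \<Longrightarrow> Z q \<subseteq> {x \<in> XR. iv x \<subseteq> S \<and> \<not> suffix (B q) x}"
  shows "(\<Sum>q\<in>Q. (xh q)\<^sup>2 * (\<Sum>x\<in>Z q. k q x)\<^sup>2) \<le> 12960 * H\<^sup>2 * measure \<sigma> S"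
proof -
  define v where "v q = VV (length (B q) + r) q" for q
  have QG: "q \<in> G" if "q \<in> Q" for q using Q that by (auto simp: Yin_def YR_def)
  have BF: "suffix (B q) (Fd q)" "length (B q) \<le> N" if "q \<in> Q" for q using B(1)[OF that] by (auto simp: CC_def FR_def)
  have nq: "length (B q) + r \<le> length q" if "q \<in> Q" for q
    using below_len[OF QG[OF that] Fd_suffix(1)] suffix_length_le[OF BF(1)[OF that]] by simp
  have v: "suffix (v q) q" "v q \<in> G" "length (B q) + r \<le> length (v q)" if "q \<in> Q" for q
    unfolding v_def using VV_props[OF QG[OF that] nq[OF that]] by auto
  have Bv: "suffix (B q) (v q)" if "q \<in> Q" for q
  proof -
    have "suffix (B q) q" using BF(1)[OF that] Fd_suffix(2) suffix_order.trans by blast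
    then show ?thesis using suffix_length_suffix[of "B q" q "v q"] v[OF that] by simp
  qed
  show ?thesis
  proof (rule level_bound[OF S, where v = v and N = N])
    show "finite Q" using Q fin_Y(3) finite_subset by blast
    show "suffix (v q) q" "length (v q) \<le> N" if "q \<in> Q" for q using v[OF that] lenG by auto
    show "iv (v q) \<subseteq> S" if "q \<in> Q" for q using iv_mono[OF Bv[OF that]] B(2)[OF that] by blast
    show "v q = v q'" if qq: "q \<in> Q" "q' \<in> Q" "suffix (v q) (v q')" for q q'
    proof -
      have "suffix (B q) (v q')" using Bv[OF qq(1)] qq(3) suffix_order.trans by blast
      then have "suffix (B q) (B q') \<or> suffix (B q') (B q)" using Bv[OF qq(2)] suffix_same_cases by blast
      then have "B q = B q'" using anti[OF qq(1,2)] anti[OF qq(2,1)] by auto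
      then show ?thesis using VV_antichain[OF QG[OF qq(1)] nq[OF qq(1)] QG[OF qq(2)]] nq[OF qq(2)] qq(3)
        unfolding v_def by simp
    qed
    show "0 \<le> (\<Sum>x\<in>Z q. k q x)" for q by (intro sum_nonneg) auto
    fix q assume q: "q \<in> Q"
    have "(\<Sum>x\<in>Z q. k q x) \<le> (\<Sum>x\<in>Z q. 9 * (s x * pk (wd (v q)) (lo x - lo (v q))))"
    proof (rule sum_mono)
      fix x assume "x \<in> Z q"
      then have x: "x \<in> XR" "\<not> suffix (B q) x" using Z[OF q] by auto
      have "s x * pk (wd (V q)) (lo x - lo (V q)) \<le> s x * (9 * pk (wd (v q)) (lo x - lo (v q)))"
        unfolding v_def by (intro mult_left_mono VV_compare(3)[OF QG[OF q] BF(1)[OF q] no_suffix_iv[OF x(1) BF(2)[OF q] x(2)]]) simp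
      then show "k q x \<le> 9 * (s x * pk (wd (v q)) (lo x - lo (v q)))" by (simp add: k_def)
    qed
    also have "\<dots> = 9 * (\<Sum>x\<in>Z q. s x * pk (wd (v q)) (lo x - lo (v q)))" by (simp add: sum_distrib_left)
    also have "\<dots> \<le> 9 * (\<Sum>x | x \<in> atoms N \<and> iv x \<subseteq> S. s x * pk (wd (v q)) (lo x - lo (v q)))"
    proof (intro mult_left_mono sum_mono2)
      show "finite {x. x \<in> atoms N \<and> iv x \<subseteq> S}" by (rule finite_subset[OF _ finite_atoms[of N]]) auto
      show "Z q \<subseteq> {x. x \<in> atoms N \<and> iv x \<subseteq> S}" using Z[OF q] by (auto simp: XR_def)
    qed auto
    finally show "(\<Sum>x\<in>Z q. k q x) \<le> 9 * (\<Sum>x | x \<in> atoms N \<and> iv x \<subseteq> S. s x * pk (wd (v q)) (lo x - lo (v q)))" .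
  qed
qed

text \<open>Layer 0 avoids the largest interval of the chain, which is the hole for
  \<open>hole_bound\<close>. The largest intervals of different chains are equal or
  disjoint.\<close>

lemma in_bound_0: "(\<Sum>q\<in>Yin. (xh q)\<^sup>2 * (yy 0 q)\<^sup>2) \<le> 12960 * H\<^sup>2 * measure \<sigma> R"
proof -
  define B where "B q = (ARG_MIN length A. A \<in> CC q)" for q
  have B: "B q \<in> CC q" if "q \<in> Yin" for q
    unfolding B_def by (rule arg_min_natI[where k = "Fd q"]) (rule Fd_CC[OF that])
  have Bmin: "suffix (B q) A" if "q \<in> Yin" "A \<in> CC q" for q A
  proof -
    have "length (B q) \<le> length A" unfolding B_def using that(2) by (intro arg_min_nat_le)
    then show ?thesis using CC_chain[OF B[OF that(1)] that(2)] by (auto simp: suffix_def)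
  qed
  have "(\<Sum>q\<in>Yin. (xh q)\<^sup>2 * (\<Sum>x | x \<in> XR \<and> ee q x = 0. k q x)\<^sup>2) \<le> 12960 * H\<^sup>2 * measure \<sigma> R"
  proof (rule hole_bound[OF refl window(1) order_refl, where B = B])
    show "B q \<in> CC q" if "q \<in> Yin" for q by (rule B[OF that])
    then show "iv (B q) \<subseteq> R" if "q \<in> Yin" for q using that by (auto simp: CC_def FR_def)
    show "B q = B q'" if q: "q \<in> Yin" "q' \<in> Yin" "suffix (B q) (B q')" for q q'
    proof -
      have "B q \<in> CC q'" using B[OF q(1)] B[OF q(2)] q(3) suffix_order.trans by (auto simp: CC_def)
      then show ?thesis using Bmin[OF q(2)] q(3) suffix_order.antisym by blast
    qed
    show "{x \<in> XR. ee q x = 0} \<subseteq> {x \<in> XR. iv x \<subseteq> R \<and> \<not> suffix (B q) x}" if "q \<in> Yin" for q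
      using B[OF that] fin_CC[of q] by (auto simp: ee_def XR_eq)
  qed
  then show ?thesis by (simp add: yy_def)
qed

text \<open>The members of a chain that contain \<open>x\<close> are its largest ones, so a count of
  \<open>Suc (dep A)\<close> says that \<open>A\<close> is the smallest of them.\<close>

lemma ee_dep:
  assumes q: "q \<in> Yin" and A: "A \<in> CC q" "ee q x = Suc (dep A)"
  shows "suffix A x" "\<And>B. B \<in> CC q \<Longrightarrow> strict_suffix A B \<Longrightarrow> \<not> suffix B x"
proof -
  have above: "{A' \<in> FR. strict_suffix A' A} \<subseteq> CC q"
    using A(1) by (auto simp: CC_def strict_suffix_def intro: suffix_order.trans)
  show Ax: "suffix A x"
  proof (rule ccontr)
    assume n: "\<not> suffix A x"
    have "{A' \<in> CC q. suffix A' x} \<subseteq> {A' \<in> FR. strict_suffix A' A}"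
    proof
      fix A' assume A': "A' \<in> {A' \<in> CC q. suffix A' x}"
      then have "\<not> suffix A A'" using n suffix_order.trans by blast
      then have "strict_suffix A' A" using CC_chain[OF A(1), of A'] A' by (auto simp: strict_suffix_def)
      then show "A' \<in> {A' \<in> FR. strict_suffix A' A}" using A' by (auto simp: CC_def)
    qed
    then have "ee q x \<le> dep A" unfolding ee_def dep_def using fin_FR by (intro card_mono) auto
    then show False using A(2) by simp
  qed
  show "\<not> suffix B x" if B: "B \<in> CC q" "strict_suffix A B" for B
  proof
    assume Bx: "suffix B x"
    have "insert B (insert A {A' \<in> FR. strict_suffix A' A}) \<subseteq> {A' \<in> CC q. suffix A' x}"
      using above A(1) B(1) Bx Ax by (auto simp: strict_suffix_def intro: suffix_order.trans)
    then have "card (insert B (insert A {A' \<in> FR. strict_suffix A' A})) \<le> ee q x"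
      unfolding ee_def using fin_CC by (intro card_mono) auto
    moreover have "card (insert B (insert A {A' \<in> FR. strict_suffix A' A})) = Suc (Suc (dep A))"
    proof -
      have "B \<notin> insert A {A' \<in> FR. strict_suffix A' A}" "A \<notin> {A' \<in> FR. strict_suffix A' A}"
        using B(2) suffix_order.less_asym by auto
      then show ?thesis unfolding dep_def using fin_FR by simp
    qed
    ultimately show False using A(2) by simp
  qed
qed

lemma in_bound_A:
  assumes A: "A \<in> FR"
  shows "(\<Sum>q | q \<in> Yin \<and> A \<in> CC q. (xh q)\<^sup>2 * (yy (Suc (dep A)) q)\<^sup>2) \<le> 2 * (12960 * H\<^sup>2 * s A)"
proof -
  define d where "d = Suc (dep A)"
  define Q1 where "Q1 = {q \<in> Yin. A \<in> CC q \<and> Fd q = A}"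
  define Q2 where "Q2 = {q \<in> Yin. A \<in> CC q \<and> Fd q \<noteq> A}"
  let ?Z = "\<lambda>q. {x \<in> XR. ee q x = d}"
  have AFF: "A \<in> FF" using A by (auto simp: FR_def)
  have xA: "iv x \<subseteq> iv A" if "q \<in> Yin" "A \<in> CC q" "x \<in> ?Z q" for q x
    using ee_dep(1)[OF that(1,2)] that(3) iv_mono by (auto simp: d_def)
  have S: "iv A = {lo A..<lo A + wd A}" "lo A < lo A + wd A" by (auto simp: iv_def)
  have b1: "(\<Sum>q\<in>Q1. (xh q)\<^sup>2 * (yy d q)\<^sup>2) \<le> 12960 * H\<^sup>2 * measure \<sigma> (iv A)"
  proof (rule level_bound[OF S, where v = V and N = N])
    show "finite Q1" using fin_Y(3) by (simp add: Q1_def)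
    fix q assume q: "q \<in> Q1"
    then have qG: "q \<in> G" "Fd q = A" by (auto simp: Q1_def Yin_def YR_def)
    show "suffix (V q) q" "length (V q) \<le> N" using V_props[OF qG(1)] by auto
    show "iv (V q) \<subseteq> iv A" using iv_mono[OF V_props(5)[OF qG(1)]] qG(2) by simp
    show "0 \<le> yy d q" by (rule yy_nonneg)
    have "yy d q \<le> (\<Sum>x | x \<in> atoms N \<and> iv x \<subseteq> iv A. k q x)" unfolding yy_def
    proof (rule sum_mono2)
      show "finite {x. x \<in> atoms N \<and> iv x \<subseteq> iv A}" by (rule finite_subset[OF _ finite_atoms[of N]]) auto
      show "?Z q \<subseteq> {x. x \<in> atoms N \<and> iv x \<subseteq> iv A}" using xA[of q] q by (auto simp: Q1_def XR_def)
    qed simp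
    then show "yy d q \<le> 9 * (\<Sum>x | x \<in> atoms N \<and> iv x \<subseteq> iv A. s x * pk (wd (V q)) (lo x - lo (V q)))"
      unfolding k_def using sum_nonneg[of "{x. x \<in> atoms N \<and> iv x \<subseteq> iv A}" "\<lambda>x. s x * pk (wd (V q)) (lo x - lo (V q))"] by simp
  next
    fix q q' assume q: "q \<in> Q1" "q' \<in> Q1" "suffix (V q) (V q')"
    then have "q \<in> G" "q' \<in> G" "Fd q = A" "Fd q' = A" by (auto simp: Q1_def Yin_def YR_def)
    then show "V q = V q'"
      using VV_antichain[of q "length A + r" q'] below_len[OF _ Fd_suffix(1), of q] below_len[OF _ Fd_suffix(1), of q'] q(3)
      by (simp add: V_def)
  qed
  have "\<exists>B. B \<in> ch A \<and> suffix B (Fd q)" if "q \<in> Q2" for q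
  proof -
    have "suffix A (Fd q)" "Fd q \<noteq> A" using that by (auto simp: Q2_def CC_def)
    moreover have "stp (Fd q) = Fd q" by (simp add: Fd_def)
    ultimately show ?thesis using ex_ch[OF AFF, of "Fd q"] by auto
  qed
  then obtain B where B: "\<And>q. q \<in> Q2 \<Longrightarrow> B q \<in> ch A \<and> suffix (B q) (Fd q)" by metis
  have BCC: "B q \<in> CC q" "strict_suffix A (B q)" if q: "q \<in> Q2" for q
  proof -
    have ch: "B q \<in> ch A" "suffix (B q) (Fd q)" using B[OF q] by auto
    have AB: "suffix A (B q)" "A \<noteq> B q" using ch_suffix[OF ch(1)] by auto
    then show "strict_suffix A (B q)" by (simp add: strict_suffix_def)
    have "length (Fd q) \<le> N" using Fd_CC[of q] q by (auto simp: Q2_def CC_def FR_def)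
    then have "length (B q) \<le> N" using suffix_length_le[OF ch(2)] by simp
    moreover have "iv (B q) \<subseteq> R" using iv_mono[OF AB(1)] A by (auto simp: FR_def)
    ultimately show "B q \<in> CC q" using ch ch_FF(1) by (auto simp: CC_def FR_def)
  qed
  have b2: "(\<Sum>q\<in>Q2. (xh q)\<^sup>2 * (\<Sum>x\<in>?Z q. k q x)\<^sup>2) \<le> 12960 * H\<^sup>2 * measure \<sigma> (iv A)"
  proof (rule hole_bound[OF S, where B = B])
    show "Q2 \<subseteq> Yin" by (auto simp: Q2_def)
    show "B q \<in> CC q" if "q \<in> Q2" for q by (rule BCC(1)[OF that])
    show "iv (B q) \<subseteq> iv A" if "q \<in> Q2" for q
      using iv_mono[of A "B q"] BCC(2)[OF that] by (auto simp: strict_suffix_def)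
    show "B q = B q'" if "q \<in> Q2" "q' \<in> Q2" "suffix (B q) (B q')" for q q'
      by (rule ch_antichain[of _ A]) (use B that in auto)
    show "?Z q \<subseteq> {x \<in> XR. iv x \<subseteq> iv A \<and> \<not> suffix (B q) x}" if q: "q \<in> Q2" for q
    proof
      fix x assume x: "x \<in> ?Z q"
      have qA: "q \<in> Yin" "A \<in> CC q" using q by (auto simp: Q2_def)
      have "\<not> suffix (B q) x" using ee_dep(2)[OF qA _ BCC[OF q]] x by (auto simp: d_def)
      then show "x \<in> {x \<in> XR. iv x \<subseteq> iv A \<and> \<not> suffix (B q) x}" using x xA[OF qA x] by auto
    qed
  qed
  have "{q. q \<in> Yin \<and> A \<in> CC q} = Q1 \<union> Q2" "Q1 \<inter> Q2 = {}" "finite Q1" "finite Q2"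
    using fin_Y(3) by (auto simp: Q1_def Q2_def)
  then have "(\<Sum>q | q \<in> Yin \<and> A \<in> CC q. (xh q)\<^sup>2 * (yy d q)\<^sup>2)
     = (\<Sum>q\<in>Q1. (xh q)\<^sup>2 * (yy d q)\<^sup>2) + (\<Sum>q\<in>Q2. (xh q)\<^sup>2 * (yy d q)\<^sup>2)"
    by (simp add: sum.union_disjoint)
  then show ?thesis using b1 b2 by (simp add: d_def yy_def s_def)
qed

text \<open>An interval of depth d + 1 is a stopping child of one of depth d, and sparseness gains a
  factor 1/4 at each step.\<close>

lemma dep_carleson: "(\<Sum>A | A \<in> FR \<and> dep A = d. s A) \<le> (1 / 4) ^ d * measure \<sigma> R"
proof (induction d)
  case 0
  let ?S = "{A. A \<in> FR \<and> dep A = 0}"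
  have "(\<Sum>A\<in>?S. measure \<sigma> (iv A)) \<le> measure \<sigma> R"
  proof (rule lfb_measure_disjoint_le[OF \<sigma>])
    show "finite ?S" using fin_FR by simp
    show "iv A \<inter> iv A' = {}" if "A \<in> ?S" "A' \<in> ?S" "A \<noteq> A'" for A A'
    proof (rule iv_disjoint)
      show "\<not> suffix A A'" "\<not> suffix A' A"
        using that fin_FR by (auto simp: dep_def strict_suffix_def)
    qed
  qed (auto simp: FR_def)
  then show ?case by (simp add: s_def)
next
  case (Suc d)
  let ?S = "\<lambda>d. {A. A \<in> FR \<and> dep A = d}"
  have fS: "finite (?S d)" for d using fin_FR by simp
  define Q where "Q P = {A \<in> ch P. A \<in> FR}" for P
  have fQ: "finite (Q P)" for P using fin_FR by (simp add: Q_def)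
  have "?S (Suc d) \<subseteq> (\<Union>P\<in>?S d. Q P)"
  proof
    fix A assume "A \<in> ?S (Suc d)"
    then have A: "A \<in> FR" "dep A = Suc d" by auto
    then have "{A' \<in> FR. strict_suffix A' A} \<noteq> {}" unfolding dep_def by (metis card.empty nat.distinct(1))
    then obtain A' where A': "A' \<in> FR" "strict_suffix A' A" by blast
    then have nA: "A \<noteq> []" by (auto simp: strict_suffix_def)
    define P where "P = stp (tl A)"
    have chA: "A \<in> ch P" unfolding P_def using FF_parent[OF _ nA] A by (auto simp: FR_def)
    have up: "suffix B P" if "B \<in> FR" "strict_suffix B A" for B
    proof -
      have "suffix B (tl A)" using that(2) nA by (cases A) (auto simp: strict_suffix_def suffix_Cons)
      then show ?thesis unfolding P_def using FF_suffix_stp that(1) by (auto simp: FR_def)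
    qed
    have PA: "strict_suffix P A" using ch_suffix[OF chA] by (auto simp: strict_suffix_def)
    have "iv P \<subseteq> R" using iv_mono[OF up[OF A']] A'(1) by (auto simp: FR_def)
    moreover have "length P \<le> N" using ch_suffix(4)[OF chA] A(1) by (auto simp: FR_def)
    ultimately have P: "P \<in> FR" using ch_FF(2)[OF chA] by (auto simp: FR_def)
    have "{A' \<in> FR. strict_suffix A' A} = insert P {A' \<in> FR. strict_suffix A' P}"
      using up PA P by (auto simp: strict_suffix_def intro: suffix_order.trans dest: suffix_order.antisym)
    then have "dep A = Suc (dep P)" unfolding dep_def using fin_FR by simp
    then show "A \<in> (\<Union>P\<in>?S d. Q P)" using A P chA by (auto simp: Q_def)
  qed
  then have "(\<Sum>A\<in>?S (Suc d). s A) \<le> (\<Sum>A\<in>(\<Union>P\<in>?S d. Q P). s A)"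
    by (rule sum_mono2[rotated]) (use fS fQ in auto)
  also have "\<dots> \<le> (\<Sum>P\<in>?S d. sum s (Q P))" by (rule sum_UN_le[OF fS fQ]) simp
  also have "\<dots> \<le> (\<Sum>P\<in>?S d. s P / 4)"
    by (intro sum_mono sparse fQ) (auto simp: Q_def FR_def)
  also have "\<dots> = (\<Sum>P\<in>?S d. s P) / 4" by (simp add: sum_divide_distrib)
  also have "\<dots> \<le> (1 / 4) ^ d * measure \<sigma> R / 4" using Suc.IH by (intro divide_right_mono) auto
  finally show ?case by simp
qed

text \<open>A point in layer d + 1 of \<open>q\<close> has a smallest chain member around it, and
  this has depth d. So the sum can be distributed over the intervals \<open>A\<close> of that
  depth.\<close>

lemma in_bound_Suc: "(\<Sum>q\<in>Yin. (xh q)\<^sup>2 * (yy (Suc d) q)\<^sup>2) \<le> 25920 * H\<^sup>2 * ((1 / 4) ^ d * measure \<sigma> R)"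
proof -
  let ?g = "\<lambda>q. (xh q)\<^sup>2 * (yy (Suc d) q)\<^sup>2"
  let ?S = "{A. A \<in> FR \<and> dep A = d}"
  have fS: "finite ?S" using fin_FR by simp
  have z: "?g q = 0" if q: "q \<in> Yin" "\<And>A. A \<in> ?S \<Longrightarrow> A \<notin> CC q" for q
  proof -
    have "ee q x \<noteq> Suc d" if "x \<in> XR" for x
    proof
      assume e: "ee q x = Suc d"
      define W where "W = {A \<in> CC q. suffix A x}"
      have "card W = Suc d" using e by (simp add: W_def ee_def)
      then have W: "finite W" "W \<noteq> {}" by (auto intro: card_ge_0_finite)
      obtain A where A: "A \<in> W" "\<And>A'. A' \<in> W \<Longrightarrow> length A' \<le> length A"
        using Max_in[of "length ` W"] Max_ge[of "length ` W"] W by (metis (no_types, lifting) finite_imageI image_iff image_is_empty imageI)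
      have "W = insert A {A' \<in> FR. strict_suffix A' A}"
      proof (intro equalityI subsetI)
        fix A' assume A': "A' \<in> W"
        then have "suffix A' A" using suffix_length_suffix[of A' x A] A by (auto simp: W_def)
        then show "A' \<in> insert A {A' \<in> FR. strict_suffix A' A}" using A' by (auto simp: W_def CC_def strict_suffix_def)
      next
        fix A' assume "A' \<in> insert A {A' \<in> FR. strict_suffix A' A}"
        then show "A' \<in> W" using A(1) by (auto simp: W_def CC_def strict_suffix_def intro: suffix_order.trans)
      qed
      then have "ee q x = Suc (dep A)" unfolding ee_def W_def[symmetric] dep_def using fin_FR by simp
      then have "A \<in> ?S" using e A(1) by (auto simp: W_def CC_def)
      then show False using q(2) A(1) by (auto simp: W_def)
    qed
    then have "yy (Suc d) q = 0" unfolding yy_def by (intro sum.neutral) auto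
    then show ?thesis by simp
  qed
  have "sum ?g Yin = sum ?g (\<Union>A\<in>?S. {q. q \<in> Yin \<and> A \<in> CC q})"
    by (rule sum.mono_neutral_right) (use fin_Y(3) z in auto)
  also have "\<dots> \<le> (\<Sum>A\<in>?S. sum ?g {q. q \<in> Yin \<and> A \<in> CC q})"
    by (rule sum_UN_le[OF fS]) (use fin_Y(3) in auto)
  also have "\<dots> \<le> (\<Sum>A\<in>?S. 25920 * H\<^sup>2 * s A)"
  proof (rule sum_mono)
    fix A assume "A \<in> ?S"
    then show "sum ?g {q. q \<in> Yin \<and> A \<in> CC q} \<le> 25920 * H\<^sup>2 * s A" using in_bound_A[of A] by auto
  qed
  also have "\<dots> = 25920 * H\<^sup>2 * (\<Sum>A\<in>?S. s A)" by (simp add: sum_distrib_left)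
  also have "\<dots> \<le> 25920 * H\<^sup>2 * ((1 / 4) ^ d * measure \<sigma> R)" by (intro mult_left_mono dep_carleson) auto
  finally show ?thesis .
qed

text \<open>The weights 2^(d+1) against twice the decay 4^-d leave the series 4 * 2^-d; together
  with layer 0 and the factor of \<open>weighted_sum_square_le\<close> this is 2 * (1 + 4 * 2) =
  18.\<close>

lemma in_bound: "(\<Sum>q\<in>Yin. (xh q)\<^sup>2 * (\<Sum>x\<in>XR. k q x)\<^sup>2) \<le> 18 * (12960 * H\<^sup>2 * measure \<sigma> R)"
proof -
  define C where "C = 12960 * H\<^sup>2 * measure \<sigma> R"
  have C0: "C \<ge> 0" by (simp add: C_def)
  have "(\<Sum>q\<in>Yin. (xh q)\<^sup>2 * (\<Sum>x\<in>XR. k q x)\<^sup>2) \<le> (\<Sum>q\<in>Yin. (xh q)\<^sup>2 * (2 * (\<Sum>d\<le>Suc N. 2 ^ d * (yy d q)\<^sup>2)))"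
  proof (intro sum_mono mult_left_mono)
    fix q assume "q \<in> Yin"
    then have "q \<in> G" by (auto simp: Yin_def YR_def)
    then show "(\<Sum>x\<in>XR. k q x)\<^sup>2 \<le> 2 * (\<Sum>d\<le>Suc N. 2 ^ d * (yy d q)\<^sup>2)"
      unfolding sum_k_eq[OF \<open>q \<in> G\<close>] by (intro weighted_sum_square_le)
  qed simp
  also have "\<dots> = 2 * (\<Sum>d\<le>Suc N. 2 ^ d * (\<Sum>q\<in>Yin. (xh q)\<^sup>2 * (yy d q)\<^sup>2))"
    by (simp only: sum_distrib_left[of _ _ Yin] sum_distrib_left[of _ _ "{..Suc N}"]) (subst sum.swap, simp only: mult_ac)
  also have "\<dots> = 2 * ((\<Sum>q\<in>Yin. (xh q)\<^sup>2 * (yy 0 q)\<^sup>2) + (\<Sum>d\<le>N. 2 ^ Suc d * (\<Sum>q\<in>Yin. (xh q)\<^sup>2 * (yy (Suc d) q)\<^sup>2)))"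
    by (subst sum.atMost_Suc_shift) simp
  also have "\<dots> \<le> 2 * (C + (\<Sum>d\<le>N. 2 ^ Suc d * (2 * ((1 / 4) ^ d * C))))"
  proof (intro mult_left_mono add_mono sum_mono)
    show "(\<Sum>q\<in>Yin. (xh q)\<^sup>2 * (yy 0 q)\<^sup>2) \<le> C" unfolding C_def by (rule in_bound_0)
    show "(\<Sum>q\<in>Yin. (xh q)\<^sup>2 * (yy (Suc d) q)\<^sup>2) \<le> 2 * ((1 / 4) ^ d * C)" for d
      using in_bound_Suc[of d] unfolding C_def by (simp add: mult_ac)
  qed auto
  also have "(\<Sum>d\<le>N. 2 ^ Suc d * (2 * ((1 / 4) ^ d * C))) = 4 * C * (\<Sum>d\<le>N. (1 / 2) ^ d)"
  proof -
    have eq: "2 ^ Suc d * (2 * ((1 / 4) ^ d * C)) = 4 * C * (1 / 2) ^ d" for d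
    proof -
      have "(4::real) ^ d = 2 ^ d * 2 ^ d" by (simp flip: power_mult_distrib)
      then show ?thesis by (simp add: power_one_over)
    qed
    show ?thesis unfolding sum_distrib_left by (intro sum.cong refl eq)
  qed
  also have "2 * (C + 4 * C * (\<Sum>d\<le>N. (1 / 2) ^ d)) \<le> 2 * (C + 4 * C * 2)"
  proof -
    have "(\<Sum>d\<le>N. (1 / 2 :: real) ^ d) \<le> (\<Sum>d. (1 / 2) ^ d)" by (rule sum_le_suminf) (auto intro!: summable_geometric)
    also have "\<dots> = 2" by (subst suminf_geometric) auto
    finally show ?thesis using C0 by (intro mult_left_mono add_left_mono) auto
  qed
  finally show ?thesis by (simp add: C_def mult_ac)
qed

lemma window_bound: "(\<Sum>q\<in>YR. (xh q)\<^sup>2 * (\<Sum>x\<in>XR. k q x)\<^sup>2) \<le> (real r + 19) * (12960 * H\<^sup>2 * measure \<sigma> R)"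
proof -
  have "YR = Yout \<union> Yin" "Yout \<inter> Yin = {}" by (auto simp: Yout_def Yin_def)
  then have "(\<Sum>q\<in>YR. (xh q)\<^sup>2 * (\<Sum>x\<in>XR. k q x)\<^sup>2)
     = (\<Sum>q\<in>Yout. (xh q)\<^sup>2 * (\<Sum>x\<in>XR. k q x)\<^sup>2) + (\<Sum>q\<in>Yin. (xh q)\<^sup>2 * (\<Sum>x\<in>XR. k q x)\<^sup>2)"
    using fin_Y by (simp add: sum.union_disjoint)
  then show ?thesis using out_bound in_bound by (simp add: algebra_simps)
qed

end

section \<open>Arbitrary windows and the two weight inequality for the stopping data\<close>

context pair_stopping
begin

text \<open>The window is replaced by the union of the atoms whose left endpoints it contains. This
  is again an interval, it has the same points, and it contains every \<open>V y\<close> that the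
  original window contains.\<close>

lemma primal_testing:
  assumes pq: "p < q"
  shows "(\<Sum>y | y \<in> G \<and> iv (V y) \<subseteq> {p..<q}. (xh y)\<^sup>2 * (\<Sum>x | x \<in> atoms N \<and> lo x \<in> {p..<q}. s x * pk (wd (V y)) (lo x - lo (V y)))\<^sup>2)
    \<le> (real r + 19) * (12960 * H\<^sup>2 * (\<Sum>x | x \<in> atoms N \<and> lo x \<in> {p..<q}. s x))"
proof -
  define X0 where "X0 = {x \<in> atoms N. lo x \<in> {p..<q}}"
  have fin0: "finite X0" by (rule finite_subset[OF _ finite_atoms[of N]]) (auto simp: X0_def)
  show ?thesis
  proof (cases "X0 = {}")
    case True
    then show ?thesis unfolding X0_def[symmetric] by simp
  next
    case False
    define p' where "p' = Min (lo ` X0)"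
    define q' where "q' = Max (lo ` X0) + L / 2 ^ N"
    have wdN: "wd x = L / 2 ^ N" if "x \<in> atoms N" for x using that by (simp add: wd_def atoms_def)
    have "p' \<in> lo ` X0" unfolding p'_def using fin0 False by (intro Min_in) auto
    then obtain x1 where x1: "x1 \<in> X0" "p' = lo x1" by blast
    have "Max (lo ` X0) \<in> lo ` X0" using fin0 False by (intro Max_in) auto
    then obtain x2 where x2: "x2 \<in> X0" "Max (lo ` X0) = lo x2" by fastforce
    have at: "x1 \<in> atoms N" "x2 \<in> atoms N" using x1 x2 by (auto simp: X0_def)
    have q'x2: "q' = lo x2 + wd x2" using x2 wdN[OF at(2)] by (simp add: q'_def)
    have mn: "p' \<le> lo x" "lo x \<le> lo x2" if "x \<in> X0" for x
      unfolding p'_def x2(2)[symmetric] using fin0 that by auto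
    have c1: "lo x \<in> {p'..<q'} \<longleftrightarrow> x \<in> X0" if x: "x \<in> atoms N" for x
    proof
      assume z: "lo x \<in> {p'..<q'}"
      have "lo x \<le> lo x2"
      proof (rule ccontr)
        assume c: "\<not> lo x \<le> lo x2"
        then have ne: "x \<noteq> x2" by blast
        have "length x = N" "length x2 = N" using x at(2) by (auto simp only: atoms_def mem_Collect_eq)
        then have "\<not> suffix x x2" "\<not> suffix x2 x" using ne by (auto simp: suffix_def)
        then have "lo x + wd x \<le> lo x2 \<or> lo x2 + wd x2 \<le> lo x" by (rule iv_separated)
        moreover have "lo x < q'" using z by simp
        ultimately show False using c q'x2 wd_nonneg[of x] by linarith
      qed
      then show "x \<in> X0" using x z x1 x2 by (auto simp: X0_def)
    next
      assume "x \<in> X0"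
      note mn[OF this]
      moreover have "lo x2 < q'" using q'x2 wd_pos[of x2] by linarith
      ultimately show "lo x \<in> {p'..<q'}" by simp
    qed
    have win: "{p'..<q'} = (\<Union>x\<in>X0. iv x)"
    proof (intro equalityI subsetI)
      fix z assume z: "z \<in> {p'..<q'}"
      have "lo x1 \<ge> a" "lo x2 + wd x2 \<le> a + L"
        using iv_endpoints[of "[]" x1] iv_endpoints[of "[]" x2] by (auto simp: wd_def)
      then have "z \<in> iv []" using z x1 q'x2 by (auto simp: iv_Nil)
      then obtain x where x: "x \<in> atoms N" "z \<in> iv x" using iv_atoms[of "[]" N] by auto
      have "lo x1 \<le> lo x" by (rule atom_order[of _ _ "lo x1" z]) (use x x1 z at in \<open>auto simp: atoms_def\<close>)
      moreover have "lo x \<le> z" using x(2) by (simp add: iv_def)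
      ultimately have "x \<in> X0" using c1[OF x(1)] z x1 by auto
      then show "z \<in> (\<Union>x\<in>X0. iv x)" using x by blast
    next
      fix z assume "z \<in> (\<Union>x\<in>X0. iv x)"
      then obtain x where x: "x \<in> X0" "z \<in> iv x" by blast
      then have "wd x = wd x2" using wdN[of x] wdN[OF at(2)] by (simp add: X0_def)
      then show "z \<in> {p'..<q'}" using mn[OF x(1)] x(2) q'x2 by (auto simp: iv_def)
    qed
    have X0': "{x \<in> atoms N. lo x \<in> {p'..<q'}} = X0" using c1 by (auto simp: X0_def)
    have "p' < q'" using mn(1)[OF x2(1)] q'x2 wd_pos[of x2] by linarith
    then interpret tw: testing_window a L \<sigma> w bad N r G p' q'
      using win X0' by unfold_locales auto
    have XR: "tw.XR = X0" using X0' by (simp add: tw.XR_def)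
    have sub: "{y. y \<in> G \<and> iv (V y) \<subseteq> {p..<q}} \<subseteq> tw.YR"
    proof safe
      fix y assume y: "y \<in> G" "iv (V y) \<subseteq> {p..<q}"
      have "iv (V y) \<subseteq> (\<Union>x\<in>X0. iv x)"
      proof
        fix z assume "z \<in> iv (V y)"
        then obtain x where x: "x \<in> atoms N" "suffix (V y) x" "z \<in> iv x"
          using iv_atoms[OF V_props(4)[OF y(1)]] by auto
        have "lo x \<in> iv (V y)" using iv_mono[OF x(2)] lo_in_iv by blast
        then have "x \<in> X0" using y(2) x(1) by (auto simp: X0_def)
        then show "z \<in> (\<Union>x\<in>X0. iv x)" using x(3) by blast
      qed
      then show "y \<in> tw.YR" using y(1) win by (simp add: tw.YR_def)
    qed
    have meas: "measure \<sigma> {p'..<q'} \<le> sum s X0" unfolding win s_def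
      by (rule measure_subadditive_finite) (use fin0 lfb_sets[OF \<sigma>] lfb_not_top[OF \<sigma>] in auto)
    have "(\<Sum>y | y \<in> G \<and> iv (V y) \<subseteq> {p..<q}. (xh y)\<^sup>2 * (\<Sum>x\<in>X0. s x * pk (wd (V y)) (lo x - lo (V y)))\<^sup>2)
      \<le> (\<Sum>y\<in>tw.YR. (xh y)\<^sup>2 * (\<Sum>x\<in>X0. s x * pk (wd (V y)) (lo x - lo (V y)))\<^sup>2)"
      by (rule sum_mono2[OF tw.fin_Y(1) sub]) simp
    also have "\<dots> \<le> (real r + 19) * (12960 * H\<^sup>2 * measure \<sigma> {p'..<q'})"
      using tw.window_bound unfolding XR tw.k_def by simp
    also have "\<dots> \<le> (real r + 19) * (12960 * H\<^sup>2 * sum s X0)"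
      using meas by (intro mult_left_mono) auto
    finally show ?thesis unfolding X0_def .
  qed
qed

theorem functional_energy:
  assumes \<phi>0: "\<And>x. x \<in> atoms N \<Longrightarrow> \<phi> x \<ge> 0" and \<psi>0: "\<And>q. q \<in> G \<Longrightarrow> \<psi> q \<ge> 0"
  shows "(\<Sum>x\<in>atoms N. \<Sum>q\<in>G. \<phi> x * s x * (\<psi> q * (xh q)\<^sup>2) * pk (wd (V q)) (lo x - lo (V q)))
    \<le> 2703360 * (real r + 19) * H * ((\<Sum>x\<in>atoms N. (\<phi> x)\<^sup>2 * s x) + (\<Sum>q\<in>G. (\<psi> q)\<^sup>2 * (xh q)\<^sup>2))"
proof -
  \<comment> \<open>\<open>160 * (real r + 19)\<close> rounds up the square root of
    \<open>(real r + 19) * 12960\<close> and also covers the dual constant 2048. The final constant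
    is 16896 * 160.\<close>
  define T where "T = 160 * (real r + 19) * H"
  have T2: "T\<^sup>2 = (real r + 19) * (25600 * (real r + 19) * H\<^sup>2)" by (simp add: T_def power2_eq_square algebra_simps)
  have T1: "(real r + 19) * (12960 * H\<^sup>2 * S) \<le> T\<^sup>2 * S" "2048 * A2 * S \<le> T\<^sup>2 * S" if "S \<ge> 0" for S
  proof -
    have "12960 * H\<^sup>2 \<le> 25600 * (real r + 19) * H\<^sup>2" by (intro mult_right_mono) auto
    then have "(real r + 19) * (12960 * H\<^sup>2) \<le> T\<^sup>2" unfolding T2 by (intro mult_left_mono) auto
    then have "(real r + 19) * (12960 * H\<^sup>2) * S \<le> T\<^sup>2 * S" using that by (rule mult_right_mono)
    then show "(real r + 19) * (12960 * H\<^sup>2 * S) \<le> T\<^sup>2 * S" by (simp add: mult_ac)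
    have "2048 * A2 \<le> 2048 * H\<^sup>2" using A2_Tst_le_H(1) by simp
    also have "\<dots> \<le> (real r + 19) * (25600 * (real r + 19)) * H\<^sup>2"
    proof (rule mult_right_mono)
      have "1 * (25600 * 1) \<le> (real r + 19) * (25600 * (real r + 19))" by (intro mult_mono) auto
      then show "2048 \<le> (real r + 19) * (25600 * (real r + 19))" by simp
    qed simp
    finally have "2048 * A2 \<le> T\<^sup>2" unfolding T2 by (simp add: mult_ac)
    then show "2048 * A2 * S \<le> T\<^sup>2 * S" using that by (rule mult_right_mono)
  qed
  interpret pt: poisson_testing "atoms N" G lo s "\<lambda>q. lo (V q)" "\<lambda>q. wd (V q)" "\<lambda>q. (xh q)\<^sup>2" T
  proof unfold_locales
    fix p q :: real assume pq: "p < q"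
    show "(\<Sum>y | y \<in> G \<and> {lo (V y)..<lo (V y) + wd (V y)} \<subseteq> {p..<q}. (xh y)\<^sup>2 * (\<Sum>x | x \<in> atoms N \<and> lo x \<in> {p..<q}. s x * pk (wd (V y)) (lo x - lo (V y)))\<^sup>2)
        \<le> T\<^sup>2 * (\<Sum>x | x \<in> atoms N \<and> lo x \<in> {p..<q}. s x)"
      using primal_testing[OF pq] T1(1)[of "\<Sum>x | x \<in> atoms N \<and> lo x \<in> {p..<q}. s x"]
      unfolding iv_def by (meson order_trans s_nonneg sum_nonneg)
    have "(\<Sum>x | x \<in> atoms N \<and> lo x \<in> {p..<q}. s x * (\<Sum>y | y \<in> G \<and> {lo (V y)..<lo (V y) + wd (V y)} \<subseteq> {p..<q}. (xh y)\<^sup>2 * pk (wd (V y)) (lo x - lo (V y)))\<^sup>2)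
        \<le> 2048 * A2 * (\<Sum>y | y \<in> G \<and> {lo (V y)..<lo (V y) + wd (V y)} \<subseteq> {p..<q}. (xh y)\<^sup>2)"
      by (rule dual_testing[where N = N]) (use finG V_props in auto)
    also have "\<dots> \<le> T\<^sup>2 * (\<Sum>y | y \<in> G \<and> {lo (V y)..<lo (V y) + wd (V y)} \<subseteq> {p..<q}. (xh y)\<^sup>2)"
      by (rule T1(2)) (auto intro: sum_nonneg)
    finally show "(\<Sum>x | x \<in> atoms N \<and> lo x \<in> {p..<q}. s x * (\<Sum>y | y \<in> G \<and> {lo (V y)..<lo (V y) + wd (V y)} \<subseteq> {p..<q}. (xh y)\<^sup>2 * pk (wd (V y)) (lo x - lo (V y)))\<^sup>2)
        \<le> T\<^sup>2 * (\<Sum>y | y \<in> G \<and> {lo (V y)..<lo (V y) + wd (V y)} \<subseteq> {p..<q}. (xh y)\<^sup>2)" .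
  qed (use finG in \<open>auto simp: T_def\<close>)
  show ?thesis using pt.two_weight_poisson[of \<phi> \<psi>, OF \<phi>0 \<psi>0] by (simp add: T_def mult_ac)
qed

end

subsection \<open>Finite Haar sums\<close>

lemma strict_suffix_Cons_suffix:
  assumes "suffix p q" "p \<noteq> q" obtains b where "suffix (b # p) q"
proof -
  obtain zs where zs: "q = zs @ p" using assms(1) by (auto elim: suffixE)
  then have "zs \<noteq> []" using assms(2) by auto
  then have "q = butlast zs @ (last zs # p)" using zs by simp
  then have "suffix (last zs # p) q" by (rule suffixI)
  then show thesis by (rule that)
qed

lemma suffix_drop_iff: "suffix v (drop r q) \<longleftrightarrow> suffix v q \<and> (length v + r \<le> length q \<or> v = [])"
proof
  assume a: "suffix v (drop r q)"
  then have "suffix v q" using suffix_drop suffix_order.trans by blast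
  moreover have "length v \<le> length q - r" using suffix_length_le[OF a] by simp
  ultimately show "suffix v q \<and> (length v + r \<le> length q \<or> v = [])" by (cases "length q \<ge> r") auto
next
  assume a: "suffix v q \<and> (length v + r \<le> length q \<or> v = [])"
  then show "suffix v (drop r q)"
    using suffix_length_suffix[OF _ suffix_drop[of r q], of v] by auto
qed

context dyadic_tree
begin

definition "hv \<mu> v = haar \<mu> (iv (tl v)) (lo v)"
definition "hsum \<mu> A k x = (\<Sum>p\<in>A. k p * haar \<mu> (iv p) x)"

lemma haar_iv_const:
  assumes \<mu>: "locally_finite_borel \<mu>" and n: "\<not> suffix q p" and xy: "x \<in> iv q" "y \<in> iv q"
  shows "haar \<mu> (iv p) x = haar \<mu> (iv p) y"
proof -
  interpret haar_interval \<mu> "iv p" "lo p" "lo p + wd p" by (rule haar_iv[OF \<mu>])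
  show ?thesis
  proof (cases "suffix p q")
    case True
    moreover have "p \<noteq> q" using n by auto
    ultimately obtain b where "suffix (b # p) q" using strict_suffix_Cons_suffix by blast
    then have "iv q \<subseteq> iv (b # p)" by (rule iv_mono)
    then have "x \<in> iv (b # p)" "y \<in> iv (b # p)" using xy by auto
    then show ?thesis by (cases b) (simp_all add: haar_left haar_right left_child_iv right_child_iv)
  next
    case False
    then have "x \<notin> iv p" "y \<notin> iv p" using iv_disjoint[OF n False] xy by auto
    then show ?thesis by (simp add: haar_outside)
  qed
qed

lemma haar_value:
  assumes "locally_finite_borel \<mu>" "v \<noteq> []" "x \<in> iv v" shows "haar \<mu> (iv (tl v)) x = hv \<mu> v"
proof -
  have "\<not> suffix v (tl v)" using suffix_length_le[of v "tl v"] assms(2) by (cases v) auto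
  then show ?thesis unfolding hv_def using assms by (intro haar_iv_const) auto
qed

lemma hv_null:
  assumes "v \<noteq> []" "measure \<mu> (iv v) = 0" shows "hv \<mu> v = 0"
proof -
  obtain b p where v: "v = b # p" using assms(1) by (cases v) auto
  show ?thesis using assms(2) unfolding v hv_def haar_def by (cases b) (auto simp: left_child_iv right_child_iv)
qed

lemma average_hv:
  assumes \<mu>: "locally_finite_borel \<mu>" and v: "v \<noteq> []"
  shows "average \<mu> (iv v) (mart_diff \<mu> (iv (tl v)) f) = l2_inner \<mu> f (haar \<mu> (iv (tl v))) * hv \<mu> v"
proof (cases "measure \<mu> (iv v) = 0")
  case True
  then show ?thesis using hv_null[OF v] by (simp add: average_def)
next
  case False
  interpret haar_interval \<mu> "iv v" "lo v" "lo v + wd v" by (rule haar_iv[OF \<mu>])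
  show ?thesis
  proof (rule average_const)
    show "measure \<mu> (iv v) > 0" using False zero_less_measure_iff by blast
    show "mart_diff \<mu> (iv (tl v)) f x = l2_inner \<mu> f (haar \<mu> (iv (tl v))) * hv \<mu> v" if "x \<in> iv v" for x
      using haar_value[OF \<mu> v that] by (simp add: mart_diff_def)
  qed auto
qed

lemma haar_coeff_diff:
  assumes \<mu>: "locally_finite_borel \<mu>" and v: "v \<noteq> []" and f: "set_integrable \<mu> (iv (tl v)) f" and pos: "measure \<mu> (iv v) > 0"
  shows "l2_inner \<mu> f (haar \<mu> (iv (tl v))) * hv \<mu> v = average \<mu> (iv v) f - average \<mu> (iv (tl v)) f"
proof -
  obtain c p where b: "v = c # p" using v by (cases v) auto
  interpret haar_interval \<mu> "iv p" "lo p" "lo p + wd p" by (rule haar_iv[OF \<mu>])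
  have "average \<mu> (iv v) (mart_diff \<mu> (iv p) f) = average \<mu> (iv v) f - average \<mu> (iv p) f"
  proof (rule average_mart_diff)
    show "iv v = left_child (iv p) \<or> iv v = right_child (iv p)"
      unfolding b left_child_iv right_child_iv by (cases c) simp_all
  qed (use f pos b in auto)
  then show ?thesis using average_hv[OF \<mu> v, of f] b by simp
qed

lemma hsum_measurable [measurable]: "hsum \<mu> A k \<in> borel_measurable borel"
  unfolding hsum_def[abs_def] by measurable

lemma hsum_integrable:
  assumes "locally_finite_borel \<mu>" shows "integrable \<mu> (hsum \<mu> A k)"
  unfolding hsum_def[abs_def]
  by (intro Bochner_Integration.integrable_sum integrable_mult_right haar_interval.haar_integrable[OF haar_iv[OF assms]])

lemma hsum_integral:
  assumes "locally_finite_borel \<mu>" shows "(LINT x|\<mu>. hsum \<mu> A k x) = 0"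
  unfolding hsum_def
  by (subst Bochner_Integration.integral_sum)
    (auto intro!: integrable_mult_right haar_interval.haar_integrable[OF haar_iv[OF assms]] sum.neutral
      simp: haar_interval.haar_integral[OF haar_iv[OF assms]])

lemma hsum_outside:
  assumes "locally_finite_borel \<mu>" "\<And>p. p \<in> A \<Longrightarrow> suffix F p" "x \<notin> iv F" shows "hsum \<mu> A k x = 0"
  unfolding hsum_def
proof (intro sum.neutral ballI)
  fix p assume "p \<in> A"
  then have "x \<notin> iv p" using iv_mono[OF assms(2)] assms(3) by blast
  then show "k p * haar \<mu> (iv p) x = 0" using haar_interval.haar_outside[OF haar_iv[OF assms(1)]] by simp
qed

lemma hsum_sq_integrable:
  assumes "locally_finite_borel \<mu>" shows "integrable \<mu> (\<lambda>x. (hsum \<mu> A k x)\<^sup>2)"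
proof -
  have "(hsum \<mu> A k x)\<^sup>2 = (\<Sum>p\<in>A. \<Sum>q\<in>A. (k p * k q) * (haar \<mu> (iv p) x * haar \<mu> (iv q) x))" for x
    unfolding hsum_def power2_eq_square sum_product by (intro sum.cong refl) (simp add: mult_ac)
  then show ?thesis
    by (simp only:) (intro Bochner_Integration.integrable_sum integrable_mult_right haar_iv_mult_integrable[OF assms])
qed

lemma hsum_inner:
  assumes \<mu>: "locally_finite_borel \<mu>" and h: "\<And>p. p \<in> A \<Longrightarrow> integrable \<mu> (\<lambda>x. haar \<mu> (iv p) x * h x)"
  shows "l2_inner \<mu> (hsum \<mu> A k) h = (\<Sum>p\<in>A. k p * l2_inner \<mu> (haar \<mu> (iv p)) h)"
proof -
  have "l2_inner \<mu> (hsum \<mu> A k) h = (LINT x|\<mu>. (\<Sum>p\<in>A. k p * (haar \<mu> (iv p) x * h x)))"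
    unfolding l2_inner_def hsum_def sum_distrib_right by (simp only: mult.assoc)
  also have "\<dots> = (\<Sum>p\<in>A. LINT x|\<mu>. k p * (haar \<mu> (iv p) x * h x))"
    by (rule Bochner_Integration.integral_sum) (intro integrable_mult_right h)
  finally show ?thesis by (simp add: l2_inner_def)
qed

lemma hsum_coeff:
  assumes \<mu>: "locally_finite_borel \<mu>" and A: "finite A" and k: "\<And>p. p \<in> A \<Longrightarrow> haar_scale \<mu> (iv p) = 0 \<Longrightarrow> k p = 0"
  shows "l2_inner \<mu> (hsum \<mu> A k) (haar \<mu> (iv q)) = (if q \<in> A then k q else 0)"
proof -
  have "l2_inner \<mu> (hsum \<mu> A k) (haar \<mu> (iv q)) = (\<Sum>p\<in>A. k p * l2_inner \<mu> (haar \<mu> (iv p)) (haar \<mu> (iv q)))"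
    by (rule hsum_inner[OF \<mu> haar_iv_mult_integrable[OF \<mu>]])
  also have "\<dots> = (\<Sum>p\<in>A. if p = q then k q else 0)"
  proof (intro sum.cong refl)
    fix p assume "p \<in> A"
    then show "k p * l2_inner \<mu> (haar \<mu> (iv p)) (haar \<mu> (iv q)) = (if p = q then k q else 0)"
      using haar_iv_orthogonal[OF \<mu>, of p q] haar_interval.haar_norm[OF haar_iv[OF \<mu>], of p] k[of p]
      by (cases "haar_scale \<mu> (iv p) = 0"; cases "p = q"; simp)
  qed
  also have "\<dots> = (if q \<in> A then k q else 0)" using A by simp
  finally show ?thesis .
qed

lemma hsum_norm:
  assumes \<mu>: "locally_finite_borel \<mu>" and A: "finite A" and k: "\<And>p. p \<in> A \<Longrightarrow> haar_scale \<mu> (iv p) = 0 \<Longrightarrow> k p = 0"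
  shows "l2_norm \<mu> (hsum \<mu> A k) = sqrt (\<Sum>p\<in>A. (k p)\<^sup>2)"
proof -
  have int: "integrable \<mu> (\<lambda>x. haar \<mu> (iv p) x * hsum \<mu> A k x)" for p
    unfolding hsum_def sum_distrib_left
    by (intro Bochner_Integration.integrable_sum)
      (use integrable_mult_right[OF haar_iv_mult_integrable[OF \<mu>]] in \<open>auto simp: mult_ac\<close>)
  have "(LINT x|\<mu>. (hsum \<mu> A k x)\<^sup>2) = l2_inner \<mu> (hsum \<mu> A k) (hsum \<mu> A k)" by (simp add: l2_inner_def power2_eq_square)
  also have "\<dots> = (\<Sum>p\<in>A. k p * l2_inner \<mu> (haar \<mu> (iv p)) (hsum \<mu> A k))" by (rule hsum_inner[OF \<mu> int])
  also have "\<dots> = (\<Sum>p\<in>A. (k p)\<^sup>2)"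
    by (intro sum.cong refl) (simp add: l2_inner_commute[of _ "haar _ _"] hsum_coeff[OF \<mu> A k] power2_eq_square)
  finally show ?thesis by (simp add: l2_norm_def)
qed

end

section \<open>The bilinear form as a finite sum over the tree\<close>

context grid_tree
begin

lemma hsum_good_function:
  assumes \<mu>: "locally_finite_borel \<mu>" and A: "finite A" "\<And>p. p \<in> A \<Longrightarrow> suffix F p"
    and good: "\<And>p. p \<in> A \<Longrightarrow> k p \<noteq> 0 \<Longrightarrow> good_interval \<epsilon> r D (iv p)"
  shows "good_function \<epsilon> r D \<mu> (iv F) (hsum \<mu> A k)"
  unfolding good_function_def
proof (intro conjI)
  show "AE x in \<mu>. x \<notin> iv F \<longrightarrow> hsum \<mu> A k x = 0"
    by (intro AE_I2 impI hsum_outside[OF \<mu>]) (use A in auto)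
  show "\<exists>G c. finite G \<and> G \<subseteq> D \<and> (AE x in \<mu>. hsum \<mu> A k x = (\<Sum>I\<in>G. c I * haar \<mu> I x))"
  proof (intro exI conjI)
    show "finite (iv ` A)" "iv ` A \<subseteq> D" using A by auto
    have inj: "inj_on iv A" using iv_inj by (intro inj_onI) auto
    then show "AE x in \<mu>. hsum \<mu> A k x = (\<Sum>I\<in>iv ` A. k (inv_into A iv I) * haar \<mu> I x)"
      by (simp add: hsum_def sum.reindex)
  qed
  show "\<forall>I\<in>haar_support D \<mu> (hsum \<mu> A k). good_interval \<epsilon> r D I"
  proof
    fix I assume "I \<in> haar_support D \<mu> (hsum \<mu> A k)"
    then have I: "I \<in> D" "l2_inner \<mu> (hsum \<mu> A k) (haar \<mu> I) \<noteq> 0" by (auto simp: haar_support_def)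
    obtain u v where uv: "u < v" "I = {u..<v}" using grid_interval[OF D I(1)] .
    interpret I: haar_interval \<mu> I u v by unfold_locales (use uv \<mu> in auto)
    have "l2_inner \<mu> (hsum \<mu> A k) (haar \<mu> I) = (\<Sum>p\<in>A. k p * l2_inner \<mu> (haar \<mu> (iv p)) (haar \<mu> I))"
    proof (rule hsum_inner[OF \<mu>])
      fix p
      show "integrable \<mu> (\<lambda>x. haar \<mu> (iv p) x * haar \<mu> I x)"
        by (rule I.haar_mult_integrable)
          (rule haar_interval.haar_set_integrable[OF haar_iv[OF \<mu>]], simp)
    qed
    then obtain p where p: "p \<in> A" "k p * l2_inner \<mu> (haar \<mu> (iv p)) (haar \<mu> I) \<noteq> 0"
      using I(2) by (metis (no_types, lifting) sum.neutral)
    then have "iv p = I" using haar_orthogonal[OF D \<mu> iv_in_D I(1), of p] by fastforce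
    then show "good_interval \<epsilon> r D I" using good[OF p(1)] p(2) by auto
  qed
qed (use hsum_sq_integrable[OF \<mu>] hsum_integrable[OF \<mu>] hsum_integral[OF \<mu>] in auto)

lemma child_containing_iv:
  assumes "suffix (b # p) q" shows "child_containing (iv p) (iv q) = iv (b # p)"
proof -
  have "iv q \<subseteq> iv (b # p)" by (rule iv_mono[OF assms])
  moreover have "\<not> iv q \<subseteq> iv (False # p)" if "b"
  proof
    assume "iv q \<subseteq> iv (False # p)"
    then have "lo q \<in> iv (False # p)" using lo_in_iv by blast
    moreover have "lo q \<in> iv (True # p)" using \<open>iv q \<subseteq> iv (b # p)\<close> that lo_in_iv by auto
    ultimately show False using iv_split(2)[of p] by blast
  qed
  ultimately show ?thesis unfolding child_containing_def left_child_iv right_child_iv by (cases b) auto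
qed

lemma deep_inside_iv: "deep_inside r (iv q) (iv v) \<longleftrightarrow> suffix v q \<and> length v + r \<le> length q"
proof -
  have "2 ^ r * wd q \<le> wd v \<longleftrightarrow> (2::real) ^ (length v + r) \<le> 2 ^ length q"
    using L_pos by (simp add: wd_def power_add field_simps)
  also have "\<dots> \<longleftrightarrow> length v + r \<le> length q" by simp
  finally show ?thesis by (simp add: deep_inside_def iv_subset_iff)
qed

definition "th \<alpha> \<beta> \<sigma> w v q = l2_inner w (hilbert \<alpha> \<beta> \<sigma> (indicator (iv v))) (haar w (iv q))"

text \<open>An interval together with its child towards J is recorded by the child \<open>v\<close>
  alone, with \<open>tl v\<close> the interval itself. That J is deep inside the child becomes
  \<open>suffix v (drop r q)\<close>. The bound \<open>N\<close> on the Haar supports makes the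
  infinite sums finite.\<close>

lemma B_above_eq:
  assumes \<sigma>: "locally_finite_borel \<sigma>"
    and f: "\<And>p. N \<le> length p \<Longrightarrow> l2_inner \<sigma> f (haar \<sigma> (iv p)) = 0" and g: "\<And>q. N \<le> length q \<Longrightarrow> l2_inner w g (haar w (iv q)) = 0"
  shows "B_above \<alpha> \<beta> r D \<sigma> w (iv F) f g = (\<Sum>q | length q < N. \<Sum>v | v \<noteq> [] \<and> suffix v (drop r q) \<and> suffix F (tl v).
    l2_inner w g (haar w (iv q)) * (l2_inner \<sigma> f (haar \<sigma> (iv (tl v))) * hv \<sigma> v) * th \<alpha> \<beta> \<sigma> w v q)"
proof -
  define X where "X v q = l2_inner w g (haar w (iv q)) * (l2_inner \<sigma> f (haar \<sigma> (iv (tl v))) * hv \<sigma> v) * th \<alpha> \<beta> \<sigma> w v q" for v q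
  define W where "W I J = average \<sigma> (child_containing I J) (mart_diff \<sigma> I f) *
        l2_inner w (hilbert \<alpha> \<beta> \<sigma> (indicator (child_containing I J))) (mart_diff w J g)" for I J
  have W: "W (iv (tl v)) (iv q) = X v q" if v: "v \<noteq> []" "suffix v q" for v q
  proof -
    obtain b p where b: "v = b # p" using v by (cases v) auto
    have "l2_inner w h (mart_diff w (iv q) g) = l2_inner w g (haar w (iv q)) * l2_inner w h (haar w (iv q))" for h
    proof -
      have "l2_inner w h (mart_diff w (iv q) g) = (LINT x|w. l2_inner w g (haar w (iv q)) * (h x * haar w (iv q) x))"
        unfolding l2_inner_def[of w h] mart_diff_def by (simp only: mult_ac)
      then show ?thesis by (simp add: l2_inner_def)
    qed
    moreover have "child_containing (iv (tl v)) (iv q) = iv v" using child_containing_iv v b by simp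
    ultimately show ?thesis unfolding W_def X_def th_def by (simp add: average_hv[OF \<sigma> v(1)])
  qed
  \<comment> \<open>Empty or the single child of \<open>p\<close> towards the r-th ancestor of
    \<open>q\<close>; a sum over it treats the missing child as 0.\<close>
  define E where "E p q = {v. v \<noteq> [] \<and> suffix v (drop r q) \<and> tl v = p}" for p q :: "bool list"
  have finS: "finite {v. v \<noteq> [] \<and> suffix v (drop r q) \<and> P v}" for q :: "bool list" and P
    by (rule finite_subset[OF _ finite_suffixes[of "drop r q"]]) auto
  have E1: "E p q = {v}" if "v \<in> E p q" for p q v
  proof -
    have "v' = v" if v': "v' \<in> E p q" for v'
    proof -
      have "suffix v (drop r q)" "suffix v' (drop r q)" "length v = length v'"
        using v' \<open>v \<in> E p q\<close> unfolding E_def by (cases v; cases v'; auto)+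
      then show "v' = v" by (auto simp: suffix_def)
    qed
    then show ?thesis using that by blast
  qed
  have inner: "(\<Sum>\<^sub>\<infinity>J\<in>{J\<in>D. deep_inside r J (child_containing (iv p) J)}. W (iv p) J) = (\<Sum>q | length q < N. \<Sum>v\<in>E p q. X v q)" for p
  proof -
    have set: "{J\<in>D. deep_inside r J (child_containing (iv p) J)} = iv ` {q. E p q \<noteq> {}}" (is "?A = _")
    proof (intro equalityI subsetI)
      fix J assume "J \<in> ?A"
      then have J: "J \<in> D" "deep_inside r J (child_containing (iv p) J)" by auto
      obtain b where b: "child_containing (iv p) J = iv (b # p)"
        unfolding child_containing_def left_child_iv right_child_iv by metis
      then have "J \<subseteq> iv (b # p)" using J(2) by (simp add: deep_inside_def)
      then obtain q where q: "suffix (b # p) q" "J = iv q" using D_subset_iv[OF J(1)] by blast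
      have "deep_inside r (iv q) (iv (b # p))" using J(2) b q(2) by simp
      then have "suffix (b # p) (drop r q)" unfolding deep_inside_iv suffix_drop_iff by simp
      then have "b # p \<in> E p q" by (simp add: E_def)
      then show "J \<in> iv ` {q. E p q \<noteq> {}}" using q(2) by blast
    next
      fix J assume "J \<in> iv ` {q. E p q \<noteq> {}}"
      then obtain q v where q: "J = iv q" "v \<in> E p q" by blast
      then obtain b where b: "v = b # p" "suffix (b # p) (drop r q)" unfolding E_def by (cases v) auto
      then have "suffix (b # p) q" "length (b # p) + r \<le> length q" unfolding suffix_drop_iff by auto
      then show "J \<in> ?A" unfolding q(1) by (simp add: child_containing_iv deep_inside_iv)
    qed
    have inj: "inj_on iv {q. E p q \<noteq> {}}" using iv_inj by (intro inj_onI) auto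
    have "(\<Sum>\<^sub>\<infinity>J\<in>?A. W (iv p) J) = (\<Sum>\<^sub>\<infinity>q\<in>{q. E p q \<noteq> {}}. W (iv p) (iv q))"
      unfolding set infsum_reindex[OF inj] by (simp add: o_def)
    also have "\<dots> = (\<Sum>\<^sub>\<infinity>q\<in>{q. length q < N}. \<Sum>v\<in>E p q. X v q)"
    proof (rule infsum_cong_neutral)
      fix q assume "q \<in> {q. E p q \<noteq> {}} - {q. length q < N}"
      then obtain v where v: "v \<in> E p q" and l: "N \<le> length q" by auto
      then have "W (iv p) (iv q) = X v q" using W[of v q] unfolding E_def suffix_drop_iff by auto
      then show "W (iv p) (iv q) = 0" using g[OF l] by (simp add: X_def)
    next
      fix q assume "q \<in> {q. E p q \<noteq> {}} \<inter> {q. length q < N}"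
      then obtain v where v: "v \<in> E p q" by auto
      then have "W (iv p) (iv q) = X v q" using W[of v q] unfolding E_def suffix_drop_iff by auto
      then show "W (iv p) (iv q) = (\<Sum>v\<in>E p q. X v q)" unfolding E1[OF v] by simp
    qed auto
    finally show ?thesis by simp
  qed
  have set: "{I\<in>D. I \<subseteq> iv F} = iv ` {p. suffix F p}"
  proof (intro equalityI subsetI)
    fix I assume "I \<in> {I\<in>D. I \<subseteq> iv F}"
    then show "I \<in> iv ` {p. suffix F p}" using D_subset_iv[of I F] by blast
  next
    fix I assume "I \<in> iv ` {p. suffix F p}"
    then show "I \<in> {I\<in>D. I \<subseteq> iv F}" using iv_mono by auto
  qed
  have inj: "inj_on iv {p. suffix F p}" using iv_inj by (intro inj_onI) auto
  have "B_above \<alpha> \<beta> r D \<sigma> w (iv F) f g = (\<Sum>\<^sub>\<infinity>p\<in>{p. suffix F p}. \<Sum>\<^sub>\<infinity>J\<in>{J\<in>D. deep_inside r J (child_containing (iv p) J)}. W (iv p) J)"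
    unfolding B_above_def set infsum_reindex[OF inj] W_def by (simp add: o_def)
  also have "\<dots> = (\<Sum>\<^sub>\<infinity>p\<in>{p. suffix F p}. \<Sum>q | length q < N. \<Sum>v\<in>E p q. X v q)" by (simp only: inner)
  also have "\<dots> = (\<Sum>\<^sub>\<infinity>p\<in>{p. length p < N \<and> suffix F p}. \<Sum>q | length q < N. \<Sum>v\<in>E p q. X v q)"
  proof (rule infsum_cong_neutral)
    fix p assume "p \<in> {p. suffix F p} - {p. length p < N \<and> suffix F p}"
    then have "N \<le> length p" by auto
    then have "X v q = 0" if "v \<in> E p q" for v q using f[of p] that by (auto simp: X_def E_def)
    then show "(\<Sum>q | length q < N. \<Sum>v\<in>E p q. X v q) = 0" by simp
  qed auto
  also have "\<dots> = (\<Sum>p | length p < N \<and> suffix F p. \<Sum>q | length q < N. \<Sum>v\<in>E p q. X v q)"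
    by (rule infsum_finite) (rule finite_subset[OF _ finite_short(2)[of N]], auto)
  also have "\<dots> = (\<Sum>q | length q < N. \<Sum>p | length p < N \<and> suffix F p. \<Sum>v\<in>E p q. X v q)" by (rule sum.swap)
  also have "\<dots> = (\<Sum>q | length q < N. \<Sum>v | v \<noteq> [] \<and> suffix v (drop r q) \<and> suffix F (tl v). X v q)"
  proof (rule sum.cong[OF refl])
    fix q :: "bool list" assume q: "q \<in> {q. length q < N}"
    let ?S = "{v. v \<noteq> [] \<and> suffix v (drop r q) \<and> suffix F (tl v)}"
    have "(\<Sum>p | length p < N \<and> suffix F p. \<Sum>v\<in>E p q. X v q) = (\<Sum>p | length p < N \<and> suffix F p. \<Sum>v | v \<in> ?S \<and> tl v = p. X v q)"
      by (intro sum.cong refl) (auto simp: E_def)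
    also have "\<dots> = (\<Sum>v\<in>?S. X v q)"
    proof (rule sum.group)
      show "tl ` ?S \<subseteq> {p. length p < N \<and> suffix F p}"
      proof
        fix p assume "p \<in> tl ` ?S"
        then obtain v where v: "p = tl v" "v \<noteq> []" "suffix v (drop r q)" "suffix F (tl v)" by blast
        then have "length v \<le> length q" using suffix_length_le[OF v(3)] by simp
        then have "length p < N" using v(1,2) q by (cases v) auto
        then show "p \<in> {p. length p < N \<and> suffix F p}" using v by simp
      qed
    qed (use finS in \<open>auto intro: finite_subset[OF _ finite_short(2)[of N]]\<close>)
    finally show "(\<Sum>p | length p < N \<and> suffix F p. \<Sum>v\<in>E p q. X v q) = (\<Sum>v\<in>?S. X v q)" .
  qed
  finally show ?thesis unfolding X_def .
qed

end

subsection \<open>Calderon-Zygmund and energy stopping\<close>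

locale corona = grid_tree a L D + weight_pair a L \<sigma> w
  for a L D \<sigma> w +
  fixes \<epsilon> :: real and r :: nat and C0 \<alpha> \<beta> :: real and f g :: "real \<Rightarrow> real" and N :: nat
  assumes eps: "0 < \<epsilon>" "\<epsilon> < 1" and C0: "C0 > 0" and ab: "0 < \<alpha>" "\<alpha> < \<beta>"
    and energy: "energy_inequality C0 D \<sigma> w"
    and good_f: "good_function \<epsilon> r D \<sigma> (iv []) f" and good_g: "good_function \<epsilon> r D w (iv []) g"
    and f_N: "\<And>p. l2_inner \<sigma> f (haar \<sigma> (iv p)) \<noteq> 0 \<Longrightarrow> length p < N"
    and g_N: "\<And>q. l2_inner w g (haar w (iv q)) \<noteq> 0 \<Longrightarrow> length q < N"
begin

definition "fh p = l2_inner \<sigma> f (haar \<sigma> (iv p))"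
definition "gh q = l2_inner w g (haar w (iv q))"
definition "Ef p = average \<sigma> (iv p) f"
definition "fa p = average \<sigma> (iv p) (\<lambda>x. \<bar>f x\<bar>)"
definition "ma p = (LINT x:iv p|\<sigma>. \<bar>f x\<bar>)"
text \<open>The constant 8 and the factor 10 in the energy condition make the stopping intervals sparse:
  the children of \<open>F\<close> have at most the measure \<open>(1/8 + 1/10) \<sigma>(F)\<close>.\<close>

definition "bad F q \<longleftrightarrow> fa q > 8 * fa F \<or> iv q \<in> energy_violating C0 D \<sigma> w (iv F)"
definition "GG = {q. gh q \<noteq> 0 \<and> r \<le> length q}"

sublocale stopping_tree bad .

lemma f_int: "integrable \<sigma> f" and f_sq: "integrable \<sigma> (\<lambda>x. (f x)\<^sup>2)"
  using good_f unfolding good_function_def by blast+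

lemma g_int: "integrable w g" and g_sq: "integrable w (\<lambda>x. (g x)\<^sup>2)"
  using good_g unfolding good_function_def by blast+

lemma iv_sets [simp]: "iv p \<in> sets \<sigma>" "iv p \<in> sets w"
  by (simp_all add: lfb_sets[OF \<sigma>] lfb_sets[OF w])

lemma set_int: "integrable \<sigma> h \<Longrightarrow> set_integrable \<sigma> (iv p) h" for h :: "real \<Rightarrow> real"
  by (rule set_integrable_subset[of _ UNIV]) (simp_all add: set_integrable_def)

lemma set_int_w: "integrable w h \<Longrightarrow> set_integrable w (iv p) h" for h :: "real \<Rightarrow> real"
  by (rule set_integrable_subset[of _ UNIV]) (simp_all add: set_integrable_def)

lemma Ef_Nil: "Ef [] = 0"
proof -
  have "(LINT x:iv []|\<sigma>. f x) = (LINT x|\<sigma>. f x)" unfolding set_lebesgue_integral_def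
  proof (rule integral_cong_AE)
    have fm: "f \<in> borel_measurable \<sigma>" using f_int by simp
    show "(\<lambda>x. indicator (iv []) x *\<^sub>R f x) \<in> borel_measurable \<sigma>"
      by (intro borel_measurable_scaleR borel_measurable_indicator fm) simp
    show "f \<in> borel_measurable \<sigma>" by (rule fm)
    have "AE x in \<sigma>. x \<notin> iv [] \<longrightarrow> f x = 0" using good_f unfolding good_function_def by blast
    then show "AE x in \<sigma>. indicator (iv []) x *\<^sub>R f x = f x" by eventually_elim (auto simp: indicator_def)
  qed
  also have "\<dots> = 0" using good_f unfolding good_function_def by blast
  finally show ?thesis by (simp add: Ef_def average_def)
qed

lemma integral_null:
  assumes "s p = 0" shows "(LINT x:iv p|\<sigma>. h x) = (0::real)"
proof -
  have "emeasure \<sigma> (iv p) = 0" using assms lfb_emeasure[OF \<sigma>, of "iv p"] by (simp add: s_def)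
  then have "AE x in \<sigma>. indicator (iv p) x *\<^sub>R h x = 0"
    by (intro AE_I[where N = "iv p"]) (auto simp: indicator_def)
  then show ?thesis unfolding set_lebesgue_integral_def by (rule integral_eq_zero_AE)
qed

lemma ma_eq: "ma p = fa p * s p"
  using integral_null[of p] by (cases "s p = 0") (simp_all add: ma_def fa_def average_def s_def)

lemma ma_nonneg [simp]: "ma p \<ge> 0" unfolding ma_def set_lebesgue_integral_def by (rule integral_nonneg_AE) simp

lemma fa_nonneg [simp]: "fa p \<ge> 0" using ma_nonneg[of p] by (simp add: fa_def average_def ma_def)

lemma set_integral_split:
  assumes "integrable \<sigma> h" shows "(LINT x:iv p|\<sigma>. h x) = (LINT x:iv (False # p)|\<sigma>. h x) + (LINT x:iv (True # p)|\<sigma>. h x :: real)"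
proof -
  have "(LINT x:iv (False # p) \<union> iv (True # p)|\<sigma>. h x) = (LINT x:iv (False # p)|\<sigma>. h x) + (LINT x:iv (True # p)|\<sigma>. h x)"
    by (rule set_integral_Un) (use iv_split(2) set_int[OF assms] in auto)
  then show ?thesis using iv_split(1)[of p] by simp
qed

lemma ma_split: "ma p = ma (False # p) + ma (True # p)"
  unfolding ma_def by (rule set_integral_split) (use f_int in simp)

lemma Ef_le: "\<bar>Ef p\<bar> \<le> fa p"
proof -
  have "\<bar>LINT x:iv p|\<sigma>. f x\<bar> \<le> (LINT x:iv p|\<sigma>. \<bar>f x\<bar>)"
    using integral_abs_bound[of \<sigma> "\<lambda>x. indicator (iv p) x *\<^sub>R f x"]
    by (simp add: set_lebesgue_integral_def abs_mult)
  then show ?thesis unfolding Ef_def fa_def average_def by (simp add: divide_right_mono)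
qed

lemma fa_sq: "(fa p)\<^sup>2 * s p \<le> (LINT x:iv p|\<sigma>. (f x)\<^sup>2)"
proof -
  note i = set_int[OF f_sq, of p] set_int[OF integrable_abs[OF f_int], of p]
  have c: "set_integrable \<sigma> (iv p) (\<lambda>x. (fa p)\<^sup>2)"
    using haar_interval.const_integrable[OF haar_iv[OF \<sigma>, of p], of "\<lambda>x. (fa p)\<^sup>2" "(fa p)\<^sup>2"] by simp
  have "0 \<le> (LINT x:iv p|\<sigma>. (\<bar>f x\<bar> - fa p)\<^sup>2)" unfolding set_lebesgue_integral_def by (rule integral_nonneg_AE) simp
  also have "\<dots> = (LINT x:iv p|\<sigma>. (f x)\<^sup>2 - 2 * fa p * \<bar>f x\<bar> + (fa p)\<^sup>2)"
    by (simp add: power2_diff algebra_simps)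
  also have "\<dots> = (LINT x:iv p|\<sigma>. (f x)\<^sup>2) - 2 * fa p * ma p + (fa p)\<^sup>2 * s p"
    unfolding ma_def s_def using i c by (simp add: set_integral_const lfb_not_top[OF \<sigma>])
  finally show ?thesis by (simp add: ma_eq power2_eq_square mult_ac)
qed

definition "NF = (LINT x|\<sigma>. (f x)\<^sup>2)"
definition "NG = (LINT x|w. (g x)\<^sup>2)"

lemma NF_nonneg [simp]: "NF \<ge> 0" and NG_nonneg [simp]: "NG \<ge> 0" by (simp_all add: NF_def NG_def)

lemma sum_fh: "finite A \<Longrightarrow> (\<Sum>p\<in>A. (fh p)\<^sup>2) \<le> NF"
  unfolding fh_def NF_def by (rule bessel_haar[OF \<sigma> _ f_sq]) (use set_int[OF f_int] in auto)

lemma sum_gh: "finite A \<Longrightarrow> (\<Sum>p\<in>A. (gh p)\<^sup>2) \<le> NG"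
  unfolding gh_def NG_def by (rule bessel_haar[OF w _ g_sq]) (use set_int_w[OF g_int] in auto)

lemma fa_atoms: "(\<Sum>x\<in>atoms N. (fa x)\<^sup>2 * s x) \<le> NF"
proof -
  have "(\<Sum>x\<in>atoms N. (fa x)\<^sup>2 * s x) \<le> (\<Sum>x\<in>atoms N. (LINT z:iv x|\<sigma>. (f z)\<^sup>2))" by (intro sum_mono fa_sq)
  also have "\<dots> \<le> (LINT z:iv []|\<sigma>. (f z)\<^sup>2)"
  proof (rule set_integral_disjoint_le)
    show "iv v \<subseteq> iv []" for v by (rule iv_mono) simp
    show "iv v \<inter> iv v' = {}" if "v \<in> atoms N" "v' \<in> atoms N" "v \<noteq> v'" for v v'
      by (rule iv_disjoint) (use that in \<open>auto simp: atoms_def suffix_def\<close>)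
  qed (use set_int[OF f_sq] in auto)
  also have "\<dots> \<le> NF" unfolding NF_def set_lebesgue_integral_def
    by (rule integral_mono) (use set_int[OF f_sq, of "[]"] f_sq in \<open>auto simp: set_integrable_def indicator_def\<close>)
  finally show ?thesis .
qed

definition "At p = {x \<in> atoms N. suffix p x}"

lemma At_sub: "At p \<subseteq> atoms N" and finite_At [simp]: "finite (At p)" by (auto simp: At_def)

lemma At_sum: "length p \<le> N \<Longrightarrow> sum s (At p) = s p" "length p \<le> N \<Longrightarrow> (\<Sum>x\<in>At p. fa x * s x) = ma p"
  using s_atoms[of p N] additive_atoms[of ma p N, OF ma_split] by (simp_all add: At_def ma_eq[symmetric])

lemma At_avg: "length p \<le> N \<Longrightarrow> s p > 0 \<Longrightarrow> (\<Sum>x\<in>At p. fa x * s x) / sum s (At p) = fa p"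
  by (simp add: At_sum ma_eq)

lemma At_laminar: "At p \<subseteq> At q \<or> At q \<subseteq> At p \<or> At p \<inter> At q = {}"
proof (cases "suffix p q \<or> suffix q p")
  case True
  then show ?thesis by (auto simp: At_def intro: suffix_order.trans)
next
  case False
  then have "At p \<inter> At q = {}" unfolding At_def using suffix_same_cases by blast
  then show ?thesis by blast
qed

lemma At_subset_iff: assumes "length p \<le> N" "length q \<le> N" shows "At p \<subseteq> At q \<longleftrightarrow> suffix q p"
proof
  assume "At p \<subseteq> At q"
  then have "iv p \<subseteq> iv q" unfolding iv_atoms[OF assms(1)] iv_atoms[OF assms(2)] At_def by (rule UN_mono) simp
  then show "suffix q p" by (simp add: iv_subset_iff)
qed (auto simp: At_def intro: suffix_order.trans)

text \<open>The children with large mean are disjoint and share the mass of |f| over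
  \<open>F\<close>. The remaining ones violate the energy condition; they are completed to a
  partition of \<open>F\<close>, to which the energy inequality applies.\<close>

lemma sparse_children:
  assumes F: "F \<in> FF" and Q: "finite Q" "Q \<subseteq> ch F" shows "sum s Q \<le> s F / 4"
proof -
  define Q1 where "Q1 = {q \<in> Q. fa q > 8 * fa F}"
  define Q2 where "Q2 = {q \<in> Q. \<not> fa q > 8 * fa F}"
  have fin: "finite Q1" "finite Q2" using Q(1) by (auto simp: Q1_def Q2_def)
  have suf: "suffix F q" if "q \<in> Q" for q using ch_suffix(2) Q(2) that by blast
  have anti: "q = q'" if "q \<in> Q" "q' \<in> Q" "suffix q q'" for q q' using ch_antichain[of q F q'] Q(2) that by blast
  have "sum ma Q1 \<le> ma F"
    by (rule antichain_sum_le[OF ma_split ma_nonneg fin(1)]) (use suf anti in \<open>auto simp: Q1_def\<close>)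
  then have m: "(\<Sum>q\<in>Q1. fa q * s q) \<le> fa F * s F" by (simp add: ma_eq)
  have "sum s Q1 \<le> s F / 8"
  proof (cases "fa F = 0")
    case True
    have "Q1 = {}"
    proof (rule ccontr)
      assume "Q1 \<noteq> {}"
      then obtain q where q: "q \<in> Q1" by blast
      have "fa q * s q \<le> (\<Sum>q\<in>Q1. fa q * s q)" using fin q by (intro member_le_sum) auto
      moreover have "0 \<le> fa q * s q" by simp
      moreover have "fa F * s F = 0" using True by simp
      ultimately have "fa q * s q = 0" using m by linarith
      then have "fa q = 0" by (auto simp: fa_def average_def s_def)
      then show False using q True by (simp add: Q1_def)
    qed
    then show ?thesis by simp
  next
    case False
    then have pos: "fa F > 0" using fa_nonneg[of F] by linarith
    have "8 * fa F * sum s Q1 \<le> (\<Sum>q\<in>Q1. fa q * s q)" unfolding sum_distrib_left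
      by (intro sum_mono mult_right_mono) (auto simp: Q1_def)
    then have "fa F * (8 * sum s Q1) \<le> fa F * s F" using m by (simp add: mult_ac)
    then show ?thesis using pos by simp
  qed
  moreover have "sum s Q2 \<le> s F / 10"
  proof -
    have vio: "energy_term \<sigma> w (iv F) (iv q) > ennreal (10 * C0 * H\<^sup>2) * ennreal (s q)" if "q \<in> Q2" for q
    proof -
      have "bad F q" using ch_bad Q(2) that by (auto simp: Q2_def)
      then have "iv q \<in> energy_violating C0 D \<sigma> w (iv F)" using that by (auto simp: bad_def Q2_def)
      then show ?thesis using lfb_emeasure[OF \<sigma>, of "iv q"] by (simp add: energy_violating_def s_def)
    qed
    obtain P where P: "finite P" "Q2 \<subseteq> P" "partition_on (iv F) (iv ` P)"
      by (rule antichain_partition[OF fin(2), of F]) (use suf anti in \<open>auto simp: Q2_def\<close>)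
    have inj: "inj_on iv P" using iv_inj by (intro inj_onI) auto
    have PD: "iv ` P \<subseteq> D" by auto
    have "(\<Sum>\<^sub>\<infinity>I\<in>iv ` P. energy_term \<sigma> w (iv F) I) \<le> ennreal (C0 * H\<^sup>2) * emeasure \<sigma> (iv F)"
      using energy P(3) PD iv_in_D unfolding energy_inequality_def by blast
    moreover have "(\<Sum>\<^sub>\<infinity>I\<in>iv ` P. energy_term \<sigma> w (iv F) I) = (\<Sum>q\<in>P. energy_term \<sigma> w (iv F) (iv q))"
      using P(1) sum.reindex[OF inj] by simp
    ultimately have tot: "(\<Sum>q\<in>P. energy_term \<sigma> w (iv F) (iv q)) \<le> ennreal (C0 * H\<^sup>2) * ennreal (s F)"
      using lfb_emeasure[OF \<sigma>, of "iv F"] by (simp add: s_def)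
    have "(\<Sum>q\<in>Q2. energy_term \<sigma> w (iv F) (iv q)) \<le> (\<Sum>q\<in>P. energy_term \<sigma> w (iv F) (iv q))"
      by (rule sum_mono2) (use P in auto)
    note tot2 = order_trans[OF this tot]
    \<comment> \<open>For \<open>H = 0\<close> no factor can be cancelled, but then the energy terms
      sum to 0, which contradicts a strict violation.\<close>
    show ?thesis
    proof (cases "H = 0")
      case True
      have "Q2 = {}"
      proof (rule ccontr)
        assume "Q2 \<noteq> {}"
        then obtain q where q: "q \<in> Q2" by blast
        have "(\<Sum>q\<in>Q2. energy_term \<sigma> w (iv F) (iv q)) = 0" using tot2 True by simp
        then have "energy_term \<sigma> w (iv F) (iv q) = 0" using fin(2) q by simp
        then show False using vio[OF q] by simp
      qed
      then show ?thesis by simp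
    next
      case False
      have "ennreal (10 * C0 * H\<^sup>2 * sum s Q2) = (\<Sum>q\<in>Q2. ennreal (10 * C0 * H\<^sup>2) * ennreal (s q))"
        unfolding sum_distrib_left using C0 by (simp add: ennreal_mult[symmetric])
      also have "\<dots> \<le> (\<Sum>q\<in>Q2. energy_term \<sigma> w (iv F) (iv q))" by (intro sum_mono less_imp_le vio)
      also have "\<dots> \<le> ennreal (C0 * H\<^sup>2) * ennreal (s F)" by (rule tot2)
      also have "\<dots> = ennreal (C0 * H\<^sup>2 * s F)" using C0 by (simp add: ennreal_mult[symmetric])
      finally have "10 * C0 * H\<^sup>2 * sum s Q2 \<le> C0 * H\<^sup>2 * s F" using C0 by simp
      then have "C0 * H\<^sup>2 * (10 * sum s Q2) \<le> C0 * H\<^sup>2 * s F" by (simp add: mult_ac)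
      moreover have "C0 * H\<^sup>2 > 0" using C0 False by simp
      ultimately have "10 * sum s Q2 \<le> s F" by (simp only: mult_le_cancel_left_pos)
      then show ?thesis by simp
    qed
  qed
  moreover have "sum s Q = sum s Q1 + sum s Q2"
    by (subst sum.union_disjoint[symmetric]) (use fin in \<open>auto simp: Q1_def Q2_def intro: sum.cong\<close>)
  ultimately show ?thesis using s_nonneg[of F] by linarith
qed

lemma far_GG:
  assumes "q \<in> GG" "suffix F q" "length F + r \<le> length q" "x \<in> iv q" "y \<notin> iv F" shows "wd q \<le> \<bar>x - y\<bar>"
proof (rule good_far[OF _ eps assms(2-5)])
  have "iv q \<in> haar_support D w g" using assms(1) by (simp add: haar_support_def GG_def gh_def)
  then show "good_interval \<epsilon> r D (iv q)" using good_g unfolding good_function_def by blast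
qed

sublocale pair_stopping a L \<sigma> w bad N r GG
proof unfold_locales
  show "finite GG" by (rule finite_subset[OF _ finite_short(2)[of N]]) (use g_N in \<open>auto simp: GG_def gh_def\<close>)
  show "r \<le> length q \<and> length q \<le> N" if "q \<in> GG" for q using g_N[of q] that by (simp add: GG_def gh_def)
qed (use sparse_children far_GG in auto)

text \<open>Carleson embedding: 16/3 is its factor 4 times the packing constant 4/3 of the stopping
  intervals.\<close>

lemma sum_fa_FF: "(\<Sum>F | F \<in> FF \<and> length F \<le> N. (fa F)\<^sup>2 * s F) \<le> 16 / 3 * NF"
proof -
  let ?K = "{F \<in> FF. length F \<le> N}"
  have "(\<Sum>F\<in>?K. (fa F)\<^sup>2 * s F) \<le> (\<Sum>F\<in>?K. s F * ((\<Sum>x\<in>At F. fa x * s x) / sum s (At F))\<^sup>2)"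
  proof (rule sum_mono)
    fix F assume "F \<in> ?K"
    then show "(fa F)\<^sup>2 * s F \<le> s F * ((\<Sum>x\<in>At F. fa x * s x) / sum s (At F))\<^sup>2"
      using At_avg[of F] s_nonneg[of F] by (cases "s F = 0") (auto simp: mult.commute)
  qed
  also have "\<dots> \<le> 4 * (4 / 3) * (\<Sum>x\<in>atoms N. (fa x)\<^sup>2 * s x)"
  proof (rule carleson_embedding[OF finite_FF finite_atoms At_sub At_laminar])
    fix R assume R: "R \<in> ?K"
    have "{K \<in> ?K. At K \<subseteq> At R} = {F. F \<in> FF \<and> length F \<le> N \<and> suffix R F}"
      using R At_subset_iff by auto
    then show "sum s {K \<in> ?K. At K \<subseteq> At R} \<le> 4 / 3 * sum s (At R)"
      using carleson_FF[of R N] R At_sum(1)[of R] by simp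
  qed auto
  also have "\<dots> \<le> 16 / 3 * NF" using fa_atoms by simp
  finally show ?thesis .
qed

text \<open>The dyadic maximal function of f, evaluated on a small interval.\<close>

definition "mx x = Max (fa ` {p. suffix p x})"

lemma fa_le_mx: "suffix p x \<Longrightarrow> fa p \<le> mx x" unfolding mx_def by (rule Max_ge) auto

lemma mx_nonneg [simp]: "mx x \<ge> 0" by (rule order_trans[OF fa_nonneg fa_le_mx[of "[]"]]) simp

lemma mx_attained: obtains p where "suffix p x" "mx x = fa p"
proof -
  have "mx x \<in> fa ` {p. suffix p x}" unfolding mx_def by (rule Max_in) auto
  then show thesis using that by blast
qed

lemma s_mono: "suffix p q \<Longrightarrow> s q \<le> s p"
  using antichain_sum_le[OF s_split s_nonneg, of "{q}" p] by simp

lemma sum_mx: "(\<Sum>x\<in>atoms N. (mx x)\<^sup>2 * s x) \<le> 4 * NF"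
proof -
  define \<kappa> where "\<kappa> x = (SOME p. suffix p x \<and> mx x = fa p)" for x
  have \<kappa>: "suffix (\<kappa> x) x \<and> mx x = fa (\<kappa> x)" for x
    unfolding \<kappa>_def by (rule someI_ex) (rule mx_attained[of x], blast)
  have "(\<Sum>x\<in>atoms N. (mx x)\<^sup>2 * s x) \<le> (\<Sum>x\<in>atoms N. s x * ((\<Sum>z\<in>At (\<kappa> x). fa z * s z) / sum s (At (\<kappa> x)))\<^sup>2)"
  proof (rule sum_mono)
    fix x assume "x \<in> atoms N"
    then have l: "length (\<kappa> x) \<le> N" using \<kappa>[of x] suffix_length_le[of "\<kappa> x" x] by (simp add: atoms_def)
    have "s x \<le> s (\<kappa> x)" using s_mono \<kappa> by blast
    then show "(mx x)\<^sup>2 * s x \<le> s x * ((\<Sum>z\<in>At (\<kappa> x). fa z * s z) / sum s (At (\<kappa> x)))\<^sup>2"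
      using At_avg[OF l] \<kappa> s_nonneg[of x] by (cases "s x = 0") (auto simp: mult.commute)
  qed
  also have "\<dots> \<le> 4 * (\<Sum>x\<in>atoms N. (fa x)\<^sup>2 * s x)"
  proof (rule maximal_function_bound[of "{p. length p \<le> N}", OF _ finite_atoms At_sub At_laminar])
    fix x assume x: "x \<in> atoms N"
    then show "\<kappa> x \<in> {p. length p \<le> N} \<and> x \<in> At (\<kappa> x)"
      using \<kappa>[of x] suffix_length_le[of "\<kappa> x" x] by (simp add: At_def atoms_def)
  qed auto
  also have "\<dots> \<le> 4 * NF" using fa_atoms by simp
  finally show ?thesis .
qed

text \<open>The constant value on \<open>v\<close> of the martingale difference of its
  parent.\<close>

definition "cf v = fh (tl v) * hv \<sigma> v"

lemma cf_diff: "v \<noteq> [] \<Longrightarrow> s v > 0 \<Longrightarrow> cf v = Ef v - Ef (tl v)"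
  unfolding cf_def fh_def Ef_def s_def by (rule haar_coeff_diff[OF \<sigma> _ set_int[OF f_int]])

text \<open>The hypothesis on \<open>s z\<close> cannot be dropped: averages over null intervals are \<open>0\<close>.\<close>

lemma telescope: "suffix F z \<Longrightarrow> s z > 0 \<Longrightarrow> (\<Sum>v | suffix v z \<and> suffix F v \<and> v \<noteq> F. cf v) = Ef z - Ef F"
proof (induction z)
  case Nil
  then have "F = []" by simp
  then have "{v. suffix v [] \<and> suffix F v \<and> v \<noteq> F} = {}" by simp
  then show ?case using \<open>F = []\<close> by simp
next
  case (Cons b z)
  show ?case
  proof (cases "F = b # z")
    case True
    have "sum cf {v. suffix v F \<and> suffix F v \<and> v \<noteq> F} = 0"
      by (rule sum.neutral) (use suffix_order.antisym[of _ F] in blast)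
    then show ?thesis by (simp only: True diff_self)
  next
    case False
    then have Fz: "suffix F z" using Cons.prems(1) by (auto simp: suffix_Cons)
    have sz: "s z > 0" using s_mono[of z "b # z"] Cons.prems(2) by (simp add: suffix_ConsI)
    have "{v. suffix v (b # z) \<and> suffix F v \<and> v \<noteq> F} = insert (b # z) {v. suffix v z \<and> suffix F v \<and> v \<noteq> F}"
      using False Cons.prems(1) by (auto simp: suffix_Cons)
    moreover have "b # z \<notin> {v. suffix v z \<and> suffix F v \<and> v \<noteq> F}" using suffix_length_le[of "b # z" z] by auto
    moreover have "finite {v. suffix v z \<and> suffix F v \<and> v \<noteq> F}" by (rule finite_subset[OF _ finite_suffixes[of z]]) auto
    ultimately show ?thesis using Cons.IH[OF Fz sz] cf_diff[of "b # z"] Cons.prems(2) by simp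
  qed
qed

end

subsection \<open>The terms within one stopping interval\<close>

text \<open>Dividing by the product of norms shows that the infimum is admissible. If the product is
  0, some finite admissible constant, which exists as the infimum is finite, already forces the form
  to vanish.\<close>

lemma local_const_bound:
  assumes lc: "local_const \<epsilon> r C0 D \<sigma> w = ennreal \<Lambda>" "\<Lambda> \<ge> 0"
    and a: "0 < \<alpha>" "\<alpha> < \<beta>" "I0 \<in> D" "\<S> \<subseteq> D" "disjoint \<S>" "\<forall>S\<in>\<S>. S \<subseteq> I0"
      "good_function \<epsilon> r D \<sigma> I0 f" "uniform_wrt C0 D \<sigma> w I0 \<S> f"
      "good_function \<epsilon> r D w I0 g" "weakly_adapted r D w \<S> g"
  shows "\<bar>B_above \<alpha> \<beta> r D \<sigma> w I0 f g\<bar> \<le> \<Lambda> * ((sqrt (measure \<sigma> I0) + l2_norm \<sigma> f) * l2_norm w g)"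
proof -
  define X where "X = (sqrt (measure \<sigma> I0) + l2_norm \<sigma> f) * l2_norm w g"
  define B where "B = \<bar>B_above \<alpha> \<beta> r D \<sigma> w I0 f g\<bar>"
  define LS where "LS = {L. \<forall>\<alpha> \<beta> I0 \<S> f g.
     0 < \<alpha> \<and> \<alpha> < \<beta> \<and> I0 \<in> D \<and>
     \<S> \<subseteq> D \<and> disjoint \<S> \<and> (\<forall>S\<in>\<S>. S \<subseteq> I0) \<and>
     good_function \<epsilon> r D \<sigma> I0 f \<and> uniform_wrt C0 D \<sigma> w I0 \<S> f \<and>
     good_function \<epsilon> r D w I0 g \<and> weakly_adapted r D w \<S> g \<longrightarrow>
       ennreal \<bar>B_above \<alpha> \<beta> r D \<sigma> w I0 f g\<bar>
         \<le> L * ennreal ((sqrt (measure \<sigma> I0) + l2_norm \<sigma> f) * l2_norm w g)}"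
  have inf: "Inf LS = ennreal \<Lambda>" using lc(1) unfolding local_const_def LS_def .
  have LS: "ennreal B \<le> l * ennreal X" if "l \<in> LS" for l
    using that a unfolding LS_def B_def X_def by blast
  have X0: "X \<ge> 0" unfolding X_def by (simp add: l2_norm_def)
  have B0: "B \<ge> 0" by (simp add: B_def)
  have fin: "B \<le> l * X" if "ennreal l \<in> LS" "l \<ge> 0" for l
    using LS[OF that(1)] that X0 by (simp add: ennreal_mult[symmetric])
  have "B \<le> \<Lambda> * X"
  proof (cases "X = 0")
    case True
    have "Inf LS < top" using inf by simp
    then obtain l where l: "l \<in> LS" "l < top" by (auto simp: Inf_less_iff)
    then have "ennreal B \<le> 0" using LS[OF l(1)] True by simp
    then show ?thesis using True by (simp add: ennreal_eq_0_iff)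
  next
    case False
    then have Xp: "X > 0" using X0 by simp
    have "ennreal (B / X) \<le> Inf LS"
    proof (rule Inf_greatest)
      fix l assume l: "l \<in> LS"
      show "ennreal (B / X) \<le> l"
      proof (cases l)
        case (real c)
        then have "B \<le> c * X" using fin l by blast
        then show ?thesis using real Xp by (simp add: ennreal_leI divide_le_eq)
      qed simp
    qed
    then have "B / X \<le> \<Lambda>" using inf lc(2) by (simp add: ennreal_le_iff)
    then show ?thesis using Xp by (simp add: divide_le_eq)
  qed
  then show ?thesis by (simp add: B_def X_def)
qed

context corona
begin

text \<open>On the final pieces of the corona the projection of f is a difference of two averages.
  Its mean is at most (8 + 1) times \<open>fa F\<close>: 8 by the stopping rule, 1 for the
  subtracted average over \<open>F\<close>. Hence the normalisation by 9.\<close>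

definition "PF F = hsum \<sigma> {p. length p < N \<and> stp p = F} (\<lambda>p. fh p / (9 * fa F))"
definition "QG F = hsum w {q. length q < N \<and> Fd q = F} gh"

lemma finN: "finite {p :: bool list. length p < N \<and> P p}"
  by (rule finite_subset[OF _ finite_short(2)[of N]]) auto

lemma fh_0: "haar_scale \<sigma> (iv p) = 0 \<Longrightarrow> fh p = 0" and gh_0: "haar_scale w (iv p) = 0 \<Longrightarrow> gh p = 0"
  by (simp_all add: fh_def gh_def l2_inner_def haar_eq)

lemma fh_N: "\<not> length p < N \<Longrightarrow> fh p = 0" and gh_N: "\<not> length p < N \<Longrightarrow> gh p = 0"
  using f_N g_N by (auto simp: fh_def gh_def)

lemma fh_good: "fh p \<noteq> 0 \<Longrightarrow> good_interval \<epsilon> r D (iv p)"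
  using good_f unfolding good_function_def haar_support_def fh_def by (metis (mono_tags, lifting) iv_in_D mem_Collect_eq)

lemma gh_good: "gh p \<noteq> 0 \<Longrightarrow> good_interval \<epsilon> r D (iv p)"
  using good_g unfolding good_function_def haar_support_def gh_def by (metis (mono_tags, lifting) iv_in_D mem_Collect_eq)

lemma PF_good: "good_function \<epsilon> r D \<sigma> (iv F) (PF F)"
  unfolding PF_def by (rule hsum_good_function[OF \<sigma> finN]) (use suffix_stp fh_good in auto)

lemma QG_good: "good_function \<epsilon> r D w (iv F) (QG F)"
  unfolding QG_def by (rule hsum_good_function[OF w finN]) (use Fd_suffix(2) gh_good in auto)

lemma PF_coeff: "l2_inner \<sigma> (PF F) (haar \<sigma> (iv p)) = (if stp p = F then fh p / (9 * fa F) else 0)"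
  unfolding PF_def using hsum_coeff[OF \<sigma> finN] fh_0 fh_N[of p] by simp

lemma QG_coeff: "l2_inner w (QG F) (haar w (iv q)) = (if Fd q = F then gh q else 0)"
  unfolding QG_def using hsum_coeff[OF w finN] gh_0 gh_N[of q] by simp

lemma ch_stp: "F \<in> FF \<Longrightarrow> q \<in> ch F \<Longrightarrow> suffix q p \<Longrightarrow> stp p \<noteq> F"
  using FF_suffix_stp[OF ch_FF(1), of q F p] ch_suffix(4)[of q F] suffix_length_le[of q F] by auto

lemma not_bad_stp: assumes "stp q = F" "q \<noteq> F" shows "\<not> bad F q" "q \<noteq> []" "stp (tl q) = F"
proof -
  show ne: "q \<noteq> []" using assms by auto
  then obtain b p where q: "q = b # p" by (cases q) auto
  then show "\<not> bad F q" "stp (tl q) = F" using assms by (auto split: if_splits)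
qed

lemma fa_stp: "stp q = F \<Longrightarrow> fa q \<le> 8 * fa F"
  using not_bad_stp[of q F] fa_nonneg[of F] by (cases "q = F") (auto simp: bad_def)

lemma chain_stp:
  assumes F: "F \<in> FF" and z: "z \<in> ch F \<or> stp z = F" and v: "suffix v z" "suffix F v" "v \<noteq> F" shows "stp (tl v) = F"
proof -
  have "v \<noteq> []" using v by auto
  then have Fv: "suffix F (tl v)" using v by (cases v) (auto simp: suffix_Cons)
  from z show ?thesis
  proof
    assume z: "z \<in> ch F"
    then have "z \<noteq> []" "stp (tl z) = F" by (auto simp: ch_def)
    moreover have "suffix (tl v) (tl z)"
      using v(1) \<open>v \<noteq> []\<close> \<open>z \<noteq> []\<close> by (auto simp: suffix_def neq_Nil_conv append_eq_Cons_conv)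
    ultimately show ?thesis using stp_between[of "tl z" "tl v"] Fv by simp
  next
    assume z: "stp z = F"
    have "suffix (tl v) z" using v(1) suffix_tl suffix_order.trans by blast
    then show ?thesis using stp_between[of z "tl v"] Fv z by simp
  qed
qed

text \<open>On a stopping child, and on an interval of the corona below the Haar support, only the
  Haar functions of proper ancestors in the corona matter, and these are constant there. The sum
  over the path from \<open>F\<close> telescopes.\<close>

lemma PF_value:
  assumes F: "F \<in> FF" and z: "z \<in> ch F \<or> stp z = F \<and> N \<le> length z" and sz: "s z > 0" and x: "x \<in> iv z"
  shows "PF F x = (Ef z - Ef F) / (9 * fa F)"
proof -
  define S where "S = {v. suffix v z \<and> suffix F v \<and> v \<noteq> F}"
  have finS: "finite S" by (rule finite_subset[OF _ finite_suffixes[of z]]) (auto simp: S_def)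
  have Sne: "v \<noteq> []" if "v \<in> S" for v using that by (auto simp: S_def)
  have z': "z \<in> ch F \<or> stp z = F" using z by blast
  have Fz: "suffix F z" using z ch_suffix(2) suffix_stp by blast
  have inj: "inj_on tl S"
  proof (rule inj_onI)
    fix v v' assume v: "v \<in> S" "v' \<in> S" "tl v = tl v'"
    then have "length v = length v'" using Sne[OF v(1)] Sne[OF v(2)] by (cases v; cases v') auto
    then show "v = v'" using v by (auto simp: S_def suffix_def)
  qed
  have "PF F x = (\<Sum>p\<in>{p. length p < N \<and> stp p = F}. fh p * haar \<sigma> (iv p) x) / (9 * fa F)"
    unfolding PF_def hsum_def sum_divide_distrib by simp
  also have "(\<Sum>p\<in>{p. length p < N \<and> stp p = F}. fh p * haar \<sigma> (iv p) x) = (\<Sum>p\<in>tl ` S. fh p * haar \<sigma> (iv p) x)"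
  proof (rule sum.mono_neutral_cong)
    fix p assume "p \<in> tl ` S - {p. length p < N \<and> stp p = F}"
    then obtain v where v: "v \<in> S" "p = tl v" "\<not> (length p < N \<and> stp p = F)" by blast
    have "stp p = F" unfolding v(2) by (rule chain_stp[OF F z']) (use v(1) in \<open>auto simp: S_def\<close>)
    then show "fh p * haar \<sigma> (iv p) x = 0" using fh_N v(3) by simp
  next
    fix p assume p: "p \<in> {p. length p < N \<and> stp p = F} - tl ` S"
    show "fh p * haar \<sigma> (iv p) x = 0"
    proof (rule ccontr)
      assume "fh p * haar \<sigma> (iv p) x \<noteq> 0"
      then have xp: "x \<in> iv p" using haar_interval.haar_outside[OF haar_iv[OF \<sigma>], of x p] by auto
      have "\<not> suffix z p" using z ch_stp[OF F, of z p] p suffix_length_le[of z p] by auto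
      then have pz: "suffix p z" "p \<noteq> z" using iv_disjoint[of p z] x xp by auto
      then obtain b where b: "suffix (b # p) z" using strict_suffix_Cons_suffix by blast
      have Fp: "suffix F p" using p suffix_stp[of p] by auto
      then have "b # p \<in> S" using b suffix_length_le[OF Fp] by (auto simp: S_def suffix_ConsI)
      then have "tl (b # p) \<in> tl ` S" by (rule imageI)
      then show False using p by simp
    qed
  qed (use finS finN in auto)
  also have "\<dots> = (\<Sum>v\<in>S. fh (tl v) * haar \<sigma> (iv (tl v)) x)" using sum.reindex[OF inj] by simp
  also have "\<dots> = (\<Sum>v\<in>S. cf v)"
  proof (intro sum.cong refl)
    fix v assume v: "v \<in> S"
    then have "x \<in> iv v" using iv_mono[of v z] x by (auto simp: S_def)
    then show "fh (tl v) * haar \<sigma> (iv (tl v)) x = cf v" using haar_value[OF \<sigma> Sne[OF v]] by (simp add: cf_def)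
  qed
  also have "\<dots> = Ef z - Ef F" unfolding S_def by (rule telescope[OF Fz sz])
  finally show ?thesis .
qed

lemma PF_int: "integrable \<sigma> (\<lambda>x. \<bar>PF F x\<bar>)" unfolding PF_def by (intro integrable_abs hsum_integrable[OF \<sigma>])

lemma PF_mean_const:
  assumes F: "F \<in> FF" and z: "z \<in> ch F \<or> stp z = F \<and> N \<le> length z" and pos: "fa F > 0"
  shows "(LINT x:iv z|\<sigma>. \<bar>PF F x\<bar>) \<le> (ma z + fa F * s z) / (9 * fa F)"
proof (cases "s z = 0")
  case True
  then show ?thesis using integral_null[OF True] pos by simp
next
  case False
  then have sz: "s z > 0" using s_nonneg[of z] by linarith
  have "(LINT x:iv z|\<sigma>. \<bar>PF F x\<bar>) = (LINT x:iv z|\<sigma>. \<bar>(Ef z - Ef F) / (9 * fa F)\<bar>)"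
    by (rule set_lebesgue_integral_cong) (use PF_value[OF F z sz] in auto)
  also have "\<dots> = \<bar>(Ef z - Ef F) / (9 * fa F)\<bar> * s z"
    unfolding s_def by (simp add: set_integral_const lfb_not_top[OF \<sigma>])
  also have "\<dots> \<le> (fa z + fa F) / (9 * fa F) * s z"
  proof (rule mult_right_mono)
    have "\<bar>Ef z - Ef F\<bar> \<le> fa z + fa F" using Ef_le[of z] Ef_le[of F] by linarith
    then show "\<bar>(Ef z - Ef F) / (9 * fa F)\<bar> \<le> (fa z + fa F) / (9 * fa F)"
      using pos by (simp add: abs_divide divide_right_mono)
  qed simp
  finally show ?thesis by (simp add: ma_eq distrib_right)
qed

text \<open>The projection is not constant on \<open>q\<close>, so its absolute mean cannot be read
  off there. But the bound is additive in \<open>q\<close>: it is checked on stopping children and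
  from generation \<open>N\<close> on, and then summed upwards.\<close>

lemma PF_mean:
  assumes F: "F \<in> FF" and pos: "fa F > 0"
  shows "stp q = F \<Longrightarrow> (LINT x:iv q|\<sigma>. \<bar>PF F x\<bar>) \<le> (ma q + fa F * s q) / (9 * fa F)"
proof (induction "N - length q" arbitrary: q)
  case 0
  then show ?case by (intro PF_mean_const[OF F _ pos]) auto
next
  case (Suc n)
  have ch: "(LINT x:iv (b # q)|\<sigma>. \<bar>PF F x\<bar>) \<le> (ma (b # q) + fa F * s (b # q)) / (9 * fa F)" for b
  proof (cases "stp (b # q) = F")
    case True
    show ?thesis by (rule Suc.hyps(1)[OF _ True]) (use Suc.hyps(2) in simp)
  next
    case False
    then have "b # q \<in> ch F" using Suc.prems by (auto simp: ch_def split: if_splits)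
    then show ?thesis by (intro PF_mean_const[OF F _ pos]) simp
  qed
  have "(LINT x:iv q|\<sigma>. \<bar>PF F x\<bar>) \<le> (ma (False # q) + fa F * s (False # q)) / (9 * fa F) + (ma (True # q) + fa F * s (True # q)) / (9 * fa F)"
    using ch[of False] ch[of True] set_integral_split[OF PF_int[of F], of q] by linarith
  then show ?case unfolding ma_split[of q] s_split[of q] by (simp only: add_divide_distrib distrib_left add_ac)
qed

text \<open>An energy violator is \<open>bad\<close> for \<open>F\<close>, so \<open>F\<close> is
  not its smallest stopping interval and it lies in a stopping child. The mean bound concerns the
  intervals with \<open>stp q = F\<close>, where the stopping rule gives
  \<open>fa q \<le> 8 * fa F\<close>.\<close>

lemma PF_uniform:
  assumes F: "F \<in> FF" and pos: "fa F > 0" shows "uniform_wrt C0 D \<sigma> w (iv F) (iv ` ch F) (PF F)"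
  unfolding uniform_wrt_def
proof (intro conjI ballI impI)
  have down: "\<exists>S\<in>iv ` ch F. iv p \<subseteq> S" if "suffix F p" "stp p \<noteq> F" for p
    using ex_ch[OF F that] iv_mono by blast
  {
    fix E assume "E \<in> F_energy C0 D \<sigma> w (iv F)"
    then have E: "E \<in> energy_violating C0 D \<sigma> w (iv F)" by (simp add: F_energy_def)
    then have E2: "E \<in> D" "E \<subset> iv F" by (auto simp: energy_violating_def)
    then obtain p where p: "suffix F p" "E = iv p" using D_subset_iv[of E F] by blast
    have "p \<noteq> F" using E2 p by auto
    then have "stp p \<noteq> F" using not_bad_stp(1)[of p F] E p by (auto simp: bad_def)
    then show "\<exists>S\<in>iv ` ch F. E \<subseteq> S" using down p by simp
  next
    fix S assume "S \<in> iv ` ch F"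
    then obtain q where q: "q \<in> ch F" "S = iv q" by blast
    show "\<exists>c. AE x in \<sigma>. x \<in> S \<longrightarrow> PF F x = c"
    proof (cases "s q = 0")
      case True
      then have "emeasure \<sigma> (iv q) = 0" using lfb_emeasure[OF \<sigma>, of "iv q"] by (simp add: s_def)
      then have "AE x in \<sigma>. x \<in> S \<longrightarrow> PF F x = 0"
        unfolding q(2) by (intro AE_I[where N = "iv q"]) auto
      then show ?thesis by blast
    next
      case False
      then have sq: "s q > 0" using s_nonneg[of q] by linarith
      have "PF F x = (Ef q - Ef F) / (9 * fa F)" if "x \<in> S" for x
        by (rule PF_value[OF F disjI1[OF q(1)] sq]) (use that q in simp)
      then show ?thesis by (intro exI[of _ "(Ef q - Ef F) / (9 * fa F)"] AE_I2) blast
    qed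
  next
    fix I assume I: "I \<in> D" "I \<subseteq> iv F \<and> \<not> (\<exists>S\<in>iv ` ch F. I \<subseteq> S)"
    then obtain q where q: "suffix F q" "I = iv q" using D_subset_iv[of I F] by blast
    have st: "stp q = F" using down[OF q(1)] I q by blast
    show "average \<sigma> I (\<lambda>x. \<bar>PF F x\<bar>) \<le> 1"
    proof (cases "s q = 0")
      case True
      then show ?thesis by (simp add: average_def q s_def)
    next
      case False
      then have sq: "s q > 0" using s_nonneg[of q] by linarith
      have "ma q + fa F * s q \<le> 9 * fa F * s q"
        using mult_right_mono[OF fa_stp[OF st] s_nonneg[of q]] by (simp add: ma_eq mult_ac)
      then have "(ma q + fa F * s q) / (9 * fa F) \<le> s q" using pos by (simp add: divide_le_eq mult_ac)
      then have "(LINT x:iv q|\<sigma>. \<bar>PF F x\<bar>) \<le> s q" using PF_mean[OF F pos st] by linarith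
      then show ?thesis using sq by (simp add: average_def q s_def divide_le_eq)
    qed
  }
qed

text \<open>Here the assignment through the r-th ancestor pays off: if J is deep inside a stopping
  child, so is contained its r-th ancestor, and J is attached to a stopping interval below
  \<open>F\<close>.\<close>

lemma QG_adapted:
  assumes F: "F \<in> FF" shows "weakly_adapted r D w (iv ` ch F) (QG F)"
  unfolding weakly_adapted_def
proof (intro ballI impI)
  fix J assume J: "J \<in> D" "\<exists>S\<in>iv ` ch F. deep_inside r J S"
  then obtain c where c: "c \<in> ch F" "deep_inside r J (iv c)" by blast
  then have "J \<subseteq> iv c" by (simp add: deep_inside_def)
  then obtain q where q: "suffix c q" "J = iv q" using D_subset_iv[OF J(1)] by blast
  then have "suffix c (drop r q)" using c(2) unfolding q(2) deep_inside_iv suffix_drop_iff by simp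
  then have "Fd q \<noteq> F" unfolding Fd_def by (rule ch_stp[OF F c(1)])
  then show "l2_inner w (QG F) (haar w J) = 0" by (simp add: q QG_coeff)
qed

definition "diag F = (\<Sum>q | length q < N \<and> Fd q = F. \<Sum>v | v \<noteq> [] \<and> suffix v (drop r q) \<and> stp (tl v) = F. gh q * cf v * th \<alpha> \<beta> \<sigma> w v q)"
definition "fn F = sqrt (\<Sum>p | length p < N \<and> stp p = F. (fh p)\<^sup>2)"
definition "gn F = sqrt (\<Sum>q | length q < N \<and> Fd q = F. (gh q)\<^sup>2)"

lemma diag_eq: assumes "fa F > 0" shows "diag F = 9 * fa F * B_above \<alpha> \<beta> r D \<sigma> w (iv F) (PF F) (QG F)"
proof -
  have fin: "finite {v. v \<noteq> [] \<and> suffix v (drop r q) \<and> P v}" for q :: "bool list" and P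
    by (rule finite_subset[OF _ finite_suffixes[of "drop r q"]]) auto
  let ?X = "\<lambda>v q. (if Fd q = F then gh q else 0) * ((if stp (tl v) = F then fh (tl v) / (9 * fa F) else 0) * hv \<sigma> v) * th \<alpha> \<beta> \<sigma> w v q"
  have "B_above \<alpha> \<beta> r D \<sigma> w (iv F) (PF F) (QG F) = (\<Sum>q | length q < N. \<Sum>v | v \<noteq> [] \<and> suffix v (drop r q) \<and> suffix F (tl v). ?X v q)"
    unfolding PF_coeff[symmetric] QG_coeff[symmetric]
    by (rule B_above_eq[OF \<sigma>]) (use fh_N gh_N in \<open>auto simp: PF_coeff QG_coeff\<close>)
  also have "\<dots> = (\<Sum>q | length q < N \<and> Fd q = F. \<Sum>v | v \<noteq> [] \<and> suffix v (drop r q) \<and> suffix F (tl v). ?X v q)"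
    by (rule sum.mono_neutral_right) auto
  also have "\<dots> = (\<Sum>q | length q < N \<and> Fd q = F. \<Sum>v | v \<noteq> [] \<and> suffix v (drop r q) \<and> stp (tl v) = F. ?X v q)"
  proof (rule sum.cong[OF refl], rule sum.mono_neutral_right)
    fix q
    show "{v. v \<noteq> [] \<and> suffix v (drop r q) \<and> stp (tl v) = F} \<subseteq> {v. v \<noteq> [] \<and> suffix v (drop r q) \<and> suffix F (tl v)}"
      using suffix_stp by blast
  qed (use fin in auto)
  also have "\<dots> = (\<Sum>q | length q < N \<and> Fd q = F. \<Sum>v | v \<noteq> [] \<and> suffix v (drop r q) \<and> stp (tl v) = F. gh q * cf v * th \<alpha> \<beta> \<sigma> w v q / (9 * fa F))"
    by (intro sum.cong refl) (simp add: cf_def)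
  also have "\<dots> = diag F / (9 * fa F)" unfolding diag_def sum_divide_distrib ..
  finally show ?thesis using assms by simp
qed

text \<open>Covers the coronas in which the normalisation by \<open>fa F\<close> divides by 0: f
  vanishes almost everywhere on such an \<open>F\<close>, so all its Haar coefficients there are
  0.\<close>

lemma fh_stp_0: assumes "fa (stp p) = 0" shows "fh p = 0"
proof -
  have "fa p = 0" using fa_stp[of p "stp p"] fa_nonneg[of p] assms by simp
  then have "ma p = 0" by (simp add: ma_eq)
  then have "ma (b # p) = 0" for b
    using ma_split[of p] ma_nonneg by (cases b) (smt (verit))+
  then have "fa (b # p) = 0" for b by (simp add: fa_def average_def ma_def)
  then have "Ef (b # p) = 0" for b using Ef_le[of "b # p"] by simp
  then show ?thesis
    using haar_interval.haar_coeff[OF haar_iv[OF \<sigma>] set_int[OF f_int], of p] by (simp add: fh_def left_child_iv right_child_iv Ef_def)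
qed

lemma diag_bound:
  assumes F: "F \<in> FF" and lc: "local_const \<epsilon> r C0 D \<sigma> w = ennreal \<Lambda>" "\<Lambda> \<ge> 0"
  shows "\<bar>diag F\<bar> \<le> \<Lambda> * ((9 * (fa F * sqrt (s F)) + fn F) * gn F)"
proof (cases "fa F = 0")
  case True
  then have "cf v = 0" if "stp (tl v) = F" for v using fh_stp_0[of "tl v"] that by (simp add: cf_def)
  then have "diag F = 0" unfolding diag_def by (intro sum.neutral ballI) simp
  moreover have "fn F \<ge> 0" "gn F \<ge> 0" unfolding fn_def gn_def by (simp_all add: sum_nonneg)
  ultimately show ?thesis using lc(2) True by simp
next
  case False
  then have pos: "fa F > 0" using fa_nonneg[of F] by linarith
  have n1: "l2_norm \<sigma> (PF F) = fn F / (9 * fa F)"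
  proof -
    have "l2_norm \<sigma> (PF F) = sqrt (\<Sum>p | length p < N \<and> stp p = F. (fh p / (9 * fa F))\<^sup>2)"
      unfolding PF_def by (rule hsum_norm[OF \<sigma> finN]) (simp add: fh_0)
    also have "(\<Sum>p | length p < N \<and> stp p = F. (fh p / (9 * fa F))\<^sup>2) = (\<Sum>p | length p < N \<and> stp p = F. (fh p)\<^sup>2) / (9 * fa F)\<^sup>2"
      unfolding power_divide sum_divide_distrib ..
    also have "sqrt \<dots> = fn F / sqrt ((9 * fa F)\<^sup>2)" by (simp only: real_sqrt_divide fn_def)
    also have "sqrt ((9 * fa F)\<^sup>2) = 9 * fa F" using pos by (simp only: real_sqrt_abs)
    finally show ?thesis .
  qed
  have n2: "l2_norm w (QG F) = gn F"
    unfolding QG_def gn_def by (rule hsum_norm[OF w finN]) (simp add: gh_0)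
  have disj: "disjoint (iv ` ch F)"
  proof (rule disjointI)
    fix S S' assume "S \<in> iv ` ch F" "S' \<in> iv ` ch F" "S \<noteq> S'"
    then obtain q q' where q: "S = iv q" "S' = iv q'" "q \<in> ch F" "q' \<in> ch F" "q \<noteq> q'" by blast
    then have "\<not> suffix q q'" "\<not> suffix q' q" using ch_antichain[of q F q'] ch_antichain[of q' F q] by auto
    then show "S \<inter> S' = {}" unfolding q(1,2) by (rule iv_disjoint)
  qed
  have sub: "\<forall>S\<in>iv ` ch F. S \<subseteq> iv F" using iv_mono ch_suffix(2) by blast
  have "\<bar>B_above \<alpha> \<beta> r D \<sigma> w (iv F) (PF F) (QG F)\<bar> \<le> \<Lambda> * ((sqrt (measure \<sigma> (iv F)) + l2_norm \<sigma> (PF F)) * l2_norm w (QG F))"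
    by (rule local_const_bound[OF lc ab iv_in_D _ disj sub PF_good PF_uniform[OF F pos] QG_good QG_adapted[OF F]]) auto
  then have "9 * fa F * \<bar>B_above \<alpha> \<beta> r D \<sigma> w (iv F) (PF F) (QG F)\<bar> \<le> 9 * fa F * (\<Lambda> * ((sqrt (s F) + fn F / (9 * fa F)) * gn F))"
    unfolding n1 n2 s_def by (intro mult_left_mono) auto
  also have "\<dots> = \<Lambda> * ((9 * (fa F * sqrt (s F)) + fn F) * gn F)" using pos by (simp add: field_simps)
  finally show ?thesis unfolding diag_eq[OF pos] abs_mult using pos by simp
qed

end

subsection \<open>The terms above the stopping interval\<close>

text \<open>The choice u = b/a turns a sum of squares into a product. As \<open>a\<close> or
  \<open>b\<close> may be 0, both are increased by d, and d tends to 0.\<close>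

lemma optimize_scale:
  fixes S K a b :: real
  assumes "a \<ge> 0" "b \<ge> 0" "K \<ge> 0" and S: "\<And>u. u > 0 \<Longrightarrow> S \<le> K * (u * a\<^sup>2 + b\<^sup>2 / u)"
  shows "S \<le> 2 * K * (a * b)"
proof -
  have "((\<lambda>d. 2 * K * ((a + d) * (b + d))) \<longlongrightarrow> 2 * K * ((a + 0) * (b + 0))) (at_right 0)"
    by (intro tendsto_intros)
  moreover have "eventually (\<lambda>d. S \<le> 2 * K * ((a + d) * (b + d))) (at_right 0)"
    using eventually_at_right_less[of "0::real"]
  proof eventually_elim
    case (elim d)
    define u where "u = (b + d) / (a + d)"
    have p: "a + d > 0" "b + d > 0" using assms elim by auto
    then have u: "u > 0" by (simp add: u_def)
    have "S \<le> K * (u * a\<^sup>2 + b\<^sup>2 / u)" by (rule S[OF u])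
    also have "\<dots> \<le> K * (u * (a + d)\<^sup>2 + (b + d)\<^sup>2 / u)"
      using u elim assms by (intro mult_left_mono add_mono divide_right_mono power_mono) auto
    also have "u * (a + d)\<^sup>2 + (b + d)\<^sup>2 / u = 2 * ((a + d) * (b + d))"
      using p by (simp add: u_def power2_eq_square)
    finally show ?case by simp
  qed
  ultimately have "S \<le> 2 * K * ((a + 0) * (b + 0))" by (rule tendsto_lowerbound) simp
  then show ?thesis by simp
qed

lemma Cauchy_Schwarz_sum:
  fixes x y :: "'a \<Rightarrow> real"
  assumes "(\<Sum>i\<in>I. (x i)\<^sup>2) \<le> X" "(\<Sum>i\<in>I. (y i)\<^sup>2) \<le> Y"
  shows "(\<Sum>i\<in>I. \<bar>x i\<bar> * \<bar>y i\<bar>) \<le> sqrt X * sqrt Y"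
proof -
  have "(\<Sum>i\<in>I. \<bar>x i\<bar> * \<bar>y i\<bar>) \<le> L2_set x I * L2_set y I" by (rule L2_set_mult_ineq)
  also have "\<dots> \<le> sqrt X * sqrt Y"
  proof (rule mult_mono')
    show "L2_set x I \<le> sqrt X" "L2_set y I \<le> sqrt Y" unfolding L2_set_def by (intro real_sqrt_le_mono assms)+
  qed simp_all
  finally show ?thesis .
qed

context corona
begin

interpretation tr: truncation \<alpha> \<beta> \<sigma> by unfold_locales (use ab \<sigma> in auto)

abbreviation "\<theta> \<equiv> th \<alpha> \<beta> \<sigma> w"

lemma HS_set_integrable: "bounded S \<Longrightarrow> S \<in> sets borel \<Longrightarrow> set_integrable w (iv q) (tr.HS S)"
  by (rule lfb_set_integrable[OF w _ _ _ tr.HS_bound]) auto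

lemma HS_haar_integrable: "bounded S \<Longrightarrow> S \<in> sets borel \<Longrightarrow> integrable w (\<lambda>x. tr.HS S x * haar w (iv q) x)"
  by (rule haar_interval.haar_mult_integrable[OF haar_iv[OF w] HS_set_integrable])

lemma th_split: "\<theta> v q = \<theta> (False # v) q + \<theta> (True # v) q"
proof -
  have "tr.HS (iv v) x = tr.HS (iv (False # v)) x + tr.HS (iv (True # v)) x" for x
    using tr.HS_Un[of "iv (False # v)" "iv (True # v)"] iv_split[of v] by simp
  then show ?thesis unfolding th_def l2_inner_def
    by (simp add: distrib_right HS_haar_integrable)
qed

lemma th_null: assumes "s v = 0" shows "\<theta> v q = 0"
proof -
  have "tr.HS (iv v) x = 0" for x using tr.HS_bound[of "iv v" x] assms by (simp add: s_def)
  then show ?thesis by (simp add: th_def l2_inner_def)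
qed

lemma th_atoms: assumes "length v \<le> N" shows "\<theta> v q = (\<Sum>z\<in>At v. \<theta> z q)"
  unfolding At_def using additive_atoms[of "\<lambda>v. \<theta> v q", OF th_split assms] by simp

lemma sum_th_sq: assumes "finite Q" "\<And>q. q \<in> Q \<Longrightarrow> suffix F q" shows "(\<Sum>q\<in>Q. (\<theta> F q)\<^sup>2) \<le> Tst\<^sup>2 * s F"
proof -
  have "(\<Sum>q\<in>Q. (\<theta> F q)\<^sup>2) \<le> (LINT x:iv F|w. (tr.HS (iv F) x)\<^sup>2)"
    unfolding th_def
  proof (rule bessel_haar_local[OF w assms])
    show "set_integrable w (iv F) (\<lambda>x. (tr.HS (iv F) x)\<^sup>2)"
      by (rule lfb_set_integrable[OF w _ _ _ tr.HS_sq_bound]) auto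
  qed (use HS_set_integrable in auto)
  also have "\<dots> \<le> Tst\<^sup>2 * measure \<sigma> (iv F)"
    by (rule testing_real[OF ab, of _ "lo F" "lo F + wd F"]) (auto simp: iv_def)
  finally show ?thesis by (simp add: s_def)
qed

text \<open>By goodness \<open>q\<close> and the atom are at distance at least \<open>d\<close>, a
  quarter of the denominator of \<open>pk\<close>. On \<open>q\<close> the transform of the atom is
  nondecreasing and grows at most 4 / d^2 times \<open>s z\<close> as fast as x, and Haar
  coefficients are compared; 64 = 4 * 4^2.\<close>

lemma th_far:
  assumes q: "q \<in> GG" and z: "z \<in> atoms N" "\<not> suffix (Fd q) z"
  shows "\<bar>\<theta> z q\<bar> \<le> 64 * pk (wd (V q)) (lo z - lo (V q)) * s z * xh q"
proof -
  note V = V_props[OF q]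
  define d where "d = (wd (V q) + \<bar>lo z - lo (V q)\<bar>) / 4"
  have d0: "d > 0" using wd_pos[of "V q"] by (simp only: d_def) (intro divide_pos_pos add_pos_nonneg, auto)
  have lz: "length z = N" using z(1) by (simp add: atoms_def)
  have lF: "length (Fd q) \<le> N" using V(3,4) by simp
  have "\<not> suffix z (Fd q)"
  proof
    assume "suffix z (Fd q)"
    then have "z = Fd q" using lz lF by (auto simp: suffix_def)
    then show False using z(2) by simp
  qed
  then have dis: "iv z \<inter> iv (Fd q) = {}" using iv_disjoint z(2) by blast
  have wz: "wd z \<le> wd (V q)" by (rule wd_mono) (use V(4) lz in simp)
  have sep: "d \<le> \<bar>x - y\<bar>" if x: "x \<in> iv q" and y: "y \<in> iv z" for x y
  proof -
    have xV: "x \<in> iv (V q)" using iv_mono[OF V(1)] x by blast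
    have "y \<notin> iv (Fd q)" using dis y by blast
    then have "wd (V q) \<le> \<bar>x - y\<bar>" by (rule far_GG[OF V(2,5,3) xV])
    moreover have "\<bar>x - lo (V q)\<bar> \<le> wd (V q)" using xV unfolding iv_def by auto
    moreover have "\<bar>lo z - y\<bar> \<le> wd z" using y unfolding iv_def by auto
    moreover have "\<bar>lo z - lo (V q)\<bar> \<le> \<bar>lo z - y\<bar> + \<bar>x - y\<bar> + \<bar>x - lo (V q)\<bar>" by linarith
    ultimately have "wd (V q) + \<bar>lo z - lo (V q)\<bar> \<le> 4 * \<bar>x - y\<bar>" using wz by simp
    then show ?thesis unfolding d_def by simp
  qed
  have qz: "y \<notin> iv q" if "y \<in> iv z" for y
    using sep[of y y] that d0 by auto
  have side: "x' + d \<le> y \<or> y + d \<le> x" if "x \<in> iv q" "x' \<in> iv q" "x \<le> x'" "y \<in> iv z" for x x' y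
  proof -
    have "y < x \<or> x' < y" using qz[OF that(4)] that(1-3) unfolding iv_def by auto
    then show ?thesis using sep[OF that(1,4)] sep[OF that(2,4)] that(3) by (auto simp: abs_if split: if_splits)
  qed
  define c where "c = 4 / d\<^sup>2 * s z"
  have mono: "0 \<le> tr.HS (iv z) x' - tr.HS (iv z) x" "tr.HS (iv z) x' - tr.HS (iv z) x \<le> (x' - x) * c"
    if "x \<in> iv q" "x' \<in> iv q" "x \<le> x'" for x x'
    unfolding c_def s_def by (rule tr.HS_diff_upper[OF _ _ d0 that(3) side[OF that]]; simp)+
  interpret hq: haar_interval w "iv q" "lo q" "lo q + wd q" by (rule haar_iv[OF w])
  have "\<theta> z q \<ge> 0" unfolding th_def
    by (rule hq.mono_coeff[OF HS_set_integrable]) (use mono(1) in auto)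
  moreover have "\<theta> z q \<le> c * xh q"
  proof -
    have int: "set_integrable w (iv q) (\<lambda>x. c * x)" using id_set_integrable[of q c 0] by simp
    have "0 \<le> l2_inner w (\<lambda>x. c * x - tr.HS (iv z) x) (haar w (iv q))"
    proof (rule hq.mono_coeff)
      show "set_integrable w (iv q) (\<lambda>x. c * x - tr.HS (iv z) x)"
        by (rule set_integral_diff(1)[OF int HS_set_integrable]) auto
      show "c * x - tr.HS (iv z) x \<le> c * x' - tr.HS (iv z) x'" if "x \<in> iv q" "x' \<in> iv q" "x \<le> x'" for x x'
        using mono(2)[OF that] by (simp add: algebra_simps)
    qed
    also have "\<dots> = (LINT x|w. c * x * haar w (iv q) x) - \<theta> z q"
      unfolding l2_inner_def th_def left_diff_distrib
      by (rule Bochner_Integration.integral_diff[OF hq.haar_mult_integrable[OF int] HS_haar_integrable]) auto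
    also have "(LINT x|w. c * x * haar w (iv q) x) = c * xh q" by (simp add: xh_def l2_inner_def mult.assoc)
    finally show ?thesis by simp
  qed
  moreover have "c * xh q = 64 * pk (wd (V q)) (lo z - lo (V q)) * s z * xh q"
    by (simp add: c_def d_def pk_def power_divide)
  ultimately show ?thesis by simp
qed

text \<open>Outside of \<open>F\<close> the multiplier \<open>kap F\<close> telescopes to an average over a common ancestor,
  which the maximal function controls.\<close>

definition "kap F z = (\<Sum>v | v \<noteq> [] \<and> suffix v F \<and> suffix v z. cf v)"

lemma finite_suf: "finite {v :: bool list. P v \<and> suffix v F \<and> Q v}" "finite {v :: bool list. P v \<and> suffix v F}"
  by (rule finite_subset[OF _ finite_suffixes[of F]]; auto)+

lemma kap_self: assumes "s F > 0" shows "kap F F = Ef F"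
proof -
  have "kap F F = (\<Sum>v | suffix v F \<and> suffix [] v \<and> v \<noteq> []. cf v)"
    unfolding kap_def by (rule sum.cong) auto
  then show ?thesis using telescope[of "[]" F] assms by (simp add: Ef_Nil)
qed

lemma kap_below: "suffix F z \<Longrightarrow> kap F z = kap F F"
  unfolding kap_def by (rule sum.cong) (auto intro: suffix_order.trans)

lemma kap_bound: assumes "s z > 0" shows "\<bar>kap F z\<bar> \<le> mx z"
proof -
  define k where "k = (ARG_MAX length v. suffix v F \<and> suffix v z)"
  have "(suffix k F \<and> suffix k z) \<and> (\<forall>v. suffix v F \<and> suffix v z \<longrightarrow> length v \<le> length k)"
    unfolding k_def by (rule arg_max_nat_lemma[where k = "[]" and b = "Suc (length z)"])
      (auto dest: suffix_length_le simp: less_Suc_eq_le)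
  then have k: "suffix k F" "suffix k z" "\<And>v. suffix v F \<Longrightarrow> suffix v z \<Longrightarrow> length v \<le> length k" by auto
  have "suffix v F \<and> suffix v z \<longleftrightarrow> suffix v k" for v
    using suffix_length_suffix[OF _ k(1), of v] k(3)[of v] suffix_order.trans[OF _ k(1), of v] suffix_order.trans[OF _ k(2), of v]
    by blast
  then have "kap F z = kap k k" by (simp add: kap_def)
  also have "\<dots> = Ef k" by (rule kap_self) (use s_mono[OF k(2)] assms in linarith)
  finally show ?thesis using Ef_le[of k] fa_le_mx[OF k(2)] by linarith
qed

definition "off q = (\<Sum>v | v \<noteq> [] \<and> suffix v (Fd q). cf v * \<theta> v q)"
definition "kk q z = mx z * (64 * pk (wd (V q)) (lo z - lo (V q)) * s z * xh q)"

lemma kk_nonneg: "kk q z \<ge> 0" unfolding kk_def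
  using xh_nonneg pk_pos[OF wd_pos, of "V q" "lo z - lo (V q)"] by (intro mult_nonneg_nonneg) (auto simp: less_imp_le)

text \<open>Each transform is split into atoms. On the atoms of \<open>Fd q\<close> the multiplier
  is the constant \<open>kap (Fd q) (Fd q)\<close>, so they reassemble to a testing term. The atoms
  outside are far from \<open>q\<close> and carry at most the maximal function.\<close>

lemma off_bound:
  assumes q: "q \<in> GG" shows "\<bar>off q\<bar> \<le> fa (Fd q) * \<bar>\<theta> (Fd q) q\<bar> + (\<Sum>z\<in>atoms N. kk q z)"
proof -
  let ?F = "Fd q"
  let ?S = "{v. v \<noteq> [] \<and> suffix v ?F}"
  have lF: "length ?F \<le> N" using V_props(3,4)[OF q] by simp
  have "off q = (\<Sum>v\<in>?S. \<Sum>z\<in>atoms N. if suffix v z then cf v * \<theta> z q else 0)"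
    unfolding off_def
  proof (rule sum.cong[OF refl])
    fix v assume "v \<in> ?S"
    then have "length v \<le> N" using suffix_length_le[of v ?F] lF by simp
    then show "cf v * \<theta> v q = (\<Sum>z\<in>atoms N. if suffix v z then cf v * \<theta> z q else 0)"
      by (simp add: th_atoms sum_distrib_left At_def sum.inter_filter[symmetric])
  qed
  also have "\<dots> = (\<Sum>z\<in>atoms N. \<Sum>v\<in>?S. if suffix v z then cf v * \<theta> z q else 0)" by (rule sum.swap)
  also have "\<dots> = (\<Sum>z\<in>atoms N. kap ?F z * \<theta> z q)"
  proof (rule sum.cong[OF refl])
    fix z
    have "{v \<in> ?S. suffix v z} = {v. v \<noteq> [] \<and> suffix v ?F \<and> suffix v z}" by auto
    then show "(\<Sum>v\<in>?S. if suffix v z then cf v * \<theta> z q else 0) = kap ?F z * \<theta> z q"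
      using finite_suf(2)[of "\<lambda>v. v \<noteq> []" ?F] by (simp add: kap_def sum_distrib_right sum.inter_filter[symmetric])
  qed
  also have "\<dots> = (\<Sum>z\<in>At ?F. kap ?F z * \<theta> z q) + (\<Sum>z\<in>atoms N - At ?F. kap ?F z * \<theta> z q)"
    using sum.subset_diff[OF At_sub finite_atoms] by (simp add: add.commute)
  also have "(\<Sum>z\<in>At ?F. kap ?F z * \<theta> z q) = kap ?F ?F * \<theta> ?F q"
    unfolding th_atoms[OF lF] sum_distrib_left by (intro sum.cong refl) (metis kap_below At_def mem_Collect_eq)
  finally have "\<bar>off q\<bar> \<le> \<bar>kap ?F ?F * \<theta> ?F q\<bar> + (\<Sum>z\<in>atoms N - At ?F. \<bar>kap ?F z * \<theta> z q\<bar>)"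
    using sum_abs[of "\<lambda>z. kap ?F z * \<theta> z q" "atoms N - At ?F"] by linarith
  also have "\<bar>kap ?F ?F * \<theta> ?F q\<bar> \<le> fa ?F * \<bar>\<theta> ?F q\<bar>"
  proof (cases "s ?F = 0")
    case False
    then have "kap ?F ?F = Ef ?F" using kap_self s_nonneg[of ?F] by (metis less_eq_real_def)
    then show ?thesis using Ef_le[of ?F] by (simp add: abs_mult mult_right_mono)
  qed (simp add: th_null)
  also have "(\<Sum>z\<in>atoms N - At ?F. \<bar>kap ?F z * \<theta> z q\<bar>) \<le> (\<Sum>z\<in>atoms N - At ?F. kk q z)"
  proof (rule sum_mono)
    fix z assume "z \<in> atoms N - At ?F"
    then have z: "z \<in> atoms N" "\<not> suffix ?F z" by (auto simp: At_def)
    show "\<bar>kap ?F z * \<theta> z q\<bar> \<le> kk q z"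
    proof (cases "s z = 0")
      case True
      then show ?thesis by (simp add: th_null kk_def)
    next
      case False
      then have "s z > 0" using s_nonneg[of z] by (metis less_eq_real_def)
      then show ?thesis unfolding kk_def abs_mult by (intro mult_mono kap_bound th_far[OF q z]) auto
    qed
  qed
  also have "\<dots> \<le> (\<Sum>z\<in>atoms N. kk q z)" by (rule sum_mono2) (auto simp: kk_nonneg)
  finally show ?thesis by simp
qed

lemma FF_N: "q \<in> GG \<Longrightarrow> Fd q \<in> {F \<in> FF. length F \<le> N}" using V_props(3,4)[of q] by simp

text \<open>Cauchy-Schwarz against the coefficients of g, then Bessel and testing inside each
  stopping interval, then the Carleson embedding over the stopping intervals.\<close>

lemma testing_part: "(\<Sum>q\<in>GG. \<bar>gh q\<bar> * \<bar>fa (Fd q) * \<theta> (Fd q) q\<bar>) \<le> sqrt NG * sqrt (Tst\<^sup>2 * (16 / 3 * NF))"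
proof (rule Cauchy_Schwarz_sum)
  show "(\<Sum>q\<in>GG. (gh q)\<^sup>2) \<le> NG" by (rule sum_gh[OF finG])
  let ?K = "{F \<in> FF. length F \<le> N}"
  have "(\<Sum>q\<in>GG. (fa (Fd q) * \<theta> (Fd q) q)\<^sup>2) = (\<Sum>F\<in>?K. \<Sum>q | q \<in> GG \<and> Fd q = F. (fa (Fd q) * \<theta> (Fd q) q)\<^sup>2)"
    by (rule sum.group[symmetric, OF finG finite_FF]) (use FF_N in blast)
  also have "\<dots> = (\<Sum>F\<in>?K. (fa F)\<^sup>2 * (\<Sum>q | q \<in> GG \<and> Fd q = F. (\<theta> F q)\<^sup>2))"
    unfolding sum_distrib_left by (intro sum.cong refl) (auto simp: power_mult_distrib)
  also have "\<dots> \<le> (\<Sum>F\<in>?K. (fa F)\<^sup>2 * (Tst\<^sup>2 * s F))"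
    by (intro sum_mono mult_left_mono sum_th_sq) (use finG Fd_suffix(2) in auto)
  also have "\<dots> = Tst\<^sup>2 * (\<Sum>F\<in>?K. (fa F)\<^sup>2 * s F)" by (simp add: sum_distrib_left mult_ac)
  also have "\<dots> \<le> Tst\<^sup>2 * (16 / 3 * NF)" using sum_fa_FF by (intro mult_left_mono) auto
  finally show "(\<Sum>q\<in>GG. (fa (Fd q) * \<theta> (Fd q) q)\<^sup>2) \<le> Tst\<^sup>2 * (16 / 3 * NF)" .
qed

text \<open>692060160 = 64 * 2 * 2703360 * 2: the factors are those of \<open>th_far\<close>,
  \<open>optimize_scale\<close>, \<open>functional_energy\<close> and the norm of the maximal
  function.\<close>

lemma poisson_part: "(\<Sum>q\<in>GG. \<bar>gh q\<bar> * (\<Sum>z\<in>atoms N. kk q z)) \<le> 692060160 * (real r + 19) * H * (sqrt NF * sqrt NG)"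
proof -
  \<comment> \<open>Where \<open>xh q = 0\<close> the quotient is 0, which is harmless since
    \<open>kk q z\<close> contains a factor \<open>xh q\<close>.\<close>
  define \<psi> where "\<psi> q = \<bar>gh q\<bar> / xh q" for q
  have \<psi>: "\<psi> q * (xh q)\<^sup>2 = \<bar>gh q\<bar> * xh q" "(\<psi> q)\<^sup>2 * (xh q)\<^sup>2 \<le> (gh q)\<^sup>2" "\<psi> q \<ge> 0" for q
    using xh_nonneg[of q] by (auto simp: \<psi>_def power2_eq_square power_divide)
  define A where "A = (\<Sum>z\<in>atoms N. \<Sum>q\<in>GG. mx z * s z * (\<psi> q * (xh q)\<^sup>2) * pk (wd (V q)) (lo z - lo (V q)))"
  have "(\<Sum>q\<in>GG. \<bar>gh q\<bar> * (\<Sum>z\<in>atoms N. kk q z)) = (\<Sum>q\<in>GG. \<Sum>z\<in>atoms N. 64 * (mx z * s z * (\<psi> q * (xh q)\<^sup>2) * pk (wd (V q)) (lo z - lo (V q))))"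
    unfolding sum_distrib_left \<psi>(1) kk_def by (intro sum.cong refl) (simp add: mult_ac)
  also have "\<dots> = 64 * A" unfolding A_def sum_distrib_left by (rule sum.swap)
  also have "A \<le> 2 * (2703360 * (real r + 19) * H) * ((2 * sqrt NF) * sqrt NG)"
  proof (rule optimize_scale)
    fix u :: real assume u: "u > 0"
    define t where "t = sqrt u"
    have t: "t > 0" "t\<^sup>2 = u" using u by (auto simp: t_def)
    have "A = (\<Sum>x\<in>atoms N. \<Sum>q\<in>GG. (t * mx x) * s x * ((\<psi> q / t) * (xh q)\<^sup>2) * pk (wd (V q)) (lo x - lo (V q)))"
      unfolding A_def by (intro sum.cong refl) (use t(1) in simp)
    also have "\<dots> \<le> 2703360 * (real r + 19) * H * ((\<Sum>x\<in>atoms N. (t * mx x)\<^sup>2 * s x) + (\<Sum>q\<in>GG. (\<psi> q / t)\<^sup>2 * (xh q)\<^sup>2))"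
      by (rule functional_energy) (use t \<psi>(3) in auto)
    also have "\<dots> \<le> 2703360 * (real r + 19) * H * (u * (2 * sqrt NF)\<^sup>2 + (sqrt NG)\<^sup>2 / u)"
    proof (intro mult_left_mono add_mono)
      have "(\<Sum>x\<in>atoms N. (t * mx x)\<^sup>2 * s x) = u * (\<Sum>x\<in>atoms N. (mx x)\<^sup>2 * s x)"
        by (simp add: sum_distrib_left power_mult_distrib t(2) mult_ac)
      also have "\<dots> \<le> u * (4 * NF)" using sum_mx u by (intro mult_left_mono) auto
      finally show "(\<Sum>x\<in>atoms N. (t * mx x)\<^sup>2 * s x) \<le> u * (2 * sqrt NF)\<^sup>2" by (simp add: power_mult_distrib)
      have "(\<Sum>q\<in>GG. (\<psi> q / t)\<^sup>2 * (xh q)\<^sup>2) = (\<Sum>q\<in>GG. (\<psi> q)\<^sup>2 * (xh q)\<^sup>2) / u"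
        by (simp add: sum_divide_distrib power_divide t(2))
      also have "\<dots> \<le> (\<Sum>q\<in>GG. (gh q)\<^sup>2) / u" using u by (intro divide_right_mono sum_mono \<psi>(2)) auto
      also have "\<dots> \<le> NG / u" using u sum_gh[OF finG] by (intro divide_right_mono) auto
      finally show "(\<Sum>q\<in>GG. (\<psi> q / t)\<^sup>2 * (xh q)\<^sup>2) \<le> (sqrt NG)\<^sup>2 / u" by simp
    qed auto
    finally show "A \<le> 2703360 * (real r + 19) * H * (u * (2 * sqrt NF)\<^sup>2 + (sqrt NG)\<^sup>2 / u)" .
  qed auto
  finally show ?thesis by (simp add: algebra_simps)
qed

text \<open>The coronas partition the Haar coefficients of f, and \<open>Fd\<close> those of g, so
  Cauchy-Schwarz in \<open>F\<close> applies. 7/3 rounds up the square root of 16/3, and 22 = 9 *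
  7/3 + 1.\<close>

lemma diag_sum:
  assumes lc: "local_const \<epsilon> r C0 D \<sigma> w = ennreal \<Lambda>" "\<Lambda> \<ge> 0"
  shows "(\<Sum>F | F \<in> FF \<and> length F \<le> N. \<bar>diag F\<bar>) \<le> \<Lambda> * (22 * (sqrt NF * sqrt NG))"
proof -
  let ?K = "{F \<in> FF. length F \<le> N}"
  have n: "fn F \<ge> 0" "gn F \<ge> 0" for F unfolding fn_def gn_def by (simp_all add: sum_nonneg)
  have sq: "(fn F)\<^sup>2 = (\<Sum>p | length p < N \<and> stp p = F. (fh p)\<^sup>2)" "(gn F)\<^sup>2 = (\<Sum>q | length q < N \<and> Fd q = F. (gh q)\<^sup>2)" for F
    unfolding fn_def gn_def by (simp_all add: sum_nonneg)
  have sf: "(\<Sum>F\<in>?K. (fn F)\<^sup>2) \<le> NF"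
  proof -
    have "(\<Sum>F\<in>?K. (fn F)\<^sup>2) = (\<Sum>F\<in>?K. \<Sum>p | p \<in> {p. length p < N} \<and> stp p = F. (fh p)\<^sup>2)"
      unfolding sq by (simp only: mem_Collect_eq)
    also have "\<dots> = (\<Sum>p | length p < N. (fh p)\<^sup>2)"
    proof (rule sum.group[OF finite_short(2) finite_FF])
      show "stp ` {p. length p < N} \<subseteq> ?K"
      proof safe
        fix p :: "bool list" assume "length p < N"
        then show "length (stp p) \<le> N" using suffix_length_le[OF suffix_stp, of p] by linarith
      qed simp
    qed
    finally show ?thesis using sum_fh[OF finite_short(2)] by simp
  qed
  have sg: "(\<Sum>F\<in>?K. (gn F)\<^sup>2) \<le> NG"
  proof -
    have "(\<Sum>F\<in>?K. (gn F)\<^sup>2) = (\<Sum>F\<in>?K. \<Sum>p | p \<in> {p. length p < N} \<and> Fd p = F. (gh p)\<^sup>2)"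
      unfolding sq by (simp only: mem_Collect_eq)
    also have "\<dots> = (\<Sum>p | length p < N. (gh p)\<^sup>2)"
    proof (rule sum.group[OF finite_short(2) finite_FF])
      show "Fd ` {p. length p < N} \<subseteq> ?K"
      proof safe
        fix p :: "bool list" assume "length p < N"
        then show "length (Fd p) \<le> N" using suffix_length_le[OF Fd_suffix(2), of p] by linarith
      qed simp
    qed
    finally show ?thesis using sum_gh[OF finite_short(2)] by simp
  qed
  have "(\<Sum>F\<in>?K. \<bar>diag F\<bar>) \<le> (\<Sum>F\<in>?K. \<Lambda> * ((9 * (fa F * sqrt (s F)) + fn F) * gn F))"
    by (intro sum_mono diag_bound[OF _ lc]) simp
  also have "\<dots> = \<Lambda> * (9 * (\<Sum>F\<in>?K. \<bar>fa F * sqrt (s F)\<bar> * \<bar>gn F\<bar>) + (\<Sum>F\<in>?K. \<bar>fn F\<bar> * \<bar>gn F\<bar>))"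
    unfolding sum_distrib_left sum.distrib[symmetric] by (intro sum.cong refl) (simp add: n abs_mult algebra_simps)
  also have "\<dots> \<le> \<Lambda> * (9 * (7 / 3 * sqrt NF * sqrt NG) + sqrt NF * sqrt NG)"
  proof (intro mult_left_mono add_mono Cauchy_Schwarz_sum[OF sf sg])
    have "(\<Sum>F\<in>?K. (fa F * sqrt (s F))\<^sup>2) \<le> 16 / 3 * NF" using sum_fa_FF by (simp add: power_mult_distrib)
    then have "(\<Sum>F\<in>?K. \<bar>fa F * sqrt (s F)\<bar> * \<bar>gn F\<bar>) \<le> sqrt (16 / 3 * NF) * sqrt NG" by (rule Cauchy_Schwarz_sum[OF _ sg])
    also have "\<dots> \<le> sqrt ((7 / 3)\<^sup>2 * NF) * sqrt NG"
      by (intro mult_right_mono real_sqrt_le_mono) (auto simp: power2_eq_square)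
    also have "sqrt ((7 / 3)\<^sup>2 * NF) = 7 / 3 * sqrt NF" by (simp add: real_sqrt_mult)
    finally show "(\<Sum>F\<in>?K. \<bar>fa F * sqrt (s F)\<bar> * \<bar>gn F\<bar>) \<le> 7 / 3 * sqrt NF * sqrt NG" .
  qed (use lc(2) in auto)
  finally show ?thesis by (simp add: algebra_simps)
qed

text \<open>The ancestors of the r-th ancestor of \<open>q\<close> divide at \<open>Fd q\<close>.
  Those strictly below it have their parent in the corona of \<open>Fd q\<close>;
  \<open>Fd q\<close> itself belongs to the other part, because its parent lies above.\<close>

lemma B_above_split: "B_above \<alpha> \<beta> r D \<sigma> w (iv []) f g = (\<Sum>F | F \<in> FF \<and> length F \<le> N. diag F) + (\<Sum>q\<in>GG. gh q * off q)"
proof -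
  let ?K = "{F \<in> FF. length F \<le> N}"
  let ?X = "\<lambda>v q. gh q * cf v * \<theta> v q"
  let ?E = "\<lambda>q. {v. v \<noteq> [] \<and> suffix v (drop r q) \<and> stp (tl v) = Fd q}"
  have fin: "finite {v. v \<noteq> [] \<and> suffix v (drop r q) \<and> P v}" for q :: "bool list" and P
    by (rule finite_subset[OF _ finite_suffixes[of "drop r q"]]) auto
  have "B_above \<alpha> \<beta> r D \<sigma> w (iv []) f g = (\<Sum>q | length q < N. \<Sum>v | v \<noteq> [] \<and> suffix v (drop r q) \<and> suffix [] (tl v). ?X v q)"
    unfolding cf_def fh_def gh_def
    by (rule B_above_eq[OF \<sigma>]) (use fh_N gh_N in \<open>auto simp: fh_def gh_def\<close>)
  also have "\<dots> = (\<Sum>q | length q < N. (\<Sum>v\<in>?E q. ?X v q) + gh q * off q)"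
  proof (rule sum.cong[OF refl])
    fix q
    have eq: "{v. v \<noteq> [] \<and> suffix v (drop r q) \<and> suffix [] (tl v)} = ?E q \<union> {v. v \<noteq> [] \<and> suffix v (Fd q)}"
    proof (intro equalityI subsetI)
      fix v assume "v \<in> {v. v \<noteq> [] \<and> suffix v (drop r q) \<and> suffix [] (tl v)}"
      then have v: "v \<noteq> []" "suffix v (drop r q)" by auto
      show "v \<in> ?E q \<union> {v. v \<noteq> [] \<and> suffix v (Fd q)}"
      proof (cases "suffix v (Fd q)")
        case False
        then have "suffix (Fd q) v" using suffix_same_cases[OF v(2) Fd_suffix(1)] by blast
        moreover have "Fd q \<noteq> v" using False by auto
        ultimately have "suffix (Fd q) (tl v)" using v(1) by (cases v) (auto simp: suffix_Cons)
        moreover have "suffix (tl v) (drop r q)" using v(2) suffix_tl suffix_order.trans by blast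
        ultimately have "stp (tl v) = Fd q" using stp_between[of "drop r q" "tl v"] by (simp add: Fd_def)
        then show ?thesis using v by simp
      qed (use v in simp)
    next
      fix v assume "v \<in> ?E q \<union> {v. v \<noteq> [] \<and> suffix v (Fd q)}"
      then show "v \<in> {v. v \<noteq> [] \<and> suffix v (drop r q) \<and> suffix [] (tl v)}"
        using suffix_order.trans[OF _ Fd_suffix(1)[of q]] by auto
    qed
    have dis: "?E q \<inter> {v. v \<noteq> [] \<and> suffix v (Fd q)} = {}"
    proof (rule equals0I)
      fix v assume "v \<in> ?E q \<inter> {v. v \<noteq> [] \<and> suffix v (Fd q)}"
      then have v: "v \<noteq> []" "stp (tl v) = Fd q" "suffix v (Fd q)" by auto
      then have "length v \<le> length (tl v)"
        using suffix_length_le[OF v(3)] suffix_length_le[OF suffix_stp[of "tl v"]] by (simp only: v(2))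
      then show False using v(1) by (cases v) auto
    qed
    show "(\<Sum>v | v \<noteq> [] \<and> suffix v (drop r q) \<and> suffix [] (tl v). ?X v q) = (\<Sum>v\<in>?E q. ?X v q) + gh q * off q"
      unfolding eq sum.union_disjoint[OF fin finite_suf(2) dis] off_def sum_distrib_left by (simp add: mult.assoc)
  qed
  also have "\<dots> = (\<Sum>q | length q < N. \<Sum>v\<in>?E q. ?X v q) + (\<Sum>q | length q < N. gh q * off q)" by (rule sum.distrib)
  also have "(\<Sum>q | length q < N. gh q * off q) = (\<Sum>q\<in>GG. gh q * off q)"
  proof (rule sum.mono_neutral_right)
    show "GG \<subseteq> {q. length q < N}" using gh_N by (auto simp: GG_def)
    show "\<forall>q\<in>{q. length q < N} - GG. gh q * off q = 0"
    proof
      fix q assume "q \<in> {q. length q < N} - GG"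
      then have "gh q = 0 \<or> drop r q = []" by (auto simp: GG_def)
      moreover have "off q = 0" if "drop r q = []" using that by (simp add: off_def Fd_def)
      ultimately show "gh q * off q = 0" by auto
    qed
  qed simp
  also have "(\<Sum>q | length q < N. \<Sum>v\<in>?E q. ?X v q) = (\<Sum>F\<in>?K. \<Sum>q | q \<in> {q. length q < N} \<and> Fd q = F. \<Sum>v\<in>?E q. ?X v q)"
  proof (rule sum.group[symmetric, OF finite_short(2) finite_FF])
    show "Fd ` {p. length p < N} \<subseteq> ?K"
    proof safe
      fix p :: "bool list" assume "length p < N"
      then show "length (Fd p) \<le> N" using suffix_length_le[OF Fd_suffix(2), of p] by linarith
    qed simp
  qed
  also have "\<dots> = (\<Sum>F\<in>?K. diag F)"
    unfolding diag_def by (intro sum.cong refl) auto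
  finally show ?thesis .
qed

theorem above_bound:
  assumes lc: "local_const \<epsilon> r C0 D \<sigma> w = ennreal \<Lambda>" "\<Lambda> \<ge> 0"
  shows "\<bar>B_above \<alpha> \<beta> r D \<sigma> w (iv []) f g\<bar> \<le> 10 ^ 9 * (real r + 19) * (H + \<Lambda>) * (l2_norm \<sigma> f * l2_norm w g)"
proof -
  define n where "n = sqrt NF * sqrt NG"
  have n0: "n \<ge> 0" by (simp add: n_def)
  have "\<bar>\<Sum>q\<in>GG. gh q * off q\<bar> \<le> (\<Sum>q\<in>GG. \<bar>gh q * off q\<bar>)" by (rule sum_abs)
  also have "\<dots> \<le> (\<Sum>q\<in>GG. \<bar>gh q\<bar> * (fa (Fd q) * \<bar>\<theta> (Fd q) q\<bar> + (\<Sum>z\<in>atoms N. kk q z)))"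
    unfolding abs_mult by (intro sum_mono mult_left_mono off_bound) auto
  also have "\<dots> = (\<Sum>q\<in>GG. \<bar>gh q\<bar> * \<bar>fa (Fd q) * \<theta> (Fd q) q\<bar>) + (\<Sum>q\<in>GG. \<bar>gh q\<bar> * (\<Sum>z\<in>atoms N. kk q z))"
    unfolding sum.distrib[symmetric] by (intro sum.cong refl) (simp add: distrib_left abs_mult)
  also have "(\<Sum>q\<in>GG. \<bar>gh q\<bar> * \<bar>fa (Fd q) * \<theta> (Fd q) q\<bar>) \<le> 7 / 3 * H * n"
  proof -
    have "sqrt (Tst\<^sup>2 * (16 / 3 * NF)) \<le> sqrt (H\<^sup>2 * ((7 / 3)\<^sup>2 * NF))"
      using A2_Tst_le_H(3) by (intro real_sqrt_le_mono mult_mono) (auto simp: power2_eq_square)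
    also have "\<dots> = H * (7 / 3 * sqrt NF)" by (simp add: real_sqrt_mult)
    finally have "sqrt NG * sqrt (Tst\<^sup>2 * (16 / 3 * NF)) \<le> sqrt NG * (H * (7 / 3 * sqrt NF))" by (intro mult_left_mono) auto
    then show ?thesis using testing_part by (simp add: n_def mult_ac)
  qed
  also have "(\<Sum>q\<in>GG. \<bar>gh q\<bar> * (\<Sum>z\<in>atoms N. kk q z)) \<le> 692060160 * (real r + 19) * H * n"
    unfolding n_def by (rule poisson_part)
  finally have "\<bar>\<Sum>q\<in>GG. gh q * off q\<bar> \<le> 7 / 3 * H * n + 692060160 * (real r + 19) * H * n" by simp
  moreover have "\<bar>\<Sum>F | F \<in> FF \<and> length F \<le> N. diag F\<bar> \<le> \<Lambda> * (22 * n)"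
    using sum_abs[of diag "{F. F \<in> FF \<and> length F \<le> N}"] diag_sum[OF lc] unfolding n_def by (rule order_trans)
  ultimately have "\<bar>B_above \<alpha> \<beta> r D \<sigma> w (iv []) f g\<bar> \<le> \<Lambda> * (22 * n) + (7 / 3 * H * n + 692060160 * (real r + 19) * H * n)"
    unfolding B_above_split by linarith
  also have "\<dots> = (22 * \<Lambda> + (7 / 3 + 692060160 * (real r + 19)) * H) * n" by (simp add: algebra_simps)
  also have "\<dots> \<le> (10 ^ 9 * (real r + 19) * \<Lambda> + 10 ^ 9 * (real r + 19) * H) * n"
    using lc(2) n0 by (intro mult_right_mono add_mono) auto
  also have "\<dots> = 10 ^ 9 * (real r + 19) * (H + \<Lambda>) * n" by (simp add: algebra_simps)
  finally show ?thesis by (simp add: n_def NF_def NG_def l2_norm_def)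
qed

end

subsection \<open>Duality and the theorem\<close>

lemma finite_haar_support:
  assumes D: "dyadic_grid D" and \<mu>: "locally_finite_borel \<mu>" and f: "good_function \<epsilon> r D \<mu> I0 f"
  shows "finite (haar_support D \<mu> f)"
proof -
  obtain G c where G: "finite G" "G \<subseteq> D" and ae: "AE x in \<mu>. f x = (\<Sum>I\<in>G. c I * haar \<mu> I x)"
    using f unfolding good_function_def by blast
  have meas: "f \<in> borel_measurable \<mu>" using f unfolding good_function_def by (simp add: lfb_measurable[OF \<mu>])
  have hm: "haar \<mu> J \<in> borel_measurable \<mu>" for J using haar_measurable by (simp add: lfb_measurable[OF \<mu>])
  have "haar_support D \<mu> f \<subseteq> G"
  proof
    fix J assume "J \<in> haar_support D \<mu> f"
    then have J: "J \<in> D" "l2_inner \<mu> f (haar \<mu> J) \<noteq> 0" by (auto simp: haar_support_def)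
    obtain u v where uv: "u < v" "J = {u..<v}" using grid_interval[OF D J(1)] .
    interpret J: haar_interval \<mu> J u v by unfold_locales (use uv \<mu> in auto)
    have int: "integrable \<mu> (\<lambda>x. haar \<mu> I x * haar \<mu> J x)" if IG: "I \<in> G" for I
    proof -
      have "I \<in> D" using IG G(2) by blast
      then obtain u' v' where uv': "u' < v'" "I = {u'..<v'}" by (rule grid_interval[OF D])
      interpret I: haar_interval \<mu> I u' v' by unfold_locales (use uv' \<mu> in auto)
      show ?thesis by (rule J.haar_mult_integrable[OF I.haar_set_integrable]) simp
    qed
    show "J \<in> G"
    proof (rule ccontr)
      assume JG: "J \<notin> G"
      have "l2_inner \<mu> f (haar \<mu> J) = (LINT x|\<mu>. (\<Sum>I\<in>G. c I * (haar \<mu> I x * haar \<mu> J x)))"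
        unfolding l2_inner_def
      proof (rule integral_cong_AE)
        show "AE x in \<mu>. f x * haar \<mu> J x = (\<Sum>I\<in>G. c I * (haar \<mu> I x * haar \<mu> J x))"
          using ae by eventually_elim (simp add: sum_distrib_right mult.assoc)
      qed (use meas hm in measurable)
      also have "\<dots> = (\<Sum>I\<in>G. c I * l2_inner \<mu> (haar \<mu> I) (haar \<mu> J))"
        using int by (simp add: l2_inner_def)
      also have "\<dots> = 0"
      proof (rule sum.neutral, rule ballI)
        fix I assume "I \<in> G"
        then have "l2_inner \<mu> (haar \<mu> I) (haar \<mu> J) = 0" using JG G(2) J(1) by (intro haar_orthogonal[OF D \<mu>]) auto
        then show "c I * l2_inner \<mu> (haar \<mu> I) (haar \<mu> J) = 0" by simp
      qed
      finally show False using J(2) by simp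
    qed
  qed
  then show ?thesis using G(1) finite_subset by blast
qed

lemma H_const_commute: "H_const \<sigma> w = H_const w \<sigma>"
  by (simp add: H_const_def A2_const_commute[of \<sigma>] testing_const_commute[of \<sigma>])

lemma above_estimate:
  assumes D: "dyadic_grid D" and \<sigma>: "locally_finite_borel \<sigma>" and w: "locally_finite_borel w"
    and fin: "A2_const \<sigma> w < \<infinity>" "testing_const \<sigma> w < \<infinity>" and en: "energy_inequality C0 D \<sigma> w"
    and par: "0 < \<epsilon>" "\<epsilon> < 1" "0 < C0" "0 < \<alpha>" "\<alpha> < \<beta>" and I0: "I0 \<in> D"
    and f: "good_function \<epsilon> r D \<sigma> I0 f" and g: "good_function \<epsilon> r D w I0 g"
  shows "ennreal \<bar>B_above \<alpha> \<beta> r D \<sigma> w I0 f g\<bar>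
    \<le> ennreal (10 ^ 9 * (real r + 19)) * (ennreal (H_const \<sigma> w) + local_const \<epsilon> r C0 D \<sigma> w) * ennreal (l2_norm \<sigma> f * l2_norm w g)"
proof -
  obtain a b where ab: "a < b" "I0 = {a..<b}" using grid_interval[OF D I0] .
  interpret grid_tree a "b - a" D by unfold_locales (use ab D I0 in auto)
  have iv0: "iv [] = I0" using ab by (simp add: iv_Nil)
  have lens: "finite {p. l2_inner \<mu> h (haar \<mu> (iv p)) \<noteq> 0}"
    if "locally_finite_borel \<mu>" "good_function \<epsilon> r D \<mu> I0 h" for \<mu> h
  proof (rule finite_imageD)
    show "finite (iv ` {p. l2_inner \<mu> h (haar \<mu> (iv p)) \<noteq> 0})"
      by (rule finite_subset[OF _ finite_haar_support[OF D that]]) (auto simp: haar_support_def)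
    show "inj_on iv {p. l2_inner \<mu> h (haar \<mu> (iv p)) \<noteq> 0}" using iv_inj by (intro inj_onI) auto
  qed
  define A where "A = {p. l2_inner \<sigma> f (haar \<sigma> (iv p)) \<noteq> 0} \<union> {p. l2_inner w g (haar w (iv p)) \<noteq> 0}"
  \<comment> \<open>One generation beyond the Haar supports of both functions.\<close>
  define N where "N = Suc (Max (insert 0 (length ` A)))"
  have "finite A" using lens[OF \<sigma> f] lens[OF w g] by (simp add: A_def)
  then have N: "length p < N" if "p \<in> A" for p using that by (simp add: N_def less_Suc_eq_le)
  interpret corona a "b - a" D \<sigma> w \<epsilon> r C0 \<alpha> \<beta> f g N
    by unfold_locales (use \<sigma> w fin en par f g iv0 N in \<open>auto simp: A_def\<close>)
  define n where "n = l2_norm \<sigma> f * l2_norm w g"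
  have n0: "n \<ge> 0" by (simp add: n_def l2_norm_def)
  \<comment> \<open>For an infinite local constant the right side is \<open>top * 0 = 0\<close> when
    a norm vanishes, so the form has to be shown to vanish directly.\<close>
  have zero: "B_above \<alpha> \<beta> r D \<sigma> w I0 f g = 0" if "n = 0"
  proof -
    have "NF = 0 \<or> NG = 0" using that by (simp add: n_def NF_def NG_def l2_norm_def)
    then have "(\<forall>p. fh p = 0) \<or> (\<forall>p. gh p = 0)" using sum_fh[of "{_}"] sum_gh[of "{_}"] by auto
    then have "gh q * (fh p * c) * d = 0" for p q and c d :: real by auto
    moreover have "B_above \<alpha> \<beta> r D \<sigma> w (iv []) f g = (\<Sum>q | length q < N. \<Sum>v | v \<noteq> [] \<and> suffix v (drop r q) \<and> suffix [] (tl v).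
        gh q * (fh (tl v) * hv \<sigma> v) * th \<alpha> \<beta> \<sigma> w v q)"
      unfolding fh_def gh_def by (rule B_above_eq[OF \<sigma>]) (use fh_N gh_N in \<open>auto simp: fh_def gh_def\<close>)
    ultimately show ?thesis by (simp only: iv0 sum.neutral_const)
  qed
  show ?thesis
  proof (cases "local_const \<epsilon> r C0 D \<sigma> w")
    case (real \<Lambda>)
    have "\<bar>B_above \<alpha> \<beta> r D \<sigma> w I0 f g\<bar> \<le> 10 ^ 9 * (real r + 19) * (H + \<Lambda>) * n"
      using above_bound[OF real(2,1)] unfolding iv0 n_def .
    then have "ennreal \<bar>B_above \<alpha> \<beta> r D \<sigma> w I0 f g\<bar> \<le> ennreal (10 ^ 9 * (real r + 19) * (H + \<Lambda>) * n)" by (rule ennreal_leI)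
    also have "\<dots> = ennreal (10 ^ 9 * (real r + 19)) * (ennreal H + ennreal \<Lambda>) * ennreal n"
    proof -
      have "ennreal (10 ^ 9 * (real r + 19) * (H + \<Lambda>) * n) = ennreal (10 ^ 9 * (real r + 19) * (H + \<Lambda>)) * ennreal n"
        by (rule ennreal_mult) (use real n0 in auto)
      also have "ennreal (10 ^ 9 * (real r + 19) * (H + \<Lambda>)) = ennreal (10 ^ 9 * (real r + 19)) * ennreal (H + \<Lambda>)"
        by (rule ennreal_mult) (use real in auto)
      also have "ennreal (H + \<Lambda>) = ennreal H + ennreal \<Lambda>" by (rule ennreal_plus) (use real in auto)
      finally show ?thesis .
    qed
    finally show ?thesis unfolding n_def real(2) .
  next
    case top
    show ?thesis
    proof (cases "n = 0")
      case True
      then show ?thesis using zero by simp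
    next
      case False
      then have "ennreal n \<noteq> 0" using n0 by (simp add: ennreal_eq_0_iff)
      then show ?thesis unfolding n_def top by (simp add: ennreal_mult_top ennreal_top_mult ennreal_eq_0_iff)
    qed
  qed
qed

text \<open>Fubini: both functions are bounded with bounded support and the truncated kernel is
  bounded, so the double integral converges absolutely.\<close>

lemma hilbert_antisymmetric:
  assumes ab: "0 < \<alpha>" "\<alpha> < \<beta>" and \<sigma>: "locally_finite_borel \<sigma>" and w: "locally_finite_borel w"
    and S: "bounded S" "S \<in> sets borel" and U: "bounded U" "U \<in> sets borel"
    and h: "h \<in> borel_measurable borel" "\<And>x. \<bar>h x\<bar> \<le> B" "\<And>x. x \<notin> U \<Longrightarrow> h x = 0"
  shows "l2_inner w (hilbert \<alpha> \<beta> \<sigma> h) (indicator S) = - l2_inner \<sigma> (hilbert \<alpha> \<beta> w (indicator S)) h"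
proof -
  let ?K = "trunc_kernel \<alpha> \<beta>"
  interpret \<sigma>: sigma_finite_measure \<sigma> by (rule lfb_sigma_finite[OF \<sigma>])
  interpret w: sigma_finite_measure w by (rule lfb_sigma_finite[OF w])
  interpret P: pair_sigma_finite w \<sigma> ..
  define k where "k x y = indicator S x * (h y * ?K (y - x))" for x y
  have sets: "sets (w \<Otimes>\<^sub>M \<sigma>) = sets (borel \<Otimes>\<^sub>M borel)" by (rule sets_pair_measure_cong[OF lfb_sets[OF w] lfb_sets[OF \<sigma>]])
  have "case_prod k \<in> borel_measurable (borel \<Otimes>\<^sub>M borel)"
    unfolding k_def[abs_def] using h(1) S(2) by measurable
  then have km: "case_prod k \<in> borel_measurable (w \<Otimes>\<^sub>M \<sigma>)" unfolding measurable_cong_sets[OF sets refl] .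
  have B0: "B \<ge> 0" using h(2)[of 0] by linarith
  have int: "integrable (w \<Otimes>\<^sub>M \<sigma>) (case_prod k)"
  proof (rule integrableI_bounded_set[where A = "S \<times> U" and B = "B * (2 / \<alpha>)"])
    have SU: "S \<in> sets w" "U \<in> sets \<sigma>" using S U by (simp_all add: lfb_sets[OF w] lfb_sets[OF \<sigma>])
    then show "S \<times> U \<in> sets (w \<Otimes>\<^sub>M \<sigma>)" by simp
    show "emeasure (w \<Otimes>\<^sub>M \<sigma>) (S \<times> U) < \<infinity>"
      using \<sigma>.emeasure_pair_measure_Times[OF SU] lfb_finite[OF w S] lfb_finite[OF \<sigma> U] by (simp add: ennreal_mult_less_top)
    show "AE z in w \<Otimes>\<^sub>M \<sigma>. z \<in> S \<times> U \<longrightarrow> norm (case_prod k z) \<le> B * (2 / \<alpha>)"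
    proof (intro AE_I2 impI)
      fix z assume "z \<in> S \<times> U"
      obtain x y where z: "z = (x, y)" by (cases z)
      have "\<bar>h y\<bar> * \<bar>?K (y - x)\<bar> \<le> B * (2 / \<alpha>)" by (intro mult_mono h(2) trunc_kernel_bound ab B0) auto
      moreover have "0 \<le> B * (2 / \<alpha>)" using B0 ab by simp
      ultimately show "norm (case_prod k z) \<le> B * (2 / \<alpha>)" by (simp add: z k_def abs_mult indicator_def)
    qed
    show "AE z in w \<Otimes>\<^sub>M \<sigma>. z \<notin> S \<times> U \<longrightarrow> case_prod k z = 0"
      using h(3) by (intro AE_I2) (force simp: k_def indicator_def)
  qed (rule km)
  have "l2_inner w (hilbert \<alpha> \<beta> \<sigma> h) (indicator S) = (LINT x|w. LINT y|\<sigma>. k x y)"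
    unfolding l2_inner_def hilbert_def k_def by (simp add: mult.commute)
  also have "\<dots> = (LINT y|\<sigma>. LINT x|w. k x y)" by (rule P.Fubini_integral[OF int, symmetric])
  also have "\<dots> = (LINT y|\<sigma>. - ((LINT x|w. indicator S x * ?K (x - y)) * h y))"
  proof (rule Bochner_Integration.integral_cong[OF refl])
    fix y
    have "k x y = - h y * (indicator S x * ?K (x - y))" for x
      using trunc_kernel_odd[of \<alpha> \<beta> "x - y"] by (simp add: k_def)
    then have "(LINT x|w. k x y) = - h y * (LINT x|w. indicator S x * ?K (x - y))" by simp
    then show "(LINT x|w. k x y) = - ((LINT x|w. indicator S x * ?K (x - y)) * h y)" by (simp add: mult.commute)
  qed
  also have "\<dots> = - l2_inner \<sigma> (hilbert \<alpha> \<beta> w (indicator S)) h" by (simp add: l2_inner_def hilbert_def)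
  finally show ?thesis .
qed

lemma B_below_eq:
  assumes D: "dyadic_grid D" and ab: "0 < \<alpha>" "\<alpha> < \<beta>" and \<sigma>: "locally_finite_borel \<sigma>" and w: "locally_finite_borel w"
  shows "B_below \<alpha> \<beta> r D \<sigma> w I0 f g = - B_above \<alpha> \<beta> r D w \<sigma> I0 g f"
proof -
  have eq: "l2_inner w (hilbert \<alpha> \<beta> \<sigma> (mart_diff \<sigma> I f)) (indicator (child_containing J I))
      = - l2_inner \<sigma> (hilbert \<alpha> \<beta> w (indicator (child_containing J I))) (mart_diff \<sigma> I f)"
    if I: "I \<in> D" and J: "J \<in> D" for I J
  proof -
    obtain u v where uv: "u < v" "I = {u..<v}" using grid_interval[OF D I] .
    obtain u' v' where uv': "u' < v'" "J = {u'..<v'}" using grid_interval[OF D J] .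
    interpret I: haar_interval \<sigma> I u v by unfold_locales (use uv \<sigma> in auto)
    interpret J: haar_interval w J u' v' by unfold_locales (use uv' w in auto)
    obtain B where B: "\<And>x. \<bar>haar \<sigma> I x\<bar> \<le> B" using I.haar_bounded by blast
    show ?thesis
    proof (rule hilbert_antisymmetric[OF ab \<sigma> w, where U = I])
      show "\<bar>mart_diff \<sigma> I f x\<bar> \<le> \<bar>l2_inner \<sigma> f (haar \<sigma> I)\<bar> * B" for x
        unfolding mart_diff_def abs_mult by (intro mult_left_mono B) simp
      show "mart_diff \<sigma> I f \<in> borel_measurable borel" unfolding mart_diff_def[abs_def] by measurable
      show "mart_diff \<sigma> I f x = 0" if "x \<notin> I" for x using I.haar_outside[OF that] by (simp add: mart_diff_def)
    qed (auto simp: child_containing_def)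
  qed
  show ?thesis
    unfolding B_below_def B_above_def infsum_uminus[symmetric]
    by (intro infsum_cong) (simp add: eq)
qed

theorem theorem3p5:
  shows "\<exists>\<epsilon>0::real. 0 < \<epsilon>0 \<and> \<epsilon>0 \<le> 1/2 \<and>
    (\<forall>\<epsilon>. 0 < \<epsilon> \<and> \<epsilon> < \<epsilon>0 \<longrightarrow>
      (\<exists>r0::nat. 1 \<le> r0 \<and>
        (\<forall>r\<ge>r0. \<forall>C0::real. 0 < C0 \<longrightarrow>
          (\<exists>C::real. 0 < C \<and>
            (\<forall>(\<sigma>::real measure) (w::real measure) (D::real set set).
              admissible D \<sigma> w \<and>
              A2_const \<sigma> w < \<infinity> \<and> testing_const \<sigma> w < \<infinity> \<and>
              energy_inequality C0 D \<sigma> w \<and> energy_inequality C0 D w \<sigma> \<longrightarrow>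
              (\<forall>\<alpha> \<beta> I0 f g.
                0 < \<alpha> \<and> \<alpha> < \<beta> \<and> I0 \<in> D \<and>
                good_function \<epsilon> r D \<sigma> I0 f \<and> good_function \<epsilon> r D w I0 g \<longrightarrow>
                ennreal \<bar>B_above \<alpha> \<beta> r D \<sigma> w I0 f g\<bar>
                  \<le> ennreal C * (ennreal (H_const \<sigma> w) + local_const \<epsilon> r C0 D \<sigma> w)
                      * ennreal (l2_norm \<sigma> f * l2_norm w g) \<and>
                ennreal \<bar>B_below \<alpha> \<beta> r D \<sigma> w I0 f g\<bar>
                  \<le> ennreal C * (ennreal (H_const \<sigma> w) + local_const \<epsilon> r C0 D w \<sigma>)
                      * ennreal (l2_norm \<sigma> f * l2_norm w g)))))))"
\<comment> \<open>Goodness is exploited through \<open>good_far\<close>, which holds for 0 <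
  \<epsilon> < 1 and every r. So 1/2 and 1 can be taken as thresholds, and the constant grows
  linearly in r.\<close>
proof (rule exI[of _ "1/2"], intro conjI allI impI, goal_cases)
  case (3 \<epsilon>)
  note \<epsilon> = this
  show ?case
  proof (intro exI[of _ "1::nat"] conjI allI impI, goal_cases)
    case (2 r C0)
    note C0 = this(2)
    show ?case
    proof (intro exI[of _ "10 ^ 9 * (real r + 19)"] conjI allI impI, goal_cases)
      case (2 \<sigma> w D \<alpha> \<beta> I0 f g)
      then show ?case by (intro above_estimate) (use \<epsilon> C0 in \<open>auto simp: admissible_def\<close>)
    next
      case (3 \<sigma> w D \<alpha> \<beta> I0 f g)
      then have "ennreal \<bar>B_above \<alpha> \<beta> r D w \<sigma> I0 g f\<bar>
          \<le> ennreal (10 ^ 9 * (real r + 19)) * (ennreal (H_const w \<sigma>) + local_const \<epsilon> r C0 D w \<sigma>)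
              * ennreal (l2_norm w g * l2_norm \<sigma> f)"
        using A2_const_commute[of \<sigma> w] testing_const_commute[of \<sigma> w]
        by (intro above_estimate) (use \<epsilon> C0 in \<open>auto simp: admissible_def\<close>)
      moreover have "B_below \<alpha> \<beta> r D \<sigma> w I0 f g = - B_above \<alpha> \<beta> r D w \<sigma> I0 g f"
        using 3 by (intro B_below_eq) (auto simp: admissible_def)
      ultimately show ?case
        by (simp only: abs_minus_cancel H_const_commute[of \<sigma> w] mult.commute[of "l2_norm \<sigma> f"])
    qed simp
  qed simp
qed simp_all

end
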